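(* Let $\mathbb{H}$ be one of the algebras $\mathbb{H}^{Cl}_{W(A_{n-1})}$, $\mathbb{H}^{Cl}_{W(B_n)}(\mathbf k,N)$ or $\mathbb{H}^{Cl}_{W(D_n)}(\mathbf k,N)$, with Weyl group $W$ and Dirac element $D$. Let $(\pi,X)$ be an irreducible $\mathbb{H}$-supermodule with central character $\chi_\pi:Z(\mathbb{H})_0\to\mathbb{C}$, and let $$H_D(X)=\ker\pi(D)/(\ker\pi(D)\cap\mathrm{im}\,\pi(D)).$$ Then $H_D(X)$ has a natural $\mathrm{Seg}(W)$-module structure. Suppose $\mathrm{Hom}_{\mathrm{Seg}(W)}(U,H_D(X))\ne0$ for some irreducible $\mathrm{Seg}(W)$-module $(\sigma,U)$, with central character $\chi_\sigma$. Then $\chi_\pi=\chi^\sigma$, where $\chi^\sigma(z)=\chi_\sigma(\zeta(z))$ for $z\in Z(\mathbb{H})_0$.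
   Context: Everything is over $\mathbb{C}$; $e_1,\dots,e_n$ is the standard basis of $\mathbb{R}^n$ with $\langle e_i,e_j\rangle=\delta_{ij}$. Root systems: $R(A_{n-1})=\{e_i-e_j:i\ne j\}$, $R(B_n)=\{\pm e_i\pm e_j:i<j\}\cup\{\pm e_i\}$, $R(D_n)=\{\pm e_i\pm e_j:i<j\}$, with positive roots $e_i-e_j$ ($i<j$) in type $A_{n-1}$; $e_i\pm e_j$ ($i<j$) and $e_i$ in type $B_n$; $e_i\pm e_j$ ($i<j$) in type $D_n$. $\alpha>0$ means $\alpha$ is positive; $W(\cdot)$ is the Weyl group and $s_\alpha$ the reflection in $\alpha$. $\mathbf{k}:R\to\mathbb{C}$, $\alpha\mapsto\mathbf{k}_\alpha$, is a $W$-invariant function. Write $s_{i,j}=s_{e_i-e_j}$, $s_n=s_{e_n}$. Type $A_{n-1}$: $\mathbb{H}^{Cl}_{W(A_{n-1})}$ is the unital algebra generated by $x_i,c_i$ ($1\le i\le n$) and $w\in W(A_{n-1})=S_n$ such that $\mathbb{C}[S_n]$ embeds as a subalgebra, with relations: $x_ix_j=x_jx_i$; $x_ic_j=c_jx_i$ ($i\ne j$), $x_ic_i=-c_ix_i$; $c_ic_j=-c_jc_i$ ($i\neq j$), $c_i^2=-1$; $wc_i=c_{w(i)}w$; $s_{i,i+1}x_i-x_{i+1}s_{i,i+1}=\mathbf{k}(-1+c_ic_{i+1})$, and $s_{i,i+1}x_j=x_js_{i,i+1}$ for $j\ne i,i+1$, where $\mathbf{k}$ is the common value of $\mathbf{k}_\alpha$.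 Type $B_n$: for $N\in\mathbb{C}$, $\mathbb{H}^{Cl}_{W(B_n)}(\mathbf{k},N)$ is generated by $x_i,c_i$ and $w\in W(B_n)$ with $\mathbb{C}[W(B_n)]$ embedded, subject to all relations of type $A_{n-1}$ above except $x_ix_j=x_jx_i$ (for $w\in W(A_{n-1})=S_n\subset W(B_n)$ and $\mathbf{k}$ the value on long roots $\pm e_i\pm e_j$), together with $s_nc_n=-c_ns_n$, $s_nc_i=c_is_n$ ($i\ne n$); $s_nx_n+x_ns_n=-\sqrt2\,\mathbf{k}_{e_n}$, $s_nx_j=x_js_n$ ($j\ne n$); $x_ix_j-x_jx_i=N c_jc_i$ ($i\ne j$). Type $D_n$: given $\mathbf{k}$ on $R(D_n)$ and $N\in\mathbb{C}$, let $\mathbf{k}^B$ on $R(B_n)$ equal $\mathbf{k}$ on $R(D_n)$ and $0$ on short roots $\pm e_i$; $\mathbb{H}^{Cl}_{W(D_n)}(\mathbf{k},N)$ is the subalgebra of $\mathbb{H}^{Cl}_{W(B_n)}(\mathbf{k}^B,N)$ generated by $W(D_n)\subset W(B_n)$, the $x_i$ and the $c_i$. These are superalgebras with $\deg c_i=1$, $\deg x_i=\deg w=0$. $\mathrm{Seg}(W)$ is the subalgebra generated by $W$ and the $c_i$. For positive roots: $c_{e_i\pm e_j}=\frac{\sqrt2}{2}(c_i\pm c_j)$ ($i<j$), $c_{e_i}=c_i$, and $\widetilde s_\alpha=s_\alpha c_\alpha$. The Dirac element is $$D=\sum_{i=1}^nx_ic_i+\frac{\sqrt2}{2}\sum_{\alpha>0}\mathbf{k}_\alpha\langle\alpha,\alpha\rangle\,\widetilde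 s_\alpha .$$ For a superalgebra $\mathcal A$, $Z(\mathcal A)_0$ is the set of even elements of its center; the central character of an irreducible (super)module sends $z\in Z(\mathcal A)_0$ to the scalar by which it acts. A supermodule is irreducible if it has no proper nonzero graded submodule. The map $\zeta:Z(\mathbb{H})_0\to Z(\mathrm{Seg}(W))_0$ sends $z$ to the unique $\zeta(z)\in Z(\mathrm{Seg}(W))_0$ with $z-\zeta(z)\in\mathrm{im}\,d$, where $d(h)=Dh-(-1)^{\deg(h)}hD$ for homogeneous $h\in\mathbb{H}$. *)

theory Defs
  imports "HOL-Algebra.Algebra" "HOL-Library.Poly_Mapping" "HOL-Library.Function_Algebras" Complex_Main
begin

section \<open>Complex superalgebras and their modules\<close>

text \<open>
  A unital complex superalgebra is a ring together with the structure map of its complex scalars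
  and its two homogeneous parts; the parity \<^term>\<open>True\<close> means odd.
\<close>

record 'a superalgebra = "'a ring" +
  scalar :: "complex \<Rightarrow> 'a"
  homog :: "bool \<Rightarrow> 'a set"

text \<open>The unital complex subalgebra generated by a set of homogeneous elements.\<close>

definition gen_subalgebra :: "'a superalgebra \<Rightarrow> 'a set \<Rightarrow> 'a superalgebra" where
  "gen_subalgebra A S =
     (let B = generate_ring A (S \<union> range (scalar A))
      in A\<lparr>carrier := B, homog := (\<lambda>p. homog A p \<inter> B)\<rparr>)"

definition even_center :: "'a superalgebra \<Rightarrow> 'a set" where
  "even_center A = {z \<in> homog A False. \<forall>a \<in> carrier A. z \<otimes>\<^bsub>A\<^esub> a = a \<otimes>\<^bsub>A\<^esub> z}"

text \<open>
  The modules of \<^theory>\<open>HOL-Algebra.Module\<close> are over commutative rings; the record is reused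
  here. The complex vector space structure of a module over a superalgebra \<open>A\<close> is the one given
  by the action of \<^term>\<open>scalar A\<close>.
\<close>

locale left_module = R?: ring A + M?: abelian_group M
    for A :: "('a, 'c) ring_scheme" and M :: "('a, 'x, 'm) module_scheme" +
  assumes smult_closed: "\<lbrakk>a \<in> carrier A; x \<in> carrier M\<rbrakk> \<Longrightarrow> a \<odot>\<^bsub>M\<^esub> x \<in> carrier M"
    and smult_l_distr: "\<lbrakk>a \<in> carrier A; b \<in> carrier A; x \<in> carrier M\<rbrakk> \<Longrightarrow>
      (a \<oplus>\<^bsub>A\<^esub> b) \<odot>\<^bsub>M\<^esub> x = a \<odot>\<^bsub>M\<^esub> x \<oplus>\<^bsub>M\<^esub> b \<odot>\<^bsub>M\<^esub> x"
    and smult_r_distr: "\<lbrakk>a \<in> carrier A; x \<in> carrier M; y \<in> carrier M\<rbrakk> \<Longrightarrow>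
      a \<odot>\<^bsub>M\<^esub> (x \<oplus>\<^bsub>M\<^esub> y) = a \<odot>\<^bsub>M\<^esub> x \<oplus>\<^bsub>M\<^esub> a \<odot>\<^bsub>M\<^esub> y"
    and smult_assoc: "\<lbrakk>a \<in> carrier A; b \<in> carrier A; x \<in> carrier M\<rbrakk> \<Longrightarrow>
      (a \<otimes>\<^bsub>A\<^esub> b) \<odot>\<^bsub>M\<^esub> x = a \<odot>\<^bsub>M\<^esub> (b \<odot>\<^bsub>M\<^esub> x)"
    and smult_one: "x \<in> carrier M \<Longrightarrow> \<one>\<^bsub>A\<^esub> \<odot>\<^bsub>M\<^esub> x = x"

text \<open>A supermodule is a module with a grading \<open>G\<close> by parity.\<close>

locale supermodule = left_module A M
    for A :: "'a superalgebra" and M :: "('a, 'x) module" +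
  fixes G :: "bool \<Rightarrow> 'x set"
  assumes part_subgroup: "subgroup (G p) (add_monoid M)"
    and parts_sum: "carrier M = G False <+>\<^bsub>M\<^esub> G True"
    and parts_inter: "G False \<inter> G True = {\<zero>\<^bsub>M\<^esub>}"
    and smult_part: "\<lbrakk>a \<in> homog A p; x \<in> G q\<rbrakk> \<Longrightarrow> a \<odot>\<^bsub>M\<^esub> x \<in> G (p \<noteq> q)"

definition graded_subset :: "('a, 'x) module \<Rightarrow> (bool \<Rightarrow> 'x set) \<Rightarrow> 'x set \<Rightarrow> bool" where
  "graded_subset M G N \<longleftrightarrow> N = (N \<inter> G False) <+>\<^bsub>M\<^esub> (N \<inter> G True)"

definition irreducible_supermodule ::
    "'a superalgebra \<Rightarrow> ('a, 'x) module \<Rightarrow> (bool \<Rightarrow> 'x set) \<Rightarrow> bool" where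
  "irreducible_supermodule A M G \<longleftrightarrow>
     supermodule A M G \<and> carrier M \<noteq> {\<zero>\<^bsub>M\<^esub>} \<and>
     (\<forall>N. submodule N A M \<and> graded_subset M G N \<longrightarrow> N = {\<zero>\<^bsub>M\<^esub>} \<or> N = carrier M)"

definition irreducible_module :: "'a superalgebra \<Rightarrow> ('a, 'x) module \<Rightarrow> bool" where
  "irreducible_module A M \<longleftrightarrow>
     left_module A M \<and> carrier M \<noteq> {\<zero>\<^bsub>M\<^esub>} \<and>
     (\<forall>N. submodule N A M \<longrightarrow> N = {\<zero>\<^bsub>M\<^esub>} \<or> N = carrier M)"

definition module_homs ::
    "'a superalgebra \<Rightarrow> ('a, 'x) module \<Rightarrow> ('a, 'y) module \<Rightarrow> ('x \<Rightarrow> 'y) set" where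
  "module_homs A M M' =
     {f \<in> carrier M \<rightarrow> carrier M'.
        (\<forall>x \<in> carrier M. \<forall>y \<in> carrier M. f (x \<oplus>\<^bsub>M\<^esub> y) = f x \<oplus>\<^bsub>M'\<^esub> f y) \<and>
        (\<forall>a \<in> carrier A. \<forall>x \<in> carrier M. f (a \<odot>\<^bsub>M\<^esub> x) = a \<odot>\<^bsub>M'\<^esub> f x)}"

definition central_character :: "'a superalgebra \<Rightarrow> ('a, 'x) module \<Rightarrow> 'a \<Rightarrow> complex" where
  "central_character A M z =
     (THE s. \<forall>x \<in> carrier M. z \<odot>\<^bsub>M\<^esub> x = scalar A s \<odot>\<^bsub>M\<^esub> x)"


section \<open>Dirac cohomology and the map \<open>\<zeta>\<close>\<close>

definition action_kernel :: "('a, 'x) module \<Rightarrow> 'a \<Rightarrow> 'x set" where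
  "action_kernel M D = {x \<in> carrier M. D \<odot>\<^bsub>M\<^esub> x = \<zero>\<^bsub>M\<^esub>}"

definition action_image :: "('a, 'x) module \<Rightarrow> 'a \<Rightarrow> 'x set" where
  "action_image M D = (\<lambda>x. D \<odot>\<^bsub>M\<^esub> x) ` carrier M"

text \<open>
  The elements of the Dirac cohomology are the cosets in \<open>ker D\<close> of \<open>ker D \<inter> im D\<close>; an element
  \<open>a\<close> acts by sending the coset of \<open>x\<close> to the coset of \<open>a \<cdot> x\<close>. The ring multiplication fields of
  the record play no role for modules.
\<close>

definition dirac_boundary :: "('a, 'x) module \<Rightarrow> 'a \<Rightarrow> 'x set" where
  "dirac_boundary M D = action_kernel M D \<inter> action_image M D"

definition dirac_cohomology :: "('a, 'x) module \<Rightarrow> 'a \<Rightarrow> ('a, 'x set) module" where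
  "dirac_cohomology M D =
     \<lparr>carrier = (\<lambda>x. dirac_boundary M D +>\<^bsub>M\<^esub> x) ` action_kernel M D,
      monoid.mult = undefined, one = undefined,
      ring.zero = dirac_boundary M D,
      ring.add = set_add M,
      smult = (\<lambda>a P. \<Union>x\<in>P. dirac_boundary M D +>\<^bsub>M\<^esub> (a \<odot>\<^bsub>M\<^esub> x))\<rparr>"

text \<open>
  The image of \<open>d\<close>, where \<open>d h = D h - h D\<close> for \<open>h\<close> even and \<open>d h = D h + h D\<close> for \<open>h\<close> odd,
  extended additively to \<open>h = h\<^sub>0 + h\<^sub>1\<close>.
\<close>

definition dirac_d_image :: "'a superalgebra \<Rightarrow> 'a \<Rightarrow> 'a set" where
  "dirac_d_image A D =
     {(D \<otimes>\<^bsub>A\<^esub> h0 \<ominus>\<^bsub>A\<^esub> h0 \<otimes>\<^bsub>A\<^esub> D) \<oplus>\<^bsub>A\<^esub> (D \<otimes>\<^bsub>A\<^esub> h1 \<oplus>\<^bsub>A\<^esub> h1 \<otimes>\<^bsub>A\<^esub> D) | h0 h1.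
        h0 \<in> homog A False \<and> h1 \<in> homog A True}"

definition dirac_zeta :: "'a superalgebra \<Rightarrow> 'a superalgebra \<Rightarrow> 'a \<Rightarrow> 'a \<Rightarrow> 'a" where
  "dirac_zeta A S D z = (THE y. y \<in> even_center S \<and> z \<ominus>\<^bsub>A\<^esub> y \<in> dirac_d_image A D)"


section \<open>Free superalgebras and presentations\<close>

text \<open>
  Words under concatenation form an additively written monoid, so that finitely supported
  functions from words to the complex numbers form the free algebra, with convolution as product.
\<close>

datatype 'g word = Word (letters: "'g list")

instantiation word :: (type) monoid_add
begin

definition zero_word :: "'a word" where "zero_word = Word []"

definition plus_word :: "'a word \<Rightarrow> 'a word \<Rightarrow> 'a word" where
  "plus_word u v = Word (letters u @ letters v)"

instance
  by standard (simp_all add: zero_word_def plus_word_def)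

end

type_synonym 'g free = "'g word \<Rightarrow>\<^sub>0 complex"

definition fgen :: "'g \<Rightarrow> 'g free" where
  "fgen g = Poly_Mapping.single (Word [g]) 1"

definition scal :: "complex \<Rightarrow> 'g free" where
  "scal a = Poly_Mapping.single 0 a"

definition free_algebra :: "'g set \<Rightarrow> 'g free ring" where
  "free_algebra S =
     \<lparr>carrier = {f. \<forall>w \<in> Poly_Mapping.keys f. set (letters w) \<subseteq> S},
      monoid.mult = (*), one = 1, ring.zero = 0, ring.add = (+)\<rparr>"

definition free_homog :: "'g set \<Rightarrow> ('g \<Rightarrow> bool) \<Rightarrow> bool \<Rightarrow> 'g free set" where
  "free_homog S od p =
     {f \<in> carrier (free_algebra S).
        \<forall>w \<in> Poly_Mapping.keys f. odd (length (filter od (letters w))) = p}"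

text \<open>
  The superalgebra presented by the generators \<open>S\<close>, those satisfying \<open>od\<close> being odd, and the
  relations \<open>f = 0\<close> for \<open>f\<close> in \<open>R\<close>. It is only used for homogeneous relations.
\<close>

definition present_class :: "'g set \<Rightarrow> 'g free set \<Rightarrow> 'g free \<Rightarrow> 'g free set" where
  "present_class S R f = (Idl\<^bsub>free_algebra S\<^esub> R) +>\<^bsub>free_algebra S\<^esub> f"

definition presented :: "'g set \<Rightarrow> ('g \<Rightarrow> bool) \<Rightarrow> 'g free set \<Rightarrow> 'g free set superalgebra" where
  "presented S od R =
     ring.extend (free_algebra S Quot (Idl\<^bsub>free_algebra S\<^esub> R))
       (superalgebra.fields
          (\<lambda>a. present_class S R (scal a))
          (\<lambda>p. present_class S R ` free_homog S od p))"


section \<open>Root systems and Weyl groups\<close>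

text \<open>
  Vectors of \<open>\<real>\<^sup>n\<close> are functions whose coordinates outside \<open>{1..n}\<close> are irrelevant: they do not
  enter the inner product, and roots vanish there, so that reflections leave them unchanged.
\<close>

type_synonym vec = "nat \<Rightarrow> real"

definition std :: "nat \<Rightarrow> vec" where
  "std i = (\<lambda>j. if j = i then 1 else 0)"

definition ip :: "nat \<Rightarrow> vec \<Rightarrow> vec \<Rightarrow> real" where
  "ip n u v = (\<Sum>i = 1..n. u i * v i)"

definition refl_in :: "nat \<Rightarrow> vec \<Rightarrow> vec \<Rightarrow> vec" where
  "refl_in n \<alpha> v = (\<lambda>i. v i - 2 * ip n v \<alpha> / ip n \<alpha> \<alpha> * \<alpha> i)"

inductive_set weyl :: "nat \<Rightarrow> vec set \<Rightarrow> (vec \<Rightarrow> vec) set" for n R where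
  weyl_id: "id \<in> weyl n R"
| weyl_refl: "\<lbrakk>\<alpha> \<in> R; w \<in> weyl n R\<rbrakk> \<Longrightarrow> refl_in n \<alpha> \<circ> w \<in> weyl n R"

definition pos_rootsA :: "nat \<Rightarrow> vec set" where
  "pos_rootsA n = {std i - std j | i j. 1 \<le> i \<and> i < j \<and> j \<le> n}"

definition pos_rootsD :: "nat \<Rightarrow> vec set" where
  "pos_rootsD n = pos_rootsA n \<union> {std i + std j | i j. 1 \<le> i \<and> i < j \<and> j \<le> n}"

definition pos_rootsB :: "nat \<Rightarrow> vec set" where
  "pos_rootsB n = pos_rootsD n \<union> {std i | i. 1 \<le> i \<and> i \<le> n}"

definition rootsA :: "nat \<Rightarrow> vec set" where
  "rootsA n = pos_rootsA n \<union> uminus ` pos_rootsA n"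

definition rootsB :: "nat \<Rightarrow> vec set" where
  "rootsB n = pos_rootsB n \<union> uminus ` pos_rootsB n"

definition rootsD :: "nat \<Rightarrow> vec set" where
  "rootsD n = pos_rootsD n \<union> uminus ` pos_rootsD n"

definition weyl_invariant :: "nat \<Rightarrow> vec set \<Rightarrow> (vec \<Rightarrow> complex) \<Rightarrow> bool" where
  "weyl_invariant n R k \<longleftrightarrow> (\<forall>w \<in> weyl n R. \<forall>\<alpha> \<in> R. k (w \<alpha>) = k \<alpha>)"

definition extend_by_zero :: "nat \<Rightarrow> (vec \<Rightarrow> complex) \<Rightarrow> vec \<Rightarrow> complex" where
  "extend_by_zero n k \<alpha> = (if \<alpha> \<in> rootsD n then k \<alpha> else 0)"


section \<open>The degenerate affine Hecke-Clifford algebras\<close>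

datatype hc_letter = Lx nat | Lc nat | Lw "vec \<Rightarrow> vec"

abbreviation x\<^sub>g :: "nat \<Rightarrow> hc_letter free" where "x\<^sub>g i \<equiv> fgen (Lx i)"
abbreviation c\<^sub>g :: "nat \<Rightarrow> hc_letter free" where "c\<^sub>g i \<equiv> fgen (Lc i)"
abbreviation w\<^sub>g :: "(vec \<Rightarrow> vec) \<Rightarrow> hc_letter free" where "w\<^sub>g w \<equiv> fgen (Lw w)"

fun is_Lc :: "hc_letter \<Rightarrow> bool" where
  "is_Lc (Lc i) = True"
| "is_Lc (Lx i) = False"
| "is_Lc (Lw w) = False"

definition hc_letters :: "nat \<Rightarrow> (vec \<Rightarrow> vec) set \<Rightarrow> hc_letter set" where
  "hc_letters n W = Lx ` {1..n} \<union> Lc ` {1..n} \<union> Lw ` W"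

definition group_rels :: "(vec \<Rightarrow> vec) set \<Rightarrow> hc_letter free set" where
  "group_rels W = {w\<^sub>g id - 1} \<union> {w\<^sub>g w * w\<^sub>g w' - w\<^sub>g (w \<circ> w') | w w'. w \<in> W \<and> w' \<in> W}"

text \<open>
  The relations of type A except for the commutation of the \<open>x\<^sub>i\<close>. Elements \<open>w\<close> of the Weyl group
  of type A permute the standard basis, and \<open>w (std i) = std j\<close> expresses \<open>w(i) = j\<close>.
\<close>

definition common_rels :: "nat \<Rightarrow> (vec \<Rightarrow> complex) \<Rightarrow> hc_letter free set" where
  "common_rels n k =
     {x\<^sub>g i * c\<^sub>g j - c\<^sub>g j * x\<^sub>g i | i j. i \<in> {1..n} \<and> j \<in> {1..n} \<and> i \<noteq> j} \<union>
     {x\<^sub>g i * c\<^sub>g i + c\<^sub>g i * x\<^sub>g i | i. i \<in> {1..n}} \<union>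
     {c\<^sub>g i * c\<^sub>g j + c\<^sub>g j * c\<^sub>g i | i j. i \<in> {1..n} \<and> j \<in> {1..n} \<and> i \<noteq> j} \<union>
     {c\<^sub>g i * c\<^sub>g i + 1 | i. i \<in> {1..n}} \<union>
     {w\<^sub>g w * c\<^sub>g i - c\<^sub>g j * w\<^sub>g w | w i j.
        w \<in> weyl n (rootsA n) \<and> i \<in> {1..n} \<and> j \<in> {1..n} \<and> w (std i) = std j} \<union>
     {w\<^sub>g (refl_in n (std i - std (i + 1))) * x\<^sub>g i - x\<^sub>g (i + 1) * w\<^sub>g (refl_in n (std i - std (i + 1)))
        - scal (k (std i - std (i + 1))) * (- 1 + c\<^sub>g i * c\<^sub>g (i + 1)) | i. i \<in> {1..<n}} \<union>
     {w\<^sub>g (refl_in n (std i - std (i + 1))) * x\<^sub>g j - x\<^sub>g j * w\<^sub>g (refl_in n (std i - std (i + 1))) | i j.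
        i \<in> {1..<n} \<and> j \<in> {1..n} \<and> j \<noteq> i \<and> j \<noteq> i + 1}"

definition hc_relsA :: "nat \<Rightarrow> (vec \<Rightarrow> complex) \<Rightarrow> hc_letter free set" where
  "hc_relsA n k = group_rels (weyl n (rootsA n)) \<union> common_rels n k \<union>
     {x\<^sub>g i * x\<^sub>g j - x\<^sub>g j * x\<^sub>g i | i j. i \<in> {1..n} \<and> j \<in> {1..n}}"

definition hc_relsB :: "nat \<Rightarrow> (vec \<Rightarrow> complex) \<Rightarrow> complex \<Rightarrow> hc_letter free set" where
  "hc_relsB n k N = group_rels (weyl n (rootsB n)) \<union> common_rels n k \<union>
     {w\<^sub>g (refl_in n (std n)) * c\<^sub>g n + c\<^sub>g n * w\<^sub>g (refl_in n (std n))} \<union>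
     {w\<^sub>g (refl_in n (std n)) * c\<^sub>g i - c\<^sub>g i * w\<^sub>g (refl_in n (std n)) | i. i \<in> {1..<n}} \<union>
     {w\<^sub>g (refl_in n (std n)) * x\<^sub>g n + x\<^sub>g n * w\<^sub>g (refl_in n (std n))
        + scal (complex_of_real (sqrt 2) * k (std n))} \<union>
     {w\<^sub>g (refl_in n (std n)) * x\<^sub>g j - x\<^sub>g j * w\<^sub>g (refl_in n (std n)) | j. j \<in> {1..<n}} \<union>
     {x\<^sub>g i * x\<^sub>g j - x\<^sub>g j * x\<^sub>g i - scal N * (c\<^sub>g j * c\<^sub>g i) | i j.
        i \<in> {1..n} \<and> j \<in> {1..n} \<and> i \<noteq> j}"

text \<open>
  The argument in types B and D is the commutator parameter \<open>N\<close>.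
\<close>

datatype hc_type = TypeA | TypeB complex | TypeD complex

type_synonym hc_elem = "hc_letter free set"

fun hc_pos_roots :: "hc_type \<Rightarrow> nat \<Rightarrow> vec set" where
  "hc_pos_roots TypeA n = pos_rootsA n"
| "hc_pos_roots (TypeB N) n = pos_rootsB n"
| "hc_pos_roots (TypeD N) n = pos_rootsD n"

fun hc_weyl :: "hc_type \<Rightarrow> nat \<Rightarrow> (vec \<Rightarrow> vec) set" where
  "hc_weyl TypeA n = weyl n (rootsA n)"
| "hc_weyl (TypeB N) n = weyl n (rootsB n)"
| "hc_weyl (TypeD N) n = weyl n (rootsD n)"

text \<open>
  In type D the extension by zero has to be an admissible parameter for type B. For \<open>n \<noteq> 2\<close>
  this is automatic; for \<open>n = 2\<close> it forces equal values on the two orbits of \<open>W(D\<^sub>2)\<close>.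
\<close>

fun hc_parameter :: "hc_type \<Rightarrow> nat \<Rightarrow> (vec \<Rightarrow> complex) \<Rightarrow> bool" where
  "hc_parameter TypeA n k \<longleftrightarrow> weyl_invariant n (rootsA n) k"
| "hc_parameter (TypeB N) n k \<longleftrightarrow> weyl_invariant n (rootsB n) k"
| "hc_parameter (TypeD N) n k \<longleftrightarrow>
     weyl_invariant n (rootsD n) k \<and> weyl_invariant n (rootsB n) (extend_by_zero n k)"

definition hc_algebraA :: "nat \<Rightarrow> (vec \<Rightarrow> complex) \<Rightarrow> hc_elem superalgebra" where
  "hc_algebraA n k = presented (hc_letters n (weyl n (rootsA n))) is_Lc (hc_relsA n k)"

definition hc_algebraB :: "nat \<Rightarrow> (vec \<Rightarrow> complex) \<Rightarrow> complex \<Rightarrow> hc_elem superalgebra" where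
  "hc_algebraB n k N = presented (hc_letters n (weyl n (rootsB n))) is_Lc (hc_relsB n k N)"

text \<open>
  The class of an element of the free algebra in the presented algebra of type A or B; in type D
  the classes are taken in the ambient algebra of type B.
\<close>

fun hc_class :: "hc_type \<Rightarrow> nat \<Rightarrow> (vec \<Rightarrow> complex) \<Rightarrow> hc_letter free \<Rightarrow> hc_elem" where
  "hc_class TypeA n k = present_class (hc_letters n (weyl n (rootsA n))) (hc_relsA n k)"
| "hc_class (TypeB N) n k = present_class (hc_letters n (weyl n (rootsB n))) (hc_relsB n k N)"
| "hc_class (TypeD N) n k =
     present_class (hc_letters n (weyl n (rootsB n))) (hc_relsB n (extend_by_zero n k) N)"

fun hc_algebra :: "hc_type \<Rightarrow> nat \<Rightarrow> (vec \<Rightarrow> complex) \<Rightarrow> hc_elem superalgebra" where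
  "hc_algebra TypeA n k = hc_algebraA n k"
| "hc_algebra (TypeB N) n k = hc_algebraB n k N"
| "hc_algebra (TypeD N) n k =
     gen_subalgebra (hc_algebraB n (extend_by_zero n k) N)
       ((\<lambda>l. hc_class (TypeD N) n k (fgen l)) ` hc_letters n (weyl n (rootsD n)))"

definition hc_Seg :: "hc_type \<Rightarrow> nat \<Rightarrow> (vec \<Rightarrow> complex) \<Rightarrow> hc_elem superalgebra" where
  "hc_Seg T n k = gen_subalgebra (hc_algebra T n k)
     ((\<lambda>l. hc_class T n k (fgen l)) ` (Lw ` hc_weyl T n \<union> Lc ` {1..n}))"

text \<open>
  For a positive root \<open>\<alpha>\<close>, \<open>c\<^sub>\<alpha>\<close> is the Clifford element of the normalised root: the lemmas below
  give \<open>c\<^sub>\<alpha> = \<surd>2/2 (c\<^sub>i \<plusminus> c\<^sub>j)\<close> for \<open>\<alpha> = e\<^sub>i \<plusminus> e\<^sub>j\<close> and \<open>c\<^sub>\<alpha> = c\<^sub>i\<close> for \<open>\<alpha> = e\<^sub>i\<close>.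
\<close>

definition c_root :: "nat \<Rightarrow> vec \<Rightarrow> hc_letter free" where
  "c_root n \<alpha> = (\<Sum>i = 1..n. scal (complex_of_real (\<alpha> i / sqrt (ip n \<alpha> \<alpha>))) * c\<^sub>g i)"

lemma ip_std: "\<lbrakk>i \<in> {1..n}; j \<in> {1..n}\<rbrakk> \<Longrightarrow> ip n (std i) (std j) = (if i = j then 1 else 0)"
proof -
  assume "i \<in> {1..n}" "j \<in> {1..n}"
  have "ip n (std i) (std j) = (\<Sum>l = 1..n. if l = i then (if i = j then 1 else 0) else 0)"
    unfolding ip_def by (intro sum.cong) (auto simp: std_def)
  thus ?thesis using \<open>i \<in> {1..n}\<close> by simp
qed

lemma scal_0 [simp]: "scal 0 = 0"
  by (simp add: scal_def)

lemma scal_1 [simp]: "scal 1 = 1"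
  by (simp add: scal_def)

lemma scal_uminus: "scal (- a) = - scal a"
  by (simp add: scal_def single_uminus)

lemma c_root_std:
  assumes "i \<in> {1..n}"
  shows "c_root n (std i) = c\<^sub>g i"
proof -
  have "c_root n (std i) = (\<Sum>l = 1..n. if l = i then c\<^sub>g i else 0)"
    using assms unfolding c_root_def by (intro sum.cong) (auto simp: ip_std, auto simp: std_def)
  thus ?thesis using assms by simp
qed

lemma ip_add_left: "ip n (u + v) w = ip n u w + ip n v w"
  by (simp add: ip_def algebra_simps sum.distrib)

lemma ip_add_right: "ip n u (v + w) = ip n u v + ip n u w"
  by (simp add: ip_def algebra_simps sum.distrib)

lemma ip_diff_left: "ip n (u - v) w = ip n u w - ip n v w"
  by (simp add: ip_def algebra_simps sum_subtractf)

lemma ip_diff_right: "ip n u (v - w) = ip n u v - ip n u w"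
  by (simp add: ip_def algebra_simps sum_subtractf)

lemma inverse_sqrt_2: "1 / complex_of_real (sqrt 2) = complex_of_real (sqrt 2) / 2"
proof -
  have "1 / sqrt 2 = sqrt 2 / 2"
    by (simp add: field_simps)
  hence "complex_of_real (1 / sqrt 2) = complex_of_real (sqrt 2 / 2)"
    by (rule arg_cong)
  thus ?thesis by simp
qed

lemma c_root_std_add:
  assumes "1 \<le> i" "i < j" "j \<le> n"
  shows "c_root n (std i + std j) = scal (complex_of_real (sqrt 2 / 2)) * (c\<^sub>g i + c\<^sub>g j)"
proof -
  let ?r = "scal (complex_of_real (sqrt 2 / 2)) :: hc_letter free"
  have ip: "ip n (std i + std j) (std i + std j) = 2"
    using assms by (simp add: ip_add_left ip_add_right ip_std)
  have "c_root n (std i + std j) =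
      (\<Sum>l = 1..n. (if l = i then ?r * c\<^sub>g i else 0) + (if l = j then ?r * c\<^sub>g j else 0))"
    using assms unfolding c_root_def ip
    by (intro sum.cong) (auto simp: std_def inverse_sqrt_2)
  thus ?thesis using assms by (simp add: sum.distrib distrib_left)
qed

lemma c_root_std_diff:
  assumes "1 \<le> i" "i < j" "j \<le> n"
  shows "c_root n (std i - std j) = scal (complex_of_real (sqrt 2 / 2)) * (c\<^sub>g i - c\<^sub>g j)"
proof -
  let ?r = "scal (complex_of_real (sqrt 2 / 2)) :: hc_letter free"
  have ip: "ip n (std i - std j) (std i - std j) = 2"
    using assms by (simp add: ip_diff_left ip_diff_right ip_std)
  have "c_root n (std i - std j) =
      (\<Sum>l = 1..n. (if l = i then ?r * c\<^sub>g i else 0) - (if l = j then ?r * c\<^sub>g j else 0))"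
    using assms unfolding c_root_def ip
    by (intro sum.cong) (auto simp: std_def inverse_sqrt_2 scal_uminus)
  thus ?thesis using assms by (simp add: sum_subtractf right_diff_distrib)
qed

definition s_tilde :: "nat \<Rightarrow> vec \<Rightarrow> hc_letter free" where
  "s_tilde n \<alpha> = w\<^sub>g (refl_in n \<alpha>) * c_root n \<alpha>"

definition hc_dirac :: "hc_type \<Rightarrow> nat \<Rightarrow> (vec \<Rightarrow> complex) \<Rightarrow> hc_elem" where
  "hc_dirac T n k = hc_class T n k
     ((\<Sum>i = 1..n. x\<^sub>g i * c\<^sub>g i) +
      scal (complex_of_real (sqrt 2 / 2)) *
        (\<Sum>\<alpha> \<in> hc_pos_roots T n. scal (k \<alpha> * complex_of_real (ip n \<alpha> \<alpha>)) * s_tilde n \<alpha>))"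

end

theory Submission
  imports Defs "HOL-Computational_Algebra.Fundamental_Theorem_Algebra" "HOL-Library.Multiset" "HOL-Combinatorics.Permutations"
begin

text \<open>
  The algebra is realised faithfully by operators on functions: shift operators, Clifford operators and
  signed permutations give the associated graded algebra, and \<open>x\<^sub>i\<close> acts as a shift plus a sum over the positive
  roots which \<open>w\<close> makes negative. Comparing leading terms shows that ordered monomials in the \<open>x\<^sub>i\<close> are
  independent over \<open>Seg W\<close>. On leading terms \<open>d\<close> becomes a Koszul differential, and induction on the degree gives
  \<open>z = \<zeta> z + D h + h D\<close> for central \<open>z\<close>, with \<open>h\<close> odd. On a cohomology class \<open>z\<close> therefore acts as \<open>\<zeta> z\<close>.
  If \<open>s\<close> is the scalar of \<open>\<zeta> z\<close> on \<open>U\<close>, then \<open>(z - s) x\<close> lies in the image of \<open>D\<close> for some \<open>x\<close> in the kernel that is not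
  a boundary. By Schur's lemma \<open>z - s\<close> is zero or invertible on the irreducible supermodule, and invertibility would
  make \<open>x\<close> a boundary.
\<close>

section \<open>Linear endomorphisms of function spaces\<close>

text \<open>The algebra is given by generators and relations, so independence, and with it the
  uniqueness of \<zeta>, needs a model that provably satisfies the relations. The condition w
  \<alpha> < 0 in x_i is chosen because moving a simple reflection s_\<beta> across the sum changes
  only the term \<alpha> = \<beta>, and what is left over is the inhomogeneous term of the defining
  relation. The commutators of these x_i are then computed over each w by induction on its number of
  inversions. The parameter N comes from one extra Clifford generator \<eta>: a summand a c_i \<eta>
  in x_i yields N = -2 a^2. Type D is read off from type B with weight zero on the short roots. The
  obstacle in the descent is that d^2 = 0 is available only for elements that supercommute with W
  and the c_i. Averaging over W and over Clifford conjugations projects onto these elements and is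
  compatible with d, so each correction term can be brought back among them. On symbols the homotopy
  is explicit: it multiplies by minus the number of variables that occur, which is nonzero in
  positive degree.\<close>

typedef 'i lend = "{F :: ('i \<Rightarrow> complex) \<Rightarrow> ('i \<Rightarrow> complex).
    (\<forall>f g. F (\<lambda>i. f i + g i) = (\<lambda>i. F f i + F g i)) \<and>
    (\<forall>a f. F (\<lambda>i. a * f i) = (\<lambda>i. a * F f i))}"
  morphisms app Lend
  by (rule exI[of _ id]) simp

setup_lifting type_definition_lend

lemma lend_eqI: "(\<And>f i. app S f i = app T f i) \<Longrightarrow> S = T"
  by (metis app_inject ext)

instantiation lend :: (type) ring_1
begin

lift_definition zero_lend :: "'a lend" is "\<lambda>f i. 0" by simp
lift_definition one_lend :: "'a lend" is "\<lambda>f. f" by simp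
lift_definition plus_lend :: "'a lend \<Rightarrow> 'a lend \<Rightarrow> 'a lend" is "\<lambda>F G f i. F f i + G f i"
  by (auto simp: algebra_simps)
lift_definition uminus_lend :: "'a lend \<Rightarrow> 'a lend" is "\<lambda>F f i. - F f i"
  by (auto simp: algebra_simps)
lift_definition minus_lend :: "'a lend \<Rightarrow> 'a lend \<Rightarrow> 'a lend" is "\<lambda>F G f i. F f i - G f i"
  by (auto simp: algebra_simps)
lift_definition times_lend :: "'a lend \<Rightarrow> 'a lend \<Rightarrow> 'a lend" is "\<lambda>F G f. F (G f)"
  by auto

instance
proof
  fix a b c :: "'a lend"
  show "a + b + c = a + (b + c)" by transfer (simp add: add.assoc)
  show "a + b = b + a" by transfer (simp add: add.commute)
  show "0 + a = a" by transfer simp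
  show "- a + a = 0" by transfer simp
  show "a - b = a + - b" by transfer simp
  show "a * b * c = a * (b * c)" by transfer simp
  show "(a + b) * c = a * c + b * c" by transfer simp
  show "a * (b + c) = a * b + a * c" by transfer simp
  show "1 * a = a" by transfer simp
  show "a * 1 = a" by transfer simp
  show "(0 :: 'a lend) \<noteq> 1" 
  proof transfer
    have "(\<lambda>i::'a. 0::complex) \<noteq> (\<lambda>i. 1)" by (simp add: fun_eq_iff)
    then show "(\<lambda>(f::'a \<Rightarrow> complex) i. 0) \<noteq> (\<lambda>f. f)" by metis
  qed
qed

end

lemma app_simps [simp]:
  "app (S + T) f i = app S f i + app T f i"
  "app (S - T) f i = app S f i - app T f i"
  "app (- S) f i = - app S f i"
  "app 0 f i = 0"
  "app 1 f = f"
  "app (S * T) f = app S (app T f)"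
  by (transfer, simp)+

lemma app_cmult: "app T (\<lambda>i. a * f i) = (\<lambda>i. a * app T f i)"
  by transfer auto

lemma app_sum [simp]: "app (sum F A) f i = (\<Sum>a\<in>A. app (F a) f i)"
  by (induction A rule: infinite_finite_induct) auto

lift_definition sc :: "complex \<Rightarrow> 'i lend" is "\<lambda>a f i. a * f i"
  by (auto simp: algebra_simps)

lemma app_sc [simp]: "app (sc a) f i = a * f i"
  by transfer simp

lemma sc_simps [simp]: "sc 0 = 0" "sc 1 = 1"
  by (auto intro!: lend_eqI)

lemma sc_add: "sc (a + b) = sc a + sc b"
  and sc_mult: "sc (a * b) = sc a * sc b"
  and sc_uminus: "sc (- a) = - sc a"
  and sc_diff: "sc (a - b) = sc a - sc b"
  by (auto intro!: lend_eqI simp: algebra_simps)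

lemma sc_commute: "(T :: 'a lend) * sc a = sc a * T"
proof (rule lend_eqI)
  fix f :: "'a \<Rightarrow> complex" and i
  have "app (sc a) f = (\<lambda>i. a * f i)" by (rule ext) simp
  then show "app (T * sc a) f i = app (sc a * T) f i" by (simp add: app_cmult)
qed

lemma sc_eq_0_iff [simp]: "(sc a :: 'a lend) = 0 \<longleftrightarrow> a = 0"
proof
  assume "sc a = (0 :: 'a lend)"
  then have "app (sc a) (\<lambda>i::'a. 1) i = app 0 (\<lambda>i. 1) i" for i by simp
  then show "a = 0" by simp
qed simp

lemma sc_sum: "sc (sum f A) = (\<Sum>a\<in>A. sc (f a))"
  by (induction A rule: infinite_finite_induct) (auto simp: sc_add)

lemma sc_numeral: "sc (numeral k) = numeral k"
  by (induction k) (simp_all only: numeral.simps sc_add sc_simps)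

text \<open>Substitution is contravariant: in a product \<open>S * T\<close> the index map of
  \<open>S\<close> is applied before that of \<open>T\<close>. All basic operators of the model have
  this form, so an identity between their products reduces to one between weights and index
  maps.\<close>

lift_definition wsub :: "('i \<Rightarrow> complex) \<Rightarrow> ('i \<Rightarrow> 'i) \<Rightarrow> 'i lend" is "\<lambda>\<psi> \<theta> f i. \<psi> i * f (\<theta> i)"
  by (auto simp: algebra_simps)

lemma app_wsub [simp]: "app (wsub \<psi> \<theta>) f i = \<psi> i * f (\<theta> i)"
  by transfer simp

section \<open>Signed permutations and the basic operators\<close>

text \<open>Signed permutation matrices written by rows: e_i goes to a multiple of the basis vector
  at position \<pi>^-1 i. The set \<open>A\<close> contains every coordinate that is moved or
  negated; for Weyl group elements it is {1..n}.\<close>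

definition signed_perm :: "nat set \<Rightarrow> (vec \<Rightarrow> vec) \<Rightarrow> bool" where
  "signed_perm A u \<longleftrightarrow> (\<exists>\<pi> \<sigma>. \<pi> permutes A \<and> (\<forall>i. \<sigma> i = 1 \<or> \<sigma> i = - 1) \<and>
     (\<forall>i. i \<notin> A \<longrightarrow> \<sigma> i = 1) \<and> u = (\<lambda>v i. \<sigma> i * v (\<pi> i)))"

lemma signed_perm_id [simp]: "signed_perm A id"
  unfolding signed_perm_def
  by (rule exI[of _ id], rule exI[of _ "\<lambda>_. 1"]) (auto simp: permutes_id)

lemma signed_perm_comp:
  assumes "signed_perm A u" "signed_perm A w"
  shows "signed_perm A (u \<circ> w)"
proof -
  obtain \<pi> \<sigma> where u: "\<pi> permutes A" "\<forall>i. \<sigma> i = 1 \<or> \<sigma> i = - 1" "\<forall>i. i \<notin> A \<longrightarrow> \<sigma> i = 1"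
    "u = (\<lambda>v i. \<sigma> i * v (\<pi> i))"
    using assms(1) unfolding signed_perm_def by blast
  obtain \<pi>' \<sigma>' where w: "\<pi>' permutes A" "\<forall>i. \<sigma>' i = 1 \<or> \<sigma>' i = - 1" "\<forall>i. i \<notin> A \<longrightarrow> \<sigma>' i = 1"
    "w = (\<lambda>v i. \<sigma>' i * v (\<pi>' i))"
    using assms(2) unfolding signed_perm_def by blast
  show ?thesis
    unfolding signed_perm_def
  proof (intro exI[of _ "\<pi>' \<circ> \<pi>"] exI[of _ "\<lambda>i. \<sigma> i * \<sigma>' (\<pi> i)"] conjI allI impI)
    show "\<pi>' \<circ> \<pi> permutes A" using u(1) w(1) by (rule permutes_compose)
    show "\<sigma> i * \<sigma>' (\<pi> i) = 1 \<or> \<sigma> i * \<sigma>' (\<pi> i) = - 1" for i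
      using u(2) w(2) by (metis mult_1 mult_minus1 minus_minus)
    show "\<sigma> i * \<sigma>' (\<pi> i) = 1" if "i \<notin> A" for i
      using that u w permutes_not_in[OF u(1) that] by simp
  qed (auto simp: u(4) w(4) fun_eq_iff)
qed

lemma signed_perm_mono: "signed_perm A u \<Longrightarrow> A \<subseteq> B \<Longrightarrow> signed_perm B u"
  unfolding signed_perm_def using permutes_subset by blast

lemma signed_perm_inv:
  assumes "signed_perm A u"
  obtains u' where "signed_perm A u'" "u \<circ> u' = id" "u' \<circ> u = id"
proof -
  obtain \<pi> \<sigma> where u: "\<pi> permutes A" "\<forall>i. \<sigma> i = 1 \<or> \<sigma> i = - 1" "\<forall>i. i \<notin> A \<longrightarrow> \<sigma> i = 1"
    "u = (\<lambda>v i. \<sigma> i * v (\<pi> i))"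
    using assms(1) unfolding signed_perm_def by blast
  let ?u = "\<lambda>v i. \<sigma> (inv_into UNIV \<pi> i) * v (inv_into UNIV \<pi> i)"
  have sq: "\<sigma> i * \<sigma> i = 1" for i using u(2) by (metis mult_1 mult_minus1 minus_minus)
  show ?thesis
  proof (rule that[of ?u])
    show "signed_perm A ?u"
      unfolding signed_perm_def
      using u permutes_inv[OF u(1)] permutes_not_in[OF permutes_inv[OF u(1)]]
      by (intro exI[of _ "inv_into UNIV \<pi>"] exI[of _ "\<lambda>i. \<sigma> (inv_into UNIV \<pi> i)"]) auto
    show "u \<circ> ?u = id" "?u \<circ> u = id"
      using sq by (auto simp: u(4) fun_eq_iff permutes_inverses[OF u(1)] mult.assoc[symmetric])
  qed
qed

lemma signed_perm_linear:
  assumes "signed_perm A u"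
  shows "u (v + v') = u v + u v'" "u (v - v') = u v - u v'" "u (- v) = - u v" "u (\<lambda>i. r * v i) = (\<lambda>i. r * u v i)"
    "u 0 = 0"
  using assms unfolding signed_perm_def by (auto simp: fun_eq_iff algebra_simps)

text \<open>The group component of an index ranges over all signed permutations of the natural
  numbers, so that one index type serves every n and all three Weyl groups.\<close>

typedef sperm = "{w. signed_perm UNIV w}"
  by (rule exI[of _ id]) simp

definition sp_pos :: "sperm \<Rightarrow> nat \<Rightarrow> nat" where
  "sp_pos w i = (THE j. Rep_sperm w (std i) j \<noteq> 0)"

definition sp_sgn :: "sperm \<Rightarrow> nat \<Rightarrow> real" where
  "sp_sgn w i = Rep_sperm w (std i) (sp_pos w i)"

lemma sp_std: "Rep_sperm w (std i) = (\<lambda>l. sp_sgn w i * std (sp_pos w i) l)"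
  and sp_sgn: "sp_sgn w i = 1 \<or> sp_sgn w i = - 1"
  and sp_pos_eq_iff: "sp_pos w i = sp_pos w j \<longleftrightarrow> i = j"
proof -
  obtain \<pi> \<sigma> where w: "\<pi> permutes UNIV" "\<forall>i. \<sigma> i = 1 \<or> \<sigma> i = - 1" "Rep_sperm w = (\<lambda>v i. \<sigma> i * v (\<pi> i))"
    using Rep_sperm[of w] unfolding signed_perm_def by auto
  have s: "Rep_sperm w (std i) = (\<lambda>l. if l = inv_into UNIV \<pi> i then \<sigma> l else 0)" for i
    using permutes_inverses[OF w(1)] by (auto simp: w(3) std_def fun_eq_iff)
  have nz: "\<sigma> i \<noteq> 0" for i using w(2) by (metis one_neq_zero neg_equal_0_iff_equal)
  have p: "sp_pos w i = inv_into UNIV \<pi> i" for i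
    unfolding sp_pos_def s by (rule the_equality) (use nz in \<open>auto split: if_splits\<close>)
  show "Rep_sperm w (std i) = (\<lambda>l. sp_sgn w i * std (sp_pos w i) l)"
    by (auto simp: sp_sgn_def p s std_def[of "inv_into UNIV \<pi> i"] fun_eq_iff)
  show "sp_sgn w i = 1 \<or> sp_sgn w i = - 1" using w(2) by (auto simp: sp_sgn_def p s)
  show "sp_pos w i = sp_pos w j \<longleftrightarrow> i = j" by (metis p permutes_inverses(1)[OF w(1)])
qed

definition sp_mult :: "sperm \<Rightarrow> (vec \<Rightarrow> vec) \<Rightarrow> sperm" where
  "sp_mult w u = Abs_sperm (Rep_sperm w \<circ> u)"

lemma Rep_sp_mult: "signed_perm A u \<Longrightarrow> Rep_sperm (sp_mult w u) = Rep_sperm w \<circ> u"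
  unfolding sp_mult_def using Rep_sperm[of w] signed_perm_mono[of A u UNIV]
  by (intro Abs_sperm_inverse) (auto intro: signed_perm_comp)

lemma sp_mult_id [simp]: "sp_mult w id = w"
  by (simp add: sp_mult_def Rep_sperm_inverse)

lemma sp_mult_mult:
  "signed_perm A u \<Longrightarrow> sp_mult (sp_mult w u) u' = sp_mult w (u \<circ> u')"
  by (simp add: sp_mult_def[of _ u'] sp_mult_def[of w "u \<circ> u'"] Rep_sp_mult comp_assoc)

text \<open>The product w u sees e_i through u e_i = t e_j. This computation is what makes the
  Clifford and shift operators equivariant.\<close>

lemma sp_mult_std:
  assumes u: "signed_perm A u" and "u (std i) = (\<lambda>l. t * std j l)"
  shows "sp_pos (sp_mult w u) i = sp_pos w j" "sp_sgn (sp_mult w u) i = t * sp_sgn w j"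
proof -
  have "signed_perm UNIV (Rep_sperm w)" using Rep_sperm[of w] by simp
  note lin = signed_perm_linear[OF this]
  have *: "Rep_sperm (sp_mult w u) (std i) = (\<lambda>l. t * (sp_sgn w j * std (sp_pos w j) l))"
    by (simp add: Rep_sp_mult[OF u] assms(2) lin sp_std)
  have "(\<lambda>l. sp_sgn (sp_mult w u) i * std (sp_pos (sp_mult w u) i) l) = (\<lambda>l. t * (sp_sgn w j * std (sp_pos w j) l))"
    using * sp_std[of "sp_mult w u" i] by simp
  then have e: "sp_sgn (sp_mult w u) i * std (sp_pos (sp_mult w u) i) l = t * (sp_sgn w j * std (sp_pos w j) l)" for l
    by (rule fun_cong)
  have nz: "sp_sgn (sp_mult w u) i \<noteq> 0" using sp_sgn[of "sp_mult w u" i] by auto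
  show p: "sp_pos (sp_mult w u) i = sp_pos w j"
    using e[of "sp_pos (sp_mult w u) i"] nz by (auto simp: std_def split: if_splits)
  show "sp_sgn (sp_mult w u) i = t * sp_sgn w j"
    using e[of "sp_pos w j"] by (simp add: p) (simp add: std_def)
qed

text \<open>Negativity in the lexicographic order. Positive roots are not negative in this sense,
  and the order refers neither to n nor to the type.\<close>

definition vneg :: "vec \<Rightarrow> bool" where
  "vneg v \<longleftrightarrow> (\<exists>m. v m < 0 \<and> (\<forall>l<m. v l = 0))"

lemma vneg_uminus:
  assumes "v \<noteq> 0"
  shows "vneg (- v) \<longleftrightarrow> \<not> vneg v"
proof -
  define m where "m = (LEAST m. v m \<noteq> 0)"
  obtain j where "v j \<noteq> 0" using assms by (auto simp: fun_eq_iff)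
  then have m: "v m \<noteq> 0" unfolding m_def by (rule LeastI)
  have l: "v l = 0" if "l < m" for l using not_less_Least[OF that[unfolded m_def]] by simp
  have *: "vneg v' \<longleftrightarrow> v' m < 0" if "v' m \<noteq> 0" "\<And>l. l < m \<Longrightarrow> v' l = 0" for v' :: vec
    unfolding vneg_def by (metis that linorder_neqE_nat less_irrefl)
  have "vneg v \<longleftrightarrow> v m < 0" using m l by (rule *)
  moreover have "vneg (- v) \<longleftrightarrow> (- v) m < 0" using m l by (intro *) auto
  ultimately show ?thesis using m by auto
qed

lemma not_vneg_add:
  assumes "\<not> vneg u" "\<not> vneg v"
  shows "\<not> vneg (u + v)"
proof
  assume "vneg (u + v)"
  then obtain m where m: "u m + v m < 0" "\<And>l. l < m \<Longrightarrow> u l + v l = 0"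
    unfolding vneg_def by auto
  have z: "u l = 0 \<and> v l = 0" if "l < m" for l
    using that
  proof (induction l rule: less_induct)
    case (less l)
    then have "\<not> u l < 0" "\<not> v l < 0" using assms unfolding vneg_def by (metis less_trans)+
    then show ?case using m(2)[OF less.prems] by auto
  qed
  have "u m < 0 \<or> v m < 0" using m(1) by auto
  then show False using z assms unfolding vneg_def by metis
qed

section \<open>Fermionic modes and the basic operators\<close>

definition flip :: "nat \<Rightarrow> nat set \<Rightarrow> nat set" where
  "flip p I = (if p \<in> I then I - {p} else insert p I)"

text \<open>The Jordan-Wigner sign of mode p. Only modes below p are counted, so the cardinality is
  that of a finite set even when \<open>I\<close> is infinite.\<close>

definition jw :: "nat \<Rightarrow> nat set \<Rightarrow> complex" where
  "jw p I = (- 1) ^ card {q \<in> I. q < p}"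

lemma flip_flip [simp]: "flip p (flip p I) = I"
  by (auto simp: flip_def)

lemma flip_commute: "flip p (flip q I) = flip q (flip p I)"
  by (auto simp: flip_def)

lemma mem_flip: "p \<in> flip q I \<longleftrightarrow> (if p = q then p \<notin> I else p \<in> I)"
  by (auto simp: flip_def)

lemma jw_flip: "jw p (flip q I) = (if q < p then - jw p I else jw p I)"
proof (cases "q < p")
  case True
  have fin: "finite {r \<in> I. r < p}" by simp
  show ?thesis
  proof (cases "q \<in> I")
    case True
    have "{r \<in> I. r < p} = insert q {r \<in> flip q I. r < p}"
      using True \<open>q < p\<close> by (auto simp: flip_def)
    moreover have "q \<notin> {r \<in> flip q I. r < p}" using True by (auto simp: flip_def)
    moreover have "finite {r \<in> flip q I. r < p}" by simp
    ultimately have "card {r \<in> I. r < p} = Suc (card {r \<in> flip q I. r < p})"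
      by (metis card_insert_disjoint)
    then show ?thesis using \<open>q < p\<close> by (simp add: jw_def)
  next
    case False
    have "{r \<in> flip q I. r < p} = insert q {r \<in> I. r < p}"
      using False \<open>q < p\<close> by (auto simp: flip_def)
    then have "card {r \<in> flip q I. r < p} = Suc (card {r \<in> I. r < p})"
      using fin False by simp
    then show ?thesis using \<open>q < p\<close> by (simp add: jw_def)
  qed
next
  case False
  then have "{r \<in> flip q I. r < p} = {r \<in> I. r < p}" by (auto simp: flip_def)
  then show ?thesis using False by (simp add: jw_def)
qed

lemma jw_square: "jw p I * jw p I = 1"
  by (simp add: jw_def power_mult_distrib[symmetric])

text \<open>The components (w, I, e, b, d) are a group element, the set of occupied fermionic modes,
  a parity bit, an exponent vector and a degree. Since \<open>I\<close> and \<open>b\<close> may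
  have infinite support, neither the parity of \<open>I\<close> nor the sum of \<open>b\<close>
  makes sense in general; \<open>e\<close> and \<open>d\<close> record how these change.\<close>

type_synonym idx = "sperm \<times> nat set \<times> bool \<times> (nat \<Rightarrow> int) \<times> int"
type_synonym hend = "idx lend"

text \<open>The Clifford generator attached to w(e_i) = sgn e_j acts on mode j + 1; mode 0 is kept
  free for \<open>etaO\<close>. The factor \<i> makes the square equal to -1.\<close>

definition cO :: "nat \<Rightarrow> hend" where
  "cO i = wsub (\<lambda>(w, I, e, b, d). complex_of_real (sp_sgn w i) * (\<i> * jw (Suc (sp_pos w i)) I))
     (\<lambda>(w, I, e, b, d). (w, flip (Suc (sp_pos w i)) I, \<not> e, b, d))"

text \<open>A further Clifford generator that does not depend on w and therefore commutes with the
  group operators. It is used to produce the commutator parameter N.\<close>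

definition etaO :: hend where
  "etaO = wsub (\<lambda>(w, I, e, b, d). \<i> * jw 0 I) (\<lambda>(w, I, e, b, d). (w, flip 0 I, \<not> e, b, d))"

text \<open>The shift in the direction w(e_i), the associated graded version of x_i. The sign read
  from the mode of c_i makes it anticommute with c_i while it commutes with the other c_j.\<close>

definition sO :: "nat \<Rightarrow> hend" where
  "sO i = wsub (\<lambda>(w, I, e, b, d). complex_of_real (sp_sgn w i) * (if Suc (sp_pos w i) \<in> I then - 1 else 1))
     (\<lambda>(w, I, e, b, d). (w, I, e, b(sp_pos w i := b (sp_pos w i) + 1), d + 1))"

text \<open>Right multiplication on the group component; by contravariance of substitution it is a
  left action of the group.\<close>

definition gO :: "(vec \<Rightarrow> vec) \<Rightarrow> hend" where
  "gO u = wsub (\<lambda>_. 1) (\<lambda>(w, I, e, b, d). (sp_mult w u, I, e, b, d))"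

text \<open>The projection onto the indices at which w makes \<alpha> negative. Conjugation by
  \<open>gO u\<close> turns \<alpha> into u \<alpha>.\<close>

definition nuO :: "vec \<Rightarrow> hend" where
  "nuO \<alpha> = wsub (\<lambda>(w, I, e, b, d). if vneg (Rep_sperm w \<alpha>) then 1 else 0) (\<lambda>i. i)"

definition piO :: hend where
  "piO = wsub (\<lambda>(w, I, e, b, d). if e then - 1 else 1) (\<lambda>i. i)"

text \<open>A separating device: these multiplications commute with Clifford and group operators but
  detect the exponents, so they isolate one monomial in the proof of independence.\<close>

definition mbO :: "((nat \<Rightarrow> int) \<Rightarrow> complex) \<Rightarrow> hend" where
  "mbO \<phi> = wsub (\<lambda>(w, I, e, b, d). \<phi> b) (\<lambda>i. i)"

lemmas op_defs = cO_def etaO_def sO_def gO_def nuO_def piO_def mbO_def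

lemma sp_sgn_sq [simp]: "complex_of_real (sp_sgn w i) * complex_of_real (sp_sgn w i) = 1"
  using sp_sgn[of w i] by auto

lemma sp_sgn_sq' [simp]: "complex_of_real (sp_sgn w i) * (complex_of_real (sp_sgn w i) * z) = z"
  by (simp add: mult.assoc[symmetric])

lemma jw_square' [simp]: "jw p I * (jw p I * z) = z"
  by (simp add: mult.assoc[symmetric] jw_square)

lemma ii_ii [simp]: "\<i> * (\<i> * z) = - z"
  by (simp add: mult.assoc[symmetric])

lemma cO_anti: "i \<noteq> j \<Longrightarrow> cO i * cO j = - (cO j * cO i)"
  by (rule lend_eqI)
    (auto simp: op_defs jw_flip flip_commute sp_pos_eq_iff split: prod.splits)

lemma cO_sq: "cO i * cO i = - 1"
  by (rule lend_eqI) (auto simp: op_defs jw_flip ac_simps split: prod.splits)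

lemma eta_sq: "etaO * etaO = - 1"
  by (rule lend_eqI) (auto simp: op_defs jw_flip ac_simps split: prod.splits)

lemma eta_cO: "etaO * cO i = - (cO i * etaO)"
  by (rule lend_eqI)
    (auto simp: op_defs jw_flip flip_commute[of 0] sp_pos_eq_iff split: prod.splits)

lemma sO_commute: "sO i * sO j = sO j * sO i"
  by (rule lend_eqI) (auto simp: op_defs fun_upd_twist sp_pos_eq_iff split: prod.splits)

lemma sO_cO: "sO i * cO j = (if i = j then - (cO j * sO i) else cO j * sO i)"
  by (rule lend_eqI) (auto simp: op_defs mem_flip sp_pos_eq_iff split: prod.splits)

lemma sO_eta: "sO i * etaO = etaO * sO i"
  by (rule lend_eqI) (auto simp: op_defs mem_flip split: prod.splits)

lemma nuO_commute:
  "nuO \<alpha> * cO i = cO i * nuO \<alpha>" "nuO \<alpha> * etaO = etaO * nuO \<alpha>" "nuO \<alpha> * sO i = sO i * nuO \<alpha>"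
  "nuO \<alpha> * piO = piO * nuO \<alpha>" "nuO \<alpha> * mbO \<phi> = mbO \<phi> * nuO \<alpha>"
  by (rule lend_eqI, auto simp: op_defs split: prod.splits)+

lemma piO_commute:
  "piO * cO i = - (cO i * piO)" "piO * etaO = - (etaO * piO)" "piO * sO i = sO i * piO"
  "piO * gO u = gO u * piO" "piO * piO = 1"
  by (rule lend_eqI, auto simp: op_defs split: prod.splits)+

lemma mbO_commute:
  "mbO \<phi> * cO i = cO i * mbO \<phi>" "mbO \<phi> * etaO = etaO * mbO \<phi>" "mbO \<phi> * gO u = gO u * mbO \<phi>"
  by (rule lend_eqI, auto simp: op_defs split: prod.splits)+

lemma gO_id: "gO id = 1"
  by (rule lend_eqI) (auto simp: op_defs split: prod.splits)

lemma gO_mult: "signed_perm A u \<Longrightarrow> gO u * gO v = gO (u \<circ> v)"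
  by (rule lend_eqI) (auto simp: op_defs sp_mult_mult split: prod.splits)

lemma gO_eta: "gO u * etaO = etaO * gO u"
  by (rule lend_eqI) (auto simp: op_defs split: prod.splits)

lemma gO_nuO: "signed_perm A u \<Longrightarrow> gO u * nuO \<alpha> = nuO (u \<alpha>) * gO u"
  by (rule lend_eqI) (auto simp: op_defs Rep_sp_mult split: prod.splits)

lemma gO_cO_std:
  assumes "signed_perm A u" "u (std i) = (\<lambda>l. t * std j l)"
  shows "gO u * cO i = sc (complex_of_real t) * cO j * gO u"
  by (rule lend_eqI) (auto simp: op_defs sp_mult_std[OF assms] split: prod.splits)

lemma gO_sO_std:
  assumes "signed_perm A u" "u (std i) = (\<lambda>l. t * std j l)"
  shows "gO u * sO i = sc (complex_of_real t) * sO j * gO u"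
  by (rule lend_eqI) (auto simp: op_defs sp_mult_std[OF assms] split: prod.splits)

lemma nuO_uminus:
  assumes "\<alpha> \<noteq> 0"
  shows "nuO (- \<alpha>) = 1 - nuO \<alpha>"
proof (rule lend_eqI)
  fix f and i :: idx
  obtain w I e b d where i: "i = (w, I, e, b, d)" by (cases i)
  have w: "signed_perm UNIV (Rep_sperm w)" using Rep_sperm[of w] by simp
  obtain w' where "w' \<circ> Rep_sperm w = id" "signed_perm UNIV w'" using signed_perm_inv[OF w] by metis
  then have "Rep_sperm w \<alpha> \<noteq> 0" using assms signed_perm_linear(5) by (metis comp_apply id_apply)
  then show "app (nuO (- \<alpha>)) f i = app (1 - nuO \<alpha>) f i"
    by (simp add: op_defs i signed_perm_linear[OF w] vneg_uminus)
qed

section \<open>Linear extension to vectors, equivariance and reflections\<close>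

definition lin :: "nat \<Rightarrow> (nat \<Rightarrow> hend) \<Rightarrow> vec \<Rightarrow> hend" where
  "lin n F v = (\<Sum>l = 1..n. sc (complex_of_real (v l)) * F l)"

abbreviation cv :: "nat \<Rightarrow> vec \<Rightarrow> hend" where "cv n \<equiv> lin n cO"

lemma sc_left: "T * (sc a * S) = sc a * (T * S)"
  by (simp add: mult.assoc[symmetric] sc_commute[of T])

lemmas sc_ops = sc_left[of "cO i" for i] sc_left[of "sO i" for i] sc_left[of etaO] sc_left[of "gO u" for u]
  sc_left[of "nuO \<alpha>" for \<alpha>] sc_commute[of "cO i" for i] sc_commute[of "sO i" for i] sc_commute[of etaO]
  sc_commute[of "gO u" for u] sc_commute[of "nuO \<alpha>" for \<alpha>]

lemma sc_sc: "sc a * (sc b * S) = sc (a * b) * S"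
  by (simp add: sc_mult mult.assoc)

lemma lin_diff: "lin n F (u - v) = lin n F u - lin n F v"
  by (simp add: lin_def sc_diff left_diff_distrib sum_subtractf)

lemma lin_uminus: "lin n F (- v) = - lin n F v"
  by (simp add: lin_def sc_uminus sum_negf)

lemma lin_cmult: "lin n F (\<lambda>i. r * v i) = sc (complex_of_real r) * lin n F v"
  by (simp add: lin_def sum_distrib_left sc_sc)

lemma lin_std: "i \<in> {1..n} \<Longrightarrow> lin n F (std i) = F i"
proof -
  assume i: "i \<in> {1..n}"
  have "lin n F (std i) = (\<Sum>l = 1..n. if l = i then F l else 0)"
    unfolding lin_def by (rule sum.cong) (auto simp: std_def)
  then show ?thesis using i by simp
qed

lemma cO_anti_sum: "cO i * cO j + cO j * cO i = (if i = j then sc (- 2) else 0)"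
  using cO_anti[of i j] by (auto simp: cO_sq sc_uminus sc_numeral)

lemma cv_anti: "cv n u * cv n v + cv n v * cv n u = sc (complex_of_real (- 2 * ip n u v))"
proof -
  have 1: "cv n u * cv n v = (\<Sum>i = 1..n. \<Sum>j = 1..n. sc (complex_of_real (u i * v j)) * (cO i * cO j))" for u v
    by (simp add: lin_def sum_product sc_ops sc_sc mult.assoc mult.commute)
  have 2: "cv n v * cv n u = (\<Sum>i = 1..n. \<Sum>j = 1..n. sc (complex_of_real (u i * v j)) * (cO j * cO i))"
    by (subst 1, subst sum.swap) (simp add: mult.commute)
  have "cv n u * cv n v + cv n v * cv n u =
      (\<Sum>i = 1..n. \<Sum>j = 1..n. sc (complex_of_real (u i * v j)) * (cO i * cO j + cO j * cO i))"
    by (simp add: 1[of u v] 2 sum.distrib[symmetric] distrib_left)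
  also have "\<dots> = (\<Sum>i = 1..n. \<Sum>j = 1..n. if i = j then sc (complex_of_real (- 2 * (u i * v j))) else 0)"
    by (intro sum.cong) (auto simp: cO_anti_sum sc_mult[symmetric] ac_simps)
  also have "\<dots> = sc (complex_of_real (- 2 * ip n u v))"
    by (simp add: ip_def sc_sum[symmetric] sum_distrib_left sum_negf sc_uminus)
  finally show ?thesis .
qed

lemma cv_sq: "cv n v * cv n v = sc (- complex_of_real (ip n v v))"
proof -
  have "cv n v * cv n v + cv n v * cv n v = sc (- complex_of_real (ip n v v)) + sc (- complex_of_real (ip n v v))"
    by (simp add: cv_anti sc_add[symmetric])
  then have "sc (1/2) * (cv n v * cv n v + cv n v * cv n v) = sc (1/2) * (sc (- complex_of_real (ip n v v)) + sc (- complex_of_real (ip n v v)))"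
    by simp
  then show ?thesis by (simp add: distrib_left[symmetric] mult_2[symmetric] sc_numeral[symmetric] sc_sc sc_mult[symmetric])
qed

lemma signed_perm_std:
  assumes "\<pi> permutes A" "u = (\<lambda>v i. \<sigma> i * v (\<pi> i))"
  shows "u (std i) = (\<lambda>l. \<sigma> (inv_into UNIV \<pi> i) * std (inv_into UNIV \<pi> i) l)"
  using permutes_inverses[OF assms(1)] by (auto simp: assms(2) std_def fun_eq_iff)

text \<open>The family F behaves under conjugation by the group like the images of the basis vectors
  under a linear map, signs included. Only this is needed to move \<open>gO u\<close> across
  \<open>lin n F v\<close>.\<close>

definition equivariant :: "(nat \<Rightarrow> hend) \<Rightarrow> bool" where
  "equivariant F \<longleftrightarrow> (\<forall>A u i j t. signed_perm A u \<longrightarrow> u (std i) = (\<lambda>l. t * std j l) \<longrightarrow>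
     gO u * F i = sc (complex_of_real t) * F j * gO u)"

lemma equivariant_cO: "equivariant cO" and equivariant_sO: "equivariant sO"
  unfolding equivariant_def using gO_cO_std gO_sO_std by blast+

lemma gO_lin:
  assumes F: "equivariant F" and u: "signed_perm {1..n} u"
  shows "gO u * lin n F v = lin n F (u v) * gO u"
proof -
  obtain \<pi> \<sigma> where w: "\<pi> permutes {1..n}" "u = (\<lambda>v i. \<sigma> i * v (\<pi> i))"
    using u unfolding signed_perm_def by blast
  note F' = F[unfolded equivariant_def, rule_format, OF u signed_perm_std[OF w]]
  let ?p = "inv_into UNIV \<pi>"
  have uv: "u v (?p l) = \<sigma> (?p l) * v l" for l
    by (simp add: w(2) permutes_inverses[OF w(1)])
  have "gO u * lin n F v = (\<Sum>l = 1..n. sc (complex_of_real (v l)) * (gO u * F l))"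
    by (simp add: lin_def sum_distrib_left sc_ops)
  also have "\<dots> = (\<Sum>l = 1..n. sc (complex_of_real (u v (?p l))) * (F (?p l) * gO u))"
    by (simp add: F' mult.assoc sc_sc uv mult.commute)
  also have "\<dots> = (\<Sum>l = 1..n. sc (complex_of_real (u v l)) * (F l * gO u))"
    using sum.permute[OF permutes_inv[OF w(1)], of "\<lambda>l. sc (complex_of_real (u v l)) * (F l * gO u)"]
    by (simp add: comp_def)
  finally show ?thesis by (simp add: lin_def sum_distrib_right mult.assoc)
qed

text \<open>Moving \<open>gO u\<close> across a summand permutes the indices, and the two signs
  coming from F and G are equal, hence cancel.\<close>

lemma gO_pairing:
  assumes F: "equivariant F" and G: "equivariant G" and u: "signed_perm {1..n} u"
  shows "gO u * (\<Sum>l = 1..n. F l * G l) = (\<Sum>l = 1..n. F l * G l) * gO u"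
proof -
  obtain \<pi> \<sigma> where w: "\<pi> permutes {1..n}" "\<forall>i. \<sigma> i = 1 \<or> \<sigma> i = - 1" "u = (\<lambda>v i. \<sigma> i * v (\<pi> i))"
    using u unfolding signed_perm_def by blast
  note F' = F[unfolded equivariant_def, rule_format, OF u signed_perm_std[OF w(1,3)]]
  note G' = G[unfolded equivariant_def, rule_format, OF u signed_perm_std[OF w(1,3)]]
  let ?p = "inv_into UNIV \<pi>"
  have s: "\<sigma> i * \<sigma> i = 1" for i using w(2) by (metis mult_1 mult_minus1 minus_minus)
  have 1: "gO u * (F l * G l) = F (?p l) * G (?p l) * gO u" for l
  proof -
    have "gO u * (F l * G l) = sc (complex_of_real (\<sigma> (?p l))) * (F (?p l) * (gO u * G l))"
      by (simp add: mult.assoc[symmetric] F')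
    also have "\<dots> = sc (complex_of_real (\<sigma> (?p l) * \<sigma> (?p l))) * (F (?p l) * (G (?p l) * gO u))"
      by (simp only: G' mult.assoc sc_left[of "F (?p l)"] sc_sc of_real_mult)
    finally show ?thesis by (simp add: s mult.assoc)
  qed
  have "gO u * (\<Sum>l = 1..n. F l * G l) = (\<Sum>l = 1..n. F (?p l) * G (?p l) * gO u)"
    by (simp add: sum_distrib_left 1)
  also have "\<dots> = (\<Sum>l = 1..n. F l * G l * gO u)"
    using sum.permute[OF permutes_inv[OF w(1)], of "\<lambda>l. F l * G l * gO u"] by (simp add: comp_def)
  finally show ?thesis by (simp add: sum_distrib_right)
qed

lemma ip_signed_perm:
  assumes u: "signed_perm {1..n} u"
  shows "ip n (u v) (u v') = ip n v v'"
proof -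
  obtain \<pi> \<sigma> where w: "\<pi> permutes {1..n}" "\<forall>i. \<sigma> i = 1 \<or> \<sigma> i = - 1" "u = (\<lambda>v i. \<sigma> i * v (\<pi> i))"
    using u unfolding signed_perm_def by blast
  have s: "\<sigma> i * x * (\<sigma> i * y) = x * y" for i x y using w(2)[rule_format, of i] by auto
  have "ip n (u v) (u v') = (\<Sum>l = 1..n. v (\<pi> l) * v' (\<pi> l))"
    by (simp add: ip_def w(3) s)
  also have "\<dots> = ip n v v'"
    unfolding ip_def using sum.permute[OF w(1), of "\<lambda>l. v l * v' l"] by (simp add: comp_def)
  finally show ?thesis .
qed

lemma refl_in_eq: "refl_in n \<alpha> v = v - (\<lambda>i. (2 * ip n v \<alpha> / ip n \<alpha> \<alpha>) * \<alpha> i)"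
  by (simp add: refl_in_def fun_eq_iff)

lemma refl_in_conj:
  assumes u: "signed_perm {1..n} u"
  shows "u \<circ> refl_in n \<alpha> = refl_in n (u \<alpha>) \<circ> u"
  by (simp only: fun_eq_iff comp_apply refl_in_eq ip_signed_perm[OF u] signed_perm_linear[OF u])
    simp

lemma ip_uminus: "ip n (- u) v = - ip n u v" "ip n u (- v) = - ip n u v"
  by (simp_all add: ip_def sum_negf)

lemma ip_cmult: "ip n (\<lambda>i. r * u i) v = r * ip n u v"
  by (simp add: ip_def sum_distrib_left mult.assoc)

lemma refl_in_uminus: "refl_in n (- \<alpha>) = refl_in n \<alpha>"
  by (simp add: refl_in_def ip_uminus fun_eq_iff)

lemma refl_in_refl_in:
  assumes "ip n \<alpha> \<alpha> \<noteq> 0"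
  shows "refl_in n \<alpha> \<circ> refl_in n \<alpha> = id"
proof
  fix v
  have *: "ip n (refl_in n \<alpha> v) \<alpha> = - ip n v \<alpha>"
    unfolding refl_in_eq ip_diff_left ip_cmult using assms by simp
  have "refl_in n \<alpha> (refl_in n \<alpha> v) = (\<lambda>i. refl_in n \<alpha> v i - 2 * ip n (refl_in n \<alpha> v) \<alpha> / ip n \<alpha> \<alpha> * \<alpha> i)"
    by (simp add: refl_in_def[of n \<alpha> "refl_in n \<alpha> v"])
  also have "\<dots> = v" unfolding * by (simp add: refl_in_def)
  finally show "(refl_in n \<alpha> \<circ> refl_in n \<alpha>) v = id v" by simp
qed

lemma refl_in_self: "ip n \<alpha> \<alpha> \<noteq> 0 \<Longrightarrow> refl_in n \<alpha> \<alpha> = - \<alpha>"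
  by (simp add: refl_in_def fun_eq_iff)

text \<open>Restriction of v to the support of \<alpha>. It commutes with signed permutations acting
  on both arguments, and on basis vectors it expresses the condition \<alpha>_i \<noteq> 0 in a form
  linear in v.\<close>

definition pr :: "vec \<Rightarrow> vec \<Rightarrow> vec" where
  "pr \<alpha> v = (\<lambda>l. if \<alpha> l = 0 then 0 else v l)"

text \<open>The element s_\<alpha> c_\<alpha> with the root not normalised, the length being
  absorbed into the weights. It is odd in \<alpha>, because s_\<alpha> does not see the
  sign.\<close>

definition rs :: "nat \<Rightarrow> vec \<Rightarrow> hend" where
  "rs n \<alpha> = gO (refl_in n \<alpha>) * cv n \<alpha>"

lemma rs_uminus: "rs n (- \<alpha>) = - rs n \<alpha>"
  by (simp add: rs_def refl_in_uminus lin_uminus)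

lemma rs_conj:
  assumes u: "signed_perm {1..n} u" and r: "signed_perm {1..n} (refl_in n \<alpha>)"
  shows "gO u * rs n \<alpha> = rs n (u \<alpha>) * gO u"
proof -
  have r': "signed_perm {1..n} (refl_in n (u \<alpha>))"
  proof -
    obtain u' where u': "signed_perm {1..n} u'" "u \<circ> u' = id" using signed_perm_inv[OF u] .
    have "refl_in n (u \<alpha>) = u \<circ> refl_in n \<alpha> \<circ> u'"
      by (simp add: refl_in_conj[OF u] comp_assoc u'(2))
    then show ?thesis using u u'(1) r by (simp add: signed_perm_comp)
  qed
  have "gO u * rs n \<alpha> = gO (u \<circ> refl_in n \<alpha>) * cv n \<alpha>"
    by (simp add: rs_def mult.assoc[symmetric] gO_mult[OF u])
  also have "\<dots> = gO (refl_in n (u \<alpha>)) * (gO u * cv n \<alpha>)"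
    by (simp add: refl_in_conj[OF u] gO_mult[OF r', symmetric] mult.assoc)
  also have "\<dots> = rs n (u \<alpha>) * gO u"
    by (simp add: gO_lin[OF equivariant_cO u] rs_def mult.assoc)
  finally show ?thesis .
qed

text \<open>Moving c_v past s_\<alpha> reflects v. The multiple of \<alpha> so subtracted
  contributes exactly the anticommutator of c_v and c_\<alpha>, which leaves -c_\<alpha>
  c_v.\<close>

lemma rs_cv_anti:
  assumes r: "signed_perm {1..n} (refl_in n \<alpha>)" and nz: "ip n \<alpha> \<alpha> \<noteq> 0"
  shows "cv n v * rs n \<alpha> = - (rs n \<alpha> * cv n v)"
proof -
  let ?s = "gO (refl_in n \<alpha>)" and ?t = "2 * ip n v \<alpha> / ip n \<alpha> \<alpha>"
  have "refl_in n \<alpha> (refl_in n \<alpha> v) = v" using refl_in_refl_in[OF nz] by (metis comp_apply id_apply)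
  then have "cv n v * ?s = ?s * cv n (refl_in n \<alpha> v)"
    by (simp add: gO_lin[OF equivariant_cO r])
  then have "cv n v * rs n \<alpha> = ?s * (cv n (refl_in n \<alpha> v) * cv n \<alpha>)"
    by (simp add: rs_def mult.assoc[symmetric])
  also have "refl_in n \<alpha> v = v - (\<lambda>i. ?t * \<alpha> i)" by (rule refl_in_eq)
  also have "cv n (v - (\<lambda>i. ?t * \<alpha> i)) * cv n \<alpha> = cv n v * cv n \<alpha> - sc (complex_of_real ?t) * (cv n \<alpha> * cv n \<alpha>)"
    by (simp only: lin_diff lin_cmult left_diff_distrib mult.assoc)
  also have "\<dots> = cv n v * cv n \<alpha> - sc (complex_of_real (- 2 * ip n v \<alpha>))"
    using nz by (simp add: cv_sq sc_mult[symmetric])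
  also have "\<dots> = - (cv n \<alpha> * cv n v)"
    using cv_anti[of n v \<alpha>] by (simp add: algebra_simps)
  finally show ?thesis by (simp add: rs_def mult.assoc)
qed

text \<open>The operator x_i without reflection terms. The element c_i \<eta> is even and has the
  same commutation signs with the c_j as the shift, so it may be added freely; its commutators
  produce the term -2 a^2 c_j c_i.\<close>

definition xh :: "complex \<Rightarrow> nat \<Rightarrow> hend" where
  "xh a i = sO i + sc a * cO i * etaO"

lemma equivariant_xh: "equivariant (xh a)"
  unfolding equivariant_def
proof (intro allI impI)
  fix A u i j t
  assume u: "signed_perm A u" "u (std i) = (\<lambda>l. t * std j l)"
  have "gO u * xh a i = gO u * sO i + sc a * (gO u * cO i * etaO)"
    by (simp add: xh_def distrib_left mult.assoc sc_ops)
  also have "\<dots> = sc (complex_of_real t) * sO j * gO u + sc a * (sc (complex_of_real t) * cO j * etaO * gO u)"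
    by (simp add: gO_sO_std[OF u] gO_cO_std[OF u] mult.assoc gO_eta)
  also have "\<dots> = sc (complex_of_real t) * xh a j * gO u"
    by (simp add: xh_def algebra_simps sc_ops sc_sc mult.commute)
  finally show "gO u * xh a i = sc (complex_of_real t) * xh a j * gO u" .
qed

lemma eta_cO': "etaO * (cO i * T) = - (cO i * (etaO * T))"
  by (simp add: mult.assoc[symmetric] eta_cO)

lemma cO_sq': "cO i * (cO i * T) = - T"
  by (simp add: mult.assoc[symmetric] cO_sq)

lemma xh_cO: "xh a i * cO j = (if i = j then - (cO j * xh a i) else cO j * xh a i)"
proof (cases "i = j")
  case True
  then show ?thesis by (simp add: xh_def distrib_left distrib_right sO_cO mult.assoc eta_cO sc_ops eta_cO' cO_sq')
next
  case False
  then have "cO i * (cO j * etaO) = - (cO j * (cO i * etaO))"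
    using cO_anti[OF False] by (metis mult.assoc mult_minus_left)
  then show ?thesis using False by (simp add: xh_def distrib_left distrib_right sO_cO mult.assoc eta_cO sc_ops)
qed

lemma xh_commutator:
  assumes "i \<noteq> j"
  shows "xh a i * xh a j - xh a j * xh a i = sc (- 2 * a\<^sup>2) * (cO j * cO i)"
proof -
  have *: "xh a i * xh a j = sO i * sO j + sc a * (cO j * (sO i * etaO)) + sc a * (cO i * (sO j * etaO)) + sc (a * a) * (cO i * cO j)"
    if "i \<noteq> j" for i j
  proof -
    have "xh a i * xh a j = sO i * sO j + sc a * (sO i * cO j * etaO) + sc a * (cO i * (etaO * sO j)) +
        sc (a * a) * (cO i * (etaO * (cO j * etaO)))"
      by (simp add: xh_def distrib_left distrib_right mult.assoc sc_ops sc_sc)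
    also have "\<dots> = sO i * sO j + sc a * (cO j * (sO i * etaO)) + sc a * (cO i * (sO j * etaO)) + sc (a * a) * (cO i * cO j)"
      using that by (simp add: sO_cO sO_eta eta_cO' eta_sq mult.assoc)
    finally show ?thesis .
  qed
  have "xh a i * xh a j - xh a j * xh a i = sc (a * a) * (cO i * cO j) - sc (a * a) * (cO j * cO i)"
    using assms by (simp add: * sO_commute[of i j])
  also have "\<dots> = sc (- 2 * a\<^sup>2) * (cO j * cO i)"
    by (simp add: cO_anti[OF assms] power2_eq_square sc_uminus sc_mult sc_numeral algebra_simps mult_2)
  finally show ?thesis .
qed

section \<open>The operator model\<close>

text \<open>The sign of w \<alpha> as a diagonal operator. It is odd in \<alpha> for \<alpha>
  \<noteq> 0, so its product with the odd \<open>rs n \<alpha>\<close> does not depend on the choice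
  between \<alpha> and -\<alpha>.\<close>

definition ep :: "vec \<Rightarrow> hend" where
  "ep \<alpha> = 1 - 2 * nuO \<alpha>"

lemma ep_uminus: "\<alpha> \<noteq> 0 \<Longrightarrow> ep (- \<alpha>) = - ep \<alpha>"
  by (simp add: ep_def nuO_uminus algebra_simps)

lemma gO_ep: "signed_perm A u \<Longrightarrow> gO u * ep \<alpha> = ep (u \<alpha>) * gO u"
  by (simp add: ep_def mult_2[where 'a=hend] distrib_left distrib_right right_diff_distrib left_diff_distrib gO_nuO)

lemma ep_cO: "ep \<alpha> * cO i = cO i * ep \<alpha>"
  by (simp add: ep_def mult_2[where 'a=hend] distrib_left distrib_right right_diff_distrib left_diff_distrib nuO_commute)

lemma pr_std: "pr \<alpha> (std i) = (if \<alpha> i = 0 then 0 else std i)"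
  by (auto simp: pr_def std_def fun_eq_iff)

lemma pr_signed_perm:
  assumes u: "signed_perm A u"
  shows "u (pr \<alpha> v) = pr (u \<alpha>) (u v)"
proof -
  obtain \<pi> \<sigma> where w: "\<forall>i. \<sigma> i = 1 \<or> \<sigma> i = - 1" "u = (\<lambda>v i. \<sigma> i * v (\<pi> i))"
    using u unfolding signed_perm_def by blast
  have "\<sigma> i \<noteq> 0" for i using w(1) by (metis one_neq_zero neg_equal_0_iff_equal)
  then show ?thesis by (auto simp: w(2) pr_def fun_eq_iff)
qed

lemma pr_uminus: "pr (- \<alpha>) v = pr \<alpha> v"
  by (simp add: pr_def)

text \<open>Here P stands for the positive roots and W for the Weyl group. The properties collected
  are common to the three types. By \<open>root_coord\<close> the square of \<alpha>_i is the
  indicator of \<alpha>_i \<noteq> 0, which is how the inner product of \<alpha> with itself arises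
  in \<open>DO_eq\<close>.\<close>

locale hc_model =
  fixes n :: nat and P :: "vec set" and k :: "vec \<Rightarrow> complex" and W :: "(vec \<Rightarrow> vec) set" and a :: complex
  assumes finP: "finite P"
    and root_coord: "\<alpha> \<in> P \<Longrightarrow> \<alpha> l = 0 \<or> \<alpha> l = 1 \<or> \<alpha> l = - 1"
    and root_supp: "\<alpha> \<in> P \<Longrightarrow> l \<notin> {1..n} \<Longrightarrow> \<alpha> l = 0"
    and root_nz: "\<alpha> \<in> P \<Longrightarrow> \<alpha> \<noteq> 0"
    and root_neg: "\<alpha> \<in> P \<Longrightarrow> - \<alpha> \<notin> P"
    and W_sp: "u \<in> W \<Longrightarrow> signed_perm {1..n} u"
    and W_fin: "finite W"
    and W_id: "id \<in> W"
    and W_comp: "u \<in> W \<Longrightarrow> v \<in> W \<Longrightarrow> u \<circ> v \<in> W"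
    and W_inv: "u \<in> W \<Longrightarrow> \<exists>u'\<in>W. u \<circ> u' = id \<and> u' \<circ> u = id"
    and refl_W: "\<alpha> \<in> P \<Longrightarrow> refl_in n \<alpha> \<in> W"
    and W_P: "u \<in> W \<Longrightarrow> \<alpha> \<in> P \<Longrightarrow> u \<alpha> \<in> P \<or> - u \<alpha> \<in> P"
    and k_inv: "u \<in> W \<Longrightarrow> \<alpha> \<in> P \<Longrightarrow> u \<alpha> \<in> P \<Longrightarrow> k (u \<alpha>) = k \<alpha>"
    and k_inv': "u \<in> W \<Longrightarrow> \<alpha> \<in> P \<Longrightarrow> - u \<alpha> \<in> P \<Longrightarrow> k (- u \<alpha>) = k \<alpha>"
begin

text \<open>With these weights \<open>\<kappa>\<^sub>\<alpha>\<close> is \<open>k\<^sub>\<alpha>\<close> for long roots and \<open>\<surd>2 k\<^sub>\<alpha>\<close> for short ones.\<close>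

definition kap :: "vec \<Rightarrow> complex" where
  "kap \<alpha> = k \<alpha> * complex_of_real (sqrt 2 / sqrt (ip n \<alpha> \<alpha>))"

text \<open>The coefficient of the unnormalised \<open>rs n \<alpha>\<close> in the Dirac element:
  \<surd>2/2 times the squared length, divided by the length because c_\<alpha> is normalised
  there.\<close>

definition kp :: "vec \<Rightarrow> complex" where
  "kp \<alpha> = k \<alpha> * complex_of_real (sqrt 2 / 2 * sqrt (ip n \<alpha> \<alpha>))"

text \<open>The reflection term of \<alpha> in x_v. It vanishes at every w with w \<alpha> not
  negative, so that x_v reduces to the part without reflections where w keeps all of P
  positive.\<close>

definition th :: "vec \<Rightarrow> vec \<Rightarrow> hend" where
  "th \<alpha> v = nuO \<alpha> * rs n \<alpha> * cv n (pr \<alpha> v)"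

definition xv :: "vec \<Rightarrow> hend" where
  "xv v = lin n (xh a) v + (\<Sum>\<alpha>\<in>P. sc (kap \<alpha>) * th \<alpha> v)"

definition xO :: "nat \<Rightarrow> hend" where
  "xO i = xv (std i)"

definition KO :: hend where
  "KO = (\<Sum>\<alpha>\<in>P. sc (kp \<alpha>) * rs n \<alpha>)"

definition DO :: hend where
  "DO = (\<Sum>i = 1..n. xO i * cO i) + KO"

lemma ip_root: assumes "\<alpha> \<in> P" shows "ip n \<alpha> \<alpha> > 0"
proof -
  obtain l where l: "\<alpha> l \<noteq> 0" using root_nz[OF assms] by (auto simp: fun_eq_iff)
  then have "l \<in> {1..n}" using root_supp[OF assms] by blast
  then have "\<alpha> l * \<alpha> l \<le> ip n \<alpha> \<alpha>" unfolding ip_def by (intro member_le_sum) auto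
  moreover have "0 < \<alpha> l * \<alpha> l" using l by (simp flip: power2_eq_square)
  ultimately show ?thesis by linarith
qed

lemma ip_root': "\<alpha> \<in> P \<Longrightarrow> ip n \<alpha> \<alpha> \<noteq> 0"
  using ip_root by fastforce

lemma refl_sp: "\<alpha> \<in> P \<Longrightarrow> signed_perm {1..n} (refl_in n \<alpha>)"
  using refl_W W_sp by blast

lemma kap_ip: assumes "\<alpha> \<in> P" shows "kap \<alpha> * complex_of_real (ip n \<alpha> \<alpha>) = 2 * kp \<alpha>"
proof -
  have "sqrt 2 / sqrt (ip n \<alpha> \<alpha>) * ip n \<alpha> \<alpha> = sqrt 2 * sqrt (ip n \<alpha> \<alpha>)"
    using ip_root[OF assms] by (simp add: field_simps)
  then have "complex_of_real (sqrt 2 / sqrt (ip n \<alpha> \<alpha>)) * complex_of_real (ip n \<alpha> \<alpha>) =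
      complex_of_real (sqrt 2 * sqrt (ip n \<alpha> \<alpha>))"
    by (metis of_real_mult)
  then show ?thesis unfolding kap_def kp_def mult.assoc by simp
qed

text \<open>The representative in P of the pair u \<alpha>, -u \<alpha>. It permutes P and thus
  reindexes sums over positive roots even though u does not preserve P.\<close>

definition tau :: "(vec \<Rightarrow> vec) \<Rightarrow> vec \<Rightarrow> vec" where
  "tau u \<alpha> = (if u \<alpha> \<in> P then u \<alpha> else - u \<alpha>)"

lemma tau_P: "u \<in> W \<Longrightarrow> \<alpha> \<in> P \<Longrightarrow> tau u \<alpha> \<in> P"
  using W_P by (auto simp: tau_def)

lemma tau_tau:
  assumes "u \<in> W" "u' \<in> W" "u' \<circ> u = id" "\<alpha> \<in> P"
  shows "tau u' (tau u \<alpha>) = \<alpha>"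
proof -
  have 1: "u' (u \<alpha>) = \<alpha>" using assms(3) by (metis comp_apply id_apply)
  have 2: "u' (- u \<alpha>) = - \<alpha>" using signed_perm_linear(3)[OF W_sp[OF assms(2)]] 1 by simp
  show ?thesis using assms(4) root_neg by (auto simp: tau_def 1 2)
qed

lemma sum_tau:
  assumes "u \<in> W"
  shows "(\<Sum>\<alpha>\<in>P. F (tau u \<alpha>)) = sum F P"
proof -
  obtain u' where u': "u' \<in> W" "u \<circ> u' = id" "u' \<circ> u = id" using W_inv[OF assms] by blast
  have "bij_betw (tau u) P P"
    using tau_P tau_tau assms u' by (intro bij_betwI[of _ _ _ "tau u'"]) auto
  then show ?thesis by (rule sum.reindex_bij_betw)
qed

lemma k_tau: "u \<in> W \<Longrightarrow> \<alpha> \<in> P \<Longrightarrow> k (tau u \<alpha>) = k \<alpha>"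
  using W_P[of u \<alpha>] k_inv[of u \<alpha>] k_inv'[of u \<alpha>] by (auto simp: tau_def simp del: fun_Compl_def)

lemma ip_tau: "u \<in> W \<Longrightarrow> ip n (tau u \<alpha>) (tau u \<alpha>) = ip n \<alpha> \<alpha>"
  using W_sp ip_signed_perm by (auto simp: tau_def ip_uminus)

lemma kap_tau: "u \<in> W \<Longrightarrow> \<alpha> \<in> P \<Longrightarrow> kap (tau u \<alpha>) = kap \<alpha>"
  and kp_tau: "u \<in> W \<Longrightarrow> \<alpha> \<in> P \<Longrightarrow> kp (tau u \<alpha>) = kp \<alpha>"
  by (simp_all add: kap_def kp_def k_tau ip_tau)

lemma th_uminus: "\<alpha> \<in> P \<Longrightarrow> th (- \<alpha>) v = th \<alpha> v - rs n \<alpha> * cv n (pr \<alpha> v)"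
  by (simp add: th_def nuO_uminus root_nz rs_uminus pr_uminus algebra_simps)

lemma gO_rs: "u \<in> W \<Longrightarrow> \<alpha> \<in> P \<Longrightarrow> gO u * rs n \<alpha> = rs n (u \<alpha>) * gO u"
  by (rule rs_conj[OF W_sp refl_sp])

lemma gO_th:
  assumes "u \<in> W" "\<alpha> \<in> P"
  shows "gO u * th \<alpha> v = th (u \<alpha>) (u v) * gO u"
proof -
  have "gO u * th \<alpha> v = nuO (u \<alpha>) * (gO u * rs n \<alpha>) * cv n (pr \<alpha> v)"
    by (simp add: th_def mult.assoc[symmetric] gO_nuO[OF W_sp[OF assms(1)]])
  also have "\<dots> = nuO (u \<alpha>) * rs n (u \<alpha>) * (gO u * cv n (pr \<alpha> v))"
    by (simp add: gO_rs[OF assms] mult.assoc)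
  also have "\<dots> = th (u \<alpha>) (u v) * gO u"
    by (simp add: th_def gO_lin[OF equivariant_cO W_sp[OF assms(1)]] pr_signed_perm[OF W_sp[OF assms(1)]] mult.assoc)
  finally show ?thesis .
qed

text \<open>The correction runs over the inversions of \<open>u\<^sup>-\<^sup>1\<close>.\<close>

lemma gO_xv:
  assumes u: "u \<in> W" and u': "u' \<in> W" "u' \<circ> u = id"
  shows "gO u * xv v = (xv (u v) - (\<Sum>\<alpha>\<in>{\<alpha>\<in>P. u' \<alpha> \<notin> P}. sc (kap \<alpha>) * (rs n \<alpha> * cv n (pr \<alpha> (u v))))) * gO u"
proof -
  have "gO u * (\<Sum>\<alpha>\<in>P. sc (kap \<alpha>) * th \<alpha> v) = (\<Sum>\<alpha>\<in>P. sc (kap \<alpha>) * th (u \<alpha>) (u v)) * gO u"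
    by (simp add: sum_distrib_left sum_distrib_right gO_th[OF u] sc_ops mult.assoc)
  also have "(\<Sum>\<alpha>\<in>P. sc (kap \<alpha>) * th (u \<alpha>) (u v)) =
     (\<Sum>\<alpha>\<in>P. sc (kap (tau u \<alpha>)) * (if u' (tau u \<alpha>) \<in> P then th (tau u \<alpha>) (u v) else th (- tau u \<alpha>) (u v)))"
  proof (intro sum.cong refl)
    fix \<alpha> assume \<alpha>: "\<alpha> \<in> P"
    have 1: "u' (u \<alpha>) = \<alpha>" using u'(2) by (metis comp_apply id_apply)
    have 2: "u' (- u \<alpha>) = - \<alpha>" using signed_perm_linear(3)[OF W_sp[OF u'(1)]] 1 by simp
    show "sc (kap \<alpha>) * th (u \<alpha>) (u v) =
      sc (kap (tau u \<alpha>)) * (if u' (tau u \<alpha>) \<in> P then th (tau u \<alpha>) (u v) else th (- tau u \<alpha>) (u v))"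
      unfolding kap_tau[OF u \<alpha>] using \<alpha> root_neg by (auto simp: tau_def 1 2)
  qed
  also have "\<dots> = (\<Sum>\<alpha>\<in>P. sc (kap \<alpha>) * (if u' \<alpha> \<in> P then th \<alpha> (u v) else th (- \<alpha>) (u v)))"
    by (rule sum_tau[OF u])
  also have "\<dots> = (\<Sum>\<alpha>\<in>P. sc (kap \<alpha>) * th \<alpha> (u v)) -
      (\<Sum>\<alpha>\<in>P. if u' \<alpha> \<notin> P then sc (kap \<alpha>) * (rs n \<alpha> * cv n (pr \<alpha> (u v))) else 0)"
    unfolding sum_subtractf[symmetric] by (intro sum.cong) (auto simp: th_uminus right_diff_distrib)
  also have "(\<Sum>\<alpha>\<in>P. if u' \<alpha> \<notin> P then sc (kap \<alpha>) * (rs n \<alpha> * cv n (pr \<alpha> (u v))) else 0) =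
      (\<Sum>\<alpha>\<in>{\<alpha>\<in>P. u' \<alpha> \<notin> P}. sc (kap \<alpha>) * (rs n \<alpha> * cv n (pr \<alpha> (u v))))"
    using finP by (simp add: sum.inter_filter)
  finally show ?thesis
    by (simp add: xv_def distrib_left distrib_right left_diff_distrib gO_lin[OF equivariant_xh W_sp[OF u]])
qed

lemma rs_cv: "\<alpha> \<in> P \<Longrightarrow> cv n v * rs n \<alpha> = - (rs n \<alpha> * cv n v)"
  by (rule rs_cv_anti[OF refl_sp ip_root'])

lemma rs_cO: "\<alpha> \<in> P \<Longrightarrow> i \<in> {1..n} \<Longrightarrow> cO i * rs n \<alpha> = - (rs n \<alpha> * cO i)"
  using rs_cv[of \<alpha> "std i"] by (simp add: lin_std)

lemma th_std: "i \<in> {1..n} \<Longrightarrow> th \<alpha> (std i) = (if \<alpha> i = 0 then 0 else nuO \<alpha> * rs n \<alpha> * cO i)"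
  by (simp add: th_def pr_std lin_std) (simp add: lin_def)

text \<open>Moving c_j across \<open>rs n \<alpha>\<close> costs one sign, and exchanging it with
  c_i costs another exactly when i and j differ. So the reflection terms follow the same rule as the
  shifts.\<close>

lemma th_cO:
  assumes "\<alpha> \<in> P" "i \<in> {1..n}" "j \<in> {1..n}"
  shows "th \<alpha> (std i) * cO j = (if i = j then - (cO j * th \<alpha> (std i)) else cO j * th \<alpha> (std i))"
proof -
  have *: "cO j * (nuO \<alpha> * rs n \<alpha> * cO i) = - (nuO \<alpha> * rs n \<alpha> * (cO j * cO i))"
  proof -
    have "cO j * (nuO \<alpha> * rs n \<alpha> * cO i) = nuO \<alpha> * (cO j * rs n \<alpha>) * cO i"
      by (simp add: mult.assoc[symmetric] nuO_commute)
    also have "\<dots> = - (nuO \<alpha> * rs n \<alpha> * (cO j * cO i))"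
      unfolding rs_cO[OF assms(1,3)] by (simp add: mult.assoc)
    finally show ?thesis .
  qed
  show ?thesis
  proof (cases "i = j")
    case True
    then show ?thesis using * by (simp add: th_std[OF assms(3)] mult.assoc)
  next
    case False
    have "th \<alpha> (std i) * cO j = (if \<alpha> i = 0 then 0 else nuO \<alpha> * rs n \<alpha> * (cO i * cO j))"
      by (simp add: th_std[OF assms(2)] mult.assoc)
    also have "cO i * cO j = - (cO j * cO i)" by (rule cO_anti[OF False])
    finally show ?thesis using False * by (simp add: th_std[OF assms(2)])
  qed
qed

lemma xO_eq: "i \<in> {1..n} \<Longrightarrow> xO i = xh a i + (\<Sum>\<alpha>\<in>P. sc (kap \<alpha>) * th \<alpha> (std i))"
  by (simp add: xO_def xv_def lin_std)

lemma xO_cO: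
  assumes "i \<in> {1..n}" "j \<in> {1..n}"
  shows "xO i * cO j = (if i = j then - (cO j * xO i) else cO j * xO i)"
proof (cases "i = j")
  case True
  then show ?thesis
    using th_cO[OF _ assms] assms
    by (simp add: xO_eq distrib_left distrib_right sum_distrib_left sum_distrib_right xh_cO mult.assoc sc_ops sum_negf)
next
  case False
  then show ?thesis
    using th_cO[OF _ assms] assms
    by (simp add: xO_eq distrib_left distrib_right sum_distrib_left sum_distrib_right xh_cO mult.assoc sc_ops)
qed

text \<open>Summed against the c_i, the reflection terms of \<alpha> give -2
  \<open>kp \<alpha>\<close> times \<open>nuO \<alpha> * rs n \<alpha>\<close>; together with the
  term of \<alpha> in \<open>KO\<close> this becomes the sign operator \<open>ep \<alpha>\<close>.
  In this form each term is even in \<alpha>, which makes the invariance of D under W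
  visible.\<close>

lemma DO_eq:
  "DO = (\<Sum>i = 1..n. xh a i * cO i) + (\<Sum>\<alpha>\<in>P. sc (kp \<alpha>) * (ep \<alpha> * rs n \<alpha>))"
proof -
  have *: "(\<Sum>i = 1..n. sc (kap \<alpha>) * th \<alpha> (std i) * cO i) = - (sc (kp \<alpha>) * (2 * nuO \<alpha> * rs n \<alpha>))"
    if \<alpha>: "\<alpha> \<in> P" for \<alpha>
  proof -
    have "(\<Sum>i = 1..n. sc (kap \<alpha>) * th \<alpha> (std i) * cO i) =
        (\<Sum>i = 1..n. sc (kap \<alpha>) * (nuO \<alpha> * rs n \<alpha>) * sc (- complex_of_real (\<alpha> i * \<alpha> i)))"
      using root_coord[OF \<alpha>] by (intro sum.cong) (force simp: th_std mult.assoc cO_sq sc_uminus)+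
    also have "\<dots> = sc (kap \<alpha>) * (nuO \<alpha> * rs n \<alpha>) * sc (- complex_of_real (ip n \<alpha> \<alpha>))"
      unfolding sum_distrib_left[symmetric] sc_sum[symmetric] by (simp add: ip_def sum_negf)
    also have "\<dots> = - sc (kap \<alpha> * complex_of_real (ip n \<alpha> \<alpha>)) * (nuO \<alpha> * rs n \<alpha>)"
      by (subst sc_commute) (simp add: sc_sc sc_uminus[symmetric] mult.commute)
    also have "\<dots> = - (sc (kp \<alpha>) * (2 * nuO \<alpha> * rs n \<alpha>))"
      
    proof -
      have "sc (2 * kp \<alpha>) = (sc (kp \<alpha>) * 2 :: hend)" by (metis mult.commute sc_mult sc_numeral)
      then show ?thesis by (simp only: kap_ip[OF \<alpha>] mult.assoc mult_minus_left)
    qed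
    finally show ?thesis .
  qed
  have "(\<Sum>i = 1..n. xO i * cO i) = (\<Sum>i = 1..n. xh a i * cO i) +
      (\<Sum>\<alpha>\<in>P. \<Sum>i = 1..n. sc (kap \<alpha>) * th \<alpha> (std i) * cO i)"
    by (subst sum.swap) (simp add: xO_eq distrib_right sum.distrib sum_distrib_right)
  also have "\<dots> = (\<Sum>i = 1..n. xh a i * cO i) + (\<Sum>\<alpha>\<in>P. - (sc (kp \<alpha>) * (2 * nuO \<alpha> * rs n \<alpha>)))"
    using * by simp
  finally show ?thesis
    by (simp add: DO_def KO_def ep_def add.assoc sum.distrib[symmetric] left_diff_distrib right_diff_distrib)
qed

lemma gO_invariant_sum:
  assumes u: "u \<in> W" and sym: "\<And>\<alpha>. \<alpha> \<in> P \<Longrightarrow> F (- \<alpha>) = F \<alpha>"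
    and eq: "\<And>\<alpha>. \<alpha> \<in> P \<Longrightarrow> gO u * F \<alpha> = F (u \<alpha>) * gO u"
  shows "gO u * (\<Sum>\<alpha>\<in>P. sc (kp \<alpha>) * F \<alpha>) = (\<Sum>\<alpha>\<in>P. sc (kp \<alpha>) * F \<alpha>) * gO u"
proof -
  have F: "F (u \<alpha>) = F (tau u \<alpha>)" if "\<alpha> \<in> P" for \<alpha>
    using sym[OF tau_P[OF u that]] by (auto simp: tau_def)
  have "gO u * (\<Sum>\<alpha>\<in>P. sc (kp \<alpha>) * F \<alpha>) = (\<Sum>\<alpha>\<in>P. sc (kp (tau u \<alpha>)) * F (tau u \<alpha>)) * gO u"
    by (simp add: sum_distrib_left sum_distrib_right eq sc_ops mult.assoc F kp_tau u)
  also have "(\<Sum>\<alpha>\<in>P. sc (kp (tau u \<alpha>)) * F (tau u \<alpha>)) = (\<Sum>\<alpha>\<in>P. sc (kp \<alpha>) * F \<alpha>)"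
    by (rule sum_tau[OF u])
  finally show ?thesis .
qed

lemma gO_DO: assumes u: "u \<in> W" shows "gO u * DO = DO * gO u"
proof -
  have "gO u * (\<Sum>\<alpha>\<in>P. sc (kp \<alpha>) * (ep \<alpha> * rs n \<alpha>)) = (\<Sum>\<alpha>\<in>P. sc (kp \<alpha>) * (ep \<alpha> * rs n \<alpha>)) * gO u"
  proof (rule gO_invariant_sum[OF u])
    fix \<alpha> assume \<alpha>: "\<alpha> \<in> P"
    show "ep (- \<alpha>) * rs n (- \<alpha>) = ep \<alpha> * rs n \<alpha>"
      by (simp add: ep_uminus root_nz \<alpha> rs_uminus)
    show "gO u * (ep \<alpha> * rs n \<alpha>) = ep (u \<alpha>) * rs n (u \<alpha>) * gO u"
      using gO_ep[OF W_sp[OF u], of \<alpha>] gO_rs[OF u \<alpha>] by (metis mult.assoc)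
  qed
  then show ?thesis
    unfolding DO_eq distrib_left distrib_right gO_pairing[OF equivariant_xh equivariant_cO W_sp[OF u]] by simp
qed

lemma cO_DO: assumes j: "j \<in> {1..n}" shows "cO j * DO = - (DO * cO j)"
proof -
  have 1: "cO j * (xh a i * cO i) = - (xh a i * cO i * cO j)" for i
  proof (cases "i = j")
    case True then show ?thesis by (simp add: xh_cO mult.assoc)
  next
    case False
    then have "cO j * xh a i = xh a i * cO j" by (simp add: xh_cO)
    then have "cO j * (xh a i * cO i) = xh a i * (cO j * cO i)"
      by (metis mult.assoc)
    then show ?thesis using cO_anti[of j i] False by (simp add: mult.assoc)
  qed
  have 2: "cO j * (ep \<alpha> * rs n \<alpha>) = - (ep \<alpha> * rs n \<alpha> * cO j)" if "\<alpha> \<in> P" for \<alpha>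
  proof -
    have "cO j * (ep \<alpha> * rs n \<alpha>) = ep \<alpha> * (cO j * rs n \<alpha>)"
      by (metis ep_cO mult.assoc)
    then show ?thesis by (simp add: rs_cO[OF that j] mult.assoc)
  qed
  show ?thesis
    by (simp add: DO_eq distrib_left distrib_right sum_distrib_left sum_distrib_right 1 2 sc_ops mult.assoc sum_negf)
qed

lemma cO_KO: "j \<in> {1..n} \<Longrightarrow> cO j * KO = - (KO * cO j)"
  by (simp add: KO_def sum_distrib_left sum_distrib_right sc_ops rs_cO mult.assoc sum_negf)

end

section \<open>Simple reflections\<close>

inductive_set wgen :: "(vec \<Rightarrow> vec) set \<Rightarrow> (vec \<Rightarrow> vec) set" for B where
  wgen_id: "id \<in> wgen B"
| wgen_step: "s \<in> B \<Longrightarrow> u \<in> wgen B \<Longrightarrow> s \<circ> u \<in> wgen B"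

lemma sc_double: "sc (2 * z) = (sc z * 2 :: hend)"
  by (metis mult.commute sc_mult sc_numeral)

lemma commute_mult:
  fixes x y z :: "'r :: semigroup_mult"
  assumes "x * z = z * x" "y * z = z * y"
  shows "(x * y) * z = z * (x * y)"
  by (metis assms mult.assoc)

text \<open>The properties of a simple system B that are used: a simple reflection keeps the other
  positive roots positive, positivity of w on B implies positivity on P, and the simple reflections
  generate W. The restriction \<open>B_cases\<close> on the shape of B fits types A and B; type D is
  obtained from type B instead.\<close>

locale hc_simple = hc_model +
  fixes B :: "vec set"
  assumes B_P: "B \<subseteq> P"
    and simple: "\<beta> \<in> B \<Longrightarrow> \<alpha> \<in> P \<Longrightarrow> \<alpha> \<noteq> \<beta> \<Longrightarrow> refl_in n \<beta> \<alpha> \<in> P"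
    and B_pos: "signed_perm UNIV w \<Longrightarrow> (\<And>\<beta>. \<beta> \<in> B \<Longrightarrow> \<not> vneg (w \<beta>)) \<Longrightarrow> \<alpha> \<in> P \<Longrightarrow> \<not> vneg (w \<alpha>)"
    and W_gen: "W \<subseteq> wgen (refl_in n ` B)"
    and B_cases: "\<beta> \<in> B \<Longrightarrow> (\<exists>i \<in> {1..<n}. \<beta> = std i - std (i + 1)) \<or> \<beta> = std n"
begin

lemma gO_refl_sq: "\<beta> \<in> P \<Longrightarrow> gO (refl_in n \<beta>) * gO (refl_in n \<beta>) = 1"
  by (simp add: gO_mult[OF refl_sp] refl_in_refl_in ip_root' gO_id)

lemma rs_gO: assumes "\<beta> \<in> P" shows "gO (refl_in n \<beta>) * rs n \<beta> = - (rs n \<beta> * gO (refl_in n \<beta>))"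
    "gO (refl_in n \<beta>) * rs n \<beta> = cv n \<beta>" "rs n \<beta> * gO (refl_in n \<beta>) = - cv n \<beta>"
proof -
  show 1: "gO (refl_in n \<beta>) * rs n \<beta> = - (rs n \<beta> * gO (refl_in n \<beta>))"
    using gO_rs[OF refl_W[OF assms] assms] by (simp add: refl_in_self ip_root' assms rs_uminus)
  show 2: "gO (refl_in n \<beta>) * rs n \<beta> = cv n \<beta>"
    by (simp add: rs_def mult.assoc[symmetric] gO_refl_sq assms)
  show "rs n \<beta> * gO (refl_in n \<beta>) = - cv n \<beta>" using 1 2 by simp
qed

text \<open>A simple reflection has \<beta> as its only inversion, so the correction consists of a
  single term. For basis vectors v this gives the defining relations between reflections and the
  x_i.\<close>

lemma gO_xv_simple:
  assumes "\<beta> \<in> B"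
  shows "gO (refl_in n \<beta>) * xv v = xv (refl_in n \<beta> v) * gO (refl_in n \<beta>) + sc (kap \<beta>) * (cv n \<beta> * cv n (pr \<beta> v))"
proof -
  let ?s = "refl_in n \<beta>"
  have \<beta>: "\<beta> \<in> P" using assms B_P by blast
  have ss: "?s \<circ> ?s = id" by (rule refl_in_refl_in[OF ip_root'[OF \<beta>]])
  have inv: "{\<alpha>\<in>P. ?s \<alpha> \<notin> P} = {\<beta>}"
  proof (intro equalityI subsetI)
    show "\<alpha> \<in> {\<beta>}" if "\<alpha> \<in> {\<alpha>\<in>P. ?s \<alpha> \<notin> P}" for \<alpha> using simple[OF assms] that by blast
    show "\<alpha> \<in> {\<alpha>\<in>P. ?s \<alpha> \<notin> P}" if "\<alpha> \<in> {\<beta>}" for \<alpha>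
      using that \<beta> root_neg[OF \<beta>] refl_in_self[OF ip_root'[OF \<beta>]] by simp
  qed
  have "pr \<beta> (?s v) = ?s (pr \<beta> v)"
    by (simp add: pr_signed_perm[OF refl_sp[OF \<beta>]] refl_in_self ip_root' \<beta> pr_uminus)
  then have "cv n (pr \<beta> (?s v)) * gO ?s = gO ?s * cv n (pr \<beta> v)"
    by (simp add: gO_lin[OF equivariant_cO refl_sp[OF \<beta>]])
  then have "rs n \<beta> * cv n (pr \<beta> (?s v)) * gO ?s = - (cv n \<beta> * cv n (pr \<beta> v))"
    using rs_gO(3)[OF \<beta>] by (metis mult.assoc mult_minus_left)
  then show ?thesis
    unfolding gO_xv[OF refl_W[OF \<beta>] refl_W[OF \<beta>] ss] inv by (simp add: left_diff_distrib mult.assoc)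
qed

lemma gO_KO_simple:
  assumes "\<beta> \<in> B"
  shows "gO (refl_in n \<beta>) * KO = (KO - sc (2 * kp \<beta>) * rs n \<beta>) * gO (refl_in n \<beta>)"
proof -
  let ?s = "refl_in n \<beta>"
  have \<beta>: "\<beta> \<in> P" using assms B_P by blast
  have rs: "rs n (?s \<alpha>) = rs n (tau ?s \<alpha>) - (if \<alpha> = \<beta> then 2 * rs n \<beta> else 0)" if "\<alpha> \<in> P" for \<alpha>
    using simple[OF assms that] root_neg[OF \<beta>] refl_in_self[OF ip_root'[OF \<beta>]]
    by (auto simp: tau_def rs_uminus mult_2[where 'a=hend])
  have "gO ?s * KO = (\<Sum>\<alpha>\<in>P. sc (kp \<alpha>) * rs n (?s \<alpha>)) * gO ?s"
    by (simp add: KO_def sum_distrib_left sum_distrib_right sc_ops gO_rs refl_W \<beta> mult.assoc)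
  also have "(\<Sum>\<alpha>\<in>P. sc (kp \<alpha>) * rs n (?s \<alpha>)) =
      (\<Sum>\<alpha>\<in>P. sc (kp (tau ?s \<alpha>)) * rs n (tau ?s \<alpha>)) - (\<Sum>\<alpha>\<in>P. if \<alpha> = \<beta> then sc (kp \<beta>) * (2 * rs n \<beta>) else 0)"
    unfolding sum_subtractf[symmetric]
    by (intro sum.cong) (auto simp: rs kp_tau refl_W \<beta> right_diff_distrib)
  also have "(\<Sum>\<alpha>\<in>P. sc (kp (tau ?s \<alpha>)) * rs n (tau ?s \<alpha>)) = KO"
    unfolding KO_def by (rule sum_tau[OF refl_W[OF \<beta>]])
  also have "(\<Sum>\<alpha>\<in>P. if \<alpha> = \<beta> then sc (kp \<beta>) * (2 * rs n \<beta>) else 0) = sc (kp \<beta>) * (2 * rs n \<beta>)"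
    using finP \<beta> by simp
  also have "sc (kp \<beta>) * (2 * rs n \<beta>) = sc (2 * kp \<beta>) * rs n \<beta>"
    by (simp only: sc_double mult.assoc)
  finally show ?thesis .
qed

lemma cv_KO: "cv n v * KO = - (KO * cv n v)"
  by (simp add: KO_def sum_distrib_left sum_distrib_right sc_left[of "cv n v"] rs_cv mult.assoc sum_negf)

text \<open>Conjugation replaces K by K - q r with r = \<open>rs n \<beta>\<close> and q = 2
  \<open>kp \<beta>\<close>. Since this also implies K r + r K = q r^2, the cross terms in the
  square of K - q r cancel against q^2 r^2.\<close>

lemma gO_KO2_simple:
  assumes "\<beta> \<in> B"
  shows "gO (refl_in n \<beta>) * (KO * KO) = KO * KO * gO (refl_in n \<beta>)"
proof -
  define s where "s = gO (refl_in n \<beta>)"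
  define q :: hend where "q = sc (2 * kp \<beta>)"
  define r where "r = rs n \<beta>"
  define c where "c = cv n \<beta>"
  have \<beta>: "\<beta> \<in> P" using assms B_P by blast
  have q: "T * q = q * T" for T unfolding q_def by (rule sc_commute)
  have sK: "s * KO = (KO - q * r) * s" using gO_KO_simple[OF assms] by (simp add: s_def q_def r_def)
  have ss: "s * s = 1" using gO_refl_sq[OF \<beta>] by (simp add: s_def)
  have r: "r = s * c" by (simp add: r_def s_def c_def rs_def)
  have sr: "s * r = c" "r * s = - c" using rs_gO[OF \<beta>] by (simp_all add: s_def r_def c_def)
  have Kc: "KO * c = - (c * KO)" using cv_KO[of \<beta>] by (simp add: c_def)
  have rr: "r * r = - (c * c)"
    by (subst (2) r) (simp add: mult.assoc[symmetric] sr)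
  have "KO * s = s * (s * KO) * s" using ss by (simp add: mult.assoc[symmetric])
  also have "\<dots> = s * (KO - q * r)" using sK ss by (simp add: mult.assoc)
  finally have "KO * r = s * (KO - q * r) * c" by (simp add: r mult.assoc[symmetric])
  also have "\<dots> = s * (KO * c) - q * (s * r * c)"
    by (simp add: left_diff_distrib right_diff_distrib mult.assoc) (metis mult.assoc q)
  also have "\<dots> = - (r * KO) + q * (r * r)"
    by (simp add: Kc sr rr) (simp add: r mult.assoc)
  finally have Kr: "KO * r = - (r * KO) + q * (r * r)" .
  have qr: "q * r * KO = q * (r * KO)" "KO * (q * r) = q * (KO * r)" "q * r * (q * r) = q * (q * (r * r))"
    by (metis mult.assoc q)+
  have "s * (KO * KO) = (KO - q * r) * (KO - q * r) * s"
    using sK by (metis mult.assoc)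
  also have "(KO - q * r) * (KO - q * r) = KO * KO"
    by (simp add: left_diff_distrib right_diff_distrib qr Kr distrib_left)
  finally show ?thesis unfolding s_def .
qed

lemma gO_KO2: "u \<in> W \<Longrightarrow> gO u * (KO * KO) = KO * KO * gO u"
proof -
  assume "u \<in> W"
  then have "u \<in> wgen (refl_in n ` B)" using W_gen by blast
  then show ?thesis
  proof induction
    case wgen_id show ?case unfolding gO_id by simp
  next
    case (wgen_step s u)
    then obtain \<beta> where \<beta>: "\<beta> \<in> B" "s = refl_in n \<beta>" by blast
    have "gO (s \<circ> u) = gO s * gO u" using B_P \<beta> gO_mult[OF refl_sp] by auto
    then show ?case using commute_mult[OF gO_KO2_simple[OF \<beta>(1)] wgen_step.IH] by (simp only: \<beta>(2))
  qed
qed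

section \<open>The commutators of the x_i\<close>

definition YO :: "nat \<Rightarrow> nat \<Rightarrow> hend" where
  "YO i j = xO i * xO j - xO j * xO i - sc (- 2 * a\<^sup>2) * (cO j * cO i)"

lemma xv_cmult: "xv (\<lambda>i. t * v i) = sc (complex_of_real t) * xv v"
proof -
  have "pr \<alpha> (\<lambda>i. t * v i) = (\<lambda>i. t * pr \<alpha> v i)" for \<alpha> by (auto simp: pr_def)
  then have "th \<alpha> (\<lambda>i. t * v i) = sc (complex_of_real t) * th \<alpha> v" for \<alpha>
    by (simp add: th_def lin_cmult sc_left[of "nuO \<alpha> * rs n \<alpha>"])
  then show ?thesis
    by (simp add: xv_def lin_cmult distrib_left sum_distrib_left sc_sc mult.commute)
qed

lemma cO_xO:
  "i \<in> {1..n} \<Longrightarrow> j \<in> {1..n} \<Longrightarrow> cO j * xO i = (if i = j then - (xO i * cO j) else xO i * cO j)"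
  by (simp add: xO_cO)

lemma cO_xO':
  "i \<in> {1..n} \<Longrightarrow> j \<in> {1..n} \<Longrightarrow> cO j * (xO i * T) = (if i = j then - (xO i * (cO j * T)) else xO i * (cO j * T))"
  using cO_xO[of i j] by (auto simp: mult.assoc[symmetric])

lemma cv_xO: "\<beta> i = 0 \<Longrightarrow> i \<in> {1..n} \<Longrightarrow> cv n \<beta> * xO i = xO i * cv n \<beta>"
  unfolding lin_def sum_distrib_left sum_distrib_right
  by (intro sum.cong refl) (auto simp: xO_cO mult.assoc sc_left[of "xO i"])

lemma cv_pr_std: "i \<in> {1..n} \<Longrightarrow> cv n (pr \<beta> (std i)) = (if \<beta> i = 0 then 0 else cO i)"
  by (simp add: pr_std lin_std) (simp add: lin_def)

text \<open>With c_\<beta> = c_p - c_q, the products with c_p^2 or c_q^2 leave multiples of x_p and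
  x_q that cancel, and c_p c_q anticommutes with both x_p and x_q, so the remaining products cancel
  too.\<close>

lemma long_bracket:
  assumes "i \<in> {1..<n}" "\<beta> = std i - std (i + 1)"
  shows "xO (i+1) * (cv n \<beta> * cO (i+1)) + cv n \<beta> * cO i * xO (i+1) - xO i * (cv n \<beta> * cO i) - cv n \<beta> * cO (i+1) * xO i = 0"
proof -
  define p q where "p = i" and "q = i + 1"
  have pq: "p \<in> {1..n}" "q \<in> {1..n}" "p \<noteq> q" using assms(1) by (auto simp: p_def q_def)
  have c: "cv n \<beta> = cO p - cO q" using pq by (simp add: assms(2) lin_diff lin_std p_def q_def)
  have anti: "cO q * cO p = - (cO p * cO q)" using cO_anti[of q p] pq by simp
  have 1: "cO p * cO q * xO q = - (xO q * (cO p * cO q))" "cO p * cO q * xO p = - (xO p * (cO p * cO q))"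
    using pq by (simp_all add: mult.assoc cO_xO cO_xO')
  have "xO q * (cv n \<beta> * cO q) + cv n \<beta> * cO p * xO q - xO p * (cv n \<beta> * cO p) - cv n \<beta> * cO q * xO p = 0"
    by (simp add: c left_diff_distrib right_diff_distrib cO_sq anti 1 distrib_left distrib_right)
  then show ?thesis by (simp add: p_def q_def)
qed

text \<open>These are the cross terms that arise when s_\<beta> is moved across a commutator of two
  x's, each passage leaving a term c_\<beta> c_i. Unless both indices lie in the support of \<beta>,
  the c's involved commute suitably with the x's.\<close>

lemma bracket:
  assumes \<beta>: "\<beta> \<in> B" and ij: "i \<in> {1..n}" "j \<in> {1..n}" "i \<noteq> j"
  defines "c \<equiv> cv n \<beta>" and "s \<equiv> refl_in n \<beta>"
  defines "e \<equiv> \<lambda>i. cv n (pr \<beta> (std i))"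
  shows "xv (s (std i)) * (c * e j) + c * e i * xO j - xv (s (std j)) * (c * e i) - c * e j * xO i = 0"
proof -
  have fix_std: "s (std i) = std i" if "\<beta> i = 0" "i \<in> {1..n}" for i
  proof -
    have "ip n (std i) \<beta> = (\<Sum>l = 1..n. if l = i then \<beta> i else 0)"
      unfolding ip_def by (intro sum.cong) (auto simp: std_def)
    then show ?thesis using that by (simp add: s_def refl_in_def)
  qed
  have one: "c * cO i * xO j - xO j * (c * cO i) = 0" if "i \<in> {1..n}" "j \<in> {1..n}" "i \<noteq> j" "\<beta> j = 0" for i j
  proof -
    have "c * cO i * xO j = c * (xO j * cO i)" using that by (simp add: mult.assoc cO_xO)
    also have "\<dots> = xO j * (c * cO i)" using cv_xO[of \<beta> j] that by (simp add: c_def mult.assoc[symmetric])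
    finally show ?thesis by simp
  qed
  consider "\<beta> i = 0" "\<beta> j = 0" | "\<beta> i \<noteq> 0" "\<beta> j = 0" | "\<beta> i = 0" "\<beta> j \<noteq> 0" | "\<beta> i \<noteq> 0" "\<beta> j \<noteq> 0" by blast
  then show ?thesis
  proof cases
    case 1
    then show ?thesis using ij by (simp add: e_def cv_pr_std)
  next
    case 2
    then show ?thesis using ij one[of i j] by (simp add: e_def cv_pr_std fix_std xO_def)
  next
    case 3
    then show ?thesis using ij one[of j i] by (simp add: e_def cv_pr_std fix_std xO_def)
  next
    case 4
    \<comment> \<open>A root supported at two indices is not the short simple root, so it is some
      e_p - e_(p+1), and i, j are p and p + 1 in some order.\<close>
    have "\<beta> \<noteq> std n" using 4 ij(3) by (auto simp: std_def split: if_splits)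
    then have "\<exists>p\<in>{1..<n}. \<beta> = std p - std (p + 1)"
      using B_cases[OF \<beta>] by simp
    then obtain p where p: "p \<in> {1..<n}" "\<beta> = std p - std (p + 1)" by blast
    have \<beta>1: "\<beta> p = 1" "\<beta> (p+1) = - 1" by (auto simp: p(2) std_def)
    have ipb: "ip n \<beta> \<beta> = 2" using p by (simp add: ip_diff_left ip_diff_right ip_std)
    have "ip n (std p) \<beta> = 1" "ip n (std (p + 1)) \<beta> = - 1"
      using p by (simp_all add: ip_diff_right ip_std)
    then have s: "s (std p) = std (p + 1)" "s (std (p + 1)) = std p"
      by (simp_all add: s_def refl_in_def ipb fun_eq_iff) (simp_all add: p(2) std_def)
    have "i = p \<and> j = p + 1 \<or> i = p + 1 \<and> j = p"
      using 4 ij(3) by (auto simp: p(2) std_def split: if_splits)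
    then show ?thesis
      using long_bracket[OF p] p(1) \<beta>1 ij
      by (auto simp: e_def cv_pr_std s[unfolded Suc_eq_plus1[symmetric]] xO_def[symmetric] c_def algebra_simps)
  qed
qed

text \<open>The cross terms vanish by \<open>bracket\<close>, so s_\<beta> carries the defect of the
  commutator relation at (i, j) to a multiple of the defect at the permuted pair. Vanishing of the
  defect can thus be transported between group components.\<close>

lemma gO_YO:
  assumes \<beta>: "\<beta> \<in> B" and ij: "i \<in> {1..n}" "j \<in> {1..n}" "i \<noteq> j"
  obtains i' j' t where "i' \<in> {1..n}" "j' \<in> {1..n}" "i' \<noteq> j'" "gO (refl_in n \<beta>) * YO i j = sc t * YO i' j' * gO (refl_in n \<beta>)"
proof -
  let ?s = "refl_in n \<beta>"
  define g where "g = gO ?s"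
  have \<beta>P: "\<beta> \<in> P" using \<beta> B_P by blast
  obtain \<pi> \<sigma> where w: "\<pi> permutes {1..n}" "?s = (\<lambda>v i. \<sigma> i * v (\<pi> i))"
    using refl_sp[OF \<beta>P] unfolding signed_perm_def by blast
  let ?p = "inv_into UNIV \<pi>"
  note st = signed_perm_std[OF w]
  have p: "?p i \<in> {1..n}" "?p j \<in> {1..n}" "?p i \<noteq> ?p j"
    using ij permutes_in_image[OF permutes_inv[OF w(1)]] permutes_inj[OF permutes_inv[OF w(1)]] by (auto dest: injD)
  define Xx where "Xx i = xv (?s (std i))" for i
  define C where "C i = cv n (?s (std i))" for i
  define e where "e i = sc (kap \<beta>) * (cv n \<beta> * cv n (pr \<beta> (std i)))" for i
  have gx: "g * xO i = Xx i * g + e i" for i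
    using gO_xv_simple[OF \<beta>, of "std i"] by (simp add: g_def Xx_def e_def xO_def)
  have gc: "g * cO i = C i * g" if "i \<in> {1..n}" for i
    using gO_lin[OF equivariant_cO refl_sp[OF \<beta>P], of "std i"] that by (simp add: g_def C_def lin_std)
  have br: "Xx i * e j + e i * xO j - Xx j * e i - e j * xO i = 0"
  proof -
    have "Xx i * e j + e i * xO j - Xx j * e i - e j * xO i =
      sc (kap \<beta>) * (Xx i * (cv n \<beta> * cv n (pr \<beta> (std j))) + cv n \<beta> * cv n (pr \<beta> (std i)) * xO j
        - Xx j * (cv n \<beta> * cv n (pr \<beta> (std i))) - cv n \<beta> * cv n (pr \<beta> (std j)) * xO i)"
      by (simp add: e_def sc_left[of "Xx _"] distrib_left right_diff_distrib mult.assoc)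
    then show ?thesis using bracket[OF \<beta> ij] by (simp add: Xx_def)
  qed
  have gxx: "g * (xO i * xO j) = Xx i * Xx j * g + Xx i * e j + e i * xO j" for i j
  proof -
    have "g * (xO i * xO j) = Xx i * (g * xO j) + e i * xO j"
      by (simp only: mult.assoc[symmetric] gx[of i] distrib_right)
    then show ?thesis by (simp add: gx distrib_left mult.assoc)
  qed
  have gcc: "g * (cO j * cO i) = C j * C i * g"
    by (simp only: mult.assoc[symmetric] gc[OF ij(2)]) (simp only: mult.assoc gc[OF ij(1)])
  have "g * YO i j = (Xx i * Xx j - Xx j * Xx i - sc (- 2 * a\<^sup>2) * (C j * C i)) * g
      + (Xx i * e j + e i * xO j - Xx j * e i - e j * xO i)"
    unfolding YO_def right_diff_distrib gxx sc_left[of g] gcc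
    by (simp add: left_diff_distrib mult.assoc)
  also have "Xx i * Xx j - Xx j * Xx i - sc (- 2 * a\<^sup>2) * (C j * C i) = sc (complex_of_real (\<sigma> (?p i) * \<sigma> (?p j))) * YO (?p i) (?p j)"
  proof -
    have 1: "Xx i = sc (complex_of_real (\<sigma> (?p i))) * xO (?p i)" for i
      unfolding Xx_def st xv_cmult by (simp add: xO_def)
    have 2: "C i = sc (complex_of_real (\<sigma> (?p i))) * cO (?p i)" if "i \<in> {1..n}" for i
      unfolding C_def st lin_cmult using that permutes_in_image[OF permutes_inv[OF w(1)], of i] by (subst lin_std) auto
    show ?thesis
      by (simp add: 1 2[OF ij(1)] 2[OF ij(2)] YO_def right_diff_distrib sc_left[of "xO _"] sc_ops sc_sc mult.assoc mult.commute mult.left_commute)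
  qed
  finally show ?thesis
    using that[OF p, of "complex_of_real (\<sigma> (?p i) * \<sigma> (?p j))"] br by (simp add: g_def)
qed

lemma xh_local: "(\<And>r. f (w, r) = f' (w, r)) \<Longrightarrow> app (xh a i) f (w, r) = app (xh a i) f' (w, r)"
  by (cases r) (auto simp: xh_def op_defs)

text \<open>Induction on the number of positive roots made negative by w. If w makes some simple
  \<beta> negative, then w s_\<beta> has fewer inversions and \<open>gO_YO\<close> transports the
  claim back; otherwise w keeps all of P positive and the reflection terms vanish there.\<close>

lemma YO_app_0:
  "\<lbrakk>i \<in> {1..n}; j \<in> {1..n}; i \<noteq> j\<rbrakk> \<Longrightarrow> app (YO i j) f (w, r) = 0"
proof (induction "card {\<alpha>\<in>P. vneg (Rep_sperm w \<alpha>)}" arbitrary: w i j f rule: less_induct)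
  case less
  have w: "signed_perm UNIV (Rep_sperm w)" using Rep_sperm[of w] by simp
  show ?case
  proof (cases "\<exists>\<beta>\<in>B. vneg (Rep_sperm w \<beta>)")
    case True
    then obtain \<beta> where \<beta>: "\<beta> \<in> B" "vneg (Rep_sperm w \<beta>)" by blast
    let ?s = "refl_in n \<beta>"
    have \<beta>P: "\<beta> \<in> P" using \<beta> B_P by blast
    note sp = refl_sp[OF \<beta>P]
    define w' where "w' = sp_mult w ?s"
    have ss: "?s (?s v) = v" for v using refl_in_refl_in[OF ip_root'[OF \<beta>P]] by (metis comp_apply id_apply)
    have w'w: "sp_mult w' ?s = w"
      unfolding w'_def sp_mult_mult[OF sp] refl_in_refl_in[OF ip_root'[OF \<beta>P]] by simp
    have Rw': "Rep_sperm w' v = Rep_sperm w (?s v)" for v by (simp add: w'_def Rep_sp_mult[OF sp])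
    \<comment> \<open>The inversions of w s_\<beta> are mapped injectively by s_\<beta> to
      inversions of w different from \<beta>.\<close>
    have "?s ` {\<alpha>\<in>P. vneg (Rep_sperm w' \<alpha>)} \<subseteq> {\<alpha>\<in>P. vneg (Rep_sperm w \<alpha>)} - {\<beta>}"
    proof
      fix \<gamma> assume "\<gamma> \<in> ?s ` {\<alpha>\<in>P. vneg (Rep_sperm w' \<alpha>)}"
      then obtain \<alpha> where \<alpha>: "\<alpha> \<in> P" "vneg (Rep_sperm w (?s \<alpha>))" "\<gamma> = ?s \<alpha>" by (auto simp: Rw')
      have "Rep_sperm w \<beta> \<noteq> 0" using \<beta>(2) by (auto simp: vneg_def)
      then have "\<not> vneg (Rep_sperm w (?s \<beta>))"
        using \<beta>(2) vneg_uminus by (simp add: refl_in_self ip_root' \<beta>P signed_perm_linear[OF w])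
      then have "\<alpha> \<noteq> \<beta>" using \<alpha> by auto
      moreover have "?s \<alpha> \<noteq> \<beta>"
      proof
        assume "?s \<alpha> = \<beta>"
        then have "\<alpha> = - \<beta>" using ss[of \<alpha>] refl_in_self[OF ip_root'[OF \<beta>P]] by simp
        then show False using root_neg[OF \<beta>P] \<alpha>(1) by simp
      qed
      ultimately show "\<gamma> \<in> {\<alpha>\<in>P. vneg (Rep_sperm w \<alpha>)} - {\<beta>}" using simple[OF \<beta>(1) \<alpha>(1)] \<alpha> by simp
    qed
    moreover have "inj_on ?s {\<alpha>\<in>P. vneg (Rep_sperm w' \<alpha>)}" by (rule inj_on_inverseI[where g = ?s], rule ss)
    ultimately have "card {\<alpha>\<in>P. vneg (Rep_sperm w' \<alpha>)} \<le> card ({\<alpha>\<in>P. vneg (Rep_sperm w \<alpha>)} - {\<beta>})"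
      using finP by (intro card_inj_on_le[of ?s]) auto
    also have "\<dots> < card {\<alpha>\<in>P. vneg (Rep_sperm w \<alpha>)}"
      using \<beta> \<beta>P finP by (intro psubset_card_mono) auto
    finally have lt: "card {\<alpha>\<in>P. vneg (Rep_sperm w' \<alpha>)} < card {\<alpha>\<in>P. vneg (Rep_sperm w \<alpha>)}" .
    obtain i' j' t where ij': "i' \<in> {1..n}" "j' \<in> {1..n}" "i' \<noteq> j'" "gO ?s * YO i j = sc t * YO i' j' * gO ?s"
      using gO_YO[OF \<beta>(1) less.prems] .
    have "app (YO i j) f (w, r) = app (gO ?s * YO i j) f (w', r)"
      by (cases r) (simp add: gO_def w'w)
    also have "\<dots> = t * app (YO i' j') (app (gO ?s) f) (w', r)" by (simp add: ij'(4))
    also have "\<dots> = 0" using less.hyps[OF lt ij'(1-3)] by simp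
    finally show ?thesis .
  next
    case False
    \<comment> \<open>The operator x_l does not change w except through its reflection terms, so
      over this w both factors of a product may be replaced by \<open>xh\<close>.\<close>
    then have pos: "\<not> vneg (Rep_sperm w \<alpha>)" if "\<alpha> \<in> P" for \<alpha> using B_pos[OF w _ that] by blast
    have x: "app (xO l) f (w, r) = app (xh a l) f (w, r)" if "l \<in> {1..n}" for l f r
      unfolding xO_eq[OF that] by (cases r) (simp add: th_def nuO_def pos)
    have xx: "app (xO i * xO j) f (w, r) = app (xh a i * xh a j) f (w, r)" if "i \<in> {1..n}" "j \<in> {1..n}" for i j
      using xh_local[of "app (xO j) f" w "app (xh a j) f" i r] x that by simp
    have "app (YO i j) f (w, r) = app (xh a i * xh a j - xh a j * xh a i - sc (- 2 * a\<^sup>2) * (cO j * cO i)) f (w, r)"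
      using xx less.prems by (simp add: YO_def)
    then show ?thesis by (simp only: xh_commutator[OF less.prems(3)] diff_self app_simps)
  qed
qed

lemma xO_commutator:
  assumes "i \<in> {1..n}" "j \<in> {1..n}" "i \<noteq> j"
  shows "xO i * xO j - xO j * xO i = sc (- 2 * a\<^sup>2) * (cO j * cO i)"
proof -
  have "YO i j = 0" using YO_app_0[OF assms] by (intro lend_eqI) (metis app_simps(4) surj_pair)
  then show ?thesis by (simp add: YO_def)
qed

end

section \<open>The spanning set of ordered monomials\<close>

declare One_nat_def [simp del]

inductive_set alg :: "(complex \<Rightarrow> 'r :: ring_1) \<Rightarrow> 'r set \<Rightarrow> 'r set" for sca Y where
  alg_sca: "sca a \<in> alg sca Y"
| alg_gen: "y \<in> Y \<Longrightarrow> y \<in> alg sca Y"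
| alg_add: "y \<in> alg sca Y \<Longrightarrow> z \<in> alg sca Y \<Longrightarrow> y + z \<in> alg sca Y"
| alg_mult: "y \<in> alg sca Y \<Longrightarrow> z \<in> alg sca Y \<Longrightarrow> y * z \<in> alg sca Y"

definition Fset :: "nat \<Rightarrow> nat \<Rightarrow> nat multiset set" where
  "Fset n l = {A. set_mset A \<subseteq> {1..n} \<and> size A = l}"

lemma finite_Fset: "finite (Fset n l)"
proof (induction l)
  case 0
  have "Fset n 0 \<subseteq> {{#}}" by (auto simp: Fset_def)
  then show ?case using finite_subset by blast
next
  case (Suc l)
  have "Fset n (Suc l) \<subseteq> (\<lambda>(i, A). add_mset i A) ` ({1..n} \<times> Fset n l)"
  proof
    fix A assume A: "A \<in> Fset n (Suc l)"
    then obtain i A' where "A = add_mset i A'" by (auto simp: Fset_def size_Suc_Diff1 dest!: size_eq_Suc_imp_eq_union)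
    with A show "A \<in> (\<lambda>(i, A). add_mset i A) ` ({1..n} \<times> Fset n l)" by (force simp: Fset_def)
  qed
  then show ?case using Suc finite_subset by blast
qed

text \<open>The sorted list fixes an order of the factors, which need not commute.\<close>

definition xm :: "(nat \<Rightarrow> 'r :: monoid_mult) \<Rightarrow> nat multiset \<Rightarrow> 'r" where
  "xm x A = prod_list (map x (sorted_list_of_multiset A))"

definition cm :: "(nat \<Rightarrow> 'r :: monoid_mult) \<Rightarrow> nat set \<Rightarrow> 'r" where
  "cm c I = prod_list (map c (sorted_list_of_set I))"

text \<open>Straightening is done once, modulo a two-sided ideal J of a subring Cr. It is applied
  with J = {0} to the operators, and with the ideal of relations to the free algebra. The set W0
  contains those group elements for which relations with the c_i and x_i are given; the others are
  reached as products.\<close>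

locale hc_span =
  fixes Cr J :: "'r :: ring_1 set" and sca :: "complex \<Rightarrow> 'r" and x c :: "nat \<Rightarrow> 'r"
    and g :: "(vec \<Rightarrow> vec) \<Rightarrow> 'r" and W W0 :: "(vec \<Rightarrow> vec) set" and n :: nat and N :: complex
  assumes Cr_sca: "sca s \<in> Cr" and Cr_x: "i \<in> {1..n} \<Longrightarrow> x i \<in> Cr" and Cr_c: "i \<in> {1..n} \<Longrightarrow> c i \<in> Cr"
    and Cr_g: "u \<in> W \<Longrightarrow> g u \<in> Cr"
    and Cr_add: "f \<in> Cr \<Longrightarrow> h \<in> Cr \<Longrightarrow> f + h \<in> Cr" and Cr_mult: "f \<in> Cr \<Longrightarrow> h \<in> Cr \<Longrightarrow> f * h \<in> Cr"
    and J_0: "0 \<in> J" and J_add: "f \<in> J \<Longrightarrow> h \<in> J \<Longrightarrow> f + h \<in> J"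
    and J_left: "f \<in> Cr \<Longrightarrow> h \<in> J \<Longrightarrow> f * h \<in> J" and J_right: "f \<in> Cr \<Longrightarrow> h \<in> J \<Longrightarrow> h * f \<in> J"
    and sca_0: "sca 0 = 0" and sca_1: "sca 1 = 1" and sca_add: "sca (s + t) = sca s + sca t"
    and sca_mult: "sca (s * t) = sca s * sca t" and sca_comm: "f * sca s = sca s * f"
    and W_finite: "finite W" and W0_W: "W0 \<subseteq> W" and id_W: "id \<in> W" and comp_W: "u \<in> W \<Longrightarrow> v \<in> W \<Longrightarrow> u \<circ> v \<in> W"
    and W_wgen: "W \<subseteq> wgen W0"
    and rel_cx: "i \<in> {1..n} \<Longrightarrow> j \<in> {1..n} \<Longrightarrow> \<exists>s. c j * x i - sca s * x i * c j \<in> J"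
    and rel_cc: "i \<in> {1..n} \<Longrightarrow> j \<in> {1..n} \<Longrightarrow> i \<noteq> j \<Longrightarrow> c i * c j + c j * c i \<in> J"
    and rel_c2: "i \<in> {1..n} \<Longrightarrow> c i * c i + 1 \<in> J"
    and rel_xx: "i \<in> {1..n} \<Longrightarrow> j \<in> {1..n} \<Longrightarrow> i \<noteq> j \<Longrightarrow> x i * x j - x j * x i - sca N * (c j * c i) \<in> J"
    and rel_id: "g id - 1 \<in> J"
    and rel_gg: "u \<in> W \<Longrightarrow> v \<in> W \<Longrightarrow> g u * g v - g (u \<circ> v) \<in> J"
    and rel_gc: "u \<in> W0 \<Longrightarrow> i \<in> {1..n} \<Longrightarrow> \<exists>s. \<exists>i'\<in>{1..n}. g u * c i - sca s * c i' * g u \<in> J"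
    and rel_gx: "u \<in> W0 \<Longrightarrow> i \<in> {1..n} \<Longrightarrow> \<exists>s. \<exists>i'\<in>{1..n}. \<exists>e\<in>alg sca (c ` {1..n} \<union> g ` W).
        g u * x i - sca s * x i' * g u - e \<in> J"
begin

abbreviation SS :: "'r set" where "SS \<equiv> alg sca (c ` {1..n} \<union> g ` W)"
abbreviation HH :: "'r set" where "HH \<equiv> alg sca (x ` {1..n} \<union> c ` {1..n} \<union> g ` W)"

lemma sca_minus: "sca (- s) = - sca s"
  using sca_add[of s "- s"] sca_0 by (simp add: minus_unique)

lemma sca_left: "f * (sca s * h) = sca s * (f * h)"
  by (metis mult.assoc sca_comm)

lemma J_uminus: "f \<in> J \<Longrightarrow> - f \<in> J"
  using J_left[OF Cr_sca[of "- 1"]] by (simp add: sca_minus sca_1)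

definition eqJ :: "'r \<Rightarrow> 'r \<Rightarrow> bool" (infix \<open>\<doteq>\<close> 50) where
  "f \<doteq> h \<longleftrightarrow> f - h \<in> J"

lemma eqJ_refl [simp]: "f \<doteq> f" by (simp add: eqJ_def J_0)

lemma eqJ_sym: "f \<doteq> h \<Longrightarrow> h \<doteq> f"
  using J_uminus[of "f - h"] by (simp add: eqJ_def)

lemma eqJ_trans [trans]: "f \<doteq> h \<Longrightarrow> h \<doteq> k \<Longrightarrow> f \<doteq> k"
  using J_add[of "f - h" "h - k"] by (simp add: eqJ_def)

lemma eqJ_add: "f \<doteq> h \<Longrightarrow> f' \<doteq> h' \<Longrightarrow> f + f' \<doteq> h + h'"
  using J_add[of "f - h" "f' - h'"] by (simp add: eqJ_def algebra_simps)

lemma eqJ_left: "f \<doteq> h \<Longrightarrow> k \<in> Cr \<Longrightarrow> k * f \<doteq> k * h"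
  using J_left[of k "f - h"] by (simp add: eqJ_def right_diff_distrib)

lemma eqJ_right: "f \<doteq> h \<Longrightarrow> k \<in> Cr \<Longrightarrow> f * k \<doteq> h * k"
  using J_right[of k "f - h"] by (simp add: eqJ_def left_diff_distrib)

lemma Cr_1: "1 \<in> Cr" using Cr_sca[of 1] by (simp add: sca_1)

lemma alg_Cr: assumes "Y \<subseteq> Cr" "y \<in> alg sca Y" shows "y \<in> Cr"
  using assms(2) by induction (use assms(1) in \<open>auto intro: Cr_sca Cr_add Cr_mult\<close>)

lemma SS_Cr: "u \<in> SS \<Longrightarrow> u \<in> Cr"
  by (rule alg_Cr) (auto intro: Cr_c Cr_g)

lemma SS_0: "0 \<in> SS" using alg_sca[of sca 0] by (simp add: sca_0)
lemma SS_1: "1 \<in> SS" using alg_sca[of sca 1] by (simp add: sca_1)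
lemma SS_c: "i \<in> {1..n} \<Longrightarrow> c i \<in> SS" by (intro alg_gen) auto
lemma SS_g: "u \<in> W \<Longrightarrow> g u \<in> SS" by (intro alg_gen) auto

lemma prod_Cr: "set l \<subseteq> {1..n} \<Longrightarrow> prod_list (map x l) \<in> Cr"
  by (induction l) (auto intro!: Cr_mult Cr_x Cr_1)

lemma xm_Cr: "A \<in> Fset n l \<Longrightarrow> xm x A \<in> Cr"
  unfolding xm_def by (rule prod_Cr) (auto simp: Fset_def)

section \<open>Spanning by ordered monomials with coefficients on the right\<close>

definition Sp :: "nat \<Rightarrow> 'r set" where
  "Sp m = {f. \<exists>U. (\<forall>A. U A \<in> SS) \<and> f \<doteq> (\<Sum>l\<le>m. \<Sum>A\<in>Fset n l. xm x A * U A)}"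

lemma SpI: "f \<doteq> (\<Sum>l\<le>m. \<Sum>A\<in>Fset n l. xm x A * U A) \<Longrightarrow> (\<And>A. U A \<in> SS) \<Longrightarrow> f \<in> Sp m"
  unfolding Sp_def by blast

lemma Sp_eqJ: "f \<doteq> h \<Longrightarrow> h \<in> Sp m \<Longrightarrow> f \<in> Sp m"
  unfolding Sp_def using eqJ_trans by blast

lemma Sp_add: assumes "f \<in> Sp m" "h \<in> Sp m" shows "f + h \<in> Sp m"
proof -
  obtain U V where U: "\<forall>A. U A \<in> SS" "f \<doteq> (\<Sum>l\<le>m. \<Sum>A\<in>Fset n l. xm x A * U A)"
    and V: "\<forall>A. V A \<in> SS" "h \<doteq> (\<Sum>l\<le>m. \<Sum>A\<in>Fset n l. xm x A * V A)"
    using assms unfolding Sp_def by blast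
  have "f + h \<doteq> (\<Sum>l\<le>m. \<Sum>A\<in>Fset n l. xm x A * (U A + V A))"
    using eqJ_add[OF U(2) V(2)] by (simp add: distrib_left sum.distrib)
  then show ?thesis by (rule SpI) (use U(1) V(1) in \<open>auto intro: alg_add\<close>)
qed

lemma Sp_0: "0 \<in> Sp m"
  unfolding Sp_def using SS_0 by (auto intro!: exI[of _ "\<lambda>_. 0"])

lemma Sp_sum: "(\<And>a. a \<in> A \<Longrightarrow> f a \<in> Sp m) \<Longrightarrow> sum f A \<in> Sp m"
  by (induction A rule: infinite_finite_induct) (auto intro: Sp_add Sp_0)

lemma Sp_right: assumes "f \<in> Sp m" "u \<in> SS" shows "f * u \<in> Sp m"
proof -
  obtain U where U: "\<forall>A. U A \<in> SS" "f \<doteq> (\<Sum>l\<le>m. \<Sum>A\<in>Fset n l. xm x A * U A)"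
    using assms unfolding Sp_def by blast
  have "f * u \<doteq> (\<Sum>l\<le>m. \<Sum>A\<in>Fset n l. xm x A * (U A * u))"
    using eqJ_right[OF U(2) SS_Cr[OF assms(2)]] by (simp add: sum_distrib_right mult.assoc)
  then show ?thesis by (rule SpI) (use U(1) assms(2) in \<open>auto intro: alg_mult\<close>)
qed

lemma Sp_monom: assumes "A \<in> Fset n l" "l \<le> m" "u \<in> SS" shows "xm x A * u \<in> Sp m"
proof -
  have "(\<Sum>l\<le>m. \<Sum>B\<in>Fset n l. xm x B * (if B = A then u else 0)) = (\<Sum>k\<le>m. if k = l then xm x A * u else 0)"
  proof (intro sum.cong refl)
    fix k
    have "(\<Sum>B\<in>Fset n k. xm x B * (if B = A then u else 0)) = (\<Sum>B\<in>Fset n k. if B = A then xm x A * u else 0)"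
      by (intro sum.cong) auto
    also have "\<dots> = (if A \<in> Fset n k then xm x A * u else 0)" by (simp add: finite_Fset)
    finally show "(\<Sum>B\<in>Fset n k. xm x B * (if B = A then u else 0)) = (if k = l then xm x A * u else 0)"
      using assms(1) by (auto simp: Fset_def)
  qed
  then have "xm x A * u = (\<Sum>l\<le>m. \<Sum>B\<in>Fset n l. xm x B * (if B = A then u else 0))" using assms(2) by simp
  then show ?thesis using SS_0 assms(3) by (intro SpI[where U = "\<lambda>B. if B = A then u else 0"]) auto
qed

lemma Sp_left:
  assumes "y \<in> Cr" "\<And>l A u. l \<le> m \<Longrightarrow> A \<in> Fset n l \<Longrightarrow> u \<in> SS \<Longrightarrow> y * (xm x A * u) \<in> Sp m'" "f \<in> Sp m"
  shows "y * f \<in> Sp m'"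
proof -
  obtain U where U: "\<forall>A. U A \<in> SS" "f \<doteq> (\<Sum>l\<le>m. \<Sum>A\<in>Fset n l. xm x A * U A)"
    using assms(3) unfolding Sp_def by blast
  have "y * f \<doteq> (\<Sum>l\<le>m. \<Sum>A\<in>Fset n l. y * (xm x A * U A))"
    using eqJ_left[OF U(2) assms(1)] by (simp add: sum_distrib_left)
  then show ?thesis by (rule Sp_eqJ) (use U(1) assms(2) in \<open>auto intro!: Sp_sum\<close>)
qed

lemma Sp_mono: assumes "f \<in> Sp m" "m \<le> m'" shows "f \<in> Sp m'"
proof -
  have "1 * f \<in> Sp m'"
  proof (rule Sp_left[OF Cr_1 _ assms(1)])
    fix l A u assume "l \<le> m" "A \<in> Fset n l" "u \<in> SS"
    then show "1 * (xm x A * u) \<in> Sp m'" using Sp_monom[of A l m' u] assms(2) by simp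
  qed
  then show ?thesis by simp
qed

lemma Sp_sca: "f \<in> Sp m \<Longrightarrow> sca s * f \<in> Sp m"
  using Sp_right[OF _ alg_sca[of sca s]] by (simp add: sca_comm)

lemma c_prod:
  assumes "j \<in> {1..n}"
  shows "set l \<subseteq> {1..n} \<Longrightarrow> \<exists>s. c j * prod_list (map x l) \<doteq> prod_list (map x l) * (sca s * c j)"
proof (induction l)
  case Nil
  show ?case by (rule exI[of _ 1]) (simp add: sca_1)
next
  case (Cons i l)
  then obtain s where s: "c j * prod_list (map x l) \<doteq> prod_list (map x l) * (sca s * c j)" by auto
  obtain t where t: "c j * x i \<doteq> sca t * x i * c j"
    using rel_cx[of i j] Cons.prems assms unfolding eqJ_def by auto
  have "c j * x i * prod_list (map x l) \<doteq> sca t * x i * c j * prod_list (map x l)"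
    using eqJ_right[OF t prod_Cr] Cons.prems by simp
  also have "sca t * x i * c j * prod_list (map x l) = sca t * x i * (c j * prod_list (map x l))"
    by (simp add: mult.assoc)
  also have "\<dots> \<doteq> sca t * x i * (prod_list (map x l) * (sca s * c j))"
    by (rule eqJ_left[OF s]) (use Cons.prems in \<open>auto intro!: Cr_mult Cr_sca Cr_x\<close>)
  also have "\<dots> = x i * prod_list (map x l) * (sca (t * s) * c j)"
    by (simp only: sca_mult mult.assoc sca_comm[of _ t, symmetric])
  finally show ?case by (intro exI[of _ "t * s"]) (simp add: mult.assoc)
qed

lemma Sp_c: assumes "j \<in> {1..n}" "f \<in> Sp m" shows "c j * f \<in> Sp m"
proof (rule Sp_left[OF Cr_c[OF assms(1)] _ assms(2)])
  fix l A u assume A: "l \<le> m" "A \<in> Fset n l" "u \<in> SS"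
  have "set (sorted_list_of_multiset A) \<subseteq> {1..n}" using A(2) by (simp add: Fset_def)
  then obtain s where s: "c j * xm x A \<doteq> xm x A * (sca s * c j)"
    using c_prod[OF assms(1)] unfolding xm_def by blast
  have "c j * (xm x A * u) \<doteq> xm x A * (sca s * c j * u)"
    using eqJ_right[OF s SS_Cr[OF A(3)]] by (simp add: mult.assoc)
  moreover have "xm x A * (sca s * c j * u) \<in> Sp m"
    using A assms(1) by (intro Sp_monom[OF A(2,1)] alg_mult alg_sca SS_c)
  ultimately show "c j * (xm x A * u) \<in> Sp m" by (rule Sp_eqJ)
qed

text \<open>Both claims are proved together. To insert x_i behind a smaller x_j, the exchange costs
  a term in the c's without loss of spanning degree, insertion into the shorter monomial is the
  first claim in lower degree, and putting x_j back in front of the error is the second claim in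
  lower degree.\<close>

lemma Sp_x_aux:
  "(\<forall>i\<in>{1..n}. \<forall>A\<in>Fset n m. x i * xm x A - xm x (add_mset i A) \<in> Sp m) \<and>
   (\<forall>i\<in>{1..n}. \<forall>f\<in>Sp m. x i * f \<in> Sp (Suc m))"
proof (induction m rule: less_induct)
  case (less m)
  have 1: "x i * xm x A - xm x (add_mset i A) \<in> Sp m" if i: "i \<in> {1..n}" and A: "A \<in> Fset n m" for i A
  proof (cases "sorted_list_of_multiset A")
    case Nil
    then have "A = {#}" by (metis mset_sorted_list_of_multiset mset.simps(1))
    then show ?thesis by (simp add: xm_def Sp_0)
  next
    case (Cons j l)
    have srt: "sorted (j # l)" using Cons sorted_sorted_list_of_multiset[of A] by simp
    have set: "set (j # l) \<subseteq> {1..n}" using A Cons[symmetric] by (simp add: Fset_def)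
    have len: "m = Suc (length l)"
      using A Cons by (metis (mono_tags, lifting) Fset_def length_Cons mem_Collect_eq mset_sorted_list_of_multiset size_mset)
    have add: "sorted_list_of_multiset (add_mset i A) = insort i (j # l)" by (simp add: Cons)
    show ?thesis
    proof (cases "i \<le> j")
      case True
      then show ?thesis using Cons add by (simp add: xm_def Sp_0)
    next
      case False
      define p where "p = prod_list (map x l)"
      have j: "j \<in> {1..n}" and ij: "i \<noteq> j" using set False by auto
      have pC: "p \<in> Cr" using set by (auto simp: p_def intro!: prod_Cr)
      have l: "sort l = l" using srt by (simp add: sorted_sort_id)
      have lF: "mset l \<in> Fset n (length l)" using set by (auto simp: Fset_def)
      have xl: "xm x (mset l) = p" by (simp add: xm_def l p_def)
      define q where "q = prod_list (map x (insort i l))"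
      have xil: "xm x (add_mset i (mset l)) = q" by (simp add: xm_def l q_def)
      note IH = less.IH[of "length l"] 
      have "x i * p - q \<in> Sp (length l)" using IH len i lF xl xil by fastforce
      then have a: "x j * (x i * p - q) \<in> Sp m" using IH len j by simp
      have pS: "p \<in> Sp (length l)" using Sp_monom[OF lF order.refl SS_1] xl by simp
      have b: "sca N * (c j * (c i * p)) \<in> Sp m"
        by (rule Sp_mono[OF Sp_sca[OF Sp_c[OF j Sp_c[OF i pS]]]]) (simp add: len)
      have "x i * x j \<doteq> x j * x i + sca N * (c j * c i)"
        using rel_xx[OF i j ij] by (simp add: eqJ_def algebra_simps)
      from eqJ_right[OF this pC] have "x i * (x j * p) \<doteq> x j * (x i * p) + sca N * (c j * (c i * p))"
        by (simp add: distrib_right mult.assoc)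
      from eqJ_add[OF this eqJ_refl[of "- (x j * q)"]]
      have "x i * (x j * p) - x j * q \<doteq> x j * (x i * p - q) + sca N * (c j * (c i * p))"
        by (simp add: algebra_simps)
      from Sp_eqJ[OF this Sp_add[OF a b]] have "x i * (x j * p) - x j * q \<in> Sp m" .
      moreover have "xm x A = x j * p" "xm x (add_mset i A) = x j * q"
        using False Cons add by (simp_all add: xm_def p_def q_def)
      ultimately show ?thesis by simp
    qed
  qed
  have 2: "x i * f \<in> Sp (Suc m)" if i: "i \<in> {1..n}" and f: "f \<in> Sp m" for i f
  proof (rule Sp_left[OF Cr_x[OF i] _ f])
    fix l A u assume A: "l \<le> m" "A \<in> Fset n l" "u \<in> SS"
    have "x i * xm x A - xm x (add_mset i A) \<in> Sp (Suc m)"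
    proof (cases "l = m")
      case True
      then show ?thesis using 1[OF i] A by (metis Sp_mono le_SucI order.refl)
    next
      case False
      then show ?thesis using less.IH[of l] A i Sp_mono[of _ l "Suc m"] by simp
    qed
    moreover have "add_mset i A \<in> Fset n (Suc l)" using A(2) i by (auto simp: Fset_def)
    then have "xm x (add_mset i A) * 1 \<in> Sp (Suc m)" using A(1) SS_1 by (intro Sp_monom) auto
    ultimately have "x i * xm x A \<in> Sp (Suc m)" using Sp_add by fastforce
    from Sp_right[OF this A(3)] show "x i * (xm x A * u) \<in> Sp (Suc m)" by (simp add: mult.assoc)
  qed
  show ?case using 1 2 by blast
qed

lemma Sp_x: "i \<in> {1..n} \<Longrightarrow> f \<in> Sp m \<Longrightarrow> x i * f \<in> Sp (Suc m)"
  using Sp_x_aux by blast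

lemma W_induct:
  assumes "w \<in> W" "Q id" "\<And>s u. s \<in> W0 \<Longrightarrow> u \<in> W \<Longrightarrow> Q u \<Longrightarrow> Q (s \<circ> u)"
  shows "Q w"
proof -
  have "w \<in> wgen W0" using assms(1) W_wgen by blast
  then have "w \<in> W \<and> Q w"
  proof induction
    case wgen_id
    then show ?case using id_W assms(2) by blast
  next
    case (wgen_step s u)
    then show ?case using assms(3) comp_W W0_W by blast
  qed
  then show ?thesis by blast
qed

text \<open>Left multiplication by the c_i is known to preserve the filtration, so only generators
  of the group remain to be checked.\<close>

lemma Sp_SS_aux:
  assumes gen: "\<And>u f. u \<in> W0 \<Longrightarrow> f \<in> Sp m \<Longrightarrow> g u * f \<in> Sp m" and e: "e \<in> SS"
  shows "f \<in> Sp m \<Longrightarrow> e * f \<in> Sp m"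
  using e
proof (induction arbitrary: f)
  case (alg_sca s) then show ?case by (rule Sp_sca[rotated -1])
next
  case (alg_gen y)
  have gW: "\<forall>f\<in>Sp m. g w * f \<in> Sp m" if "w \<in> W" for w
  proof (rule W_induct[where Q = "\<lambda>w. \<forall>f\<in>Sp m. g w * f \<in> Sp m", OF that])
    show "\<forall>f\<in>Sp m. g id * f \<in> Sp m"
    proof
      fix f assume f: "f \<in> Sp m"
      show "g id * f \<in> Sp m"
      proof (rule Sp_left[OF Cr_g[OF id_W] _ f])
        fix l A u assume A: "l \<le> m" "A \<in> Fset n l" "u \<in> SS"
        have "g id \<doteq> 1" unfolding eqJ_def by (rule rel_id)
        from eqJ_right[OF this Cr_mult[OF xm_Cr[OF A(2)] SS_Cr[OF A(3)]]]
        have "g id * (xm x A * u) \<doteq> xm x A * u" by simp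
        then show "g id * (xm x A * u) \<in> Sp m" using Sp_monom[OF A(2,1,3)] by (rule Sp_eqJ)
      qed
    qed
  next
    fix s u assume s: "s \<in> W0" and u: "u \<in> W" and IH: "\<forall>f\<in>Sp m. g u * f \<in> Sp m"
    have sW: "s \<in> W" using s W0_W by blast
    show "\<forall>f\<in>Sp m. g (s \<circ> u) * f \<in> Sp m"
    proof
      fix f assume f: "f \<in> Sp m"
      show "g (s \<circ> u) * f \<in> Sp m"
      proof (rule Sp_left[OF Cr_g[OF comp_W[OF sW u]] _ f])
        fix l A v assume A: "l \<le> m" "A \<in> Fset n l" "v \<in> SS"
        have "g (s \<circ> u) \<doteq> g s * g u" by (rule eqJ_sym) (unfold eqJ_def, rule rel_gg[OF sW u])
        from eqJ_right[OF this Cr_mult[OF xm_Cr[OF A(2)] SS_Cr[OF A(3)]]]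
        have "g (s \<circ> u) * (xm x A * v) \<doteq> g s * (g u * (xm x A * v))" by (simp only: mult.assoc)
        then show "g (s \<circ> u) * (xm x A * v) \<in> Sp m"
          by (rule Sp_eqJ) (use Sp_monom[OF A(2,1,3)] IH gen[OF s] in blast)
      qed
    qed
  qed
  from alg_gen show ?case using gW Sp_c by auto
next
  case (alg_add y z) then show ?case by (simp add: distrib_right Sp_add)
next
  case (alg_mult y z) then show ?case by (simp add: mult.assoc)
qed

text \<open>Moving g_u past the first factor x_i leaves an error e in \<open>SS\<close> in front of
  a monomial with one factor fewer. The induction hypothesis covers arbitrary e in
  \<open>SS\<close>, so the degree does not grow.\<close>

lemma Sp_SS: "e \<in> SS \<Longrightarrow> f \<in> Sp m \<Longrightarrow> e * f \<in> Sp m"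
proof (induction m arbitrary: e f rule: less_induct)
  case (less m)
  show ?case
  proof (rule Sp_SS_aux[OF _ less.prems])
    fix u f assume u: "u \<in> W0" and f: "f \<in> Sp m"
    have uW: "u \<in> W" using u W0_W by blast
    show "g u * f \<in> Sp m"
    proof (rule Sp_left[OF Cr_g[OF uW] _ f])
      fix l A v assume A: "l \<le> m" "A \<in> Fset n l" "v \<in> SS"
      show "g u * (xm x A * v) \<in> Sp m"
      proof (cases "sorted_list_of_multiset A")
        case Nil
        then have "xm x A = 1" by (simp add: xm_def)
        moreover have "xm x {#} * (g u * v) \<in> Sp m"
          using A(3) uW by (intro Sp_monom[of _ 0] alg_mult SS_g) (auto simp: Fset_def)
        ultimately show ?thesis by (simp add: xm_def)
      next
        case (Cons i k)
        have set: "set (i # k) \<subseteq> {1..n}" using A Cons[symmetric] by (simp add: Fset_def)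
        have len: "l = Suc (length k)"
          using A(2) Cons by (metis (mono_tags, lifting) Fset_def length_Cons mem_Collect_eq mset_sorted_list_of_multiset size_mset)
        have srt: "sorted (i # k)" using Cons sorted_sorted_list_of_multiset[of A] by simp
        define p where "p = prod_list (map x k)"
        have k: "sort k = k" using srt by (simp add: sorted_sort_id)
        have kF: "mset k \<in> Fset n (length k)" using set by (auto simp: Fset_def)
        have xk: "xm x (mset k) = p" by (simp add: xm_def k p_def)
        have pv: "p * v \<in> Sp (length k)" using Sp_monom[OF kF order.refl A(3)] xk by simp
        have lt: "length k < m" using len A(1) by simp
        have i: "i \<in> {1..n}" using set by simp
        obtain s i' e where e: "i' \<in> {1..n}" "e \<in> SS" "g u * x i - sca s * x i' * g u - e \<in> J"
          using rel_gx[OF u i] by blast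
        then have "g u * x i \<doteq> sca s * x i' * g u + e" by (simp add: eqJ_def algebra_simps)
        moreover have "p * v \<in> Cr" using xm_Cr[OF kF] xk SS_Cr[OF A(3)] Cr_mult by simp
        ultimately have "g u * x i * (p * v) \<doteq> (sca s * x i' * g u + e) * (p * v)" by (rule eqJ_right)
        moreover have "sca s * (x i' * (g u * (p * v))) + e * (p * v) \<in> Sp m"
        proof (rule Sp_add)
          have "g u * (p * v) \<in> Sp (length k)" using less.IH[OF lt SS_g[OF uW] pv] .
          then have "sca s * (x i' * (g u * (p * v))) \<in> Sp (Suc (length k))"
            by (intro Sp_sca Sp_x e(1))
          then show "sca s * (x i' * (g u * (p * v))) \<in> Sp m" using lt by (elim Sp_mono) simp
          show "e * (p * v) \<in> Sp m" using less.IH[OF lt e(2) pv] lt by (elim Sp_mono) simp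
        qed
        ultimately have "g u * x i * (p * v) \<in> Sp m"
          using Sp_eqJ by (simp add: distrib_right mult.assoc)
        moreover have "xm x A = x i * p" using Cons by (simp add: xm_def p_def)
        ultimately show ?thesis by (simp add: mult.assoc)
      qed
    qed
  qed
qed

text \<open>The statement proved by induction is that left multiplication by h preserves the union
  of the \<open>Sp m\<close>; applying it to 1 gives the claim.\<close>

lemma HH_Sp: assumes "h \<in> HH" shows "\<exists>m. h \<in> Sp m"
proof -
  have "\<forall>m. \<forall>f\<in>Sp m. \<exists>m'. h * f \<in> Sp m'"
    using assms
  proof induction
    case (alg_sca a) then show ?case using Sp_sca by blast
  next
    case (alg_gen y)
    then consider i where "i \<in> {1..n}" "y = x i" | "y \<in> c ` {1..n} \<union> g ` W" by blast
    then show ?case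
    proof cases
      case 1 then show ?thesis using Sp_x by blast
    next
      case 2
      then have "y \<in> SS" by (rule alg.alg_gen)
      then show ?thesis using Sp_SS by blast
    qed
  next
    case (alg_add y z)
    show ?case
    proof (intro allI ballI)
      fix m f assume "f \<in> Sp m"
      then obtain p q where "y * f \<in> Sp p" "z * f \<in> Sp q" using alg_add.IH by blast
      then have "y * f \<in> Sp (max p q)" "z * f \<in> Sp (max p q)" using Sp_mono by auto
      then show "\<exists>m'. (y + z) * f \<in> Sp m'" using Sp_add by (auto simp: distrib_right)
    qed
  next
    case (alg_mult y z) then show ?case by (metis mult.assoc)
  qed
  moreover have "xm x {#} * 1 \<in> Sp 0" using SS_1 by (intro Sp_monom[of _ 0]) (auto simp: Fset_def)
  then have "1 \<in> Sp 0" by (simp add: xm_def)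
  ultimately show ?thesis by (metis mult.right_neutral)
qed

section \<open>Normal forms in the subalgebra generated by W and the c_i\<close>

definition NF :: "'r set" where
  "NF = {f. \<exists>s. f \<doteq> (\<Sum>I\<in>Pow {1..n}. \<Sum>w\<in>W. sca (s I w) * (cm c I * g w))}"

lemma NFI: "f \<doteq> (\<Sum>I\<in>Pow {1..n}. \<Sum>w\<in>W. sca (s I w) * (cm c I * g w)) \<Longrightarrow> f \<in> NF"
  unfolding NF_def by blast

lemma NF_eqJ: "f \<doteq> h \<Longrightarrow> h \<in> NF \<Longrightarrow> f \<in> NF"
  unfolding NF_def using eqJ_trans by blast

lemma NF_add: assumes "f \<in> NF" "h \<in> NF" shows "f + h \<in> NF"
proof -
  obtain U V where U: "f \<doteq> (\<Sum>I\<in>Pow {1..n}. \<Sum>w\<in>W. sca (U I w) * (cm c I * g w))"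
    and V: "h \<doteq> (\<Sum>I\<in>Pow {1..n}. \<Sum>w\<in>W. sca (V I w) * (cm c I * g w))"
    using assms unfolding NF_def by blast
  have "f + h \<doteq> (\<Sum>I\<in>Pow {1..n}. \<Sum>w\<in>W. sca (U I w + V I w) * (cm c I * g w))"
    using eqJ_add[OF U V] by (simp add: sca_add distrib_right sum.distrib)
  then show ?thesis by (rule NFI)
qed

lemma NF_0: "0 \<in> NF"
  unfolding NF_def by (auto intro!: exI[of _ "\<lambda>_ _. 0"] simp: sca_0)

lemma NF_sum: "(\<And>a. a \<in> A \<Longrightarrow> f a \<in> NF) \<Longrightarrow> sum f A \<in> NF"
  by (induction A rule: infinite_finite_induct) (auto intro: NF_add NF_0)

lemma NF_sca: assumes "f \<in> NF" shows "sca t * f \<in> NF"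
proof -
  obtain U where U: "f \<doteq> (\<Sum>I\<in>Pow {1..n}. \<Sum>w\<in>W. sca (U I w) * (cm c I * g w))"
    using assms unfolding NF_def by blast
  have "sca t * f \<doteq> (\<Sum>I\<in>Pow {1..n}. \<Sum>w\<in>W. sca (t * U I w) * (cm c I * g w))"
    using eqJ_left[OF U Cr_sca[of t]] by (simp add: sum_distrib_left sca_mult mult.assoc)
  then show ?thesis by (rule NFI)
qed

lemma NF_monom: assumes "I \<subseteq> {1..n}" "w \<in> W" shows "cm c I * g w \<in> NF"
proof -
  have "(\<Sum>K\<in>Pow {1..n}. \<Sum>v\<in>W. sca (if K = I \<and> v = w then 1 else 0) * (cm c K * g v)) =
      (\<Sum>K\<in>Pow {1..n}. if K = I then cm c I * g w else 0)"
  proof (intro sum.cong refl)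
    fix K
    have "(\<Sum>v\<in>W. sca (if K = I \<and> v = w then 1 else 0) * (cm c K * g v)) =
        (\<Sum>v\<in>W. if v = w then (if K = I then cm c I * g w else 0) else 0)"
      by (intro sum.cong) (auto simp: sca_0 sca_1)
    then show "(\<Sum>v\<in>W. sca (if K = I \<and> v = w then 1 else 0) * (cm c K * g v)) = (if K = I then cm c I * g w else 0)"
      using W_finite assms(2) by simp
  qed
  also have "\<dots> = cm c I * g w" using assms(1) by simp
  finally show ?thesis by (intro NFI[where s = "\<lambda>K v. if K = I \<and> v = w then 1 else 0"]) simp
qed

lemma prodc_Cr: "set l \<subseteq> {1..n} \<Longrightarrow> prod_list (map c l) \<in> Cr"
  by (induction l) (auto intro!: Cr_mult Cr_c Cr_1)

lemma cm_Cr: "I \<subseteq> {1..n} \<Longrightarrow> cm c I \<in> Cr"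
  unfolding cm_def by (rule prodc_Cr) (use finite_subset[of I "{1..n}"] in auto)

lemma NF_left:
  assumes "y \<in> Cr" "\<And>I w. I \<subseteq> {1..n} \<Longrightarrow> w \<in> W \<Longrightarrow> y * (cm c I * g w) \<in> NF" "f \<in> NF"
  shows "y * f \<in> NF"
proof -
  obtain U where U: "f \<doteq> (\<Sum>I\<in>Pow {1..n}. \<Sum>w\<in>W. sca (U I w) * (cm c I * g w))"
    using assms(3) unfolding NF_def by blast
  have "y * f \<doteq> (\<Sum>I\<in>Pow {1..n}. \<Sum>w\<in>W. sca (U I w) * (y * (cm c I * g w)))"
    using eqJ_left[OF U assms(1)] by (simp add: sum_distrib_left sca_left[of y])
  then show ?thesis by (rule NF_eqJ) (use assms(2) in \<open>auto intro!: NF_sum NF_sca\<close>)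
qed

lemma c_insert:
  assumes j: "j \<in> {1..n}"
  shows "set l \<subseteq> {1..n} \<Longrightarrow> sorted l \<Longrightarrow> distinct l \<Longrightarrow>
    \<exists>s. c j * prod_list (map c l) \<doteq> sca s * prod_list (map c (if j \<in> set l then remove1 j l else insort j l))"
proof (induction l)
  case Nil
  show ?case by (rule exI[of _ 1]) (simp add: sca_1)
next
  case (Cons i l)
  define p where "p = prod_list (map c l)"
  have pC: "p \<in> Cr" unfolding p_def using Cons.prems by (intro prodc_Cr) auto
  have i: "i \<in> {1..n}" using Cons.prems by auto
  consider "j = i" | "j < i" | "j > i" by linarith
  then show ?case
  proof cases
    case 1
    have "c i * c i \<doteq> sca (- 1)" using rel_c2[OF i] by (simp add: eqJ_def sca_minus sca_1)
    from eqJ_right[OF this pC] show ?thesis using 1 by (intro exI[of _ "- 1"]) (simp add: p_def mult.assoc)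
  next
    case 2
    then have "j \<notin> set (i # l)" using Cons.prems by auto
    then show ?thesis using 2 by (intro exI[of _ 1]) (simp add: sca_1)
  next
    case 3
    obtain s where s: "c j * p \<doteq> sca s * prod_list (map c (if j \<in> set l then remove1 j l else insort j l))"
      using Cons by (auto simp: p_def)
    define q where "q = prod_list (map c (if j \<in> set l then remove1 j l else insort j l))"
    have "c j * c i \<doteq> sca (- 1) * (c i * c j)"
      using rel_cc[OF j i] 3 by (simp add: eqJ_def sca_minus sca_1)
    from eqJ_right[OF this pC] have "c j * (c i * p) \<doteq> sca (- 1) * c i * (c j * p)" by (simp add: mult.assoc)
    also have "\<dots> \<doteq> sca (- 1) * c i * (sca s * q)"
      by (rule eqJ_left) (use s i in \<open>auto simp: q_def intro!: Cr_mult Cr_sca Cr_c\<close>)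
    also have "\<dots> = sca (- s) * (c i * q)"
      by (simp add: sca_minus sca_1) (metis mult.assoc sca_comm)
    finally show ?thesis using 3 by (intro exI[of _ "- s"]) (auto simp: p_def q_def)
  qed
qed

lemma NF_c: assumes j: "j \<in> {1..n}" "f \<in> NF" shows "c j * f \<in> NF"
proof (rule NF_left[OF Cr_c[OF j(1)] _ j(2)])
  fix I w assume I: "I \<subseteq> {1..n}" "w \<in> W"
  have fin: "finite I" using I(1) finite_subset[of I "{1..n}"] by auto
  let ?K = "if j \<in> I then I - {j} else insert j I"
  have "sorted_list_of_set ?K = (if j \<in> I then remove1 j (sorted_list_of_set I) else insort j (sorted_list_of_set I))"
    using fin by (simp add: sorted_list_of_set_remove)
  then obtain s where "c j * cm c I \<doteq> sca s * cm c ?K"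
    using c_insert[OF j(1), of "sorted_list_of_set I"] I(1) fin unfolding cm_def by auto
  from eqJ_right[OF this Cr_g[OF I(2)]] have "c j * (cm c I * g w) \<doteq> sca s * (cm c ?K * g w)" by (simp add: mult.assoc)
  moreover have "sca s * (cm c ?K * g w) \<in> NF" using I j(1) by (intro NF_sca NF_monom) auto
  ultimately show "c j * (cm c I * g w) \<in> NF" by (rule NF_eqJ)
qed

lemma NF_prodc: "set l \<subseteq> {1..n} \<Longrightarrow> f \<in> NF \<Longrightarrow> prod_list (map c l) * f \<in> NF"
  by (induction l) (auto simp: mult.assoc NF_c)

lemma g_prodc:
  assumes "u \<in> W0"
  shows "set l \<subseteq> {1..n} \<Longrightarrow> \<exists>s l'. set l' \<subseteq> {1..n} \<and> g u * prod_list (map c l) \<doteq> sca s * prod_list (map c l') * g u"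
proof (induction l)
  case Nil
  show ?case by (rule exI[of _ 1], rule exI[of _ "[]"]) (simp add: sca_1)
next
  case (Cons i l)
  then obtain s l' where s: "set l' \<subseteq> {1..n}" "g u * prod_list (map c l) \<doteq> sca s * prod_list (map c l') * g u" by auto
  obtain t i' where t: "i' \<in> {1..n}" "g u * c i \<doteq> sca t * c i' * g u"
    using rel_gc[OF assms, of i] Cons.prems unfolding eqJ_def by auto
  have "g u * c i * prod_list (map c l) \<doteq> sca t * c i' * g u * prod_list (map c l)"
    by (rule eqJ_right[OF t(2) prodc_Cr]) (use Cons.prems in auto)
  also have "sca t * c i' * g u * prod_list (map c l) = sca t * c i' * (g u * prod_list (map c l))"
    by (simp add: mult.assoc)
  also have "\<dots> \<doteq> sca t * c i' * (sca s * prod_list (map c l') * g u)"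
    by (rule eqJ_left[OF s(2)]) (intro Cr_mult Cr_sca Cr_c t(1))
  also have "\<dots> = sca (t * s) * prod_list (map c (i' # l')) * g u"
    by (simp add: sca_mult mult.assoc sca_left[of "c i'"])
  finally show ?case using s(1) t(1) by (intro exI[of _ "t * s"] exI[of _ "i' # l'"]) (simp add: mult.assoc)
qed

lemma NF_g0: assumes u: "u \<in> W0" "f \<in> NF" shows "g u * f \<in> NF"
proof -
  have uW: "u \<in> W" using u W0_W by blast
  show ?thesis
  proof (rule NF_left[OF Cr_g[OF uW] _ u(2)])
    fix I w assume I: "I \<subseteq> {1..n}" "w \<in> W"
    have "set (sorted_list_of_set I) \<subseteq> {1..n}" using I(1) finite_subset[of I "{1..n}"] by auto
    then obtain s l where s: "set l \<subseteq> {1..n}" "g u * cm c I \<doteq> sca s * prod_list (map c l) * g u"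
      using g_prodc[OF u(1)] unfolding cm_def by blast
    have "g u * cm c I * g w \<doteq> sca s * prod_list (map c l) * g u * g w"
      by (rule eqJ_right[OF s(2) Cr_g[OF I(2)]])
    also have "sca s * prod_list (map c l) * g u * g w = sca s * prod_list (map c l) * (g u * g w)" by (simp add: mult.assoc)
    also have "\<dots> \<doteq> sca s * prod_list (map c l) * g (u \<circ> w)"
      by (rule eqJ_left) (use rel_gg[OF uW I(2)] s(1) in \<open>auto simp: eqJ_def intro!: Cr_mult Cr_sca prodc_Cr\<close>)
    finally have 1: "g u * cm c I * g w \<doteq> sca s * prod_list (map c l) * g (u \<circ> w)" .
    have "cm c {} * g (u \<circ> w) \<in> NF" by (rule NF_monom) (use comp_W[OF uW I(2)] in auto)
    then have "g (u \<circ> w) \<in> NF" by (simp add: cm_def)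
    then have "sca s * (prod_list (map c l) * g (u \<circ> w)) \<in> NF" using s(1) by (intro NF_sca NF_prodc)
    then show "g u * (cm c I * g w) \<in> NF" using NF_eqJ[OF 1] by (simp add: mult.assoc)
  qed
qed

text \<open>Left multiplication by each generator preserves normal forms, and 1 is one. In
  particular this subalgebra is spanned modulo J by finitely many products, which later supplies
  annihilating polynomials.\<close>

lemma SS_NF: assumes "u \<in> SS" shows "u \<in> NF"
proof -
  have "\<forall>f\<in>NF. u * f \<in> NF"
    using assms
  proof induction
    case (alg_sca a) then show ?case using NF_sca by blast
  next
    case (alg_gen y)
    have "\<forall>f\<in>NF. g w * f \<in> NF" if "w \<in> W" for w
    proof (rule W_induct[where Q = "\<lambda>w. \<forall>f\<in>NF. g w * f \<in> NF", OF that])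
      show "\<forall>f\<in>NF. g id * f \<in> NF"
      proof
        fix f assume f: "f \<in> NF"
        show "g id * f \<in> NF"
        proof (rule NF_left[OF Cr_g[OF id_W] _ f])
          fix I w assume I: "I \<subseteq> {1..n}" "w \<in> W"
          have "g id \<doteq> 1" unfolding eqJ_def by (rule rel_id)
          from eqJ_right[OF this Cr_mult[OF cm_Cr[OF I(1)] Cr_g[OF I(2)]]]
          have "g id * (cm c I * g w) \<doteq> cm c I * g w" by simp
          then show "g id * (cm c I * g w) \<in> NF" using NF_monom[OF I] by (rule NF_eqJ)
        qed
      qed
    next
      fix s u assume s: "s \<in> W0" and u: "u \<in> W" and IH: "\<forall>f\<in>NF. g u * f \<in> NF"
      have sW: "s \<in> W" using s W0_W by blast
      show "\<forall>f\<in>NF. g (s \<circ> u) * f \<in> NF"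
      proof
        fix f assume f: "f \<in> NF"
        show "g (s \<circ> u) * f \<in> NF"
        proof (rule NF_left[OF Cr_g[OF comp_W[OF sW u]] _ f])
          fix I w assume I: "I \<subseteq> {1..n}" "w \<in> W"
          have "g (s \<circ> u) \<doteq> g s * g u" by (rule eqJ_sym) (unfold eqJ_def, rule rel_gg[OF sW u])
          from eqJ_right[OF this Cr_mult[OF cm_Cr[OF I(1)] Cr_g[OF I(2)]]]
          have "g (s \<circ> u) * (cm c I * g w) \<doteq> g s * (g u * (cm c I * g w))" by (simp only: mult.assoc)
          then show "g (s \<circ> u) * (cm c I * g w) \<in> NF"
            by (rule NF_eqJ) (use NF_monom[OF I] IH NF_g0[OF s] in blast)
        qed
      qed
    qed
    then show ?case using alg_gen NF_c by auto
  next
    case (alg_add y z) then show ?case by (simp add: distrib_right NF_add)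
  next
    case (alg_mult y z) then show ?case by (simp add: mult.assoc)
  qed
  moreover have "1 \<in> NF"
  proof (rule NF_eqJ)
    show "1 \<doteq> cm c {} * g id" using rel_id J_uminus by (fastforce simp: eqJ_def cm_def)
    show "cm c {} * g id \<in> NF" using id_W by (intro NF_monom) auto
  qed
  ultimately show ?thesis by (metis mult.right_neutral)
qed

end

section \<open>Degree and parity\<close>

definition idx_deg :: "idx \<Rightarrow> int" where
  "idx_deg \<iota> = snd (snd (snd (snd \<iota>)))"

text \<open>The part of T that is homogeneous of degree r: the value at an index uses only the
  values of f at indices whose degree is larger by r.\<close>

lift_definition dcomp :: "int \<Rightarrow> hend \<Rightarrow> hend" is
  "\<lambda>r T f \<iota>. T (\<lambda>\<iota>'. if idx_deg \<iota>' = idx_deg \<iota> + r then f \<iota>' else 0) \<iota>"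
proof (intro conjI allI)
  fix r :: int and T :: "(idx \<Rightarrow> complex) \<Rightarrow> idx \<Rightarrow> complex" and f g :: "idx \<Rightarrow> complex" and a :: complex
  assume T: "(\<forall>f g. T (\<lambda>i. f i + g i) = (\<lambda>i. T f i + T g i)) \<and> (\<forall>a f. T (\<lambda>i. a * f i) = (\<lambda>i. a * T f i))"
  have 1: "(\<lambda>\<iota>'. if P \<iota>' then f \<iota>' + g \<iota>' else 0) = (\<lambda>\<iota>'. (if P \<iota>' then f \<iota>' else 0) + (if P \<iota>' then g \<iota>' else 0))"
    and 2: "(\<lambda>\<iota>'. if P \<iota>' then a * f \<iota>' else 0) = (\<lambda>\<iota>'. a * (if P \<iota>' then f \<iota>' else 0))" for P
    by auto
  show "(\<lambda>\<iota>. T (\<lambda>\<iota>'. if idx_deg \<iota>' = idx_deg \<iota> + r then f \<iota>' + g \<iota>' else 0) \<iota>) =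
      (\<lambda>i. T (\<lambda>\<iota>'. if idx_deg \<iota>' = idx_deg i + r then f \<iota>' else 0) i + T (\<lambda>\<iota>'. if idx_deg \<iota>' = idx_deg i + r then g \<iota>' else 0) i)"
    unfolding 1 using T by simp
  show "(\<lambda>\<iota>. T (\<lambda>\<iota>'. if idx_deg \<iota>' = idx_deg \<iota> + r then a * f \<iota>' else 0) \<iota>) =
      (\<lambda>i. a * T (\<lambda>\<iota>'. if idx_deg \<iota>' = idx_deg i + r then f \<iota>' else 0) i)"
    unfolding 2 using T by simp
qed

lemma app_dcomp: "app (dcomp r T) f \<iota> = app T (\<lambda>\<iota>'. if idx_deg \<iota>' = idx_deg \<iota> + r then f \<iota>' else 0) \<iota>"
  by transfer simp

lemma dcomp_simps [simp]:
  "dcomp r (S + T) = dcomp r S + dcomp r T" "dcomp r (S - T) = dcomp r S - dcomp r T"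
  "dcomp r (- T) = - dcomp r T" "dcomp r 0 = 0"
  by (rule lend_eqI, simp add: app_dcomp)+

lemma dcomp_sum [simp]: "dcomp r (sum F A) = (\<Sum>a\<in>A. dcomp r (F a))"
  by (induction A rule: infinite_finite_induct) auto

text \<open>An operator need not be the sum of its components, so homogeneity is stated through the
  effect on products with arbitrary operators. This gives the multiplication rule for degrees from
  either side.\<close>

definition dg :: "int \<Rightarrow> hend \<Rightarrow> bool" where
  "dg p A \<longleftrightarrow> (\<forall>r T. dcomp r (A * T) = A * dcomp (r - p) T \<and> dcomp r (T * A) = dcomp (r - p) T * A)"

lemma dg_wsub:
  assumes "\<And>\<iota>. idx_deg (\<theta> \<iota>) = idx_deg \<iota> + p"
  shows "dg p (wsub \<psi> \<theta>)"
  unfolding dg_def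
proof (intro allI conjI)
  fix r T
  show "dcomp r (wsub \<psi> \<theta> * T) = wsub \<psi> \<theta> * dcomp (r - p) T"
    by (rule lend_eqI) (simp add: app_dcomp assms)
  show "dcomp r (T * wsub \<psi> \<theta>) = dcomp (r - p) T * wsub \<psi> \<theta>"
  proof (rule lend_eqI)
    fix f \<iota>
    have "app (wsub \<psi> \<theta>) (\<lambda>\<iota>'. if idx_deg \<iota>' = idx_deg \<iota> + r then f \<iota>' else 0) =
        (\<lambda>\<iota>'. if idx_deg \<iota>' = idx_deg \<iota> + (r - p) then app (wsub \<psi> \<theta>) f \<iota>' else 0)"
      by (auto simp: assms fun_eq_iff)
    then show "app (dcomp r (T * wsub \<psi> \<theta>)) f \<iota> = app (dcomp (r - p) T * wsub \<psi> \<theta>) f \<iota>"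
      by (simp add: app_dcomp)
  qed
qed

lemma dcomp_left: "dg p A \<Longrightarrow> dcomp r (A * T) = A * dcomp (r - p) T"
  and dcomp_right: "dg p A \<Longrightarrow> dcomp r (T * A) = dcomp (r - p) T * A"
  by (simp_all add: dg_def)

lemma dg_add: "dg p A \<Longrightarrow> dg p B \<Longrightarrow> dg p (A + B)"
  by (simp add: dg_def distrib_left distrib_right)

lemma dg_mult:
  assumes "dg p A" "dg q B"
  shows "dg (p + q) (A * B)"
  unfolding dg_def
proof (intro allI conjI)
  fix r T
  have "dcomp r (A * B * T) = A * (B * dcomp (r - p - q) T)"
    by (simp only: mult.assoc dcomp_left[OF assms(1)] dcomp_left[OF assms(2)])
  then show "dcomp r (A * B * T) = A * B * dcomp (r - (p + q)) T" by (simp add: mult.assoc diff_diff_eq)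
  have "dcomp r (T * (A * B)) = dcomp (r - q - p) T * A * B"
    by (simp only: mult.assoc[symmetric] dcomp_right[OF assms(1)] dcomp_right[OF assms(2)])
  then show "dcomp r (T * (A * B)) = dcomp (r - (p + q)) T * (A * B)" by (simp add: mult.assoc diff_diff_eq add.commute)
qed

lemma dg_mult_0: "dg 0 A \<Longrightarrow> dg q B \<Longrightarrow> dg q (A * B)" "dg p A \<Longrightarrow> dg 0 B \<Longrightarrow> dg p (A * B)"
  using dg_mult[of 0 A q B] dg_mult[of p A 0 B] by simp_all

lemma dg_sc: "dg 0 (sc a)"
proof -
  have "(sc a :: hend) = wsub (\<lambda>_. a) (\<lambda>\<iota>. \<iota>)" by (rule lend_eqI) simp
  then show ?thesis by (simp add: dg_wsub)
qed

lemma dg_0: "dg p 0" by (simp add: dg_def)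

lemma dg_sum: "(\<And>a. a \<in> Y \<Longrightarrow> dg p (F a)) \<Longrightarrow> dg p (sum F Y)"
  by (induction Y rule: infinite_finite_induct) (auto intro: dg_add dg_0)

lemma dg_ops: "dg 0 (cO i)" "dg 0 etaO" "dg 0 (gO u)" "dg 0 (nuO \<alpha>)" "dg 0 piO" "dg 1 (sO i)"
  unfolding op_defs by (intro dg_wsub, simp add: idx_deg_def split: prod.splits)+

lemma dcomp_1: "dcomp r 1 = (if r = 0 then 1 else 0)"
proof (rule lend_eqI)
  fix f and \<iota> :: idx
  show "app (dcomp r 1) f \<iota> = app (if r = 0 then 1 else 0) f \<iota>" by (simp add: app_dcomp)
qed

lemma dcomp_dg: "dg p A \<Longrightarrow> dcomp r A = (if r = p then A else 0)"
proof -
  assume "dg p A"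
  then have "dcomp r (A * 1) = A * dcomp (r - p) 1" unfolding dg_def by blast
  then show ?thesis by (simp add: dcomp_1)
qed

lemma dcomp_left0: "dg 0 A \<Longrightarrow> dcomp r (A * T) = A * dcomp r T"
  and dcomp_right0: "dg 0 A \<Longrightarrow> dcomp r (T * A) = dcomp r T * A"
  by (simp_all add: dg_def)

lemma dg_lin: "(\<And>i. dg p (F i)) \<Longrightarrow> dg p (lin n F v)"
  unfolding lin_def by (intro dg_sum dg_mult_0 dg_sc)

lemma dg_rs: "dg 0 (rs n \<alpha>)"
  unfolding rs_def by (intro dg_mult_0 dg_ops dg_lin)

text \<open>A product of shifts moves the exponents by the multiset of directions; the accumulated
  signs amount to a nonzero scalar independent of f.\<close>

lemma app_sO_prod:
  "\<exists>\<chi>. \<chi> \<noteq> 0 \<and> (\<forall>f. app (prod_list (map sO l)) f (w, I, e, b, d) =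
     \<chi> * f (w, I, e, (\<lambda>j. b j + int (count (mset (map (sp_pos w) l)) j)), d + int (length l)))"
proof (induction l arbitrary: b d)
  case Nil
  show ?case by (rule exI[of _ 1]) simp
next
  case (Cons i l)
  let ?b = "b(sp_pos w i := b (sp_pos w i) + 1)"
  obtain \<chi> where \<chi>: "\<chi> \<noteq> 0" "\<And>f. app (prod_list (map sO l)) f (w, I, e, ?b, d + 1) =
     \<chi> * f (w, I, e, (\<lambda>j. ?b j + int (count (mset (map (sp_pos w) l)) j)), d + 1 + int (length l))"
    using Cons.IH[of ?b "d + 1"] by blast
  let ?k = "complex_of_real (sp_sgn w i) * (if Suc (sp_pos w i) \<in> I then - 1 else 1)"
  have b: "(\<lambda>j. ?b j + int (count (mset (map (sp_pos w) l)) j)) = (\<lambda>j. b j + int (count (mset (map (sp_pos w) (i # l))) j))"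
    by auto
  have "?k \<noteq> 0" using sp_sgn[of w i] by auto
  moreover have "app (prod_list (map sO (i # l))) f (w, I, e, b, d) =
     ?k * \<chi> * f (w, I, e, (\<lambda>j. b j + int (count (mset (map (sp_pos w) (i # l))) j)), d + int (length (i # l)))" for f
  proof -
    have "app (prod_list (map sO (i # l))) f (w, I, e, b, d) = ?k * app (prod_list (map sO l)) f (w, I, e, ?b, d + 1)"
      by (simp add: sO_def)
    then show ?thesis unfolding \<chi>(2) b by (simp add: algebra_simps)
  qed
  ultimately show ?case using \<chi>(1) by (intro exI[of _ "?k * \<chi>"]) auto
qed

text \<open>At a fixed w distinct multisets shift the exponents by distinct vectors. Multiplying f
  by the indicator of one exponent vector, which commutes with every coefficient, therefore singles
  out the term of \<open>A0\<close>.\<close>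

lemma pbw_independent:
  assumes fin: "finite F" and u: "\<And>A \<phi>. A \<in> F \<Longrightarrow> mbO \<phi> * u A = u A * mbO \<phi>"
    and 0: "(\<Sum>A\<in>F. xm sO A * u A) = 0" and A0: "A0 \<in> F"
  shows "u A0 = 0"
proof (rule lend_eqI)
  fix f and \<iota> :: idx
  obtain w I e b d where \<iota>: "\<iota> = (w, I, e, b, d)" by (cases \<iota>)
  define v where "v A j = int (count (image_mset (sp_pos w) A) j)" for A j
  have v_inj: "A = B" if "v A = v B" for A B
  proof -
    have "image_mset (sp_pos w) A = image_mset (sp_pos w) B"
      using that by (intro multiset_eqI) (auto simp: v_def fun_eq_iff)
    moreover have "inj (sp_pos w)" by (rule injI) (simp add: sp_pos_eq_iff)
    ultimately show ?thesis by (metis multiset.inj_map injD)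
  qed
  \<comment> \<open>The starting exponents are chosen so that the monomial of \<open>A0\<close>
    arrives at the given index.\<close>
  define b1 d1 where "b1 = b - v A0" and "d1 = d - int (size A0)"
  define \<phi> :: "(nat \<Rightarrow> int) \<Rightarrow> complex" where "\<phi> b' = (if b' = b then 1 else 0)" for b'
  have "\<exists>\<chi>. \<forall>A. \<chi> A \<noteq> 0 \<and> (\<forall>f. app (xm sO A) f (w, I, e, b1, d1) = \<chi> A * f (w, I, e, b1 + v A, d1 + int (size A)))"
  proof (rule choice, rule allI)
    fix A
    have "mset (map (sp_pos w) (sorted_list_of_multiset A)) = image_mset (sp_pos w) A"
      by (metis mset_map mset_sorted_list_of_multiset)
    moreover have "length (sorted_list_of_multiset A) = size A"
      by (metis mset_sorted_list_of_multiset size_mset)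
    moreover have "b1 + v A = (\<lambda>j. b1 j + int (count (image_mset (sp_pos w) A) j))" by (auto simp: v_def)
    ultimately show "\<exists>\<chi>. \<chi> \<noteq> 0 \<and> (\<forall>f. app (xm sO A) f (w, I, e, b1, d1) = \<chi> * f (w, I, e, b1 + v A, d1 + int (size A)))"
      using app_sO_prod[of "sorted_list_of_multiset A" w I e b1 d1] by (simp only: xm_def)
  qed
  then obtain \<chi> where \<chi>: "\<And>A. \<chi> A \<noteq> 0" "\<And>A f. app (xm sO A) f (w, I, e, b1, d1) = \<chi> A * f (w, I, e, b1 + v A, d1 + int (size A))"
    by blast
  have "0 = app (\<Sum>A\<in>F. xm sO A * u A) (app (mbO \<phi>) f) (w, I, e, b1, d1)" unfolding 0 by simp
  also have "\<dots> = (\<Sum>A\<in>F. \<chi> A * app (u A * mbO \<phi>) f (w, I, e, b1 + v A, d1 + int (size A)))"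
    by (simp add: \<chi>)
  also have "\<dots> = (\<Sum>A\<in>F. if A = A0 then \<chi> A0 * app (u A0) f (w, I, e, b, d) else 0)"
  proof (intro sum.cong refl)
    fix A assume A: "A \<in> F"
    have "b1 + v A = b \<longleftrightarrow> A = A0"
      using v_inj[of A A0] by (auto simp: b1_def fun_eq_iff)
    then show "\<chi> A * app (u A * mbO \<phi>) f (w, I, e, b1 + v A, d1 + int (size A)) =
       (if A = A0 then \<chi> A0 * app (u A0) f (w, I, e, b, d) else 0)"
      unfolding u[OF A, symmetric] by (auto simp: mbO_def \<phi>_def d1_def)
  qed
  also have "\<dots> = \<chi> A0 * app (u A0) f \<iota>" using fin A0 by (simp add: \<iota>)
  finally show "app (u A0) f \<iota> = app 0 f \<iota>" using \<chi>(1)[of A0] by simp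
qed

section \<open>The parity automorphism\<close>

definition pc :: "hend \<Rightarrow> hend" where "pc T = piO * T * piO"

lemma pc_add: "pc (S + T) = pc S + pc T" and pc_diff: "pc (S - T) = pc S - pc T" and pc_uminus: "pc (- T) = - pc T"
  by (simp_all add: pc_def algebra_simps)

lemma pc_mult: "pc (S * T) = pc S * pc T"
proof -
  have "piO * (piO * T) = T" for T by (simp add: mult.assoc[symmetric] piO_commute)
  then show ?thesis by (simp add: pc_def mult.assoc)
qed

lemma pc_pc: "pc (pc T) = T"
proof -
  have "piO * (piO * T) = T" for T by (simp add: mult.assoc[symmetric] piO_commute)
  then show ?thesis by (simp add: pc_def mult.assoc piO_commute)
qed

lemma pc_sc: "pc (sc a) = sc a"
  unfolding pc_def sc_commute[of piO] by (simp add: mult.assoc piO_commute)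

lemma pc_0: "pc 0 = 0" by (simp add: pc_def)

lemma pc_sum: "pc (sum F A) = (\<Sum>a\<in>A. pc (F a))"
  by (simp add: pc_def sum_distrib_left sum_distrib_right)

lemma pc_ops: "pc (cO i) = - cO i" "pc (sO i) = sO i" "pc (gO u) = gO u" "pc (nuO \<alpha>) = nuO \<alpha>" "pc etaO = - etaO"
  by (simp_all add: pc_def piO_commute mult.assoc nuO_commute(4)[symmetric])

lemma pc_lin_cO: "pc (lin n cO v) = - lin n cO v"
  by (simp add: lin_def pc_sum pc_mult pc_sc pc_ops sum_negf)

lemma pc_rs: "pc (rs n \<alpha>) = - rs n \<alpha>"
  by (simp add: rs_def pc_mult pc_ops pc_lin_cO)

lemma sO_xm: "sO i * xm sO A = xm sO (add_mset i A)"
proof -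
  have "sO i * prod_list (map sO l) = prod_list (map sO (insort i l))" for l
  proof (induction l)
    case (Cons j l)
    have "sO i * (sO j * prod_list (map sO l)) = sO j * (sO i * prod_list (map sO l))"
      by (simp add: mult.assoc[symmetric] sO_commute[of i j])
    then show ?case using Cons by auto
  qed simp
  then show ?thesis by (simp add: xm_def)
qed

lemma cO_xm: "cO i * xm sO A = (if odd (count A i) then - (xm sO A * cO i) else xm sO A * cO i)"
proof -
  have "cO i * prod_list (map sO l) = (if odd (count (mset l) i) then - (prod_list (map sO l) * cO i) else prod_list (map sO l) * cO i)" for l
  proof (induction l)
    case (Cons j l)
    have "cO i * (sO j * T) = (if i = j then - (sO j * (cO i * T)) else sO j * (cO i * T))" for T
      using sO_cO[of j i] by (auto simp: mult.assoc[symmetric])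
    then show ?case using Cons by (auto simp: mult.assoc)
  qed simp
  from this[of "sorted_list_of_multiset A"] show ?thesis by (simp add: xm_def)
qed

section \<open>The differential on leading symbols\<close>

definition D1 :: "nat \<Rightarrow> hend" where
  "D1 n = (\<Sum>i = 1..n. sO i * cO i)"

text \<open>This is the parity condition after one copy of i has been added to a multiset in which i
  occurs an odd number of times.\<close>

definition te :: "nat \<Rightarrow> nat multiset \<Rightarrow> bool" where
  "te i B \<longleftrightarrow> even (count B i) \<and> count B i \<noteq> 0"

definition Tmap :: "nat \<Rightarrow> (nat multiset \<Rightarrow> hend) \<Rightarrow> nat multiset \<Rightarrow> hend" where
  "Tmap n U B = (\<Sum>i = 1..n. if te i B then cO i * U (B - {#i#}) else 0)"

definition Qmap :: "nat \<Rightarrow> (nat multiset \<Rightarrow> hend) \<Rightarrow> nat multiset \<Rightarrow> hend" where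
  "Qmap n U A = (\<Sum>i = 1..n. if odd (count A i) then cO i * U (add_mset i A) else 0)"

text \<open>Moving c_i across the monomial of A costs the sign (-1)^(A_i), so only variables of odd
  multiplicity contribute, each with the factor -2. The assumption lets D1 pass the coefficients,
  leaving only its commutator with the monomials.\<close>

lemma symbol_d:
  assumes "\<And>A. A \<in> Fset n m \<Longrightarrow> D1 n * U A = sc \<sigma> * U A * D1 n"
  shows "D1 n * (\<Sum>A\<in>Fset n m. xm sO A * U A) - sc \<sigma> * (\<Sum>A\<in>Fset n m. xm sO A * U A) * D1 n =
    sc (- 2) * (\<Sum>B\<in>Fset n (Suc m). xm sO B * Tmap n U B)"
proof -
  have 1: "D1 n * (xm sO A * U A) - sc \<sigma> * (xm sO A * U A) * D1 n =
      (\<Sum>i = 1..n. if odd (count A i) then sc (- 2) * (xm sO (add_mset i A) * (cO i * U A)) else 0)"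
    if A: "A \<in> Fset n m" for A
  proof -
    have "sc \<sigma> * (xm sO A * U A) * D1 n = xm sO A * (sc \<sigma> * U A * D1 n)"
      by (simp add: mult.assoc sc_left[of "xm sO A"])
    also have "\<dots> = xm sO A * D1 n * U A" using assms[OF A] by (simp add: mult.assoc)
    finally have "D1 n * (xm sO A * U A) - sc \<sigma> * (xm sO A * U A) * D1 n = (D1 n * xm sO A - xm sO A * D1 n) * U A"
      by (simp add: left_diff_distrib mult.assoc)
    also have "D1 n * xm sO A - xm sO A * D1 n = (\<Sum>i = 1..n. if odd (count A i) then sc (- 2) * (xm sO (add_mset i A) * cO i) else 0)"
      unfolding D1_def sum_distrib_left sum_distrib_right sum_subtractf[symmetric]
    proof (intro sum.cong refl)
      fix i
      have "xm sO A * sO i = sO i * xm sO A"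
      proof -
        have "prod_list (map sO l) * sO i = sO i * prod_list (map sO l)" for l
        proof (induction l)
          case (Cons j l)
          have "sO j * (sO i * T) = sO i * (sO j * T)" for T by (simp add: mult.assoc[symmetric] sO_commute[of i j])
          then show ?case using Cons by (simp add: mult.assoc)
        qed simp
        then show ?thesis by (simp add: xm_def)
      qed
      then have "xm sO A * (sO i * cO i) = xm sO (add_mset i A) * cO i"
        by (simp add: mult.assoc[symmetric] sO_xm)
      moreover have "sO i * cO i * xm sO A = (if odd (count A i) then - (xm sO (add_mset i A) * cO i) else xm sO (add_mset i A) * cO i)"
        by (auto simp: mult.assoc cO_xm) (simp_all add: mult.assoc[symmetric] sO_xm)
      ultimately show "sO i * cO i * xm sO A - xm sO A * (sO i * cO i) =
          (if odd (count A i) then sc (- 2) * (xm sO (add_mset i A) * cO i) else 0)"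
        by (simp add: sc_uminus sc_numeral mult_2[where 'a=hend])
    qed
    finally show ?thesis
      by (simp add: sum_distrib_right mult.assoc if_distrib[of "\<lambda>z. z * _"] cong: if_cong)
  qed
  let ?H = "\<lambda>(B, i). xm sO B * (cO i * U (B - {#i#}))"
  let ?X = "{z \<in> Fset n m \<times> {1..n}. odd (count (fst z) (snd z))}" and ?Y = "{z \<in> Fset n (Suc m) \<times> {1..n}. te (snd z) (fst z)}"
  have fin: "finite (Fset n m \<times> {1..n})" "finite (Fset n (Suc m) \<times> {1..n})" by (auto simp: finite_Fset)
  have "D1 n * (\<Sum>A\<in>Fset n m. xm sO A * U A) - sc \<sigma> * (\<Sum>A\<in>Fset n m. xm sO A * U A) * D1 n =
    (\<Sum>A\<in>Fset n m. \<Sum>i = 1..n. if odd (count A i) then sc (- 2) * (xm sO (add_mset i A) * (cO i * U A)) else 0)"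
    unfolding sum_distrib_left sum_distrib_right sum_subtractf[symmetric] by (intro sum.cong refl 1)
  also have "\<dots> = (\<Sum>z\<in>Fset n m \<times> {1..n}. if odd (count (fst z) (snd z)) then sc (- 2) * ?H (add_mset (snd z) (fst z), snd z) else 0)"
    unfolding sum.cartesian_product by (intro sum.cong) auto
  also have "\<dots> = (\<Sum>z\<in>?X. sc (- 2) * ?H (add_mset (snd z) (fst z), snd z))"
    using fin(1) by (simp only: sum.inter_filter)
  \<comment> \<open>Reindexing by B = A + {i}: A_i is odd exactly when B_i is even and
    nonzero.\<close>
  also have "\<dots> = (\<Sum>z\<in>?Y. sc (- 2) * ?H z)"
  proof (rule sum.reindex_bij_witness[where i = "\<lambda>z. (fst z - {#snd z#}, snd z)" and j = "\<lambda>z. (add_mset (snd z) (fst z), snd z)"])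
    fix z assume z: "z \<in> ?Y"
    then have z': "snd z \<in># fst z" by (auto simp: te_def count_eq_zero_iff)
    then have "size (fst z - {#snd z#}) = m" using z by (auto simp: Fset_def size_Diff_singleton)
    moreover have "set_mset (fst z - {#snd z#}) \<subseteq> set_mset (fst z)" by (auto dest: in_diffD)
    ultimately show "(fst z - {#snd z#}, snd z) \<in> ?X" using z z' by (force simp: Fset_def te_def)
    show "(add_mset (snd (fst z - {#snd z#}, snd z)) (fst (fst z - {#snd z#}, snd z)), snd (fst z - {#snd z#}, snd z)) = z"
      using z' by simp
  qed (auto simp: Fset_def te_def)
  also have "\<dots> = (\<Sum>z\<in>Fset n (Suc m) \<times> {1..n}. if te (snd z) (fst z) then sc (- 2) * ?H z else 0)"
    using fin(2) by (simp only: sum.inter_filter)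
  also have "\<dots> = (\<Sum>B\<in>Fset n (Suc m). \<Sum>i = 1..n. if te i B then sc (- 2) * (xm sO B * (cO i * U (B - {#i#}))) else 0)"
    unfolding sum.cartesian_product by (intro sum.cong) auto
  also have "\<dots> = sc (- 2) * (\<Sum>B\<in>Fset n (Suc m). xm sO B * Tmap n U B)"
    unfolding Tmap_def sum_distrib_left by (intro sum.cong refl) simp
  finally show ?thesis .
qed

text \<open>The homotopy identity: \<open>T\<close> is the Koszul type differential on symbols, \<open>Q\<close> its adjoint.\<close>

lemma TQ_QT:
  assumes B: "set_mset B \<subseteq> {1..n}"
  shows "Tmap n (Qmap n U) B + Qmap n (Tmap n U) B = - (of_nat (card (set_mset B)) * U B)"
proof -
  let ?a = "\<lambda>i j. if te i B \<and> odd (count (B - {#i#}) j) then cO i * (cO j * U (add_mset j (B - {#i#}))) else 0"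
  let ?b = "\<lambda>i j. if odd (count B j) \<and> te i (add_mset j B) then cO j * (cO i * U (add_mset j B - {#i#})) else 0"
  have 1: "Tmap n (Qmap n U) B = (\<Sum>i = 1..n. \<Sum>j = 1..n. ?a i j)"
    unfolding Tmap_def[of n "Qmap n U"] by (intro sum.cong refl) (auto simp: Qmap_def sum_distrib_left intro!: sum.cong)
  have 2: "Qmap n (Tmap n U) B = (\<Sum>i = 1..n. \<Sum>j = 1..n. ?b i j)"
    unfolding Qmap_def[of n "Tmap n U"]
    by (subst sum.swap, intro sum.cong refl) (auto simp: Tmap_def sum_distrib_left intro!: sum.cong)
  \<comment> \<open>Off the diagonal the two composites cancel by anticommutation of c_i and c_j. On
    the diagonal, for i occurring in B, exactly one of them is present: the first for even and the
    second for odd multiplicity.\<close>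
  have 3: "?a i j + ?b i j = (if i = j \<and> i \<in># B then - U B else 0)" for i j
  proof (cases "i = j")
    case True
    consider "count B i = 0" | "count B i \<noteq> 0" "even (count B i)" | "count B i \<noteq> 0" "odd (count B i)" by blast
    then show ?thesis
    proof cases
      case 1
      have "even (count B i)" unfolding 1 by simp
      moreover have "i \<notin># B" "\<not> te i B" using 1 by (simp_all add: te_def count_eq_zero_iff)
      ultimately show ?thesis using True by simp
    next
      case 2
      then have "i \<in># B" "add_mset i (B - {#i#}) = B" "te i B" "odd (count (B - {#i#}) i)"
        by (simp_all add: te_def count_eq_zero_iff)
      then show ?thesis using True 2 by (simp add: cO_sq')
    next
      case 3
      then have "i \<in># B" "\<not> te i B" "te i (add_mset i B)" by (simp_all add: te_def count_eq_zero_iff)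
      then show ?thesis using True 3 by (simp add: cO_sq')
    qed
  next
    case False
    then have "cO i * (cO j * T) = - (cO j * (cO i * T))" for T
      using cO_anti[OF False] by (simp add: mult.assoc[symmetric])
    moreover have "te i B \<Longrightarrow> add_mset j (B - {#i#}) = add_mset j B - {#i#}"
      using False by simp
    ultimately show ?thesis using False by (auto simp: te_def)
  qed
  have "Tmap n (Qmap n U) B + Qmap n (Tmap n U) B = (\<Sum>i = 1..n. \<Sum>j = 1..n. if i = j \<and> i \<in># B then - U B else 0)"
    unfolding 1 2 sum.distrib[symmetric] 3 ..
  also have "\<dots> = (\<Sum>i = 1..n. if i \<in># B then - U B else 0)"
  proof (intro sum.cong refl)
    fix i assume i: "i \<in> {1..n}"
    have "(\<Sum>j = 1..n. if i = j \<and> i \<in># B then - U B else 0) = (\<Sum>j = 1..n. if j = i then (if i \<in># B then - U B else 0) else 0)"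
      by (intro sum.cong) auto
    then show "(\<Sum>j = 1..n. if i = j \<and> i \<in># B then - U B else 0) = (if i \<in># B then - U B else 0)" using i by simp
  qed
  also have "\<dots> = (\<Sum>i\<in>set_mset B. - U B)"
    using B by (subst sum.inter_restrict[symmetric]) (auto intro!: sum.cong simp: Int_absorb1)
  finally show ?thesis by simp
qed

text \<open>The differential removes a variable only where its multiplicity is at least 2, so the
  support of the multiset, and with it the scaling factor, is unchanged.\<close>

lemma Tmap_scale:
  "Tmap n (\<lambda>A. sc (1 / of_nat (card (set_mset A))) * U A) B = sc (1 / of_nat (card (set_mset B))) * Tmap n U B"
  unfolding Tmap_def sum_distrib_left
proof (intro sum.cong refl)
  fix i
  have "set_mset (B - {#i#}) = set_mset B" if "te i B"
  proof -
    have "count B i > 1" using that unfolding te_def by (metis One_nat_def gr0I less_one linorder_neqE_nat odd_one)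
    then have "x \<in># B - {#i#} \<longleftrightarrow> x \<in># B" for x
      by (auto simp: count_greater_zero_iff[symmetric] simp del: count_greater_zero_iff split: if_splits)
    then show ?thesis by blast
  qed
  then show "(if te i B then cO i * (sc (1 / of_nat (card (set_mset (B - {#i#})))) * U (B - {#i#})) else 0) =
     sc (1 / of_nat (card (set_mset B))) * (if te i B then cO i * U (B - {#i#}) else 0)"
    by (simp add: sc_ops)
qed

lemma alg_uminus: "y \<in> alg sc Y \<Longrightarrow> - y \<in> alg sc Y"
  using alg_mult[OF alg_sca[of sc "- 1"]] by (simp add: sc_uminus)

lemma alg_diff: "y \<in> alg sc Y \<Longrightarrow> z \<in> alg sc Y \<Longrightarrow> y - z \<in> alg sc Y"
  using alg_add[OF _ alg_uminus] by fastforce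

lemma alg_0: "0 \<in> alg sc Y" and alg_1: "1 \<in> alg sc Y"
  using alg_sca[of sc 0] alg_sca[of sc 1] by simp_all

lemma alg_sum: "(\<And>a. a \<in> X' \<Longrightarrow> F a \<in> alg sc Y) \<Longrightarrow> sum F X' \<in> alg sc Y"
  by (induction X' rule: infinite_finite_induct) (auto intro: alg_add alg_0)

lemma alg_mono: "y \<in> alg s Y \<Longrightarrow> Y \<subseteq> Z \<Longrightarrow> y \<in> alg s Z"
  by (induction rule: alg.induct) (auto intro: alg.intros)

lemma half_half: "sc (1/2) * (z + z) = (z :: hend)"
  by (simp add: mult_2[symmetric] sc_numeral[symmetric] sc_sc)

lemma double_cancel: "z + z = y + y \<Longrightarrow> z = (y :: hend)"
  by (metis half_half)

lemma anti_square:
  fixes y z :: "'r :: ring"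
  assumes "z * y = - (y * z)"
  shows "z * (y * y) = y * y * z"
proof -
  have "z * (y * y) = (z * y) * y" by (simp only: mult.assoc)
  also have "\<dots> = - (y * (z * y))" unfolding assms(1) by (simp only: mult_minus_left mult.assoc assms(1) mult_minus_right)
  finally show ?thesis by (simp only: assms mult_minus_right minus_minus mult.assoc)
qed

lemma sc_square_1: "\<sigma> * \<sigma> = 1 \<Longrightarrow> sc \<sigma> * (sc \<sigma> * z) = z"
  by (simp add: sc_sc)

context hc_model
begin

lemma xv_scale: "xv (\<lambda>i. t * v i) = sc (complex_of_real t) * xv v"
proof -
  have "pr \<alpha> (\<lambda>i. t * v i) = (\<lambda>i. t * pr \<alpha> v i)" for \<alpha> by (auto simp: pr_def)
  then have "th \<alpha> (\<lambda>i. t * v i) = sc (complex_of_real t) * th \<alpha> v" for \<alpha>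
    by (simp add: th_def lin_cmult sc_left[of "nuO \<alpha> * rs n \<alpha>"])
  then show ?thesis
    by (simp add: xv_def lin_cmult distrib_left sum_distrib_left sc_sc mult.commute)
qed

end

text \<open>The two facts that were derived from a simple system are turned into assumptions. Type D
  can then enter by inheriting them from type B.\<close>

locale hc_full = hc_model +
  assumes xx: "i \<in> {1..n} \<Longrightarrow> j \<in> {1..n} \<Longrightarrow> i \<noteq> j \<Longrightarrow> xO i * xO j - xO j * xO i = sc (- 2 * a\<^sup>2) * (cO j * cO i)"
    and KK: "u \<in> W \<Longrightarrow> gO u * (KO * KO) = KO * KO * gO u"
begin

abbreviation Sg :: "hend set" where "Sg \<equiv> alg sc (cO ` {1..n} \<union> gO ` W)"
abbreviation Hg :: "hend set" where "Hg \<equiv> alg sc (xO ` {1..n} \<union> cO ` {1..n} \<union> gO ` W)"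

lemma Sg_Hg: "u \<in> Sg \<Longrightarrow> u \<in> Hg"
  by (erule alg_mono) auto

lemma Sg_cO: "i \<in> {1..n} \<Longrightarrow> cO i \<in> Sg" and Sg_gO: "u \<in> W \<Longrightarrow> gO u \<in> Sg"
  and Hg_cO: "i \<in> {1..n} \<Longrightarrow> cO i \<in> Hg" and Hg_gO: "u \<in> W \<Longrightarrow> gO u \<in> Hg" and Hg_xO: "i \<in> {1..n} \<Longrightarrow> xO i \<in> Hg"
  by (auto intro: alg_gen)

lemma Sg_lin: "lin n cO v \<in> Sg"
  unfolding lin_def by (intro alg_sum alg_mult alg_sca Sg_cO)

lemma Sg_rs: "\<alpha> \<in> P \<Longrightarrow> rs n \<alpha> \<in> Sg"
  unfolding rs_def by (intro alg_mult Sg_gO Sg_lin refl_W)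

lemma Sg_KO: "KO \<in> Sg"
  unfolding KO_def by (intro alg_sum alg_mult alg_sca Sg_rs)

lemma Hg_DO: "DO \<in> Hg"
  unfolding DO_def by (intro alg_add alg_sum alg_mult Hg_xO Hg_cO Sg_Hg[OF Sg_KO])

lemma W_std: assumes "u \<in> W" "i \<in> {1..n}"
  obtains t i' where "i' \<in> {1..n}" "u (std i) = (\<lambda>l. t * std i' l)"
proof -
  obtain \<pi> \<sigma> where w: "\<pi> permutes {1..n}" "u = (\<lambda>v i. \<sigma> i * v (\<pi> i))"
    using W_sp[OF assms(1)] unfolding signed_perm_def by blast
  show ?thesis
    using that[OF _ signed_perm_std[OF w]] permutes_in_image[OF permutes_inv[OF w(1)]] assms(2) by blast
qed

text \<open>With J = {0} the congruence of the spanning argument is equality of operators. Here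
  relations are available for all of W, so W0 = W.\<close>

sublocale sp: hc_span UNIV "{0}" sc xO cO gO W W n "- 2 * a\<^sup>2"
proof
  show "W \<subseteq> wgen W"
  proof
    fix w assume "w \<in> W"
    then have "w \<circ> id \<in> wgen W" by (intro wgen_step wgen_id)
    then show "w \<in> wgen W" by simp
  qed
  show "\<exists>s. cO j * xO i - sc s * xO i * cO j \<in> {0}" if "i \<in> {1..n}" "j \<in> {1..n}" for i j
    by (rule exI[of _ "if i = j then - 1 else 1"]) (use xO_cO[OF that] in \<open>auto simp: sc_uminus\<close>)
  show "cO i * cO j + cO j * cO i \<in> {0}" if "i \<in> {1..n}" "j \<in> {1..n}" "i \<noteq> j" for i j
    using cO_anti[OF that(3)] by simp
  show "\<exists>s. \<exists>i'\<in>{1..n}. gO u * cO i - sc s * cO i' * gO u \<in> {0}" if u: "u \<in> W" "i \<in> {1..n}" for u i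
  proof -
    obtain t i' where "i' \<in> {1..n}" "u (std i) = (\<lambda>l. t * std i' l)" using W_std[OF u] .
    then show ?thesis using gO_cO_std[OF W_sp[OF u(1)]] by (intro exI[of _ "complex_of_real t"] bexI[of _ i']) auto
  qed
  show "\<exists>s. \<exists>i'\<in>{1..n}. \<exists>e\<in>Sg. gO u * xO i - sc s * xO i' * gO u - e \<in> {0}" if u: "u \<in> W" "i \<in> {1..n}" for u i
  proof -
    obtain t i' where i': "i' \<in> {1..n}" "u (std i) = (\<lambda>l. t * std i' l)" using W_std[OF u] .
    obtain u' where u': "u' \<in> W" "u' \<circ> u = id" using W_inv[OF u(1)] by blast
    let ?e = "- (\<Sum>\<alpha>\<in>{\<alpha>\<in>P. u' \<alpha> \<notin> P}. sc (kap \<alpha>) * (rs n \<alpha> * cv n (pr \<alpha> (u (std i))))) * gO u"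
    have "?e \<in> Sg" by (intro alg_mult alg_uminus alg_sum alg_sca Sg_rs Sg_lin Sg_gO u) auto
    moreover have "xv (u (std i)) = sc (complex_of_real t) * xO i'"
      unfolding i'(2) xv_scale xO_def ..
    then have "gO u * xO i - sc (complex_of_real t) * xO i' * gO u - ?e = 0"
      using gO_xv[OF u(1) u', of "std i"] by (simp add: xO_def left_diff_distrib)
    ultimately show ?thesis using i'(1) by blast
  qed
qed (auto simp: sc_add sc_mult W_fin W_id W_comp cO_sq xx gO_id gO_mult[OF W_sp] intro: sc_commute)

lemma alg_induct_pc:
  assumes "u \<in> alg sc Y" "\<And>y. y \<in> Y \<Longrightarrow> pc y \<in> alg sc Y"
  shows "pc u \<in> alg sc Y"
  using assms(1)
  by induction (auto simp: pc_sc pc_add pc_mult assms(2) intro: alg_sca alg_add alg_mult)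

lemma pc_xO: "i \<in> {1..n} \<Longrightarrow> pc (xO i) = xO i"
  by (simp add: xO_eq xh_def th_def pc_add pc_sum pc_mult pc_sc pc_ops pc_rs pc_lin_cO)

lemma pc_Sg: assumes "u \<in> Sg" shows "pc u \<in> Sg"
proof (rule alg_induct_pc[OF assms])
  fix y assume "y \<in> cO ` {1..n} \<union> gO ` W"
  then show "pc y \<in> Sg" using alg_uminus[OF Sg_cO] Sg_gO by (auto simp: pc_ops)
qed

lemma pc_KO: "pc KO = - KO"
  by (simp add: KO_def pc_sum pc_mult pc_sc pc_rs sum_negf)

lemma pc_DO: "pc DO = - DO"
  by (simp add: DO_def pc_add pc_KO pc_sum pc_mult pc_xO pc_ops sum_negf)

text \<open>Both sides are compatible with products because \<open>pc\<close> is multiplicative, so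
  the signs on generators determine the rule.\<close>

lemma anticomm_Sg:
  assumes "u \<in> Sg" and c: "\<And>j. j \<in> {1..n} \<Longrightarrow> cO j * E = - (E * cO j)" and g: "\<And>u. u \<in> W \<Longrightarrow> gO u * E = E * gO u"
  shows "E * u = pc u * E"
  using assms(1)
proof induction
  case (alg_sca s) then show ?case by (simp add: pc_sc sc_commute)
next
  case (alg_gen y) then show ?case using c g by (auto simp: pc_ops)
next
  case (alg_add y z) then show ?case by (simp add: pc_add distrib_left distrib_right)
next
  case (alg_mult y z)
  then show ?case by (simp add: pc_mult mult.assoc[symmetric]) (simp add: mult.assoc)
qed

lemma DO_Sg: "u \<in> Sg \<Longrightarrow> DO * u = pc u * DO"
  by (rule anticomm_Sg) (auto simp: cO_DO gO_DO)

lemma D1_Sg: "u \<in> Sg \<Longrightarrow> D1 n * u = pc u * D1 n"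
proof (erule anticomm_Sg)
  show "gO u * D1 n = D1 n * gO u" if "u \<in> W" for u
    unfolding D1_def by (rule gO_pairing[OF equivariant_sO equivariant_cO W_sp[OF that]])
  fix j
  have 1: "cO j * (sO i * cO i) = - (sO i * cO i * cO j)" for i
  proof (cases "i = j")
    case True
    have "cO j * sO j = - (sO j * cO j)" using sO_cO[of j j] by simp
    then show ?thesis using True by (simp add: mult.assoc[symmetric])
  next
    case False
    then have "cO j * sO i = sO i * cO j" using sO_cO[of i j] by simp
    then have "cO j * (sO i * cO i) = sO i * (cO j * cO i)" by (simp add: mult.assoc[symmetric])
    then show ?thesis using cO_anti[of j i] False by (simp add: mult.assoc)
  qed
  show "cO j * D1 n = - (D1 n * cO j)"
    unfolding D1_def sum_distrib_left sum_distrib_right by (simp add: 1 sum_negf)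
qed

lemma dg_Sg: "u \<in> Sg \<Longrightarrow> dg 0 u"
  by (induction rule: alg.induct) (auto intro: dg_sc dg_ops dg_add dg_mult_0)

lemma mbO_Sg: "u \<in> Sg \<Longrightarrow> mbO \<phi> * u = u * mbO \<phi>"
proof (induction rule: alg.induct)
  case (alg_mult y z)
  then show ?case by (simp add: mult.assoc[symmetric]) (simp add: mult.assoc)
qed (auto simp: sc_commute mbO_commute distrib_left distrib_right)

lemma xO_split: "dg 0 (xO i - sO i)" if "i \<in> {1..n}"
proof -
  have "xO i - sO i = sc a * cO i * etaO + (\<Sum>\<alpha>\<in>P. sc (kap \<alpha>) * th \<alpha> (std i))"
    by (simp add: xO_eq[OF that] xh_def)
  then show ?thesis
    by (auto simp: th_def intro!: dg_add dg_sum dg_mult_0 dg_sc dg_ops dg_rs dg_lin)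
qed

lemma DO_split: "dg 0 (DO - D1 n)"
proof -
  have "DO - D1 n = (\<Sum>i = 1..n. (xO i - sO i) * cO i) + KO"
    by (simp add: DO_def D1_def left_diff_distrib sum_subtractf)
  then show ?thesis
    by (auto intro!: dg_add dg_sum dg_mult_0 dg_ops xO_split dg_Sg[OF Sg_KO])
qed

lemma dg_D1: "dg 1 (D1 n)"
  unfolding D1_def by (intro dg_sum dg_mult_0 dg_ops)

text \<open>D differs from its leading part D1, of degree 1, by an operator of degree 0. Hence a
  component of a product with D involves only two components of the other factor.\<close>

lemma dcomp_DO: "dcomp r (DO * T) = D1 n * dcomp (r - 1) T + (DO - D1 n) * dcomp r T"
  "dcomp r (T * DO) = dcomp (r - 1) T * D1 n + dcomp r T * (DO - D1 n)"
proof -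
  have "DO * T = D1 n * T + (DO - D1 n) * T" "T * DO = T * D1 n + T * (DO - D1 n)"
    by (simp_all add: algebra_simps)
  then show "dcomp r (DO * T) = D1 n * dcomp (r - 1) T + (DO - D1 n) * dcomp r T"
    "dcomp r (T * DO) = dcomp (r - 1) T * D1 n + dcomp r T * (DO - D1 n)"
    by (simp_all add: dcomp_left[OF dg_D1] dcomp_right[OF dg_D1] dcomp_left0[OF DO_split] dcomp_right0[OF DO_split])
qed

text \<open>Each x_i differs from its shift only in degree 0, so the top component of an ordered
  monomial is the corresponding monomial in the shifts.\<close>

lemma dcomp_xm:
  assumes "A \<in> Fset n l" "r \<ge> int l"
  shows "dcomp r (xm xO A) = (if r = int l then xm sO A else 0)"
proof -
  have "set k \<subseteq> {1..n} \<Longrightarrow> r \<ge> int (length k) \<Longrightarrow>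
      dcomp r (prod_list (map xO k)) = (if r = int (length k) then prod_list (map sO k) else 0)" for k r
  proof (induction k arbitrary: r)
    case Nil then show ?case by (simp add: dcomp_1)
  next
    case (Cons i k)
    have "xO i * T = sO i * T + (xO i - sO i) * T" for T by (simp add: algebra_simps)
    then have "dcomp r (prod_list (map xO (i # k))) = sO i * dcomp (r - 1) (prod_list (map xO k)) + (xO i - sO i) * dcomp r (prod_list (map xO k))"
      using Cons.prems by (simp add: dcomp_left[OF dg_ops(6)] dcomp_left0[OF xO_split])
    then show ?case using Cons.IH[of "r - 1"] Cons.IH[of r] Cons.prems by auto
  qed
  moreover have "length (sorted_list_of_multiset A) = l"
    using assms(1) by (metis (mono_tags, lifting) Fset_def mem_Collect_eq mset_sorted_list_of_multiset size_mset)
  ultimately show ?thesis using assms unfolding xm_def by (auto simp: Fset_def)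
qed

lemma dcomp_expansion:
  assumes "\<And>A. U A \<in> Sg" "r \<ge> int m"
  shows "dcomp r (\<Sum>l\<le>m. \<Sum>A\<in>Fset n l. xm xO A * U A) = (if r = int m then \<Sum>A\<in>Fset n m. xm sO A * U A else 0)"
proof -
  have "(\<Sum>A\<in>Fset n l. dcomp r (xm xO A * U A)) =
      (if l = m then (if r = int m then \<Sum>A\<in>Fset n m. xm sO A * U A else 0) else 0)" if "l \<le> m" for l
  proof -
    have "(\<Sum>A\<in>Fset n l. dcomp r (xm xO A * U A)) = (\<Sum>A\<in>Fset n l. if r = int l then xm sO A * U A else 0)"
      using assms(2) that by (intro sum.cong refl) (simp add: dcomp_right0[OF dg_Sg[OF assms(1)]] dcomp_xm)
    then show ?thesis using assms(2) that by auto
  qed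
  then show ?thesis by simp
qed

lemma Sg_independent:
  assumes "\<And>A. U A \<in> Sg" "(\<Sum>A\<in>Fset n m. xm sO A * U A) = 0" "A \<in> Fset n m"
  shows "U A = 0"
  by (rule pbw_independent[OF finite_Fset _ assms(2,3)]) (use mbO_Sg assms(1) in blast)

text \<open>Start from an expansion of possibly larger degree. Its top component vanishes by the
  degree bound, so its top coefficients vanish by independence, and the excess degrees are removed
  one at a time.\<close>

lemma Hg_expansion:
  assumes "h \<in> Hg" "\<And>r. r > int m \<Longrightarrow> dcomp r h = 0"
  shows "\<exists>U. (\<forall>A. U A \<in> Sg) \<and> h = (\<Sum>l\<le>m. \<Sum>A\<in>Fset n l. xm xO A * U A)"
proof -
  obtain M where "h \<in> sp.Sp M" using sp.HH_Sp[OF assms(1)] by blast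
  then have "h \<in> sp.Sp (m + M)" by (rule sp.Sp_mono) simp
  then obtain U where "\<forall>A. U A \<in> Sg" "h = (\<Sum>l\<le>m + M. \<Sum>A\<in>Fset n l. xm xO A * U A)"
    unfolding sp.Sp_def sp.eqJ_def by auto
  then show ?thesis
  proof (induction M)
    case 0 then show ?case by auto
  next
    case (Suc M)
    have "dcomp (int (Suc (m + M))) h = 0" by (rule assms(2)) simp
    then have "(\<Sum>A\<in>Fset n (Suc (m + M)). xm sO A * U A) = 0"
      using dcomp_expansion[of U "Suc (m + M)" "int (Suc (m + M))"] Suc.prems by simp
    then have "U A = 0" if "A \<in> Fset n (Suc (m + M))" for A using Sg_independent that Suc.prems(1) by blast
    then have "h = (\<Sum>l\<le>m + M. \<Sum>A\<in>Fset n l. xm xO A * U A)" using Suc.prems(2) by simp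
    then show ?case using Suc.IH Suc.prems(1) by blast
  qed
qed

section \<open>The complex of supercommuting elements\<close>

definition dd :: "complex \<Rightarrow> hend \<Rightarrow> hend" where
  "dd \<sigma> h = DO * h - sc \<sigma> * h * DO"

definition sup_comm :: "complex \<Rightarrow> hend \<Rightarrow> bool" where
  "sup_comm \<sigma> h \<longleftrightarrow> (\<forall>u\<in>W. gO u * h = h * gO u) \<and> (\<forall>j\<in>{1..n}. cO j * h = sc \<sigma> * h * cO j)"

text \<open>The scalar \<sigma> is 1 for even and -1 for odd elements, so that one family of lemmas
  treats both parities of the complex on which the two differentials compose to zero.\<close>

definition Ac :: "complex \<Rightarrow> hend set" where
  "Ac \<sigma> = {h \<in> Hg. pc h = sc \<sigma> * h \<and> sup_comm \<sigma> h}"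

lemma dd_diff: "dd \<sigma> (h - h') = dd \<sigma> h - dd \<sigma> h'"
  by (simp add: dd_def algebra_simps)

lemma dd_Hg: "h \<in> Hg \<Longrightarrow> dd \<sigma> h \<in> Hg"
  unfolding dd_def by (intro alg_diff alg_mult Hg_DO alg_sca)

lemma dd_pc: "pc h = sc \<sigma> * h \<Longrightarrow> pc (dd \<sigma> h) = sc (- \<sigma>) * dd \<sigma> h"
  by (simp add: dd_def pc_diff pc_mult pc_DO pc_sc sc_uminus right_diff_distrib mult.assoc sc_left[of DO])

lemma dd_sup_comm: assumes "sup_comm \<sigma> h" shows "sup_comm (- \<sigma>) (dd \<sigma> h)"
  unfolding sup_comm_def
proof (intro conjI ballI)
  fix u assume u: "u \<in> W"
  then have h: "gO u * h = h * gO u" using assms by (simp add: sup_comm_def)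
  have "gO u * (DO * h) = DO * h * gO u" "gO u * (h * DO) = h * DO * gO u"
    using h gO_DO[OF u] by (simp_all add: mult.assoc[symmetric]) (simp_all add: mult.assoc)
  then show "gO u * dd \<sigma> h = dd \<sigma> h * gO u"
    by (simp add: dd_def right_diff_distrib left_diff_distrib mult.assoc sc_ops)
next
  fix j assume j: "j \<in> {1..n}"
  then have h: "cO j * h = sc \<sigma> * (h * cO j)" using assms by (simp add: sup_comm_def mult.assoc)
  have "cO j * (DO * h) = - (DO * (cO j * h))" by (simp add: mult.assoc[symmetric] cO_DO[OF j])
  then have 1: "cO j * (DO * h) = - (sc \<sigma> * (DO * h * cO j))" by (simp add: h sc_left[of DO] mult.assoc)
  have "cO j * (h * DO) = sc \<sigma> * (h * (cO j * DO))" by (simp add: mult.assoc[symmetric] h)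
  then have 2: "cO j * (h * DO) = - (sc \<sigma> * (h * DO * cO j))" by (simp add: cO_DO[OF j] mult.assoc)
  show "cO j * dd \<sigma> h = sc (- \<sigma>) * dd \<sigma> h * cO j"
    by (simp add: dd_def right_diff_distrib left_diff_distrib mult.assoc sc_ops 1 2 sc_uminus)
qed

lemma dd_Ac: "h \<in> Ac \<sigma> \<Longrightarrow> dd \<sigma> h \<in> Ac (- \<sigma>)"
  unfolding Ac_def using dd_Hg dd_pc dd_sup_comm by blast

text \<open>\<open>D\<^sup>2\<close> is the difference of \<open>(\<Sum> x\<^sub>i c\<^sub>i)\<^sup>2\<close>, which is central up to a constant, and of \<open>K\<^sup>2\<close>, which
  commutes with everything that supercommutes with \<open>W\<close> and the \<open>c\<^sub>i\<close>.\<close>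

lemma KO_DO: "DO * KO = - (KO * DO)"
  using DO_Sg[OF Sg_KO] by (simp add: pc_KO)

lemma DKO: "(DO - KO) * (DO - KO) = DO * DO + KO * KO"
  by (simp add: left_diff_distrib right_diff_distrib KO_DO)

lemma cO_KO': "j \<in> {1..n} \<Longrightarrow> cO j * (DO - KO) = - ((DO - KO) * cO j)"
  by (simp add: cO_DO cO_KO algebra_simps)

lemma D0_eq: "DO - KO = (\<Sum>i = 1..n. xO i * cO i)"
  by (simp add: DO_def)

text \<open>The commutator of x_i and x_l is a multiple of c_l c_i, which anticommutes with x_i and
  therefore drops out of the commutator with the square.\<close>

lemma xsq_xO: assumes "i \<in> {1..n}" "l \<in> {1..n}" shows "xO i * xO i * xO l = xO l * (xO i * xO i)"
proof (cases "i = l")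
  case True then show ?thesis by (simp add: mult.assoc)
next
  case False
  define e where "e = sc (- 2 * a\<^sup>2) * (cO l * cO i)"
  have 1: "xO i * xO l = xO l * xO i + e" using xx[OF assms False] by (simp add: e_def algebra_simps)
  have "cO i * xO i = - (xO i * cO i)" "cO l * xO i = xO i * cO l"
    using xO_cO[of i i] xO_cO[of i l] assms False by auto
  then have "cO l * cO i * xO i = - (xO i * (cO l * cO i))"
    by (simp add: mult.assoc) (simp add: mult.assoc[symmetric])
  then have 2: "e * xO i = - (xO i * e)" by (simp add: e_def mult.assoc sc_left[of "xO i"])
  have "xO i * xO i * xO l = xO i * (xO l * xO i + e)" by (simp only: mult.assoc 1)
  also have "\<dots> = (xO i * xO l) * xO i + xO i * e" by (simp only: distrib_left mult.assoc)
  also have "\<dots> = (xO l * xO i + e) * xO i + xO i * e" by (simp only: 1)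
  also have "\<dots> = xO l * (xO i * xO i)" by (simp add: distrib_right 2 mult.assoc)
  finally show ?thesis .
qed

text \<open>The square is doubled and symmetrised in the two summation indices: a diagonal pair
  gives 2 x_i^2 and an off-diagonal pair gives a scalar. Both commute with x_l.\<close>

lemma D0_sq_xO: assumes l: "l \<in> {1..n}" shows "(DO - KO) * (DO - KO) * xO l = xO l * ((DO - KO) * (DO - KO))"
proof -
  let ?N = "- 2 * a\<^sup>2" and ?Q = "(DO - KO) * (DO - KO)"
  let ?T = "\<lambda>i j. xO i * cO i * (xO j * cO j)"
  have T: "?T i j + ?T j i = (if i = j then xO i * xO i + xO i * xO i else sc ?N)" if ij: "i \<in> {1..n}" "j \<in> {1..n}" for i j
  proof (cases "i = j")
    case True
    have "cO i * (xO i * Z) = - (xO i * (cO i * Z))" for Z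
      using xO_cO[of i i] ij by (simp add: mult.assoc[symmetric])
    then show ?thesis using True by (simp add: mult.assoc cO_sq)
  next
    case False
    have "cO i * (xO j * Z) = xO j * (cO i * Z)" "cO j * (xO i * Z) = xO i * (cO j * Z)" for Z
      using xO_cO[of j i] xO_cO[of i j] ij False by (simp_all add: mult.assoc[symmetric])
    then have "?T i j + ?T j i = xO i * xO j * (cO i * cO j) + xO j * xO i * (cO j * cO i)"
      by (simp add: mult.assoc)
    also have "cO j * cO i = - (cO i * cO j)" by (rule cO_anti) (use False in simp)
    also have "xO i * xO j * (cO i * cO j) + xO j * xO i * - (cO i * cO j) = (xO i * xO j - xO j * xO i) * (cO i * cO j)"
      by (simp add: left_diff_distrib)
    also have "\<dots> = sc ?N * (cO j * (cO i * (cO i * cO j)))" by (simp only: xx[OF ij False] mult.assoc)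
    also have "\<dots> = sc ?N" by (simp add: cO_sq' cO_sq)
    finally show ?thesis using False by simp
  qed
  have "?Q = (\<Sum>i = 1..n. \<Sum>j = 1..n. ?T i j)" unfolding D0_eq by (rule sum_product)
  moreover have "(\<Sum>i = 1..n. \<Sum>j = 1..n. ?T i j) = (\<Sum>i = 1..n. \<Sum>j = 1..n. ?T j i)" by (rule sum.swap)
  ultimately have "?Q + ?Q = (\<Sum>i = 1..n. \<Sum>j = 1..n. ?T i j + ?T j i)" by (simp add: sum.distrib)
  also have "\<dots> = (\<Sum>i = 1..n. \<Sum>j = 1..n. if i = j then xO i * xO i + xO i * xO i else sc ?N)"
    by (intro sum.cong refl T)
  finally have Q: "?Q + ?Q = (\<Sum>i = 1..n. \<Sum>j = 1..n. if i = j then xO i * xO i + xO i * xO i else sc ?N)" .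
  have "(?Q + ?Q) * xO l = xO l * (?Q + ?Q)"
    unfolding Q sum_distrib_left sum_distrib_right
    by (intro sum.cong refl) (use xsq_xO[OF _ l] in \<open>auto simp: distrib_left distrib_right sc_commute[of "xO l"]\<close>)
  then have "?Q * xO l + ?Q * xO l = xO l * ?Q + xO l * ?Q" by (simp add: distrib_left distrib_right)
  then show ?thesis by (rule double_cancel)
qed

text \<open>For group elements the square is rewritten as D^2 + K^2, both summands of which are
  known to commute with W. The c_j anticommute with the factor that is squared.\<close>

lemma D0_sq_Hg: "h \<in> Hg \<Longrightarrow> (DO - KO) * (DO - KO) * h = h * ((DO - KO) * (DO - KO))"
proof (induction rule: alg.induct)
  case (alg_sca s) then show ?case by (rule sc_commute)
next
  case (alg_gen y)
  then consider i where "i \<in> {1..n}" "y = xO i" | i where "i \<in> {1..n}" "y = cO i" | u where "u \<in> W" "y = gO u" by blast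
  then show ?case
  proof cases
    case 1 then show ?thesis using D0_sq_xO by simp
  next
    case 2
    show ?thesis unfolding 2(2) by (rule anti_square[OF cO_KO'[OF 2(1)], symmetric])
  next
    case 3
    have "gO u * (DO * DO) = DO * DO * gO u"
      using commute_mult[OF gO_DO[OF 3(1), symmetric] gO_DO[OF 3(1), symmetric]] by simp
    then show ?thesis unfolding DKO 3 using KK[OF 3(1)] by (simp add: distrib_left distrib_right)
  qed
next
  case (alg_add y z) then show ?case by (simp only: distrib_left distrib_right)
next
  case (alg_mult y z) then show ?case using commute_mult by metis
qed

lemma KO_sup_comm: assumes "sup_comm \<sigma> h" shows "KO * h = sc \<sigma> * (h * KO)"
proof -
  have c: "lin n cO v * h = sc \<sigma> * (h * lin n cO v)" for v
    unfolding lin_def sum_distrib_left sum_distrib_right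
    using assms by (intro sum.cong refl) (auto simp: sup_comm_def mult.assoc sc_left[of h] sc_sc mult.commute)
  have "rs n \<alpha> * h = sc \<sigma> * (h * rs n \<alpha>)" if "\<alpha> \<in> P" for \<alpha>
  proof -
    have "gO (refl_in n \<alpha>) * h = h * gO (refl_in n \<alpha>)" using assms refl_W[OF that] by (simp add: sup_comm_def)
    then have g: "gO (refl_in n \<alpha>) * (h * Z) = h * (gO (refl_in n \<alpha>) * Z)" for Z by (simp add: mult.assoc[symmetric])
    show ?thesis by (simp add: rs_def mult.assoc c sc_ops g)
  qed
  then show ?thesis
    unfolding KO_def sum_distrib_left sum_distrib_right
    by (intro sum.cong refl) (auto simp: mult.assoc sc_left[of h] sc_sc mult.commute)
qed

text \<open>On \<open>Ac \<sigma>\<close> the element K satisfies K h = \<sigma> h K, so K^2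
  commutes with h. This is where membership in \<open>Ac\<close> rather than in \<open>Hg\<close>
  enters.\<close>

lemma dd_dd:
  assumes h: "h \<in> Ac \<sigma>" and \<sigma>: "\<sigma> * \<sigma> = 1"
  shows "dd (- \<sigma>) (dd \<sigma> h) = 0"
proof -
  have s: "sup_comm \<sigma> h" and H: "h \<in> Hg" using h by (auto simp: Ac_def)
  have ks: "KO * (h * Z) = sc \<sigma> * (h * (KO * Z))" for Z
    by (simp add: mult.assoc[symmetric] KO_sup_comm[OF s])
  have K: "KO * KO * h = h * (KO * KO)"
    by (simp add: mult.assoc KO_sup_comm[OF s] sc_left[of KO] ks sc_square_1[OF \<sigma>])
  have "DO * DO = (DO - KO) * (DO - KO) - KO * KO" by (simp add: DKO)
  then have D: "DO * DO * h = h * (DO * DO)"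
    by (simp only: left_diff_distrib[of _ "KO * KO"] right_diff_distrib[of _ _ "KO * KO"] K D0_sq_Hg[OF H])
  have "dd (- \<sigma>) (dd \<sigma> h) = DO * DO * h - sc \<sigma> * (DO * h * DO) + sc \<sigma> * (DO * h * DO) - sc \<sigma> * (sc \<sigma> * (h * (DO * DO)))"
    by (simp add: dd_def right_diff_distrib left_diff_distrib mult.assoc sc_left[of DO] sc_uminus)
  then show ?thesis by (simp add: D sc_square_1[OF \<sigma>])
qed

end

section \<open>Existence and uniqueness of \<open>\<zeta>\<close>\<close>

lemma of_nat_sc: "sc (of_nat m) = of_nat m"
  by (induction m) (simp_all add: sc_add)

context hc_full
begin

text \<open>Since the inverse of c_j is -c_j, each step averages h with its \<sigma>-twisted
  conjugate by c_j. The result supercommutes with all c_j of the list.\<close>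

fun Ec :: "complex \<Rightarrow> nat list \<Rightarrow> hend \<Rightarrow> hend" where
  "Ec \<sigma> [] h = h"
| "Ec \<sigma> (j # js) h = sc (1/2) * (Ec \<sigma> js h - sc \<sigma> * (cO j * Ec \<sigma> js h * cO j))"

definition avW :: "hend \<Rightarrow> hend" where
  "avW h = sc (1 / of_nat (card W)) * (\<Sum>w\<in>W. gO w * h * gO (inv_into UNIV w))"

text \<open>The projection onto elements that satisfy \<open>sup_comm \<sigma>\<close>. The Clifford
  average is taken inside and the average over W outside.\<close>

definition Av :: "complex \<Rightarrow> hend \<Rightarrow> hend" where
  "Av \<sigma> h = avW (Ec \<sigma> [1..<Suc n] h)"

lemma inv_W:
  assumes "w \<in> W"
  shows "inv_into UNIV w \<in> W" "w \<circ> inv_into UNIV w = id" "inv_into UNIV w \<circ> w = id"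
proof -
  obtain w' where w': "w' \<in> W" "w \<circ> w' = id" "w' \<circ> w = id" using W_inv[OF assms] by blast
  have "inv_into UNIV w = w'" using w' by (intro inv_unique_comp) auto
  then show "inv_into UNIV w \<in> W" "w \<circ> inv_into UNIV w = id" "inv_into UNIV w \<circ> w = id" using w' by auto
qed

lemma gO_inv:
  assumes "w \<in> W"
  shows "gO w * gO (inv_into UNIV w) = 1" "gO (inv_into UNIV w) * gO w = 1"
  using inv_W[OF assms] assms by (simp_all add: gO_mult[OF W_sp] gO_id)

lemma avW_sum_comm:
  assumes u: "u \<in> W"
  shows "gO u * avW h = avW h * gO u"
proof -
  let ?F = "\<lambda>w. gO w * h * gO (inv_into UNIV w)"
  have 1: "gO u * ?F w = ?F (u \<circ> w) * gO u" if w: "w \<in> W" for w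
  proof -
    have inv: "gO (inv_into UNIV (u \<circ> w)) = gO (inv_into UNIV w) * gO (inv_into UNIV u)"
    proof -
      have "inv_into UNIV (u \<circ> w) = inv_into UNIV w \<circ> inv_into UNIV u"
      proof (rule inv_unique_comp)
        have *: "w (inv_into UNIV w z) = z" "u (inv_into UNIV u z) = z" "inv_into UNIV w (w z) = z" "inv_into UNIV u (u z) = z" for z
          using inv_W[OF w] inv_W[OF u] by (metis comp_apply id_apply)+
        show "u \<circ> w \<circ> (inv_into UNIV w \<circ> inv_into UNIV u) = id" "inv_into UNIV w \<circ> inv_into UNIV u \<circ> (u \<circ> w) = id"
          by (rule ext, simp only: comp_apply id_apply *)+
      qed
      then show ?thesis by (simp only: gO_mult[OF W_sp[OF inv_W(1)[OF w]]])
    qed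
    have "?F (u \<circ> w) * gO u = gO u * gO w * h * gO (inv_into UNIV w) * (gO (inv_into UNIV u) * gO u)"
      by (simp only: inv gO_mult[OF W_sp[OF u], symmetric] mult.assoc)
    then show ?thesis by (simp add: gO_inv[OF u] mult.assoc)
  qed
  obtain u' where u': "u' \<in> W" "u \<circ> u' = id" "u' \<circ> u = id" using W_inv[OF u] by blast
  have "bij_betw (\<lambda>w. u \<circ> w) W W"
    by (rule bij_betwI[where g = "\<lambda>w. u' \<circ> w"]) (use u u' W_comp in \<open>auto simp: o_assoc\<close>)
  then have "(\<Sum>w\<in>W. ?F (u \<circ> w)) = (\<Sum>w\<in>W. ?F w)" by (rule sum.reindex_bij_betw)
  moreover have "gO u * (\<Sum>w\<in>W. ?F w) = (\<Sum>w\<in>W. ?F (u \<circ> w)) * gO u"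
    unfolding sum_distrib_left sum_distrib_right by (intro sum.cong refl 1)
  ultimately show ?thesis by (simp add: avW_def sc_ops mult.assoc)
qed

text \<open>Conjugation by W replaces c_j by another vector in the span of the c's, so the average
  over W does not disturb what the Clifford average has achieved.\<close>

lemma avW_cO:
  assumes h: "\<And>j. j \<in> {1..n} \<Longrightarrow> cO j * h = sc \<sigma> * h * cO j" and j: "j \<in> {1..n}"
  shows "cO j * avW h = sc \<sigma> * avW h * cO j"
proof -
  have c: "lin n cO v * h = sc \<sigma> * (h * lin n cO v)" for v
    unfolding lin_def sum_distrib_left sum_distrib_right
    using h by (intro sum.cong refl) (auto simp: mult.assoc sc_left[of h] sc_sc mult.commute)
  have "cO j * (gO w * h * gO (inv_into UNIV w)) = sc \<sigma> * (gO w * h * gO (inv_into UNIV w)) * cO j" if w: "w \<in> W" for w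
  proof -
    let ?w = "inv_into UNIV w"
    define v where "v = ?w (std j)"
    have wv: "w v = std j" using inv_W(2)[OF w] by (metis comp_apply id_apply v_def)
    have 1: "cO j * gO w = gO w * lin n cO v"
      using gO_lin[OF equivariant_cO W_sp[OF w], of v] by (simp add: wv lin_std[OF j])
    have 2: "gO ?w * cO j = lin n cO v * gO ?w"
      using gO_lin[OF equivariant_cO W_sp[OF inv_W(1)[OF w]], of "std j"] by (simp add: v_def lin_std[OF j])
    have "cO j * (gO w * h * gO ?w) = gO w * (lin n cO v * h) * gO ?w" by (simp only: mult.assoc[symmetric] 1)
    also have "\<dots> = sc \<sigma> * (gO w * h * (lin n cO v * gO ?w))" by (simp only: c mult.assoc sc_ops)
    also have "\<dots> = sc \<sigma> * (gO w * h * gO ?w) * cO j" by (simp only: 2[symmetric] mult.assoc)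
    finally show ?thesis .
  qed
  then have "cO j * (\<Sum>w\<in>W. gO w * h * gO (inv_into UNIV w)) = sc \<sigma> * (\<Sum>w\<in>W. gO w * h * gO (inv_into UNIV w)) * cO j"
    unfolding sum_distrib_left sum_distrib_right by (intro sum.cong refl)
  then show ?thesis by (simp add: avW_def sc_ops sc_sc mult.assoc mult.commute)
qed

lemma Ec_cO:
  assumes \<sigma>: "\<sigma> * \<sigma> = 1"
  shows "set js \<subseteq> {1..n} \<Longrightarrow> j \<in> set js \<Longrightarrow> cO j * Ec \<sigma> js h = sc \<sigma> * Ec \<sigma> js h * cO j"
proof (induction js)
  case (Cons i js)
  define z where "z = Ec \<sigma> js h"
  show ?case
  proof (cases "j = i")
    case True
    have "cO i * (z - sc \<sigma> * (cO i * z * cO i)) = sc \<sigma> * (z - sc \<sigma> * (cO i * z * cO i)) * cO i"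
      by (simp add: right_diff_distrib left_diff_distrib mult.assoc sc_ops cO_sq' cO_sq sc_square_1[OF \<sigma>])
    then show ?thesis using True by (simp add: z_def[symmetric] sc_ops mult.assoc sc_left[of "sc \<sigma>"])
  next
    case False
    then have IH: "cO j * z = sc \<sigma> * (z * cO j)" using Cons by (simp add: z_def mult.assoc)
    have c: "cO j * (cO i * T) = - (cO i * (cO j * T))" for T
      using cO_anti[OF False] by (simp add: mult.assoc[symmetric])
    have IH': "cO j * (z * T) = sc \<sigma> * (z * (cO j * T))" for T by (simp add: mult.assoc[symmetric] IH)
    have "cO j * (z - sc \<sigma> * (cO i * z * cO i)) = sc \<sigma> * (z - sc \<sigma> * (cO i * z * cO i)) * cO j"
      using cO_anti[OF False]
      by (simp add: right_diff_distrib left_diff_distrib mult.assoc sc_ops IH IH' c sc_left[of z])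
    then show ?thesis by (simp add: z_def[symmetric] sc_ops mult.assoc) ((simp add: sc_sc mult.commute)?)
  qed
qed simp

lemma Av_sup_comm: "\<sigma> * \<sigma> = 1 \<Longrightarrow> sup_comm \<sigma> (Av \<sigma> h)"
  unfolding sup_comm_def Av_def by (intro conjI ballI avW_sum_comm avW_cO Ec_cO) auto

lemma Ec_Hg: "set js \<subseteq> {1..n} \<Longrightarrow> h \<in> Hg \<Longrightarrow> Ec \<sigma> js h \<in> Hg"
  by (induction js) (auto intro!: alg_mult[OF alg_sca] alg_diff alg_mult[OF alg_mult] Hg_cO)

lemma Av_Hg: "h \<in> Hg \<Longrightarrow> Av \<sigma> h \<in> Hg"
  unfolding Av_def avW_def
  by (intro alg_mult alg_sca alg_sum Hg_gO inv_W Ec_Hg) auto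

lemma Ec_pc: "pc h = sc \<tau> * h \<Longrightarrow> pc (Ec \<sigma> js h) = sc \<tau> * Ec \<sigma> js h"
proof (induction js)
  case (Cons j js)
  then have *: "pc (Ec \<sigma> js h) = sc \<tau> * Ec \<sigma> js h" by simp
  show ?case
    by (simp add: pc_mult pc_diff pc_sc pc_ops * right_diff_distrib mult.assoc sc_ops) ((simp add: sc_sc mult.commute mult.left_commute)?)
qed simp

lemma Av_pc: "pc h = sc \<tau> * h \<Longrightarrow> pc (Av \<sigma> h) = sc \<tau> * Av \<sigma> h"
  by (simp add: Av_def avW_def pc_mult pc_sc pc_sum pc_ops Ec_pc sc_ops mult.assoc sum_distrib_left[symmetric])
    ((simp add: sc_sc mult.commute)?)

lemma Av_Ac: "\<sigma> * \<sigma> = 1 \<Longrightarrow> h \<in> Hg \<Longrightarrow> pc h = sc \<sigma> * h \<Longrightarrow> Av \<sigma> h \<in> Ac \<sigma>"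
  unfolding Ac_def using Av_Hg Av_pc Av_sup_comm by blast

lemma Ec_dd:
  assumes "set js \<subseteq> {1..n}"
  shows "dd \<sigma> (Ec \<sigma> js h) = Ec (- \<sigma>) js (dd \<sigma> h)"
  using assms
proof (induction js)
  case (Cons j js)
  define z where "z = Ec \<sigma> js h"
  have j: "j \<in> {1..n}" and IH: "dd \<sigma> z = Ec (- \<sigma>) js (dd \<sigma> h)" using Cons by (auto simp: z_def)
  have 1: "DO * (cO j * T) = - (cO j * (DO * T))" for T using cO_DO[OF j] by (simp add: mult.assoc[symmetric])
  have 2: "DO * cO j = - (cO j * DO)" using cO_DO[OF j] by simp
  have "dd \<sigma> (cO j * z * cO j) = - (cO j * dd \<sigma> z * cO j)"
    by (simp add: dd_def right_diff_distrib left_diff_distrib mult.assoc 1 cO_DO[OF j] sc_ops)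
  moreover have "dd \<sigma> (sc s * y) = sc s * dd \<sigma> y" for s y
    by (simp add: dd_def right_diff_distrib mult.assoc sc_left[of DO]) ((simp add: sc_sc mult.commute)?)
  ultimately show ?case by (simp add: z_def[symmetric] dd_diff IH[symmetric] sc_uminus)
qed simp

text \<open>D commutes with W and anticommutes with the c_j. Hence d carries the average with sign
  \<sigma> to the one with sign -\<sigma>.\<close>

lemma Av_dd: "dd \<sigma> (Av \<sigma> h) = Av (- \<sigma>) (dd \<sigma> h)"
proof -
  have 1: "dd \<sigma> (gO w * z * gO (inv_into UNIV w)) = gO w * dd \<sigma> z * gO (inv_into UNIV w)" if w: "w \<in> W" for w z
  proof -
    have "DO * (gO w * T) = gO w * (DO * T)" for T using gO_DO[OF w] by (simp add: mult.assoc[symmetric])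
    moreover have "gO (inv_into UNIV w) * DO = DO * gO (inv_into UNIV w)" using gO_DO[OF inv_W(1)[OF w]] .
    ultimately show ?thesis by (simp add: dd_def right_diff_distrib left_diff_distrib mult.assoc sc_ops)
  qed
  have s: "dd \<sigma> (sc s * y) = sc s * dd \<sigma> y" for s y
    by (simp add: dd_def right_diff_distrib mult.assoc sc_left[of DO]) ((simp add: sc_sc mult.commute)?)
  have sm: "dd \<sigma> (sum F X') = (\<Sum>x\<in>X'. dd \<sigma> (F x))" for F :: "'z \<Rightarrow> hend" and X'
    by (simp add: dd_def sum_distrib_left sum_distrib_right sum_subtractf)
  show ?thesis unfolding Av_def avW_def s sm
    by (subst Ec_dd[symmetric]) (auto simp: 1)
qed

lemma Ec_fix:
  assumes "sup_comm \<sigma> h" and \<sigma>: "\<sigma> * \<sigma> = 1" and "set js \<subseteq> {1..n}"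
  shows "Ec \<sigma> js h = h"
  using assms(3)
proof (induction js)
  case (Cons j js)
  have "cO j * h = sc \<sigma> * (h * cO j)" using assms(1) Cons.prems by (simp add: sup_comm_def mult.assoc)
  then have "h - sc \<sigma> * (cO j * h * cO j) = h + h"
    by (simp add: mult.assoc cO_sq sc_square_1[OF \<sigma>])
  moreover have "Ec \<sigma> js h = h" using Cons by simp
  ultimately show ?case by (simp only: Ec.simps half_half)
qed simp

lemma Av_fix:
  assumes "sup_comm \<sigma> h" and \<sigma>: "\<sigma> * \<sigma> = 1"
  shows "Av \<sigma> h = h"
proof -
  have E: "Ec \<sigma> [1..<Suc n] h = h" by (rule Ec_fix[OF assms]) auto
  have "gO w * h * gO (inv_into UNIV w) = h" if "w \<in> W" for w
    using gO_inv(1)[OF that] assms(1) that by (simp add: sup_comm_def mult.assoc)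
  moreover have "card W \<noteq> 0" using W_fin W_id by auto
  ultimately show ?thesis
    unfolding Av_def E by (simp add: avW_def of_nat_sc[symmetric] sc_sc)
qed

lemma Av_diff: "Av \<sigma> (h - h') = Av \<sigma> h - Av \<sigma> h'"
proof -
  have "Ec \<sigma> js (h - h') = Ec \<sigma> js h - Ec \<sigma> js h'" for js
    by (induction js) (simp_all add: right_diff_distrib left_diff_distrib)
  then show ?thesis
    by (simp add: Av_def avW_def right_diff_distrib left_diff_distrib sum_subtractf)
qed

lemma dcomp_Av: "dcomp r h = 0 \<Longrightarrow> dcomp r (Av \<sigma> h) = 0"
proof -
  assume h: "dcomp r h = 0"
  have "dcomp r (Ec \<sigma> js h) = 0" for js
    by (induction js) (simp_all add: h dcomp_left0 dcomp_right0 dg_sc dg_ops)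
  then show ?thesis
    by (simp add: Av_def avW_def dcomp_left0 dcomp_right0 dg_sc dg_ops)
qed

text \<open>One step of the descent: the leading symbol of \<open>z\<close> is a cycle for the Koszul type differential,
  hence a boundary, and subtracting the corresponding \<open>d\<close>-boundary lowers the degree.\<close>

lemma descend_step:
  assumes z: "z \<in> Ac \<sigma>" and \<sigma>: "\<sigma> * \<sigma> = 1" and deg: "\<And>r. r > int (Suc m) \<Longrightarrow> dcomp r z = 0"
    and dz: "dd \<sigma> z \<in> Sg"
  shows "\<exists>g\<in>Ac (- \<sigma>). \<forall>r > int m. dcomp r (z - dd (- \<sigma>) g) = 0"
proof -
  have zH: "z \<in> Hg" and zp: "pc z = sc \<sigma> * z" and zs: "sup_comm \<sigma> z" using z by (auto simp: Ac_def)
  obtain U0 where U0: "\<And>A. U0 A \<in> Sg" "z = (\<Sum>l\<le>Suc m. \<Sum>A\<in>Fset n l. xm xO A * U0 A)"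
    using Hg_expansion[OF zH deg] by blast
  \<comment> \<open>The coefficients are projected to parity \<sigma>. As z has this parity and the
    monomials are even, the leading symbol is unchanged, and D1 now passes each coefficient with the
    sign \<sigma>.\<close>
  define U where "U A = sc (1/2) * (U0 A + sc \<sigma> * pc (U0 A))" for A
  have USg: "U A \<in> Sg" for A unfolding U_def by (intro alg_mult alg_sca alg_add pc_Sg U0)
  have Up: "pc (U A) = sc \<sigma> * U A" for A
    by (simp add: U_def pc_mult pc_add pc_sc pc_pc distrib_left sc_left[of "sc \<sigma>" "1/2"] sc_square_1[OF \<sigma>] add.commute)
  have zM: "dcomp (int (Suc m)) z = (\<Sum>A\<in>Fset n (Suc m). xm sO A * U A)"
  proof -
    let ?s = "\<Sum>A\<in>Fset n (Suc m). xm sO A * U0 A"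
    have z0: "dcomp (int (Suc m)) z = ?s" using dcomp_expansion[OF U0(1), of "Suc m" "int (Suc m)"] by (simp add: U0(2))
    have "pc (xm sO A) = xm sO A" for A
    proof -
      have "pc (prod_list (map sO l)) = prod_list (map sO l)" for l
        by (induction l) (simp_all add: pc_mult pc_ops, simp add: pc_def piO_commute)
      then show ?thesis by (simp add: xm_def)
    qed
    then have e1: "pc ?s = (\<Sum>A\<in>Fset n (Suc m). xm sO A * pc (U0 A))" by (simp add: pc_sum pc_mult)
    have e2: "pc (dcomp (int (Suc m)) z) = sc \<sigma> * dcomp (int (Suc m)) z"
      using zp by (simp add: pc_def dcomp_left0[OF dg_ops(5), symmetric] dcomp_right0[OF dg_ops(5), symmetric]
          dcomp_left0[OF dg_sc])
    have "sc \<sigma> * (\<Sum>A\<in>Fset n (Suc m). xm sO A * pc (U0 A)) = ?s"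
      by (simp only: e1[symmetric] e2[unfolded z0] sc_square_1[OF \<sigma>])
    moreover have "(\<Sum>A\<in>Fset n (Suc m). xm sO A * U A) = sc (1/2) * (?s + sc \<sigma> * (\<Sum>A\<in>Fset n (Suc m). xm sO A * pc (U0 A)))"
      by (simp add: U_def distrib_left sum.distrib sum_distrib_left sc_left[of "xm sO _"])
    ultimately show ?thesis unfolding z0 using half_half[of ?s] by simp
  qed
  have D1U: "D1 n * V = sc \<tau> * V * D1 n" if "V \<in> Sg" "pc V = sc \<tau> * V" for V \<tau>
    using D1_Sg[OF that(1)] that(2) by simp
  have TU: "Tmap n U B = 0" if B: "B \<in> Fset n (Suc (Suc m))" for B
  proof -
    have "dcomp (int (Suc (Suc m))) (dd \<sigma> z) = 0"
      using dcomp_dg[OF dg_Sg[OF dz]] by simp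
    moreover have "dcomp (int (Suc (Suc m))) (dd \<sigma> z) =
        D1 n * dcomp (int (Suc m)) z - sc \<sigma> * dcomp (int (Suc m)) z * D1 n"
      using deg[of "int (Suc (Suc m))"]
      by (simp add: dd_def dcomp_DO mult.assoc dcomp_left0[OF dg_sc])
    ultimately have "sc (- 2) * (\<Sum>B\<in>Fset n (Suc (Suc m)). xm sO B * Tmap n U B) = 0"
      unfolding zM using symbol_d[of n "Suc m" U \<sigma>] D1U[OF USg Up] by simp
    then have "sc (- 1/2) * (sc (- 2) * (\<Sum>B\<in>Fset n (Suc (Suc m)). xm sO B * Tmap n U B)) = 0" by simp
    then have "(\<Sum>B\<in>Fset n (Suc (Suc m)). xm sO B * Tmap n U B) = 0" unfolding sc_sc by simp
    moreover have "Tmap n U B \<in> Sg" for B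
      unfolding Tmap_def by (intro alg_sum) (auto intro!: alg_mult[OF Sg_cO] alg_0 USg)
    ultimately show ?thesis using Sg_independent B by blast
  qed
  \<comment> \<open>Division by the number of variables turns the homotopy identity into an inverse
    of the differential on cycles. Only nonempty multisets matter below, so the divisor is nonzero
    there.\<close>
  define X' where "X' A = sc (1 / of_nat (card (set_mset A))) * U A" for A
  \<comment> \<open>The factor 1/2 compensates the -2 of \<open>symbol_d\<close>: the homotopy gives
    T Q X' = -U, hence -2 T V = U.\<close>
  define V where "V A = sc (1/2) * Qmap n X' A" for A
  have X'Sg: "X' A \<in> Sg" and X'p: "pc (X' A) = sc \<sigma> * X' A" for A
    unfolding X'_def by (intro alg_mult alg_sca USg) (simp add: pc_mult pc_sc Up sc_left[of "sc \<sigma>" "1 / of_nat (card (set_mset A))"])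
  have VSg: "V A \<in> Sg" for A
    unfolding V_def Qmap_def by (intro alg_mult alg_sca alg_sum) (auto intro!: alg_mult[OF Sg_cO] alg_0 X'Sg)
  have Vp: "pc (V A) = sc (- \<sigma>) * V A" for A
  proof -
    have "pc (Qmap n X' A) = sc (- \<sigma>) * Qmap n X' A"
      unfolding Qmap_def pc_sum sum_distrib_left
      by (intro sum.cong refl) (auto simp: pc_mult pc_ops X'p pc_0 sc_ops sc_uminus)
    then show ?thesis by (simp add: V_def pc_mult pc_sc sc_left[of "sc (- \<sigma>)" "1/2"])
  qed
  define g0 where "g0 = (\<Sum>l\<le>m. \<Sum>A\<in>Fset n l. xm xO A * (if size A = m then V A else 0))"
  have g0_eq: "g0 = (\<Sum>A\<in>Fset n m. xm xO A * V A)"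
  proof -
    have "g0 = (\<Sum>l\<le>m. if l = m then (\<Sum>A\<in>Fset n m. xm xO A * V A) else 0)"
      unfolding g0_def by (intro sum.cong refl) (auto simp: Fset_def)
    then show ?thesis by simp
  qed
  have g0d: "dcomp r g0 = (if r = int m then (\<Sum>A\<in>Fset n m. xm sO A * V A) else 0)" if "r \<ge> int m" for r
  proof -
    have "(if size A = m then V A else 0) \<in> Sg" for A using VSg alg_0 by auto
    then have "dcomp r g0 = (if r = int m then (\<Sum>A\<in>Fset n m. xm sO A * (if size A = m then V A else 0)) else 0)"
      unfolding g0_def using that by (rule dcomp_expansion)
    then show ?thesis by (simp add: Fset_def)
  qed
  have pcx: "pc (xm xO A) = xm xO A" if "A \<in> Fset n l" for A l
  proof -
    have "set k \<subseteq> {1..n} \<Longrightarrow> pc (prod_list (map xO k)) = prod_list (map xO k)" for k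
      by (induction k) (simp_all add: pc_mult pc_xO, simp add: pc_def piO_commute)
    then show ?thesis using that by (simp add: xm_def Fset_def)
  qed
  have g0p: "pc g0 = sc (- \<sigma>) * g0"
    unfolding g0_eq pc_sum sum_distrib_left
    by (intro sum.cong refl) (simp add: pc_mult pcx Vp sc_left[of "xm xO _"])
  have g0H: "g0 \<in> Hg"
  proof -
    have "set k \<subseteq> {1..n} \<Longrightarrow> prod_list (map xO k) \<in> Hg" for k
      by (induction k) (auto intro!: alg_mult[OF Hg_xO] alg_1)
    then have "xm xO A \<in> Hg" if "A \<in> Fset n m" for A using that by (simp add: xm_def Fset_def)
    then show ?thesis unfolding g0_eq by (intro alg_sum alg_mult Sg_Hg[OF VSg])
  qed
  have sg: "(- \<sigma>) * (- \<sigma>) = 1" using \<sigma> by simp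
  have TV: "sc (- 2) * Tmap n V B = U B" if B: "B \<in> Fset n (Suc m)" for B
  proof -
    have Bs: "set_mset B \<subseteq> {1..n}" "size B = Suc m" using B by (auto simp: Fset_def)
    then have card: "card (set_mset B) \<noteq> 0" by auto
    have "Tmap n V B = sc (1/2) * Tmap n (Qmap n X') B"
      unfolding Tmap_def V_def sum_distrib_left by (intro sum.cong refl) (simp add: sc_ops)
    then have "sc (- 2) * Tmap n V B = - Tmap n (Qmap n X') B" by (simp add: sc_sc sc_uminus)
    moreover have "Qmap n (Tmap n X') B = 0"
      unfolding Qmap_def
    proof (intro sum.neutral ballI)
      fix i assume i: "i \<in> {1..n}"
      have "add_mset i B \<in> Fset n (Suc (Suc m))" using i Bs by (auto simp: Fset_def)
      then have "Tmap n X' (add_mset i B) = 0" unfolding X'_def Tmap_scale by (simp add: TU)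
      then show "(if odd (count B i) then cO i * Tmap n X' (add_mset i B) else 0) = 0" by simp
    qed
    ultimately have "sc (- 2) * Tmap n V B = of_nat (card (set_mset B)) * X' B"
      using TQ_QT[OF Bs(1), of X'] by simp
    also have "\<dots> = U B" unfolding X'_def using card by (simp add: of_nat_sc[symmetric] sc_sc)
    finally show ?thesis .
  qed
  have dg0: "dcomp r (z - dd (- \<sigma>) g0) = 0" if r: "r > int m" for r
  proof (cases "r = int (Suc m)")
    case True
    have "dcomp r (dd (- \<sigma>) g0) = D1 n * dcomp (int m) g0 - sc (- \<sigma>) * dcomp (int m) g0 * D1 n"
      using g0d[of r] True by (simp add: dd_def dcomp_DO mult.assoc dcomp_left0[OF dg_sc])
    also have "\<dots> = sc (- 2) * (\<Sum>B\<in>Fset n (Suc m). xm sO B * Tmap n V B)"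
      using symbol_d[of n m V "- \<sigma>"] D1U[OF VSg Vp] g0d[of "int m"] by simp
    also have "\<dots> = (\<Sum>B\<in>Fset n (Suc m). xm sO B * U B)"
      unfolding sum_distrib_left by (intro sum.cong refl) (simp add: TV[symmetric] sc_left[of "xm sO _"])
    finally show ?thesis using zM True by simp
  next
    case False
    then have "r > int (Suc m)" using r by simp
    then show ?thesis using deg[of r] g0d[of r] g0d[of "r - 1"]
      by (simp add: dd_def dcomp_DO mult.assoc dcomp_left0[OF dg_sc])
  qed
  \<comment> \<open>Averaging fixes z, does not raise the degree and commutes with d up to the
    change of sign, so g0 may be replaced by its average, which lies in \<open>Ac\<close>.\<close>
  have "z - dd (- \<sigma>) (Av (- \<sigma>) g0) = Av \<sigma> (z - dd (- \<sigma>) g0)"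
    by (simp add: Av_dd Av_diff Av_fix[OF zs \<sigma>])
  then have "dcomp r (z - dd (- \<sigma>) (Av (- \<sigma>) g0)) = 0" if "r > int m" for r
    using dcomp_Av[OF dg0[OF that]] by simp
  then show ?thesis using Av_Ac[OF sg g0H g0p] by blast
qed

lemma Ac_add: "g \<in> Ac \<sigma> \<Longrightarrow> h \<in> Ac \<sigma> \<Longrightarrow> g + h \<in> Ac \<sigma>"
  by (simp add: Ac_def alg_add pc_add distrib_left distrib_right sup_comm_def mult.assoc)

lemma Ac_diff: "g \<in> Ac \<sigma> \<Longrightarrow> h \<in> Ac \<sigma> \<Longrightarrow> g - h \<in> Ac \<sigma>"
  by (simp add: Ac_def alg_diff pc_diff right_diff_distrib left_diff_distrib sup_comm_def mult.assoc)

lemma Ac_0: "0 \<in> Ac \<sigma>"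
  by (simp add: Ac_def alg_0 pc_0 sup_comm_def)

text \<open>Subtracting a boundary does not change d z because d^2 = 0 on \<open>Ac\<close>; so the
  hypothesis on d z survives each step. An element without components of positive degree lies in
  \<open>Sg\<close>.\<close>

lemma descend:
  assumes "z \<in> Ac \<sigma>" "\<sigma> * \<sigma> = 1" "\<And>r. r > int m \<Longrightarrow> dcomp r z = 0" "dd \<sigma> z \<in> Sg"
  shows "\<exists>g\<in>Ac (- \<sigma>). z - dd (- \<sigma>) g \<in> Sg"
  using assms
proof (induction m arbitrary: z)
  case 0
  have "z \<in> Hg" using 0 by (simp add: Ac_def)
  then obtain U where U: "\<And>A. U A \<in> Sg" "z = (\<Sum>l\<le>0. \<Sum>A\<in>Fset n l. xm xO A * U A)"
    using Hg_expansion[of z 0] 0(3) by auto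
  have "Fset n 0 = {{#}}" by (auto simp: Fset_def)
  then have "z = U {#}" using U(2) by (simp add: xm_def)
  then have "z - dd (- \<sigma>) 0 \<in> Sg" using U(1) by (simp add: dd_def)
  then show ?case using Ac_0 by blast
next
  case (Suc m)
  obtain g where g: "g \<in> Ac (- \<sigma>)" "\<And>r. r > int m \<Longrightarrow> dcomp r (z - dd (- \<sigma>) g) = 0"
    using descend_step[OF Suc.prems(1,2) _ Suc.prems(4)] Suc.prems(3) by blast
  have sg: "(- \<sigma>) * (- \<sigma>) = 1" using Suc.prems(2) by simp
  have z1: "z - dd (- \<sigma>) g \<in> Ac \<sigma>" using Ac_diff[OF Suc.prems(1) dd_Ac[OF g(1), simplified]] .
  have "dd \<sigma> (z - dd (- \<sigma>) g) = dd \<sigma> z" using dd_dd[OF g(1) sg] by (simp add: dd_diff)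
  then obtain g2 where g2: "g2 \<in> Ac (- \<sigma>)" "z - dd (- \<sigma>) g - dd (- \<sigma>) g2 \<in> Sg"
    using Suc.IH[OF z1 Suc.prems(2) g(2)] Suc.prems(4) by auto
  have "dd (- \<sigma>) (g + g2) = dd (- \<sigma>) g + dd (- \<sigma>) g2" by (simp add: dd_def algebra_simps)
  then have "z - dd (- \<sigma>) (g + g2) \<in> Sg" using g2(2) by (simp add: diff_diff_eq)
  then show ?case using Ac_add[OF g(1) g2(1)] by blast
qed

lemma Hg_bounded: assumes "h \<in> Hg" shows "\<exists>m. \<forall>r > int m. dcomp r h = 0"
proof -
  obtain M where "h \<in> sp.Sp M" using sp.HH_Sp[OF assms] by blast
  then obtain U where "\<And>A. U A \<in> Sg" "h = (\<Sum>l\<le>M. \<Sum>A\<in>Fset n l. xm xO A * U A)"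
    unfolding sp.Sp_def sp.eqJ_def by auto
  then have "dcomp r h = 0" if "r > int M" for r using dcomp_expansion[of U M r] that by simp
  then show ?thesis by blast
qed

text \<open>A central even z lies in \<open>Ac 1\<close> and is annihilated by d, so the descent
  applies to it. What remains is in \<open>Sg\<close> and commutes with the generators of
  \<open>Sg\<close>.\<close>

lemma zeta_exists:
  assumes z: "z \<in> Hg" "pc z = z" and cent: "\<And>h. h \<in> Hg \<Longrightarrow> z * h = h * z"
  shows "\<exists>y\<in>Sg. pc y = y \<and> (\<forall>u\<in>Sg. y * u = u * y) \<and>
    (\<exists>h\<in>Hg. pc h = - h \<and> z - y = DO * h + h * DO)"
proof -
  have zA: "z \<in> Ac 1" using z cent Hg_gO Hg_cO by (simp add: Ac_def sup_comm_def)
  have "dd 1 z = 0" using cent[OF Hg_DO] by (simp add: dd_def)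
  then have "dd 1 z \<in> Sg" by (simp add: alg_0)
  then obtain g where g: "g \<in> Ac (- 1)" "z - dd (- 1) g \<in> Sg"
    using descend[OF zA] Hg_bounded[OF z(1)] by auto
  define y where "y = z - dd (- 1) g"
  have yA: "y \<in> Ac 1" unfolding y_def using Ac_diff[OF zA] dd_Ac[OF g(1)] by simp
  have "y * u = u * y" if "u \<in> Sg" for u
    using that
  proof induction
    case (alg_sca s) then show ?case by (rule sc_commute)
  next
    case (alg_gen v) then show ?case using yA by (auto simp: Ac_def sup_comm_def)
  next
    case (alg_add u v) then show ?case by (simp add: distrib_left distrib_right)
  next
    case (alg_mult u v) then show ?case using commute_mult[of u y v] by simp
  qed
  moreover have "pc y = y" using yA by (simp add: Ac_def)
  moreover have "g \<in> Hg" "pc g = - g" using g(1) by (simp_all add: Ac_def sc_uminus)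
  moreover have "z - y = DO * g + g * DO" by (simp add: y_def dd_def sc_uminus)
  ultimately show ?thesis using g(2) y_def by blast
qed

text \<open>Parity removes the part coming from h0. The averaged h1 satisfies d h = y in
  \<open>Sg\<close>, so the descent writes h = v + d g with v odd in \<open>Sg\<close>; then d v = 0
  because D anticommutes with odd elements of \<open>Sg\<close>, and d d g = 0, whence y =
  0.\<close>

lemma zeta_unique:
  assumes y: "y \<in> Sg" "pc y = y" "\<And>u. u \<in> Sg \<Longrightarrow> y * u = u * y"
    and h: "h0 \<in> Hg" "pc h0 = h0" "h1 \<in> Hg" "pc h1 = - h1"
    and eq: "y = (DO * h0 - h0 * DO) + (DO * h1 + h1 * DO)"
  shows "y = 0"
proof -
  have "pc y = - (DO * h0 - h0 * DO) + (DO * h1 + h1 * DO)"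
    unfolding eq by (simp add: pc_add pc_diff pc_mult pc_DO h)
  then have "- (DO * h0 - h0 * DO) + (DO * h1 + h1 * DO) = (DO * h0 - h0 * DO) + (DO * h1 + h1 * DO)"
    using eq y(2) by (simp only:)
  then have "- (DO * h0 - h0 * DO) = DO * h0 - h0 * DO" by (rule add_right_imp_eq)
  then have "(DO * h0 - h0 * DO) + (DO * h0 - h0 * DO) = 0 + 0" by (metis add.left_neutral add.left_inverse)
  then have "DO * h0 - h0 * DO = 0" by (rule double_cancel)
  then have y1: "y = dd (- 1) h1" using eq by (simp add: dd_def sc_uminus)
  have h1p: "pc h1 = sc (- 1) * h1" using h by (simp add: sc_uminus)
  \<comment> \<open>The average of h1 is still a primitive of y, since y supercommutes with W and
    the c_j and is therefore fixed by averaging.\<close>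
  define h where "h = Av (- 1) h1"
  have hA: "h \<in> Ac (- 1)" unfolding h_def by (rule Av_Ac[OF _ h(3) h1p]) simp
  have "sup_comm 1 y" using y(3) Sg_gO Sg_cO by (simp add: sup_comm_def)
  then have dh: "dd (- 1) h = y" unfolding h_def Av_dd y1[symmetric] using Av_fix by simp
  have "h \<in> Hg" using hA by (simp add: Ac_def)
  then obtain m where "\<And>r. r > int m \<Longrightarrow> dcomp r h = 0" using Hg_bounded by blast
  moreover have "dd (- 1) h \<in> Sg" unfolding dh by (rule y(1))
  ultimately have "\<exists>g\<in>Ac (- (- 1)). h - dd (- (- 1)) g \<in> Sg" using descend[OF hA, of m] by simp
  then obtain g where g: "g \<in> Ac 1" "h - dd 1 g \<in> Sg" by auto
  have "h - dd 1 g \<in> Ac (- 1)" using Ac_diff[OF hA dd_Ac[OF g(1)]] .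
  then have "pc (h - dd 1 g) = - (h - dd 1 g)" by (simp add: Ac_def sc_uminus)
  then have "dd (- 1) (h - dd 1 g) = 0" using DO_Sg[OF g(2)] by (simp add: dd_def sc_uminus)
  moreover have "dd (- 1) (dd 1 g) = 0" using dd_dd[OF g(1)] by simp
  ultimately show ?thesis using dh by (simp add: dd_diff)
qed

end

section \<open>Roots and Weyl groups\<close>

lemma ip_std_right: assumes "i \<in> {1..n}" shows "ip n v (std i) = v i"
proof -
  have "ip n v (std i) = (\<Sum>l = 1..n. if l = i then v i else 0)"
    unfolding ip_def by (intro sum.cong) (auto simp: std_def)
  then show ?thesis using assms by simp
qed

lemma refl_diff:
  assumes "i \<in> {1..n}" "j \<in> {1..n}" "i \<noteq> j"
  shows "refl_in n (std i - std j) = (\<lambda>v l. v (Transposition.transpose i j l))"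
proof -
  have "ip n v (std i - std j) = v i - v j" for v using assms by (simp add: ip_diff_right ip_std_right)
  then show ?thesis
    unfolding refl_in_def using assms(3) by (auto simp: fun_eq_iff std_def Transposition.transpose_def diff_divide_distrib add_divide_distrib)
qed

lemma refl_diff_std:
  assumes "i \<in> {1..n}" "j \<in> {1..n}" "i \<noteq> j"
  shows "refl_in n (std i - std j) (std k) = std (Transposition.transpose i j k)"
  unfolding refl_diff[OF assms] by (auto simp: std_def fun_eq_iff Transposition.transpose_def)

lemma refl_add:
  assumes "i \<in> {1..n}" "j \<in> {1..n}" "i \<noteq> j"
  shows "refl_in n (std i + std j) = (\<lambda>v l. (if l = i \<or> l = j then - 1 else 1) * v (Transposition.transpose i j l))"
proof -
  have "ip n v (std i + std j) = v i + v j" for v using assms by (simp add: ip_add_right ip_std_right)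
  then show ?thesis
    unfolding refl_in_def using assms(3) by (auto simp: fun_eq_iff std_def Transposition.transpose_def diff_divide_distrib add_divide_distrib)
qed

lemma refl_std:
  assumes "i \<in> {1..n}"
  shows "refl_in n (std i) = (\<lambda>v l. (if l = i then - 1 else 1) * v l)"
  unfolding refl_in_def ip_std_right[OF assms] by (auto simp: fun_eq_iff std_def)

lemma pos_rootsB_cases:
  assumes "\<alpha> \<in> pos_rootsB n"
  obtains i j where "1 \<le> i" "i < j" "j \<le> n" "\<alpha> = std i - std j"
    | i j where "1 \<le> i" "i < j" "j \<le> n" "\<alpha> = std i + std j"
    | i where "1 \<le> i" "i \<le> n" "\<alpha> = std i"
  using assms unfolding pos_rootsB_def pos_rootsD_def pos_rootsA_def by blast

lemma signed_perm_refl: assumes "\<alpha> \<in> pos_rootsB n" shows "signed_perm {1..n} (refl_in n \<alpha>)"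
  using assms
proof (cases rule: pos_rootsB_cases)
  case (1 i j)
  then have "Transposition.transpose i j permutes {1..n}" by (intro permutes_swap_id) auto
  then show ?thesis using 1 unfolding signed_perm_def
    by (intro exI[of _ "Transposition.transpose i j"] exI[of _ "\<lambda>_. 1"]) (auto simp: refl_diff)
next
  case (2 i j)
  then have "Transposition.transpose i j permutes {1..n}" by (intro permutes_swap_id) auto
  then show ?thesis using 2 unfolding signed_perm_def
    by (intro exI[of _ "Transposition.transpose i j"] exI[of _ "\<lambda>l. if l = i \<or> l = j then - 1 else 1"]) (auto simp: refl_add)
next
  case (3 i)
  then show ?thesis unfolding signed_perm_def
    by (intro exI[of _ id] exI[of _ "\<lambda>l. if l = i then - 1 else 1"]) (auto simp: refl_std permutes_id)
qed

lemma finite_signed_perm: "finite {u. signed_perm {1..n} u}"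
proof (rule finite_subset)
  let ?F = "\<lambda>(\<pi>, E) (v :: vec) i. (if i \<in> E then - 1 else 1 :: real) * v (\<pi> i)"
  show "finite (?F ` ({\<pi>. \<pi> permutes {1..n}} \<times> Pow {1..n}))" by (simp add: finite_permutations)
  show "{u. signed_perm {1..n} u} \<subseteq> ?F ` ({\<pi>. \<pi> permutes {1..n}} \<times> Pow {1..n})"
  proof
    fix u assume "u \<in> {u. signed_perm {1..n} u}"
    then obtain \<pi> \<sigma> where w: "\<pi> permutes {1..n}" "\<forall>i. \<sigma> i = 1 \<or> \<sigma> i = - 1" "\<forall>i. i \<notin> {1..n} \<longrightarrow> \<sigma> i = (1::real)"
      "u = (\<lambda>v i. \<sigma> i * v (\<pi> i))" unfolding signed_perm_def by blast
    have s: "\<sigma> i = (if i \<in> {i. \<sigma> i = - 1} then - 1 else 1)" for i using w(2)[rule_format, of i] by auto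
    have "\<sigma> = (\<lambda>i. if i \<in> {i. \<sigma> i = - 1} then - 1 else 1)" by (rule ext) (rule s)
    then have "u = ?F (\<pi>, {i. \<sigma> i = - 1})" unfolding w(4) by (auto simp: fun_eq_iff)
    moreover have "{i. \<sigma> i = - 1} \<subseteq> {1..n}" using w(3) by force
    ultimately show "u \<in> ?F ` ({\<pi>. \<pi> permutes {1..n}} \<times> Pow {1..n})" using w(1) by (intro image_eqI[of _ _ "(\<pi>, {i. \<sigma> i = - 1})"]) auto
  qed
qed

lemma weyl_comp: "u \<in> weyl n R \<Longrightarrow> v \<in> weyl n R \<Longrightarrow> u \<circ> v \<in> weyl n R"
  by (induction rule: weyl.induct) (simp_all add: comp_assoc weyl_refl)

lemma weyl_mono: "u \<in> weyl n R \<Longrightarrow> R \<subseteq> R' \<Longrightarrow> u \<in> weyl n R'"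
  by (induction rule: weyl.induct) (auto intro: weyl.intros)

lemma refl_weyl: "\<alpha> \<in> R \<Longrightarrow> refl_in n \<alpha> \<in> weyl n R"
  using weyl_refl[OF _ weyl_id] by force

text \<open>A root and its negative define the same reflection, so positive roots suffice as
  generators.\<close>

lemma weyl_pos: assumes "u \<in> weyl n (P \<union> uminus ` P)" shows "u \<in> weyl n P"
  using assms
proof induction
  case (weyl_refl \<alpha> w)
  then obtain \<beta> where "\<beta> \<in> P" "refl_in n \<alpha> = refl_in n \<beta>" by (auto simp: refl_in_uminus)
  then show ?case using weyl_refl weyl.weyl_refl by metis
qed (rule weyl_id)

lemma weyl_signed_perm: assumes "u \<in> weyl n P" "P \<subseteq> pos_rootsB n" shows "signed_perm {1..n} u"
  using assms(1)
proof induction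
  case weyl_id show ?case by (rule signed_perm_id)
next
  case (weyl_refl \<alpha> w)
  then show ?case using assms(2) signed_perm_refl by (intro signed_perm_comp) auto
qed

lemma weyl_inv:
  assumes "u \<in> weyl n P" "\<And>\<alpha>. \<alpha> \<in> P \<Longrightarrow> ip n \<alpha> \<alpha> \<noteq> 0"
  shows "\<exists>u'\<in>weyl n P. u \<circ> u' = id \<and> u' \<circ> u = id"
  using assms(1)
proof induction
  case weyl_id
  show ?case using weyl.weyl_id[of n P] by (intro bexI[of _ id]) auto
next
  case (weyl_refl \<alpha> w)
  then obtain w' where w': "w' \<in> weyl n P" "w \<circ> w' = id" "w' \<circ> w = id" by blast
  have ss: "refl_in n \<alpha> \<circ> refl_in n \<alpha> = id" using assms(2) weyl_refl by (intro refl_in_refl_in) auto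
  have "refl_in n \<alpha> \<circ> w \<circ> (w' \<circ> refl_in n \<alpha>) = refl_in n \<alpha> \<circ> (w \<circ> w') \<circ> refl_in n \<alpha>" by (simp only: comp_assoc)
  moreover have "w' \<circ> refl_in n \<alpha> \<circ> (refl_in n \<alpha> \<circ> w) = w' \<circ> (refl_in n \<alpha> \<circ> refl_in n \<alpha>) \<circ> w" by (simp only: comp_assoc)
  ultimately show ?case
    using w' ss weyl_refl by (intro bexI[of _ "w' \<circ> refl_in n \<alpha>"] conjI weyl_comp refl_weyl) (simp_all only: comp_id)
qed

lemma pos_rootsB_not_vneg: "\<alpha> \<in> pos_rootsB n \<Longrightarrow> \<not> vneg \<alpha>"
  by (erule pos_rootsB_cases) (auto simp: vneg_def std_def split: if_splits)

lemma pos_rootsB_nz: assumes "\<alpha> \<in> pos_rootsB n" shows "\<alpha> \<noteq> 0"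
proof -
  have "\<exists>l. \<alpha> l \<noteq> 0"
    using assms by (cases rule: pos_rootsB_cases) (auto simp: std_def split: if_splits intro: exI)
  then show ?thesis by auto
qed

lemma finite_pos_rootsB: "finite (pos_rootsB n)"
proof -
  have "pos_rootsB n \<subseteq> (\<lambda>(i, j). std i - std j) ` ({1..n} \<times> {1..n}) \<union> (\<lambda>(i, j). std i + std j) ` ({1..n} \<times> {1..n}) \<union> std ` {1..n}"
  proof
    fix \<alpha> assume "\<alpha> \<in> pos_rootsB n"
    then show "\<alpha> \<in> (\<lambda>(i, j). std i - std j) ` ({1..n} \<times> {1..n}) \<union> (\<lambda>(i, j). std i + std j) ` ({1..n} \<times> {1..n}) \<union> std ` {1..n}"
      by (cases rule: pos_rootsB_cases) force+
  qed
  then show ?thesis by (rule finite_subset) auto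
qed

lemma signed_perm_std_ex:
  assumes "signed_perm {1..n} u"
  obtains t f where "\<And>i. t i = 1 \<or> t i = - 1" "\<And>i. i \<in> {1..n} \<Longrightarrow> f i \<in> {1..n}" "inj f" "\<And>i. u (std i) = (\<lambda>l. t i * std (f i) l)"
proof -
  obtain \<pi> \<sigma> where w: "\<pi> permutes {1..n}" "\<forall>i. \<sigma> i = 1 \<or> \<sigma> i = - 1" "u = (\<lambda>v i. \<sigma> i * v (\<pi> i))"
    using assms unfolding signed_perm_def by blast
  show ?thesis
  proof (rule that[of "\<lambda>i. \<sigma> (inv_into UNIV \<pi> i)" "inv_into UNIV \<pi>"])
    show "\<sigma> (inv_into UNIV \<pi> i) = 1 \<or> \<sigma> (inv_into UNIV \<pi> i) = - 1" for i using w(2) by blast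
    show "inv_into UNIV \<pi> i \<in> {1..n}" if "i \<in> {1..n}" for i
      using that permutes_in_image[OF permutes_inv[OF w(1)]] by blast
    show "inj (inv_into UNIV \<pi>)" by (rule permutes_inj[OF permutes_inv[OF w(1)]])
    show "u (std i) = (\<lambda>l. \<sigma> (inv_into UNIV \<pi> i) * std (inv_into UNIV \<pi> i) l)" for i
      by (rule signed_perm_std[OF w(1,3)])
  qed
qed

lemma signed_pair_rootsD:
  assumes "i \<in> {1..n}" "j \<in> {1..n}" "i \<noteq> j" "s = 1 \<or> s = - 1" "t = 1 \<or> t = - 1"
  shows "(\<lambda>l. s * std i l) + (\<lambda>l. t * std j l) \<in> pos_rootsD n \<or> - ((\<lambda>l. s * std i l) + (\<lambda>l. t * std j l)) \<in> pos_rootsD n"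
proof -
  define p q where "p = min i j" and "q = max i j"
  have pq: "1 \<le> p" "p < q" "q \<le> n" using assms by (auto simp: p_def q_def)
  have mem: "std p + std q \<in> pos_rootsD n" "std p - std q \<in> pos_rootsD n"
    using pq unfolding pos_rootsD_def pos_rootsA_def by blast+
  have "i = p \<and> j = q \<or> i = q \<and> j = p" by (auto simp: p_def q_def)
  then have "(\<lambda>l. s * std i l) + (\<lambda>l. t * std j l) \<in> {std p + std q, std p - std q, - (std p + std q), - (std p - std q)}"
    using assms(4,5) by (elim disjE conjE) (simp_all add: fun_eq_iff)
  then show ?thesis unfolding insert_iff empty_iff using mem by (elim disjE) (simp_all only: minus_minus simp_thms)
qed

text \<open>Every signed permutation maps e_i \<plusminus> e_j to a signed pair of distinct basis
  vectors. The number of sign changes plays no part in this, so the lemma serves type B as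
  well.\<close>

lemma signed_perm_rootsD:
  assumes u: "signed_perm {1..n} u" and \<alpha>: "\<alpha> \<in> pos_rootsD n"
  shows "u \<alpha> \<in> pos_rootsD n \<or> - u \<alpha> \<in> pos_rootsD n"
proof -
  obtain t f where tf: "\<And>i. t i = 1 \<or> t i = - 1" "\<And>i. i \<in> {1..n} \<Longrightarrow> f i \<in> {1..n}" "inj f" "\<And>i. u (std i) = (\<lambda>l. t i * std (f i) l)"
    using signed_perm_std_ex[OF u] by metis
  note lin = signed_perm_linear[OF u]
  consider i j where "1 \<le> i" "i < j" "j \<le> n" "\<alpha> = std i - std j" | i j where "1 \<le> i" "i < j" "j \<le> n" "\<alpha> = std i + std j"
    using \<alpha> unfolding pos_rootsD_def pos_rootsA_def by blast
  then show ?thesis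
  proof cases
    case (1 i j)
    then have ij: "f i \<in> {1..n}" "f j \<in> {1..n}" "f i \<noteq> f j" using tf(2)[of i] tf(2)[of j] injD[OF tf(3)] by auto
    have "u \<alpha> = (\<lambda>l. t i * std (f i) l) + (\<lambda>l. (- t j) * std (f j) l)" by (simp add: 1 lin tf(4) fun_eq_iff)
    moreover have "- t j = 1 \<or> - t j = - 1" using tf(1)[of j] by auto
    ultimately show ?thesis using signed_pair_rootsD[OF ij tf(1)[of i]] by metis
  next
    case (2 i j)
    then have ij: "f i \<in> {1..n}" "f j \<in> {1..n}" "f i \<noteq> f j" using tf(2)[of i] tf(2)[of j] injD[OF tf(3)] by auto
    have "u \<alpha> = (\<lambda>l. t i * std (f i) l) + (\<lambda>l. t j * std (f j) l)" by (simp add: 2 lin tf(4))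
    then show ?thesis using signed_pair_rootsD[OF ij tf(1)[of i] tf(1)[of j]] by metis
  qed
qed

lemma signed_perm_rootsB:
  assumes u: "signed_perm {1..n} u" and \<alpha>: "\<alpha> \<in> pos_rootsB n"
  shows "u \<alpha> \<in> pos_rootsB n \<or> - u \<alpha> \<in> pos_rootsB n"
proof (cases "\<alpha> \<in> pos_rootsD n")
  case True
  then show ?thesis using signed_perm_rootsD[OF u] unfolding pos_rootsB_def by blast
next
  case False
  then obtain i where i: "1 \<le> i" "i \<le> n" "\<alpha> = std i" using \<alpha> unfolding pos_rootsB_def by blast
  obtain t f where tf: "\<And>i. t i = 1 \<or> t i = - 1" "\<And>i. i \<in> {1..n} \<Longrightarrow> f i \<in> {1..n}" "inj f" "\<And>i. u (std i) = (\<lambda>l. t i * std (f i) l)"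
    using signed_perm_std_ex[OF u] by metis
  have "u \<alpha> = std (f i) \<or> - u \<alpha> = std (f i)" using tf(1)[of i] by (auto simp: i(3) tf(4) fun_eq_iff)
  moreover have "std (f i) \<in> pos_rootsB n" using tf(2)[of i] i unfolding pos_rootsB_def by auto
  ultimately show ?thesis by metis
qed

lemma weyl_rootsA:
  assumes u: "u \<in> weyl n (pos_rootsA n)"
  shows "\<exists>f. (\<forall>i\<in>{1..n}. f i \<in> {1..n}) \<and> inj f \<and> (\<forall>i. u (std i) = std (f i))"
  using assms
proof induction
  case weyl_id
  show ?case by (rule exI[of _ "\<lambda>i. i"]) (simp add: inj_on_def)
next
  case (weyl_refl \<alpha> w)
  then obtain f where f: "\<forall>i\<in>{1..n}. f i \<in> {1..n}" "inj f" "\<forall>i. w (std i) = std (f i)" by blast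
  obtain i j where ij: "1 \<le> i" "i < j" "j \<le> n" "\<alpha> = std i - std j" using weyl_refl unfolding pos_rootsA_def by blast
  have "refl_in n \<alpha> (std k) = std (Transposition.transpose i j k)" for k
    unfolding ij(4) using ij(1-3) by (intro refl_diff_std) auto
  moreover have "inj (\<lambda>k. Transposition.transpose i j (f k))" using f(2) by (auto simp: inj_on_def transpose_eq_iff)
  moreover have "\<forall>k\<in>{1..n}. Transposition.transpose i j (f k) \<in> {1..n}"
    using f(1) ij by (auto simp: Transposition.transpose_def)
  ultimately show ?case using f(3) by (intro exI[of _ "\<lambda>k. Transposition.transpose i j (f k)"]) simp
qed

lemma weyl_W_rootsA:
  assumes u: "u \<in> weyl n (pos_rootsA n)" and \<alpha>: "\<alpha> \<in> pos_rootsA n"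
  shows "u \<alpha> \<in> pos_rootsA n \<or> - u \<alpha> \<in> pos_rootsA n"
proof -
  obtain f where f: "\<forall>i\<in>{1..n}. f i \<in> {1..n}" "inj f" "\<forall>i. u (std i) = std (f i)" using weyl_rootsA[OF u] by blast
  obtain i j where ij: "1 \<le> i" "i < j" "j \<le> n" "\<alpha> = std i - std j" using \<alpha> unfolding pos_rootsA_def by blast
  have "signed_perm {1..n} u" using u weyl_signed_perm unfolding pos_rootsB_def pos_rootsD_def by blast
  from signed_perm_linear(2)[OF this] have e: "u \<alpha> = std (f i) - std (f j)" unfolding ij(4) f(3)[rule_format, symmetric] .
  have "f i \<in> {1..n}" "f j \<in> {1..n}" "f i \<noteq> f j" using f ij by (auto dest: injD)
  then have "f i < f j \<and> 1 \<le> f i \<and> f j \<le> n \<or> f j < f i \<and> 1 \<le> f j \<and> f i \<le> n" by auto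
  moreover have "- u \<alpha> = std (f j) - std (f i)" by (simp add: e)
  ultimately show ?thesis unfolding pos_rootsA_def using e by auto
qed

section \<open>Generation of the Weyl groups by simple reflections\<close>

lemma wgen_comp: "u \<in> wgen B \<Longrightarrow> v \<in> wgen B \<Longrightarrow> u \<circ> v \<in> wgen B"
  by (induction rule: wgen.induct) (simp_all add: comp_assoc wgen_step)

lemma wgen_incl: "s \<in> B \<Longrightarrow> s \<in> wgen B"
  using wgen_step[OF _ wgen_id] by force

lemma wgen_mono: "u \<in> wgen B \<Longrightarrow> B \<subseteq> B' \<Longrightarrow> u \<in> wgen B'"
  by (induction rule: wgen.induct) (auto intro: wgen.intros)

definition simpleA :: "nat \<Rightarrow> vec set" where "simpleA n = {std i - std (i + 1) | i. i \<in> {1..<n}}"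

lemma simpleA_mem: "1 \<le> i \<Longrightarrow> i < n \<Longrightarrow> std i - std (Suc i) \<in> simpleA n"
  unfolding simpleA_def Suc_eq_plus1 by (intro CollectI exI[of _ i] conjI refl) auto

definition simpleB :: "nat \<Rightarrow> vec set" where "simpleB n = insert (std n) (simpleA n)"

lemma refl_conj_involution:
  assumes "signed_perm {1..n} s" "s \<circ> s = id"
  shows "refl_in n (s \<alpha>) = s \<circ> refl_in n \<alpha> \<circ> s"
proof -
  have "s \<circ> refl_in n \<alpha> \<circ> s = refl_in n (s \<alpha>) \<circ> (s \<circ> s)" unfolding refl_in_conj[OF assms(1)] by (simp only: comp_assoc)
  then show ?thesis unfolding assms(2) by simp
qed

lemma pos_rootsB_ip: "\<alpha> \<in> pos_rootsB n \<Longrightarrow> ip n \<alpha> \<alpha> \<noteq> 0"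
  by (erule pos_rootsB_cases) (simp_all add: ip_diff_left ip_diff_right ip_add_left ip_add_right ip_std)

lemma rootA_mem: "1 \<le> i \<Longrightarrow> i < j \<Longrightarrow> j \<le> n \<Longrightarrow> std i - std j \<in> pos_rootsA n"
  unfolding pos_rootsA_def by blast

lemma D_B: "pos_rootsD n \<subseteq> pos_rootsB n" and A_B: "pos_rootsA n \<subseteq> pos_rootsB n"
  unfolding pos_rootsB_def pos_rootsD_def by blast+

lemma wgen_conj:
  assumes "\<beta> \<in> pos_rootsB n" "refl_in n \<beta> \<in> wgen B" "refl_in n \<alpha> \<in> wgen B" "refl_in n \<beta> \<alpha> = \<gamma>"
  shows "refl_in n \<gamma> \<in> wgen B"
  using refl_conj_involution[OF signed_perm_refl[OF assms(1)] refl_in_refl_in[OF pos_rootsB_ip[OF assms(1)]], of \<alpha>]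
    assms(2-4) by (simp add: wgen_comp)

text \<open>Induction on j: the simple reflection exchanging j and j + 1 conjugates the reflection
  in e_i - e_j into the one in e_i - e_(j+1).\<close>

lemma wgenA:
  assumes "1 \<le> i" "i < j" "j \<le> n"
  shows "refl_in n (std i - std j) \<in> wgen (refl_in n ` simpleA n)"
  using assms(2,3)
proof (induction j)
  case (Suc j)
  show ?case
  proof (cases "i = j")
    case True
    then show ?thesis using Suc.prems assms by (intro wgen_incl imageI) (simp only:, rule simpleA_mem, simp_all)
  next
    case False
    then have ij: "i < j" "j \<le> n" using Suc by auto
    have "std j - std (Suc j) \<in> simpleA n" using ij Suc.prems assms by (intro simpleA_mem) auto
    then have "refl_in n (std j - std (Suc j)) \<in> wgen (refl_in n ` simpleA n)" by (intro wgen_incl imageI)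
    moreover have "std j - std (Suc j) \<in> pos_rootsB n" using ij Suc assms rootA_mem[of j "Suc j" n] A_B by auto
    moreover have "refl_in n (std j - std (Suc j)) (std i - std j) = std i - std (Suc j)"
    proof -
      have "j \<in> {1..n}" "Suc j \<in> {1..n}" "j \<noteq> Suc j" using ij Suc assms by auto
      from refl_diff[OF this] show ?thesis using ij by (auto simp: std_def fun_eq_iff Transposition.transpose_def)
    qed
    ultimately show ?thesis using wgen_conj Suc.IH[OF ij] by blast
  qed
qed simp

text \<open>Short roots are conjugates of e_n under reflections in differences, and e_i + e_j is the
  image of e_i - e_j under the reflection in e_j.\<close>

lemma wgenB:
  assumes "\<alpha> \<in> pos_rootsB n"
  shows "refl_in n \<alpha> \<in> wgen (refl_in n ` simpleB n)"
proof -
  have A: "refl_in n (std i - std j) \<in> wgen (refl_in n ` simpleB n)" if "1 \<le> i" "i < j" "j \<le> n" for i j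
    using wgenA[OF that] by (rule wgen_mono) (auto simp: simpleB_def)
  have S: "refl_in n (std i) \<in> wgen (refl_in n ` simpleB n)" if i: "1 \<le> i" "i \<le> n" for i
  proof (cases "i = n")
    case True then show ?thesis by (intro wgen_incl imageI) (simp add: simpleB_def)
  next
    case False
    then have "i < n" using i by simp
    then have "std i - std n \<in> pos_rootsB n" using i rootA_mem A_B by blast
    moreover have "refl_in n (std i - std n) (std n) = std i"
      using i False by (subst refl_diff_std) auto
    moreover have "refl_in n (std n) \<in> wgen (refl_in n ` simpleB n)"
      by (intro wgen_incl imageI) (simp add: simpleB_def)
    ultimately show ?thesis using wgen_conj A[OF i(1) \<open>i < n\<close> order.refl] by blast
  qed
  show ?thesis
    using assms
  proof (cases rule: pos_rootsB_cases)
    case (1 i j) then show ?thesis using A by simp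
  next
    case (2 i j)
    have "std j \<in> pos_rootsB n" using 2 unfolding pos_rootsB_def by force
    moreover have "refl_in n (std j) (std i - std j) = std i + std j"
      using 2 by (subst refl_std) (auto simp: std_def fun_eq_iff)
    ultimately show ?thesis using wgen_conj[of "std j" n _ "std i - std j" "std i + std j"] S[of j] A[of i j] 2 by auto
  next
    case (3 i) then show ?thesis using S by simp
  qed
qed

lemma weyl_wgen:
  assumes "u \<in> weyl n P" "\<And>\<alpha>. \<alpha> \<in> P \<Longrightarrow> refl_in n \<alpha> \<in> wgen B"
  shows "u \<in> wgen B"
  using assms(1)
proof induction
  case weyl_id show ?case by (rule wgen_id)
next
  case (weyl_refl \<alpha> w)
  then show ?case using assms(2) by (intro wgen_comp) auto
qed

section \<open>The root systems satisfy the assumptions of the model\<close>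

lemma hc_model_weyl:
  assumes P: "P \<subseteq> pos_rootsB n" and WP: "\<And>u \<alpha>. u \<in> weyl n P \<Longrightarrow> \<alpha> \<in> P \<Longrightarrow> u \<alpha> \<in> P \<or> - u \<alpha> \<in> P"
    and k: "weyl_invariant n (P \<union> uminus ` P) k"
  shows "hc_model n P k (weyl n P)"
proof
  fix \<alpha> u v l
  show "finite P" using P finite_pos_rootsB finite_subset by blast
  have sub: "weyl n P \<subseteq> {u. signed_perm {1..n} u}" using weyl_signed_perm[OF _ P] by blast
  show "finite (weyl n P)" using sub finite_signed_perm finite_subset by blast
  show "id \<in> weyl n P" by (rule weyl_id)
  show "u \<circ> v \<in> weyl n P" if "u \<in> weyl n P" "v \<in> weyl n P" using that by (rule weyl_comp)
  show sp: "signed_perm {1..n} u" if "u \<in> weyl n P" for u using that sub by blast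
  show "\<exists>u'\<in>weyl n P. u \<circ> u' = id \<and> u' \<circ> u = id" if "u \<in> weyl n P"
    using weyl_inv[OF that] pos_rootsB_ip P by blast
  have kw: "k (u \<alpha>) = k \<alpha>" if "u \<in> weyl n P" "\<alpha> \<in> P" for u \<alpha>
    using k that weyl_mono[of u n P "P \<union> uminus ` P"] unfolding weyl_invariant_def by blast
  {
    assume \<alpha>: "\<alpha> \<in> P"
    then have B: "\<alpha> \<in> pos_rootsB n" using P by blast
    show "\<alpha> l = 0 \<or> \<alpha> l = 1 \<or> \<alpha> l = - 1" using B by (cases rule: pos_rootsB_cases) (auto simp: std_def)
    show "\<alpha> l = 0" if "l \<notin> {1..n}" using B that by (cases rule: pos_rootsB_cases) (auto simp: std_def)
    show "\<alpha> \<noteq> 0" using B by (rule pos_rootsB_nz)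
    show "- \<alpha> \<notin> P"
      using vneg_uminus[OF pos_rootsB_nz[OF B]] pos_rootsB_not_vneg P B by blast
    show R: "refl_in n \<alpha> \<in> weyl n P" using \<alpha> by (rule refl_weyl)
    show "u \<alpha> \<in> P \<or> - u \<alpha> \<in> P" if "u \<in> weyl n P" using WP[OF that \<alpha>] .
    show "k (u \<alpha>) = k \<alpha>" if "u \<in> weyl n P" using kw[OF that \<alpha>] .
    show "k (- u \<alpha>) = k \<alpha>" if "u \<in> weyl n P"
    proof -
      \<comment> \<open>A sign can be absorbed by composing with the reflection in \<alpha>, so
        invariance of k under W also covers negatives.\<close>
      have "- u \<alpha> = (u \<circ> refl_in n \<alpha>) \<alpha>"
        using signed_perm_linear(3)[OF sp[OF that]] by (simp add: refl_in_self pos_rootsB_ip[OF B])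
      then show ?thesis using kw[OF weyl_comp[OF that R] \<alpha>] by simp
    qed
  }
qed

text \<open>The root e_i - e_j is a sum of consecutive simple roots, and vectors that are not
  negative are closed under addition.\<close>

lemma telescope_not_vneg:
  assumes w: "signed_perm UNIV w" and B: "\<And>\<beta>. \<beta> \<in> simpleA n \<Longrightarrow> \<not> vneg (w \<beta>)"
    and "1 \<le> i" "i < j" "j \<le> n"
  shows "\<not> vneg (w (std i - std j))"
  using assms(4,5)
proof (induction j)
  case (Suc j)
  have s: "std j - std (Suc j) \<in> simpleA n" if "i \<le> j" using Suc.prems assms that by (intro simpleA_mem) auto
  show ?case
  proof (cases "i = j")
    case True
    from B[OF s[OF eq_refl[OF True]]] show ?thesis unfolding True .
  next
    case False
    then have "i < j" "i \<le> j" using Suc.prems by auto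
    then have "\<not> vneg (w (std i - std j) + w (std j - std (Suc j)))"
      using Suc.IH Suc.prems B[OF s] by (intro not_vneg_add) (blast dest: Suc_leD)+
    moreover have "w (std i - std j) + w (std j - std (Suc j)) = w ((std i - std j) + (std j - std (Suc j)))"
      by (rule signed_perm_linear(1)[OF w, symmetric])
    moreover have "(std i - std j) + (std j - std (Suc j)) = std i - std (Suc j)" by (simp add: fun_eq_iff)
    ultimately show ?thesis by metis
  qed
qed simp

lemma simple_refl_std:
  assumes "b \<in> {1..<n}"
  shows "refl_in n (std b - std (b + 1)) (std i) = std (Transposition.transpose b (b + 1) i)"
  using assms by (intro refl_diff_std) auto

text \<open>Exchanging b and b + 1 reverses the order of no pair other than (b, b + 1).\<close>

lemma simpleA_posA:
  assumes "b \<in> {1..<n}" "1 \<le> i" "i < j" "j \<le> n" "\<not> (i = b \<and> j = b + 1)"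
  shows "refl_in n (std b - std (b + 1)) (std i - std j) \<in> pos_rootsA n"
proof -
  have "std b - std (b + 1) \<in> pos_rootsB n" using assms rootA_mem[of b "b + 1" n] A_B by auto
  then have "refl_in n (std b - std (b + 1)) (std i - std j) = std (Transposition.transpose b (b + 1) i) - std (Transposition.transpose b (b + 1) j)"
    using signed_perm_linear(2)[OF signed_perm_refl] simple_refl_std[OF assms(1)] by simp
  then show ?thesis using assms rootA_mem by (auto simp: Transposition.transpose_def)
qed

lemma hc_simple_A:
  assumes "weyl_invariant n (rootsA n) k"
  shows "hc_simple n (pos_rootsA n) k (weyl n (pos_rootsA n)) (simpleA n)"
proof -
  interpret hc_model n "pos_rootsA n" k "weyl n (pos_rootsA n)"
  proof (rule hc_model_weyl[OF A_B])
    show "u \<alpha> \<in> pos_rootsA n \<or> - u \<alpha> \<in> pos_rootsA n" if "u \<in> weyl n (pos_rootsA n)" "\<alpha> \<in> pos_rootsA n" for u \<alpha>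
      using that by (rule weyl_W_rootsA)
    show "weyl_invariant n (pos_rootsA n \<union> uminus ` pos_rootsA n) k" using assms by (simp only: rootsA_def)
  qed
  show ?thesis
  proof
    show sub: "simpleA n \<subseteq> pos_rootsA n" by (auto simp: simpleA_def intro!: rootA_mem)
    show "refl_in n \<beta> \<alpha> \<in> pos_rootsA n" if "\<beta> \<in> simpleA n" "\<alpha> \<in> pos_rootsA n" "\<alpha> \<noteq> \<beta>" for \<alpha> \<beta>
      using that simpleA_posA unfolding simpleA_def pos_rootsA_def by blast
    show "\<not> vneg (w \<alpha>)" if "signed_perm UNIV w" "\<And>\<beta>. \<beta> \<in> simpleA n \<Longrightarrow> \<not> vneg (w \<beta>)" "\<alpha> \<in> pos_rootsA n" for w \<alpha>
      using that(3) telescope_not_vneg[OF that(1,2)] unfolding pos_rootsA_def by blast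
    show "weyl n (pos_rootsA n) \<subseteq> wgen (refl_in n ` simpleA n)"
      using weyl_wgen[of _ n "pos_rootsA n"] wgenA unfolding pos_rootsA_def by blast
    show "(\<exists>i\<in>{1..<n}. \<beta> = std i - std (i + 1)) \<or> \<beta> = std n" if "\<beta> \<in> simpleA n" for \<beta>
      using that by (auto simp: simpleA_def)
  qed
qed

lemma hc_simple_B:
  assumes "weyl_invariant n (rootsB n) k" "n \<ge> 1"
  shows "hc_simple n (pos_rootsB n) k (weyl n (pos_rootsB n)) (simpleB n)"
proof -
  interpret hc_model n "pos_rootsB n" k "weyl n (pos_rootsB n)"
  proof (rule hc_model_weyl[OF order.refl])
    show "u \<alpha> \<in> pos_rootsB n \<or> - u \<alpha> \<in> pos_rootsB n" if "u \<in> weyl n (pos_rootsB n)" "\<alpha> \<in> pos_rootsB n" for u \<alpha>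
      using weyl_signed_perm[OF that(1) order.refl] that(2) by (rule signed_perm_rootsB)
    show "weyl_invariant n (pos_rootsB n \<union> uminus ` pos_rootsB n) k" using assms by (simp only: rootsB_def)
  qed
  have short: "std i \<in> pos_rootsB n" if "i \<in> {1..n}" for i using that unfolding pos_rootsB_def by force
  have plus: "std i + std j \<in> pos_rootsB n" if "i \<in> {1..n}" "j \<in> {1..n}" "i \<noteq> j" for i j
  proof (cases "i < j")
    case True then show ?thesis using that unfolding pos_rootsB_def pos_rootsD_def by force
  next
    case False
    then have "std j + std i \<in> pos_rootsB n" using that unfolding pos_rootsB_def pos_rootsD_def by force
    then show ?thesis by (simp add: add.commute)
  qed
  show ?thesis
  proof
    have mA: "std b - std (b + 1) \<in> pos_rootsB n" if "b \<in> {1..<n}" for b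
      using rootA_mem[of b "b + 1" n] that A_B by auto
    show sub: "simpleB n \<subseteq> pos_rootsB n"
      using assms(2) short mA unfolding simpleB_def simpleA_def by auto
    show "refl_in n \<beta> \<alpha> \<in> pos_rootsB n" if \<beta>: "\<beta> \<in> simpleB n" and \<alpha>: "\<alpha> \<in> pos_rootsB n" and ne: "\<alpha> \<noteq> \<beta>" for \<alpha> \<beta>
    proof -
      have \<beta>B: "\<beta> \<in> pos_rootsB n" using \<beta> sub by blast
      note lin = signed_perm_linear[OF signed_perm_refl[OF \<beta>B]]
      consider "\<beta> = std n" | b where "b \<in> {1..<n}" "\<beta> = std b - std (b + 1)" using \<beta> by (auto simp: simpleB_def simpleA_def)
      then show ?thesis
      proof cases
        case 1
        have r: "refl_in n \<beta> (std i) = (if i = n then - std n else std i)" for i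
          using assms(2) 1 by (subst 1, subst refl_std) (auto simp: std_def fun_eq_iff)
        from \<alpha> show ?thesis
        proof (cases rule: pos_rootsB_cases)
          case (1 i j)
          have e: "refl_in n \<beta> \<alpha> = std i - (if j = n then - std n else std j)"
            unfolding 1(4) lin(2) r using 1(1-3) by simp
          show ?thesis
          proof (cases "j = n")
            case True
            then have "refl_in n \<beta> \<alpha> = std i + std n" unfolding e by (simp add: fun_eq_iff)
            then show ?thesis using plus[of i n] 1 True by simp
          next
            case False
            from e[unfolded if_not_P[OF False], folded 1(4)] have "refl_in n \<beta> \<alpha> = \<alpha>" .
            then show ?thesis using \<alpha> by metis
          qed
        next
          case (2 i j)
          have e: "refl_in n \<beta> \<alpha> = std i + (if j = n then - std n else std j)"
            unfolding 2(4) lin(1) r using 2(1-3) by simp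
          show ?thesis
          proof (cases "j = n")
            case True
            then have "refl_in n \<beta> \<alpha> = std i - std n" unfolding e by (simp add: fun_eq_iff)
            moreover have "std i - std n \<in> pos_rootsB n" using rootA_mem[of i n n] 2 True A_B by auto
            ultimately show ?thesis by metis
          next
            case False
            from e[unfolded if_not_P[OF False], folded 2(4)] have "refl_in n \<beta> \<alpha> = \<alpha>" .
            then show ?thesis using \<alpha> by metis
          qed
        next
          case (3 i)
          have "i \<noteq> n" using ne 3(3) \<open>\<beta> = std n\<close> by metis
          from r[of i, unfolded if_not_P[OF this], folded 3(3)] show ?thesis using \<alpha> by metis
        qed
      next
        case (2 b)
        let ?t = "Transposition.transpose b (b + 1)"
        have r: "refl_in n \<beta> (std i) = std (?t i)" for i unfolding 2(2) by (rule simple_refl_std[OF 2(1)])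
        have t: "?t i \<in> {1..n}" if "i \<in> {1..n}" for i using that 2(1) by (auto simp: Transposition.transpose_def)
        from \<alpha> show ?thesis
        proof (cases rule: pos_rootsB_cases)
          case (1 i j)
          have "\<not> (i = b \<and> j = b + 1)" using ne 1(4) \<open>\<beta> = std b - std (b + 1)\<close> by metis
          from simpleA_posA[OF 2(1) 1(1-3) this] show ?thesis using A_B unfolding 1(4) 2(2) by blast
        next
          case (2 i j)
          have "?t i \<noteq> ?t j" using 2(2) by (metis transpose_involutory less_irrefl)
          then have "std (?t i) + std (?t j) \<in> pos_rootsB n" using 2 by (intro plus t) auto
          then show ?thesis unfolding 2(4) lin(1) r .
        next
          case (3 i) then show ?thesis using short[OF t, of i] by (simp add: r)
        qed
      qed
    qed
    show "\<not> vneg (w \<alpha>)" if w: "signed_perm UNIV w" and B: "\<And>\<beta>. \<beta> \<in> simpleB n \<Longrightarrow> \<not> vneg (w \<beta>)" and \<alpha>: "\<alpha> \<in> pos_rootsB n" for w \<alpha>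
    proof -
      note lin = signed_perm_linear[OF w]
      have A: "\<not> vneg (w (std i - std j))" if "1 \<le> i" "i < j" "j \<le> n" for i j
        using telescope_not_vneg[OF w _ that] B by (simp add: simpleB_def)
      have S: "\<not> vneg (w (std i))" if "1 \<le> i" "i \<le> n" for i
      proof (cases "i = n")
        case True then show ?thesis using B by (simp add: simpleB_def)
      next
        case False
        have "\<not> vneg (w (std i - std n) + w (std n))"
          using A[of i n] B[of "std n"] that False by (intro not_vneg_add) (auto simp: simpleB_def)
        moreover have "w (std i - std n) + w (std n) = w (std i)"
          unfolding lin(1)[symmetric] by (rule arg_cong[of _ _ w]) (simp add: fun_eq_iff)
        ultimately show ?thesis by metis
      qed
      from \<alpha> show ?thesis
      proof (cases rule: pos_rootsB_cases)
        case (1 i j) then show ?thesis using A by metis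
      next
        case (2 i j)
        have "\<not> vneg (w (std i) + w (std j))" using 2 by (intro not_vneg_add S) auto
        then show ?thesis unfolding 2(4) lin(1) .
      next
        case (3 i) then show ?thesis using S by simp
      qed
    qed
    show "weyl n (pos_rootsB n) \<subseteq> wgen (refl_in n ` simpleB n)"
      using weyl_wgen wgenB by blast
    show "(\<exists>i\<in>{1..<n}. \<beta> = std i - std (i + 1)) \<or> \<beta> = std n" if "\<beta> \<in> simpleB n" for \<beta>
      using that by (auto simp: simpleB_def simpleA_def)
  qed
qed

lemma hc_simple_full: assumes "hc_simple n P k W B" shows "hc_full n P k W a"
proof -
  interpret hc_simple n P k W a B by (rule assms)
  show ?thesis by unfold_locales (auto simp: xO_commutator gO_KO2)
qed

lemma hc_full_A: "weyl_invariant n (rootsA n) k \<Longrightarrow> hc_full n (pos_rootsA n) k (weyl n (pos_rootsA n)) a"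
  using hc_simple_full hc_simple_A by blast

lemma hc_full_B: "weyl_invariant n (rootsB n) k \<Longrightarrow> n \<ge> 1 \<Longrightarrow> hc_full n (pos_rootsB n) k (weyl n (pos_rootsB n)) a"
  using hc_simple_full hc_simple_B by blast

section \<open>Representations of presented algebras\<close>

lemma poly_mapping_sum_single: "f = (\<Sum>w\<in>Poly_Mapping.keys f. Poly_Mapping.single w (Poly_Mapping.lookup f w))"
proof (rule poly_mapping_eqI)
  fix v
  have "(\<Sum>w\<in>Poly_Mapping.keys f. Poly_Mapping.lookup f w when w = v) =
      (\<Sum>w\<in>Poly_Mapping.keys f. if w = v then Poly_Mapping.lookup f v else 0)"
    by (rule sum.cong) (auto simp: when_def)
  then show "Poly_Mapping.lookup f v = Poly_Mapping.lookup (\<Sum>w\<in>Poly_Mapping.keys f. Poly_Mapping.single w (Poly_Mapping.lookup f w)) v"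
    by (simp add: lookup_sum lookup_single in_keys_iff)
qed

section \<open>Evaluation of noncommutative polynomials\<close>

definition wordv :: "('g \<Rightarrow> hend) \<Rightarrow> 'g word \<Rightarrow> hend" where
  "wordv e w = prod_list (map e (letters w))"

text \<open>The homomorphism from the free algebra determined by the images e of the
  letters.\<close>

definition ev :: "('g \<Rightarrow> hend) \<Rightarrow> 'g free \<Rightarrow> hend" where
  "ev e f = (\<Sum>w\<in>Poly_Mapping.keys f. sc (Poly_Mapping.lookup f w) * wordv e w)"

lemma wordv_simps: "wordv e 0 = 1" "wordv e (u + v) = wordv e u * wordv e v" "wordv e (Word [l]) = e l"
  by (simp_all add: wordv_def zero_word_def plus_word_def)

lemma ev_superset:
  assumes "finite A" "Poly_Mapping.keys f \<subseteq> A"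
  shows "ev e f = (\<Sum>w\<in>A. sc (Poly_Mapping.lookup f w) * wordv e w)"
  unfolding ev_def by (rule sum.mono_neutral_left[OF assms]) (auto simp: in_keys_iff)

lemma ev_add: "ev e (f + g) = ev e f + ev e g"
proof -
  let ?A = "Poly_Mapping.keys f \<union> Poly_Mapping.keys g"
  have "Poly_Mapping.keys (f + g) \<subseteq> ?A" by (rule Poly_Mapping.keys_add)
  then have "ev e (f + g) = (\<Sum>w\<in>?A. sc (Poly_Mapping.lookup (f + g) w) * wordv e w)" by (intro ev_superset) auto
  also have "\<dots> = (\<Sum>w\<in>?A. sc (Poly_Mapping.lookup f w) * wordv e w) + (\<Sum>w\<in>?A. sc (Poly_Mapping.lookup g w) * wordv e w)"
    by (simp add: lookup_add sc_add distrib_right sum.distrib)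
  also have "\<dots> = ev e f + ev e g" by (subst (1 2) ev_superset[of ?A]) auto
  finally show ?thesis .
qed

lemma ev_single: "ev e (Poly_Mapping.single w a) = sc a * wordv e w"
  by (cases "a = 0") (auto simp: ev_def)

lemma ev_0: "ev e 0 = 0" by (simp add: ev_def)

lemma ev_sum: "ev e (sum F A) = (\<Sum>a\<in>A. ev e (F a))"
  by (induction A rule: infinite_finite_induct) (auto simp: ev_0 ev_add)

lemma ev_mult: "ev e (f * g) = ev e f * ev e g"
proof -
  have 1: "sc s * (u * v) = sc a * u * (sc b * v)" if "s = a * b" for s a b and u v :: hend
  proof -
    have "sc a * u * (sc b * v) = sc a * (u * sc b) * v" by (simp only: mult.assoc)
    also have "\<dots> = sc a * (sc b * u) * v" by (simp only: sc_commute)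
    also have "\<dots> = sc s * (u * v)" by (simp only: that sc_mult mult.assoc)
    finally show ?thesis ..
  qed
  have "f * g = (\<Sum>u\<in>Poly_Mapping.keys f. Poly_Mapping.single u (Poly_Mapping.lookup f u)) * (\<Sum>v\<in>Poly_Mapping.keys g. Poly_Mapping.single v (Poly_Mapping.lookup g v))"
    using poly_mapping_sum_single[of f] poly_mapping_sum_single[of g] by argo
  also have "\<dots> = (\<Sum>u\<in>Poly_Mapping.keys f. \<Sum>v\<in>Poly_Mapping.keys g. Poly_Mapping.single (u + v) (Poly_Mapping.lookup f u * Poly_Mapping.lookup g v))"
    by (simp add: sum_product mult_single)
  finally have "ev e (f * g) = (\<Sum>u\<in>Poly_Mapping.keys f. \<Sum>v\<in>Poly_Mapping.keys g. sc (Poly_Mapping.lookup f u * Poly_Mapping.lookup g v) * (wordv e u * wordv e v))"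
    by (simp only: ev_sum ev_single wordv_simps)
  also have "\<dots> = ev e f * ev e g" unfolding ev_def sum_product by (intro sum.cong refl 1)
  finally show ?thesis .
qed

lemma ev_scal: "ev e (scal a) = sc a" by (simp add: scal_def ev_single wordv_simps)
lemma ev_1: "ev e 1 = 1" using ev_scal[of e 1] by simp
lemma ev_fgen: "ev e (fgen l) = e l" by (simp add: fgen_def ev_single wordv_simps)
lemma ev_uminus: "ev e (- f) = - ev e f"
  using ev_add[of e f "- f"] by (simp add: ev_0 minus_unique)
lemma ev_diff: "ev e (f - g) = ev e f - ev e g"
  using ev_add[of e f "- g"] by (simp add: ev_uminus)

lemmas ev_simps = ev_add ev_diff ev_uminus ev_mult ev_scal ev_1 ev_fgen ev_0 ev_sum

lemma free_sel [simp]: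
  "monoid.mult (free_algebra S) = (*)" "monoid.one (free_algebra S) = 1"
  "ring.zero (free_algebra S) = 0" "ring.add (free_algebra S) = (+)"
  by (simp_all add: free_algebra_def)

lemma free_carrier: "f \<in> carrier (free_algebra S) \<longleftrightarrow> (\<forall>w\<in>Poly_Mapping.keys f. set (letters w) \<subseteq> S)"
  by (simp add: free_algebra_def)

lemma free_single: "set (letters w) \<subseteq> S \<Longrightarrow> Poly_Mapping.single w a \<in> carrier (free_algebra S)"
  by (auto simp: free_carrier)

lemma free_scal: "scal a \<in> carrier (free_algebra S)"
  unfolding scal_def by (rule free_single) (simp add: zero_word_def)

lemma free_fgen: "l \<in> S \<Longrightarrow> fgen l \<in> carrier (free_algebra S)"
  unfolding fgen_def by (rule free_single) simp

lemma free_add: "f \<in> carrier (free_algebra S) \<Longrightarrow> g \<in> carrier (free_algebra S) \<Longrightarrow> f + g \<in> carrier (free_algebra S)"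
  using Poly_Mapping.keys_add[of f g] unfolding free_carrier by blast

lemma free_mult: "f \<in> carrier (free_algebra S) \<Longrightarrow> g \<in> carrier (free_algebra S) \<Longrightarrow> f * g \<in> carrier (free_algebra S)"
  using keys_mult[of f g] unfolding free_carrier by (fastforce simp: plus_word_def)

lemma free_uminus: "f \<in> carrier (free_algebra S) \<Longrightarrow> - f \<in> carrier (free_algebra S)"
  using free_mult[OF free_scal[of "- 1"], of f] by (simp add: scal_uminus)

lemma free_diff: "f \<in> carrier (free_algebra S) \<Longrightarrow> g \<in> carrier (free_algebra S) \<Longrightarrow> f - g \<in> carrier (free_algebra S)"
  using free_add[OF _ free_uminus] by fastforce

lemma free_0: "0 \<in> carrier (free_algebra S)" by (simp add: free_carrier)
lemma free_1: "1 \<in> carrier (free_algebra S)" using free_scal[of 1] by simp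

lemma free_sum: "(\<And>a. a \<in> A \<Longrightarrow> F a \<in> carrier (free_algebra S)) \<Longrightarrow> sum F A \<in> carrier (free_algebra S)"
  by (induction A rule: infinite_finite_induct) (auto intro: free_add free_0)

lemmas free_closed = free_add free_diff free_uminus free_mult free_scal free_1 free_0 free_fgen free_sum

lemma ring_free: "ring (free_algebra S)"
proof (rule ringI)
  show "abelian_group (free_algebra S)"
  proof (rule abelian_groupI)
    fix f assume "f \<in> carrier (free_algebra S)"
    then show "\<exists>g\<in>carrier (free_algebra S). g \<oplus>\<^bsub>free_algebra S\<^esub> f = \<zero>\<^bsub>free_algebra S\<^esub>"
      by (intro bexI[of _ "- f"]) (auto intro: free_closed)
  qed (auto simp: add.assoc add.commute intro: free_closed)
  show "Group.monoid (free_algebra S)"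
    by (rule monoidI) (auto simp: mult.assoc intro: free_closed)
qed (auto simp: distrib_left distrib_right)

lemma free_alg: "carrier (free_algebra S) = alg scal (fgen ` S)"
proof
  have w: "Poly_Mapping.single (Word ls) 1 \<in> alg scal (fgen ` S)" if "set ls \<subseteq> S" for ls
    using that
  proof (induction ls)
    case Nil
    have "Poly_Mapping.single (Word []) 1 = (scal 1 :: 'a free)" by (simp add: scal_def zero_word_def[symmetric])
    then show ?case using alg_sca by metis
  next
    case (Cons l ls)
    have "Poly_Mapping.single (Word (l # ls)) 1 = fgen l * Poly_Mapping.single (Word ls) (1 :: complex)"
      by (simp add: fgen_def mult_single plus_word_def)
    moreover have "fgen l * Poly_Mapping.single (Word ls) (1 :: complex) \<in> alg scal (fgen ` S)"
      by (rule alg_mult[OF alg_gen Cons.IH]) (use Cons.prems in auto)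
    ultimately show ?case by simp
  qed
  have w': "Poly_Mapping.single u a \<in> alg scal (fgen ` S)" if "set (letters u) \<subseteq> S" for u a
  proof -
    have "Poly_Mapping.single u a = scal a * Poly_Mapping.single (Word (letters u)) 1"
      by (simp add: scal_def mult_single)
    then show ?thesis using alg_mult[OF alg_sca w[OF that], of a] by simp
  qed
  show "carrier (free_algebra S) \<subseteq> alg scal (fgen ` S)"
  proof
    fix f assume f: "f \<in> carrier (free_algebra S)"
    have sums: "sum F A \<in> alg scal (fgen ` S)" if "\<And>a. a \<in> A \<Longrightarrow> F a \<in> alg scal (fgen ` S)" for F :: "'a word \<Rightarrow> 'a free" and A
      using that by (induction A rule: infinite_finite_induct) (use alg_sca[of scal 0] in \<open>auto intro: alg_add\<close>)
    have "(\<Sum>w\<in>Poly_Mapping.keys f. Poly_Mapping.single w (Poly_Mapping.lookup f w)) \<in> alg scal (fgen ` S)"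
      by (rule sums, rule w') (use f in \<open>simp add: free_carrier\<close>)
    then show "f \<in> alg scal (fgen ` S)" using poly_mapping_sum_single[of f] by argo
  qed
  show "alg scal (fgen ` S) \<subseteq> carrier (free_algebra S)"
  proof
    fix f assume "f \<in> alg scal (fgen ` S)"
    then show "f \<in> carrier (free_algebra S)" by induction (auto intro: free_closed)
  qed
qed

lemma ev_img: "ev e ` carrier (free_algebra S) = alg sc (e ` S)"
proof
  show "ev e ` carrier (free_algebra S) \<subseteq> alg sc (e ` S)"
  proof (rule image_subsetI)
    fix f assume "f \<in> carrier (free_algebra S)"
    then have "f \<in> alg scal (fgen ` S)" by (simp only: free_alg)
    then show "ev e f \<in> alg sc (e ` S)"
      by induction (auto simp: ev_simps intro: alg.intros)
  qed
  show "alg sc (e ` S) \<subseteq> ev e ` carrier (free_algebra S)"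
  proof
    fix y assume "y \<in> alg sc (e ` S)"
    then show "y \<in> ev e ` carrier (free_algebra S)"
    proof induction
      case (alg_sca a) show ?case by (rule image_eqI[of _ _ "scal a"]) (simp_all add: ev_simps free_scal)
    next
      case (alg_gen y)
      then obtain l where "l \<in> S" "y = e l" by blast
      then show ?case by (intro image_eqI[of _ _ "fgen l"]) (simp_all add: ev_simps free_fgen)
    next
      case (alg_add y z)
      then obtain f g where "f \<in> carrier (free_algebra S)" "y = ev e f" "g \<in> carrier (free_algebra S)" "z = ev e g" by blast
      then show ?case by (intro image_eqI[of _ _ "f + g"]) (simp_all add: ev_simps free_add)
    next
      case (alg_mult y z)
      then obtain f g where "f \<in> carrier (free_algebra S)" "y = ev e f" "g \<in> carrier (free_algebra S)" "z = ev e g" by blast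
      then show ?case by (intro image_eqI[of _ _ "f * g"]) (simp_all add: ev_simps free_mult)
    qed
  qed
qed

text \<open>Used to split an element of the free algebra into its even and odd words.\<close>

definition part :: "('g word \<Rightarrow> bool) \<Rightarrow> 'g free \<Rightarrow> 'g free" where
  "part Q f = (\<Sum>w\<in>{w \<in> Poly_Mapping.keys f. Q w}. Poly_Mapping.single w (Poly_Mapping.lookup f w))"

lemma lookup_part: "Poly_Mapping.lookup (part Q f) v = (if Q v then Poly_Mapping.lookup f v else 0)"
proof -
  have "Poly_Mapping.lookup (part Q f) v = (\<Sum>w\<in>{w \<in> Poly_Mapping.keys f. Q w}. if w = v then Poly_Mapping.lookup f v else 0)"
    unfolding part_def lookup_sum lookup_single by (rule sum.cong) (auto simp: when_def)
  then show ?thesis by (simp add: in_keys_iff)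
qed

lemma keys_part: "Poly_Mapping.keys (part Q f) = {w \<in> Poly_Mapping.keys f. Q w}"
  by (auto simp: in_keys_iff lookup_part split: if_splits)

lemma part_split: "f = part Q f + part (\<lambda>w. \<not> Q w) f"
  by (rule poly_mapping_eqI) (simp add: lookup_add lookup_part)

text \<open>The common value of \<open>ev\<close> on a coset; it is unique when \<open>ev\<close>
  annihilates the ideal of relations.\<close>

definition ev_class :: "('g \<Rightarrow> hend) \<Rightarrow> 'g free set \<Rightarrow> hend" where
  "ev_class e C = the_elem (ev e ` C)"

text \<open>The last assumption says that the representation \<open>e\<close> of the presented algebra is faithful.\<close>

locale presentation =
  fixes S :: "'g set" and od :: "'g \<Rightarrow> bool" and R :: "'g free set" and e :: "'g \<Rightarrow> hend"
  assumes R_carrier: "R \<subseteq> carrier (free_algebra S)"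
    and R_ev: "r \<in> R \<Longrightarrow> ev e r = 0"
    and pc_e: "l \<in> S \<Longrightarrow> pc (e l) = (if od l then - e l else e l)"
    and faithful: "f \<in> carrier (free_algebra S) \<Longrightarrow> ev e f = 0 \<Longrightarrow> f \<in> Idl\<^bsub>free_algebra S\<^esub> R"

text \<open>The kernel of the evaluation is an ideal that contains the relations.\<close>

lemma genideal_ev:
  assumes "R \<subseteq> carrier (free_algebra S)" "\<And>r. r \<in> R \<Longrightarrow> ev e r = 0" "f \<in> Idl\<^bsub>free_algebra S\<^esub> R"
  shows "ev e f = 0"
proof -
  interpret F: ring "free_algebra S" by (rule ring_free)
  let ?K = "{f \<in> carrier (free_algebra S). ev e f = 0}"
  have "ideal ?K (free_algebra S)"
  proof (rule idealI[OF ring_free])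
    have inv: "\<ominus>\<^bsub>free_algebra S\<^esub> f = - f" if "f \<in> carrier (free_algebra S)" for f
      using that by (intro F.minus_equality) (auto intro: free_closed)
    show "subgroup ?K (add_monoid (free_algebra S))"
    proof (rule F.add.subgroupI)
      show "?K \<noteq> {}" using free_0 ev_0 by blast
      show "\<ominus>\<^bsub>free_algebra S\<^esub> a \<in> ?K" if "a \<in> ?K" for a
        using that inv[of a] by (auto simp: ev_uminus intro: free_uminus)
    qed (auto simp: ev_add intro: free_add)
  qed (auto simp: ev_mult intro: free_mult)
  then have "Idl\<^bsub>free_algebra S\<^esub> R \<subseteq> ?K" by (rule F.genideal_minimal) (use assms in auto)
  then show ?thesis using assms(3) by blast
qed

context presentation
begin

abbreviation "F \<equiv> free_algebra S"
abbreviation "J \<equiv> Idl\<^bsub>F\<^esub> R"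
abbreviation "cls \<equiv> present_class S R"
abbreviation "A \<equiv> presented S od R"

sublocale fr: ring F by (rule ring_free)
sublocale J: ideal J F by (rule fr.genideal_ideal[OF R_carrier])

lemma J_ev: "f \<in> J \<Longrightarrow> ev e f = 0" by (rule genideal_ev[OF R_carrier R_ev])

lemma cls_image: "cls f = (\<lambda>h. h + f) ` J"
  by (auto simp: present_class_def a_r_coset_def')

lemma ev_cls: "f \<in> carrier F \<Longrightarrow> ev_class e (cls f) = ev e f"
proof -
  have "ev e ` cls f = {ev e f}"
  proof
    show "ev e ` cls f \<subseteq> {ev e f}" unfolding cls_image by (auto simp: ev_add J_ev)
    have "0 \<in> J" using J.zero_closed by simp
    then have "0 + f \<in> cls f" unfolding cls_image by (rule imageI)
    then show "{ev e f} \<subseteq> ev e ` cls f" by auto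
  qed
  then show ?thesis by (simp add: ev_class_def)
qed

lemma cls_sub: assumes "f \<in> carrier F" "g \<in> carrier F" "ev e f = ev e g" shows "cls f \<subseteq> cls g"
proof
  fix y assume "y \<in> cls f"
  then obtain h where h: "h \<in> J" "y = h + f" unfolding cls_image by blast
  have "f - g \<in> J" by (rule faithful) (use assms in \<open>auto simp: ev_diff intro: free_diff\<close>)
  then have "h + (f - g) \<in> J" using J.a_closed[OF h(1)] by simp
  moreover have "y = h + (f - g) + g" by (simp add: h(2))
  ultimately show "y \<in> cls g" unfolding cls_image by blast
qed

lemma cls_eqI: "f \<in> carrier F \<Longrightarrow> g \<in> carrier F \<Longrightarrow> ev e f = ev e g \<Longrightarrow> cls f = cls g"
  using cls_sub by fastforce

lemma A_sel:
  "carrier A = cls ` carrier F" "monoid.one A = cls 1" "scalar A = (\<lambda>a. cls (scal a))"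
  "homog A = (\<lambda>p. cls ` free_homog S od p)" "ring.zero A = cls 0"
  by (auto simp: presented_def ring.defs superalgebra.defs FactRing_def A_RCOSETS_def' present_class_def
      fr.a_coset_add_zero J.a_subset a_r_coset_def')

lemma A_ops:
  assumes "f \<in> carrier F" "g \<in> carrier F"
  shows "cls f \<otimes>\<^bsub>A\<^esub> cls g = cls (f * g)" "cls f \<oplus>\<^bsub>A\<^esub> cls g = cls (f + g)"
  using J.rcoset_mult_add[OF assms] J.a_rcos_sum[OF assms]
  by (simp_all add: presented_def ring.defs superalgebra.defs FactRing_def present_class_def)

lemma pc_wordv: "set (letters w) \<subseteq> S \<Longrightarrow> pc (wordv e w) = (if odd (length (filter od (letters w))) then - wordv e w else wordv e w)"
proof (induction w)
  case (Word ls)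
  have "pc (prod_list (map e ls)) = (if odd (length (filter od ls)) then - prod_list (map e ls) else prod_list (map e ls))"
    using Word by (induction ls) (use pc_sc[of 1] in \<open>auto simp: pc_mult pc_e\<close>)
  then show ?case by (simp add: wordv_def)
qed

lemma free_homog_pc: assumes "f \<in> free_homog S od p" shows "pc (ev e f) = (if p then - ev e f else ev e f)"
proof -
  have "pc (wordv e w) = (if p then - wordv e w else wordv e w)" if "w \<in> Poly_Mapping.keys f" for w
    using pc_wordv[of w] assms that unfolding free_homog_def free_carrier by auto
  then show ?thesis by (simp add: ev_def pc_sum pc_mult pc_sc sum_negf)
qed

lemma homog_A: "homog A p = {h \<in> carrier A. pc (ev_class e h) = (if p then - ev_class e h else ev_class e h)}"
proof (intro equalityI subsetI)
  fix h assume "h \<in> homog A p"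
  then obtain f where f: "f \<in> free_homog S od p" "h = cls f" unfolding A_sel by blast
  then have "f \<in> carrier F" unfolding free_homog_def by blast
  then show "h \<in> {h \<in> carrier A. pc (ev_class e h) = (if p then - ev_class e h else ev_class e h)}"
    using f free_homog_pc[OF f(1)] by (simp add: A_sel ev_cls)
next
  fix h assume "h \<in> {h \<in> carrier A. pc (ev_class e h) = (if p then - ev_class e h else ev_class e h)}"
  then obtain f where f: "f \<in> carrier F" "h = cls f" and pf: "pc (ev e f) = (if p then - ev e f else ev e f)"
    unfolding A_sel by (auto simp: ev_cls)
  define Q where "Q w = (odd (length (filter od (letters w))) = p)" for w
  let ?g = "part Q f" and ?g' = "part (\<lambda>w. \<not> Q w) f"
  have g: "?g \<in> free_homog S od p" and g': "?g' \<in> free_homog S od (\<not> p)"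
    using f(1) unfolding free_homog_def free_carrier by (auto simp: keys_part Q_def)
  have s: "ev e f = ev e ?g + ev e ?g'" using part_split[of f Q] ev_add by metis
  have "ev e ?g' + ev e ?g' = 0 + 0"
    using pf free_homog_pc[OF g] free_homog_pc[OF g'] unfolding s pc_add
    by (cases p) (simp_all add: eq_neg_iff_add_eq_0 neg_eq_iff_add_eq_0 add.assoc add.left_commute)
  then have "ev e ?g' = 0" by (rule double_cancel)
  then have "cls f = cls ?g" using s f(1) g by (intro cls_eqI) (auto simp: free_homog_def)
  then show "h \<in> homog A p" unfolding A_sel f(2) using g by blast
qed

end

text \<open>A superalgebra embedded into operators so that its grading is the parity of the image.
  This passes to generated subalgebras, as is required for type D and for the subalgebra
  Seg(W).\<close>

locale rep_alg =
  fixes A :: "'a superalgebra" and psi :: "'a \<Rightarrow> hend"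
  assumes ring_A: "ring A"
    and inj: "inj_on psi (carrier A)"
    and add: "x \<in> carrier A \<Longrightarrow> y \<in> carrier A \<Longrightarrow> psi (x \<oplus>\<^bsub>A\<^esub> y) = psi x + psi y"
    and mult: "x \<in> carrier A \<Longrightarrow> y \<in> carrier A \<Longrightarrow> psi (x \<otimes>\<^bsub>A\<^esub> y) = psi x * psi y"
    and one: "psi \<one>\<^bsub>A\<^esub> = 1"
    and scalar_closed: "scalar A s \<in> carrier A" and scalar: "psi (scalar A s) = sc s"
    and homog_eq: "homog A p = {h \<in> carrier A. pc (psi h) = (if p then - psi h else psi h)}"
begin

sublocale ring A by (rule ring_A)

lemma psi_uminus: assumes "x \<in> carrier A" shows "psi (\<ominus>\<^bsub>A\<^esub> x) = - psi x"
proof -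
  have 0: "psi \<zero>\<^bsub>A\<^esub> = 0" using add[of "\<zero>\<^bsub>A\<^esub>" "\<zero>\<^bsub>A\<^esub>"] by simp
  have "psi (\<ominus>\<^bsub>A\<^esub> x) + psi x = 0" using add[of "\<ominus>\<^bsub>A\<^esub> x" x] assms by (simp add: l_neg 0)
  then show ?thesis by (simp add: eq_neg_iff_add_eq_0)
qed

lemma gen_subalgebra_sel: "gen_subalgebra A Y = A\<lparr>carrier := carrier (gen_subalgebra A Y),
    homog := (\<lambda>p. homog A p \<inter> carrier (gen_subalgebra A Y))\<rparr>"
  by (simp add: gen_subalgebra_def Let_def)

lemma gen_subalgebra_carrier: "carrier (gen_subalgebra A Y) = generate_ring A (Y \<union> range (scalar A))"
  by (simp add: gen_subalgebra_def Let_def)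

lemma gen_subalgebra_subset: assumes "Y \<subseteq> carrier A" shows "carrier (gen_subalgebra A Y) \<subseteq> carrier A"
proof
  fix h assume "h \<in> carrier (gen_subalgebra A Y)"
  then have "h \<in> generate_ring A (Y \<union> range (scalar A))" by (simp only: gen_subalgebra_carrier)
  then show "h \<in> carrier A" by induction (use assms in \<open>auto intro: scalar_closed\<close>)
qed

lemma gen_subalgebra_img: assumes Y: "Y \<subseteq> carrier A"
  shows "psi ` carrier (gen_subalgebra A Y) = alg sc (psi ` Y)"
proof
  have sub: "h \<in> carrier A" if "h \<in> generate_ring A (Y \<union> range (scalar A))" for h
    using gen_subalgebra_subset[OF Y] that unfolding gen_subalgebra_carrier by blast
  show "psi ` carrier (gen_subalgebra A Y) \<subseteq> alg sc (psi ` Y)"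
    unfolding gen_subalgebra_carrier
  proof (rule image_subsetI)
    fix h assume "h \<in> generate_ring A (Y \<union> range (scalar A))"
    then show "psi h \<in> alg sc (psi ` Y)"
    proof induction
      case (incl h) then show ?case using alg_gen[of _ "psi ` Y" sc] alg_sca[of sc] by (auto simp: scalar)
    qed (auto simp: one add mult psi_uminus sub intro: alg_1 alg_add alg_mult alg_uminus)
  qed
  show "alg sc (psi ` Y) \<subseteq> psi ` carrier (gen_subalgebra A Y)"
    unfolding gen_subalgebra_carrier
  proof
    let ?B = "generate_ring A (Y \<union> range (scalar A))"
    fix y assume "y \<in> alg sc (psi ` Y)"
    then show "y \<in> psi ` ?B"
    proof induction
      case (alg_sca a) show ?case by (rule image_eqI[of _ _ "scalar A a"]) (auto simp: scalar intro: generate_ring.incl)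
    next
      case (alg_gen y) then show ?case by (auto intro: generate_ring.incl)
    next
      case (alg_add y z)
      then obtain f g where fg: "f \<in> ?B" "y = psi f" "g \<in> ?B" "z = psi g" by blast
      then have "psi (f \<oplus>\<^bsub>A\<^esub> g) = y + z" using sub by (simp add: add)
      then show ?case using generate_ring.eng_add[OF fg(1,3)] by (metis imageI)
    next
      case (alg_mult y z)
      then obtain f g where fg: "f \<in> ?B" "y = psi f" "g \<in> ?B" "z = psi g" by blast
      then have "psi (f \<otimes>\<^bsub>A\<^esub> g) = y * z" using sub by (simp add: mult)
      then show ?case using generate_ring.eng_mult[OF fg(1,3)] by (metis imageI)
    qed
  qed
qed

lemma gen_subalgebra_rep:
  assumes Y: "Y \<subseteq> carrier A" and r: "ring (gen_subalgebra A Y)"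
  shows "rep_alg (gen_subalgebra A Y) psi"
proof -
  let ?B = "gen_subalgebra A Y"
  have sel: "monoid.mult ?B = monoid.mult A" "ring.add ?B = ring.add A" "monoid.one ?B = monoid.one A" "scalar ?B = scalar A"
    "homog ?B = (\<lambda>p. homog A p \<inter> carrier ?B)"
    by (simp_all add: gen_subalgebra_def Let_def)
  have sub: "h \<in> carrier A" if "h \<in> carrier ?B" for h using gen_subalgebra_subset[OF Y] that by blast
  show ?thesis
  proof (rule rep_alg.intro)
    show "inj_on psi (carrier ?B)" by (rule inj_on_subset[OF inj gen_subalgebra_subset[OF Y]])
    show "scalar ?B s \<in> carrier ?B" for s
      unfolding sel gen_subalgebra_carrier by (auto intro: generate_ring.incl)
    show "homog ?B p = {h \<in> carrier ?B. pc (psi h) = (if p then - psi h else psi h)}" for p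
      unfolding sel homog_eq using sub by auto
  qed (use r sub in \<open>simp_all add: sel add mult one scalar\<close>)
qed

end

text \<open>The map on classes is injective and respects the operations, so the ring axioms are
  pulled back from the operators.\<close>

lemma (in presentation) rep_alg: "rep_alg A (ev_class e)"
proof (rule rep_alg.intro)
  have inj: "h = h'" if hh: "h \<in> carrier A" "h' \<in> carrier A" "ev_class e h = ev_class e h'" for h h'
  proof -
    obtain f g where fg: "f \<in> carrier F" "h = cls f" "g \<in> carrier F" "h' = cls g" using hh(1,2) unfolding A_sel by blast
    have "ev e f = ev e g" using hh(3) fg by (simp add: ev_cls)
    then show ?thesis unfolding fg(2,4) by (rule cls_eqI[OF fg(1,3)])
  qed
  have ops: "h \<oplus>\<^bsub>A\<^esub> h' \<in> carrier A \<and> ev_class e (h \<oplus>\<^bsub>A\<^esub> h') = ev_class e h + ev_class e h' \<and>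
      h \<otimes>\<^bsub>A\<^esub> h' \<in> carrier A \<and> ev_class e (h \<otimes>\<^bsub>A\<^esub> h') = ev_class e h * ev_class e h'"
    if hh: "h \<in> carrier A" "h' \<in> carrier A" for h h'
  proof -
    obtain f g where "f \<in> carrier F" "g \<in> carrier F" "h = cls f" "h' = cls g" using hh unfolding A_sel by blast
    then show ?thesis by (simp add: A_ops ev_cls ev_add ev_mult free_add free_mult A_sel(1))
  qed
  have c: "\<one>\<^bsub>A\<^esub> \<in> carrier A" "\<zero>\<^bsub>A\<^esub> \<in> carrier A" "ev_class e \<one>\<^bsub>A\<^esub> = 1" "ev_class e \<zero>\<^bsub>A\<^esub> = 0"
    by (simp_all add: A_sel ev_cls free_1 free_0 ev_1 ev_0)
  have cl: "h \<oplus>\<^bsub>A\<^esub> h' \<in> carrier A" "h \<otimes>\<^bsub>A\<^esub> h' \<in> carrier A"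
    and e: "ev_class e (h \<oplus>\<^bsub>A\<^esub> h') = ev_class e h + ev_class e h'" "ev_class e (h \<otimes>\<^bsub>A\<^esub> h') = ev_class e h * ev_class e h'"
    if hh: "h \<in> carrier A" "h' \<in> carrier A" for h h'
    using ops[OF hh] by blast+
  show "ring A"
  proof (rule ringI)
    show "abelian_group A"
    proof (rule abelian_groupI)
      fix h assume h: "h \<in> carrier A"
      then obtain f where f: "f \<in> carrier F" "h = cls f" unfolding A_sel by blast
      have m: "cls (- f) \<in> carrier A" "ev_class e (cls (- f)) = - ev_class e h"
        using f by (auto simp: A_sel ev_cls free_uminus ev_uminus)
      have "cls (- f) \<oplus>\<^bsub>A\<^esub> h = \<zero>\<^bsub>A\<^esub>"
        by (rule inj) (simp_all only: cl e m h c add.left_inverse)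
      then show "\<exists>y\<in>carrier A. y \<oplus>\<^bsub>A\<^esub> h = \<zero>\<^bsub>A\<^esub>" using m(1) by blast
      show "\<zero>\<^bsub>A\<^esub> \<oplus>\<^bsub>A\<^esub> h = h" by (rule inj) (simp_all only: cl e h c add_0)
      fix h' assume h': "h' \<in> carrier A"
      show "h \<oplus>\<^bsub>A\<^esub> h' \<in> carrier A" by (rule cl(1)[OF h h'])
      show "h \<oplus>\<^bsub>A\<^esub> h' = h' \<oplus>\<^bsub>A\<^esub> h" by (rule inj) (simp_all only: cl e h h' add.commute)
      fix h'' assume h'': "h'' \<in> carrier A"
      show "h \<oplus>\<^bsub>A\<^esub> h' \<oplus>\<^bsub>A\<^esub> h'' = h \<oplus>\<^bsub>A\<^esub> (h' \<oplus>\<^bsub>A\<^esub> h'')" by (rule inj) (simp_all only: cl e h h' h'' add.assoc)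
    qed (rule c(2))
    show "Group.monoid A"
    proof (rule monoidI)
      fix h assume h: "h \<in> carrier A"
      show "\<one>\<^bsub>A\<^esub> \<otimes>\<^bsub>A\<^esub> h = h" "h \<otimes>\<^bsub>A\<^esub> \<one>\<^bsub>A\<^esub> = h" by (rule inj; simp only: cl e h c mult_1_left mult_1_right)+
      fix h' assume h': "h' \<in> carrier A"
      show "h \<otimes>\<^bsub>A\<^esub> h' \<in> carrier A" by (rule cl(2)[OF h h'])
      fix h'' assume h'': "h'' \<in> carrier A"
      show "h \<otimes>\<^bsub>A\<^esub> h' \<otimes>\<^bsub>A\<^esub> h'' = h \<otimes>\<^bsub>A\<^esub> (h' \<otimes>\<^bsub>A\<^esub> h'')" by (rule inj) (simp_all only: cl e h h' h'' mult.assoc)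
    qed (rule c(1))
    fix h h' h'' assume h: "h \<in> carrier A" "h' \<in> carrier A" "h'' \<in> carrier A"
    show "(h \<oplus>\<^bsub>A\<^esub> h') \<otimes>\<^bsub>A\<^esub> h'' = h \<otimes>\<^bsub>A\<^esub> h'' \<oplus>\<^bsub>A\<^esub> h' \<otimes>\<^bsub>A\<^esub> h''"
      "h'' \<otimes>\<^bsub>A\<^esub> (h \<oplus>\<^bsub>A\<^esub> h') = h'' \<otimes>\<^bsub>A\<^esub> h \<oplus>\<^bsub>A\<^esub> h'' \<otimes>\<^bsub>A\<^esub> h'"
      by (rule inj; simp only: cl e h distrib_left distrib_right)+
  qed
  show "inj_on (ev_class e) (carrier A)" by (rule inj_onI) (rule inj)
  show "ev_class e (x \<oplus>\<^bsub>A\<^esub> y) = ev_class e x + ev_class e y" "ev_class e (x \<otimes>\<^bsub>A\<^esub> y) = ev_class e x * ev_class e y"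
    if "x \<in> carrier A" "y \<in> carrier A" for x y using e[OF that] by blast+
  show "ev_class e \<one>\<^bsub>A\<^esub> = 1" by (rule c(3))
  show "scalar A s \<in> carrier A" for s unfolding A_sel using free_scal by blast
  show "ev_class e (scalar A s) = sc s" for s unfolding A_sel by (simp only: ev_cls[OF free_scal] ev_scal)
  show "homog A p = {h \<in> carrier A. pc (ev_class e h) = (if p then - ev_class e h else ev_class e h)}" for p
    by (rule homog_A)
qed

lemma (in presentation) img_A: "ev_class e ` carrier A = alg sc (e ` S)"
proof -
  have "ev_class e ` carrier A = ev e ` carrier F"
    unfolding A_sel image_image by (intro image_cong refl ev_cls)
  then show ?thesis by (simp only: ev_img)
qed

lemma (in presentation) class_gens:
  assumes "T \<subseteq> S"
  shows "(\<lambda>l. cls (fgen l)) ` T \<subseteq> carrier A" "ev_class e ` ((\<lambda>l. cls (fgen l)) ` T) = e ` T"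
proof -
  have T: "fgen l \<in> carrier F" if "l \<in> T" for l by (rule free_fgen[OF subsetD[OF assms that]])
  show "(\<lambda>l. cls (fgen l)) ` T \<subseteq> carrier A"
  proof (rule image_subsetI)
    fix l assume "l \<in> T"
    then show "cls (fgen l) \<in> carrier A" unfolding A_sel(1) by (intro imageI T)
  qed
  show "ev_class e ` ((\<lambda>l. cls (fgen l)) ` T) = e ` T"
    unfolding image_image by (intro image_cong refl) (simp only: ev_cls[OF T] ev_fgen)
qed

section \<open>Faithfulness of the operator model\<close>

primrec lv :: "(nat \<Rightarrow> hend) \<Rightarrow> hc_letter \<Rightarrow> hend" where
  "lv X' (Lx i) = X' i"
| "lv X' (Lc i) = cO i"
| "lv X' (Lw w) = gO w"

lemma lv_letters: "lv X' ` hc_letters n W = X' ` {1..n} \<union> cO ` {1..n} \<union> gO ` W"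
  by (simp add: hc_letters_def image_Un image_image)

lemma fgen_letters: "fgen ` hc_letters n W = x\<^sub>g ` {1..n} \<union> c\<^sub>g ` {1..n} \<union> w\<^sub>g ` W"
  by (simp add: hc_letters_def image_Un image_image)

lemma scal_comm: "f * scal s = scal s * f"
proof -
  have "(\<Sum>w\<in>Poly_Mapping.keys f. Poly_Mapping.single w (Poly_Mapping.lookup f w)) * scal s
      = scal s * (\<Sum>w\<in>Poly_Mapping.keys f. Poly_Mapping.single w (Poly_Mapping.lookup f w))"
    by (simp add: scal_def sum_distrib_left sum_distrib_right mult_single mult.commute)
  then show ?thesis using poly_mapping_sum_single[of f] by argo
qed

lemma scal_add: "scal (s + t) = scal s + scal t" by (simp add: scal_def single_add)
lemma scal_mult: "scal (s * t) = scal s * scal t" by (simp add: scal_def mult_single)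

lemma alg_scal_uminus: assumes "y \<in> alg scal Y" shows "- y \<in> alg scal Y"
  using alg_mult[OF alg_sca[of scal "- 1"] assms] by (simp add: scal_uminus)

text \<open>If g is an involution modulo an ideal and g x = x' g + q holds modulo it, then so does g
  x' = x g - g q g. The identity displays the error as an explicit combination of the two given
  ones.\<close>

lemma conj_identity:
  fixes g x x' q :: "'r :: ring_1"
  shows "- (g * (g * x - x' * g - q) * g) + (g * g - 1) * (x * g) - (g * x') * (g * g - 1) = g * x' - x * g - (- (g * q * g))"
  by (simp add: algebra_simps)

text \<open>The presentations relate only simple reflections to the x_i, which is the reason for the
  separate set \<open>W0\<close>. The relation for s_b and x_(b+1) is not among them and is derived
  from the one for x_b.\<close>

lemma hc_span_free:
  fixes n :: nat and W W0 :: "(vec \<Rightarrow> vec) set" and R :: "hc_letter free set"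
  defines "F \<equiv> free_algebra (hc_letters n W)"
  assumes R: "R \<subseteq> carrier F"
    and W: "finite W" "W0 \<subseteq> W" "id \<in> W" "\<And>u v. u \<in> W \<Longrightarrow> v \<in> W \<Longrightarrow> u \<circ> v \<in> W" "W \<subseteq> wgen W0"
    and grp: "group_rels W \<subseteq> R" and common: "common_rels n k \<subseteq> R"
    and xx: "\<And>i j. i \<in> {1..n} \<Longrightarrow> j \<in> {1..n} \<Longrightarrow> i \<noteq> j \<Longrightarrow> x\<^sub>g i * x\<^sub>g j - x\<^sub>g j * x\<^sub>g i - scal N * (c\<^sub>g j * c\<^sub>g i) \<in> R"
    and W0: "\<And>u. u \<in> W0 \<Longrightarrow> (\<exists>b\<in>{1..<n}. u = refl_in n (std b - std (b + 1))) \<or>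
      u = refl_in n (std n) \<and> n \<ge> 1 \<and> w\<^sub>g u * c\<^sub>g n + c\<^sub>g n * w\<^sub>g u \<in> R \<and>
        (\<forall>i\<in>{1..<n}. w\<^sub>g u * c\<^sub>g i - c\<^sub>g i * w\<^sub>g u \<in> R \<and> w\<^sub>g u * x\<^sub>g i - x\<^sub>g i * w\<^sub>g u \<in> R) \<and>
        (\<exists>s. w\<^sub>g u * x\<^sub>g n + x\<^sub>g n * w\<^sub>g u + scal s \<in> R)"
  shows "hc_span (carrier F) (Idl\<^bsub>F\<^esub> R) scal x\<^sub>g c\<^sub>g w\<^sub>g W W0 n N"
proof -
  interpret F: ring F unfolding F_def by (rule ring_free)
  let ?J = "Idl\<^bsub>F\<^esub> R"
  interpret J: ideal ?J F by (rule F.genideal_ideal[OF R])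
  have RJ: "r \<in> ?J" if "r \<in> R" for r using F.genideal_self[OF R] that by blast
  have gens: "x\<^sub>g i \<in> carrier F" "c\<^sub>g i \<in> carrier F" if "i \<in> {1..n}" for i
    using that unfolding F_def by (auto simp: hc_letters_def intro!: free_fgen)
  have gW: "w\<^sub>g u \<in> carrier F" if "u \<in> W" for u
    using that unfolding F_def by (auto simp: hc_letters_def intro!: free_fgen)
  have J0: "0 \<in> ?J" using J.zero_closed by (simp add: F_def)
  have Ja: "f + h \<in> ?J" if "f \<in> ?J" "h \<in> ?J" for f h using J.a_closed[OF that] by (simp add: F_def)
  have Jl: "f * h \<in> ?J" "h * f \<in> ?J" if "f \<in> carrier F" "h \<in> ?J" for f h
    using J.I_l_closed[OF that(2,1)] J.I_r_closed[OF that(2,1)] by (simp_all add: F_def)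
  have sc_F: "scal s \<in> carrier F" for s unfolding F_def by (rule free_scal)
  have Jm: "- h \<in> ?J" if "h \<in> ?J" for h using Jl(1)[OF sc_F[of "- 1"] that] by (simp add: scal_uminus)
  have Jd: "f - h \<in> ?J" if "f \<in> ?J" "h \<in> ?J" for f h using Ja[OF that(1) Jm[OF that(2)]] by simp
  have fm: "f * h \<in> carrier F" if "f \<in> carrier F" "h \<in> carrier F" for f h using that unfolding F_def by (rule free_mult)
  have c_xc: "x\<^sub>g i * c\<^sub>g j - c\<^sub>g j * x\<^sub>g i \<in> R" if "i \<in> {1..n}" "j \<in> {1..n}" "i \<noteq> j" for i j
    by (rule subsetD[OF common], unfold common_rels_def, rule UnI1, rule UnI1, rule UnI1, rule UnI1, rule UnI1, rule UnI1, rule CollectI, intro exI conjI, rule refl) (use that in simp_all)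
  have c_xc': "x\<^sub>g i * c\<^sub>g i + c\<^sub>g i * x\<^sub>g i \<in> R" if "i \<in> {1..n}" for i
    by (rule subsetD[OF common], unfold common_rels_def, rule UnI1, rule UnI1, rule UnI1, rule UnI1, rule UnI1, rule UnI2, rule CollectI, intro exI conjI, rule refl) (use that in simp_all)
  have c_cc: "c\<^sub>g i * c\<^sub>g j + c\<^sub>g j * c\<^sub>g i \<in> R" if "i \<in> {1..n}" "j \<in> {1..n}" "i \<noteq> j" for i j
    by (rule subsetD[OF common], unfold common_rels_def, rule UnI1, rule UnI1, rule UnI1, rule UnI1, rule UnI2, rule CollectI, intro exI conjI, rule refl) (use that in simp_all)
  have c_c2: "c\<^sub>g i * c\<^sub>g i + 1 \<in> R" if "i \<in> {1..n}" for i
    by (rule subsetD[OF common], unfold common_rels_def, rule UnI1, rule UnI1, rule UnI1, rule UnI2, rule CollectI, intro exI conjI, rule refl) (use that in simp_all)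
  have c_wc: "w\<^sub>g w * c\<^sub>g i - c\<^sub>g j * w\<^sub>g w \<in> R" if "w \<in> weyl n (rootsA n)" "i \<in> {1..n}" "j \<in> {1..n}" "w (std i) = std j" for w i j
    by (rule subsetD[OF common], unfold common_rels_def, rule UnI1, rule UnI1, rule UnI2, rule CollectI, intro exI conjI, rule refl) (use that in simp_all)
  have c_sx: "w\<^sub>g (refl_in n (std i - std (i + 1))) * x\<^sub>g i - x\<^sub>g (i + 1) * w\<^sub>g (refl_in n (std i - std (i + 1)))
        - scal (k (std i - std (i + 1))) * (- 1 + c\<^sub>g i * c\<^sub>g (i + 1)) \<in> R" if "i \<in> {1..<n}" for i
    by (rule subsetD[OF common], unfold common_rels_def, rule UnI1, rule UnI2, rule CollectI, intro exI conjI, rule refl) (use that in simp_all)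
  have c_sx': "w\<^sub>g (refl_in n (std i - std (i + 1))) * x\<^sub>g j - x\<^sub>g j * w\<^sub>g (refl_in n (std i - std (i + 1))) \<in> R"
    if "i \<in> {1..<n}" "j \<in> {1..n}" "j \<noteq> i" "j \<noteq> i + 1" for i j
    by (rule subsetD[OF common], unfold common_rels_def, rule UnI2, rule CollectI, intro exI conjI, rule refl) (use that in simp_all)
  have g_id: "w\<^sub>g id - 1 \<in> R" by (rule subsetD[OF grp]) (unfold group_rels_def, blast)
  have g_gg: "w\<^sub>g u * w\<^sub>g v - w\<^sub>g (u \<circ> v) \<in> R" if "u \<in> W" "v \<in> W" for u v
    by (rule subsetD[OF grp]) (use that in \<open>unfold group_rels_def, blast\<close>)
  let ?SS = "alg scal (c\<^sub>g ` {1..n} \<union> w\<^sub>g ` W)"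
  show ?thesis
  proof
    show "\<exists>s. c\<^sub>g j * x\<^sub>g i - scal s * x\<^sub>g i * c\<^sub>g j \<in> ?J" if ij: "i \<in> {1..n}" "j \<in> {1..n}" for i j
    proof (cases "i = j")
      case True
      show ?thesis by (rule exI[of _ "- 1"]) (use RJ[OF c_xc'[OF ij(1)]] True in \<open>simp add: scal_uminus add.commute\<close>)
    next
      case False
      show ?thesis by (rule exI[of _ 1]) (use Jm[OF RJ[OF c_xc[OF ij False]]] in simp)
    qed
    show "\<exists>s. \<exists>i'\<in>{1..n}. w\<^sub>g u * c\<^sub>g i - scal s * c\<^sub>g i' * w\<^sub>g u \<in> ?J" if u: "u \<in> W0" and i: "i \<in> {1..n}" for u i
      using W0[OF u]
    proof (elim disjE bexE conjE)
      fix b assume b: "b \<in> {1..<n}" and ue: "u = refl_in n (std b - std (b + 1))"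
      have "u \<in> weyl n (rootsA n)"
        unfolding ue rootsA_def by (intro refl_weyl UnI1 rootA_mem) (use b in auto)
      moreover have "Transposition.transpose b (b + 1) i \<in> {1..n}"
        using b i by (auto simp: Transposition.transpose_def)
      moreover have "u (std i) = std (Transposition.transpose b (b + 1) i)"
        unfolding ue by (rule simple_refl_std[OF b])
      ultimately show ?thesis using RJ[OF c_wc[of u i "Transposition.transpose b (b + 1) i"]] i
        by (intro exI[of _ 1] bexI[of _ "Transposition.transpose b (b + 1) i"]) auto
    next
      assume n: "w\<^sub>g u * c\<^sub>g n + c\<^sub>g n * w\<^sub>g u \<in> R"
        and o: "\<forall>i\<in>{1..<n}. w\<^sub>g u * c\<^sub>g i - c\<^sub>g i * w\<^sub>g u \<in> R \<and> w\<^sub>g u * x\<^sub>g i - x\<^sub>g i * w\<^sub>g u \<in> R"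
      show ?thesis
      proof (cases "i = n")
        case True
        show ?thesis by (rule exI[of _ "- 1"], rule bexI[of _ i]) (use RJ[OF n] True i in \<open>simp_all add: scal_uminus\<close>)
      next
        case False
        then have "w\<^sub>g u * c\<^sub>g i - c\<^sub>g i * w\<^sub>g u \<in> R" using o i by auto
        then show ?thesis by (intro exI[of _ 1] bexI[of _ i]) (use RJ i in simp_all)
      qed
    qed
    show "\<exists>s. \<exists>i'\<in>{1..n}. \<exists>e\<in>?SS. w\<^sub>g u * x\<^sub>g i - scal s * x\<^sub>g i' * w\<^sub>g u - e \<in> ?J" if u: "u \<in> W0" and i: "i \<in> {1..n}" for u i
      using W0[OF u]
    proof (elim disjE bexE conjE exE)
      fix b assume b: "b \<in> {1..<n}" and ue: "u = refl_in n (std b - std (b + 1))"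
      have b1: "b \<in> {1..n}" "b + 1 \<in> {1..n}" using b by auto
      let ?q = "scal (k (std b - std (b + 1))) * (- 1 + c\<^sub>g b * c\<^sub>g (b + 1))"
      let ?g = "w\<^sub>g u"
      have r: "?g * x\<^sub>g b - x\<^sub>g (b + 1) * ?g - ?q \<in> ?J" using RJ[OF c_sx[OF b]] unfolding ue .
      have m1: "- 1 \<in> ?SS" using alg_scal_uminus[OF alg_sca[of scal 1]] by simp
      have cS: "c\<^sub>g l \<in> ?SS" if "l \<in> {1..n}" for l using that by (intro alg_gen) auto
      have q: "?q \<in> ?SS" by (intro alg_mult[OF alg_sca alg_add[OF m1 alg_mult]] cS b1)
      have uW: "u \<in> W" using u W(2) by blast
      have gS: "?g \<in> ?SS" using uW by (intro alg_gen) auto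
      consider "i = b" | "i = b + 1" | "i \<noteq> b" "i \<noteq> b + 1" by blast
      then show ?thesis
      proof cases
        case 1
        then show ?thesis using r q b1 by (intro exI[of _ 1] bexI[of _ "b + 1"] bexI[of _ ?q]) auto
      next
        case 2
        have "refl_in n (std b - std (b + 1)) \<circ> refl_in n (std b - std (b + 1)) = id"
          using b1 refl_diff[of b n "b + 1"] by (simp add: fun_eq_iff)
        then have uu: "u \<circ> u = id" unfolding ue .
        have d: "?g * ?g - 1 \<in> ?J" using Ja[OF RJ[OF g_gg[OF uW uW]] RJ[OF g_id]] unfolding uu by simp
        \<comment> \<open>The left side lies in the ideal by its shape; \<open>conj_identity\<close>
          rewrites it as the relation wanted for x_(b+1).\<close>
        have "- (?g * (?g * x\<^sub>g b - x\<^sub>g (b + 1) * ?g - ?q) * ?g) + (?g * ?g - 1) * (x\<^sub>g b * ?g) - (?g * x\<^sub>g (b + 1)) * (?g * ?g - 1) \<in> ?J"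
          by (intro Ja Jd Jm Jl fm r d gW[OF uW] gens b1)
        also have "- (?g * (?g * x\<^sub>g b - x\<^sub>g (b + 1) * ?g - ?q) * ?g) + (?g * ?g - 1) * (x\<^sub>g b * ?g) - (?g * x\<^sub>g (b + 1)) * (?g * ?g - 1)
            = ?g * x\<^sub>g (b + 1) - x\<^sub>g b * ?g - (- (?g * ?q * ?g))"
          by (rule conj_identity)
        finally have "?g * x\<^sub>g (b + 1) - x\<^sub>g b * ?g - (- (?g * ?q * ?g)) \<in> ?J" .
        moreover have "- (?g * ?q * ?g) \<in> ?SS" by (intro alg_scal_uminus alg_mult[OF alg_mult] gS q)
        ultimately show ?thesis using b1 2
          by (intro exI[of _ 1] bexI[of _ b] bexI[of _ "- (?g * ?q * ?g)"]) auto
      next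
        case 3
        have "0 \<in> ?SS" using alg_sca[of scal 0] by simp
        then show ?thesis using RJ[OF c_sx'[OF b i 3]] i unfolding ue
          by (intro exI[of _ 1] bexI[of _ i] bexI[of _ 0]) auto
      qed
    next
      fix s assume n: "w\<^sub>g u * x\<^sub>g n + x\<^sub>g n * w\<^sub>g u + scal s \<in> R"
        and o: "\<forall>i\<in>{1..<n}. w\<^sub>g u * c\<^sub>g i - c\<^sub>g i * w\<^sub>g u \<in> R \<and> w\<^sub>g u * x\<^sub>g i - x\<^sub>g i * w\<^sub>g u \<in> R"
      show ?thesis
      proof (cases "i = n")
        case True
        show ?thesis by (rule exI[of _ "- 1"], rule bexI[of _ i], rule bexI[of _ "scal (- s)"])
          (use RJ[OF n] True i in \<open>simp_all add: scal_uminus alg_scal_uminus alg_sca\<close>)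
      next
        case False
        then have "w\<^sub>g u * x\<^sub>g i - x\<^sub>g i * w\<^sub>g u \<in> R" using o i by auto
        moreover have "0 \<in> ?SS" using alg_sca[of scal 0] by simp
        ultimately show ?thesis by (intro exI[of _ 1] bexI[of _ i] bexI[of _ 0]) (use RJ i in simp_all)
      qed
    qed
    show "f + h \<in> carrier F" if "f \<in> carrier F" "h \<in> carrier F" for f h using that unfolding F_def by (rule free_add)
  qed (rule W sc_F gens gW fm J0 Ja Jl scal_0 scal_1 scal_add scal_mult scal_comm RJ[OF c_cc] RJ[OF c_c2] RJ[OF xx] RJ[OF g_id] RJ[OF g_gg]; assumption)+
qed

text \<open>Over the identity permutation c_a creates mode a + 1. Distinct letters therefore fill
  distinct modes, up to a nonzero scalar.\<close>

lemma app_cm: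
  assumes "distinct l" "Suc ` set l \<inter> I = {}" "Rep_sperm w1 = id"
  shows "\<exists>\<kappa> e'. \<kappa> \<noteq> 0 \<and> (\<forall>f. app (prod_list (map cO l)) f (w1, I, e, b, d) = \<kappa> * f (w1, I \<union> Suc ` set l, e', b, d))"
  using assms(1,2)
proof (induction l arbitrary: I e)
  case Nil show ?case by (intro exI[of _ 1] exI[of _ e]) simp
next
  case (Cons a l)
  have one: "std a = (\<lambda>m. sp_sgn w1 a * std (sp_pos w1 a) m)" using sp_std[of w1 a] assms(3) by simp
  have p: "sp_pos w1 a = a" using fun_cong[OF one, of a] by (auto simp: std_def split: if_splits)
  have s: "sp_sgn w1 a = 1" using fun_cong[OF one, of a] p by (simp add: std_def)
  have "flip (Suc a) I = insert (Suc a) I" using Cons.prems by (auto simp: flip_def)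
  moreover obtain \<kappa> e' where "\<kappa> \<noteq> 0"
    "\<forall>f. app (prod_list (map cO l)) f (w1, insert (Suc a) I, \<not> e, b, d) = \<kappa> * f (w1, insert (Suc a) I \<union> Suc ` set l, e', b, d)"
    using Cons.IH[of "insert (Suc a) I" "\<not> e"] Cons.prems by auto
  moreover have "jw (Suc a) I \<noteq> 0" using jw_square[of "Suc a" I] by auto
  moreover have "app (cO a) h (w1, I, e, b, d) = \<i> * jw (Suc a) I * h (w1, flip (Suc a) I, \<not> e, b, d)" for h
    by (simp add: cO_def p s)
  ultimately show ?case
    by (intro exI[of _ "\<i> * jw (Suc a) I * \<kappa>"] exI[of _ e']) simp
qed

text \<open>From the index with identity permutation and no occupied mode, the product belonging to
  I and w leads to group component w and occupied modes I + 1. Different pairs lead to different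
  places, so a suitable indicator function isolates one coefficient.\<close>

lemma cm_gO_independent:
  assumes W: "finite W" "\<And>w. w \<in> W \<Longrightarrow> signed_perm {1..n} w"
    and 0: "(\<Sum>I\<in>Pow {1..n}. \<Sum>w\<in>W. sc (s I w) * (cm cO I * gO w)) = 0"
    and I0: "I0 \<in> Pow {1..n}" and w0: "w0 \<in> W"
  shows "s I0 w0 = 0"
proof -
  define w1 where "w1 = Abs_sperm id"
  have w1: "Rep_sperm w1 = id" unfolding w1_def by (rule Abs_sperm_inverse) simp
  \<comment> \<open>The indicator of the place reached by the pair (I0, w0).\<close>
  define f :: "idx \<Rightarrow> complex" where
    "f = (\<lambda>\<iota>. if fst \<iota> = sp_mult w1 w0 \<and> fst (snd \<iota>) = Suc ` I0 then 1 else 0)"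
  have ex: "\<exists>\<kappa> e'. \<kappa> \<noteq> 0 \<and> (\<forall>f. app (cm cO I) f (w1, {}, False, b, d) = \<kappa> * f (w1, Suc ` I, e', b, d))" if "I \<subseteq> {1..n}" for I b d
  proof -
    have "finite I" using that finite_subset by blast
    then show ?thesis using app_cm[of "sorted_list_of_set I" "{}" w1 False b d] w1 by (simp add: cm_def)
  qed
  have rep: "Rep_sperm (sp_mult w1 w) = w" if "w \<in> W" for w
    using Rep_sp_mult[OF W(2)[OF that], of w1] by (simp add: w1)
  have mono: "w = w0" if "w \<in> W" "sp_mult w1 w = sp_mult w1 w0" for w
    using rep[OF that(1)] rep[OF w0] unfolding that(2) by (rule trans[OF sym])
  let ?\<iota> = "(w1, {}, False, \<lambda>_. 0, 0)"
  obtain \<kappa>0 where k0: "\<kappa>0 \<noteq> 0" "app (cm cO I0 * gO w0) f ?\<iota> = \<kappa>0"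
    using ex[of I0 "\<lambda>_. 0" 0] I0 by (auto simp: gO_def f_def)
  have t: "app (cm cO I * gO w) f ?\<iota> = (if I = I0 \<and> w = w0 then \<kappa>0 else 0)" if Iw: "I \<in> Pow {1..n}" "w \<in> W" for I w
  proof (cases "I = I0 \<and> w = w0")
    case True then show ?thesis using k0 by simp
  next
    case False
    obtain \<kappa> e' where "\<forall>f. app (cm cO I) f ?\<iota> = \<kappa> * f (w1, Suc ` I, e', (\<lambda>_. 0), 0)" using ex[of I "\<lambda>_. 0" 0] Iw(1) by blast
    moreover have "\<not> (sp_mult w1 w = sp_mult w1 w0 \<and> Suc ` I = Suc ` I0)"
      using False mono[OF Iw(2)] by (auto simp: inj_image_eq_iff)
    ultimately show ?thesis unfolding if_not_P[OF False] by (auto simp: gO_def f_def)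
  qed
  have "0 = app (\<Sum>I\<in>Pow {1..n}. \<Sum>w\<in>W. sc (s I w) * (cm cO I * gO w)) f ?\<iota>" unfolding 0 by simp
  also have "\<dots> = (\<Sum>I\<in>Pow {1..n}. \<Sum>w\<in>W. s I w * app (cm cO I * gO w) f ?\<iota>)" by simp
  also have "\<dots> = (\<Sum>I\<in>Pow {1..n}. \<Sum>w\<in>W. if I = I0 \<and> w = w0 then s I0 w0 * \<kappa>0 else 0)"
    by (intro sum.cong refl) (auto simp: t simp del: app_simps)
  also have "\<dots> = (\<Sum>I\<in>Pow {1..n}. if I = I0 then s I0 w0 * \<kappa>0 else 0)"
    by (intro sum.cong refl) (use W(1) w0 in simp)
  also have "\<dots> = s I0 w0 * \<kappa>0" using I0 by simp
  finally show ?thesis using k0(1) by simp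
qed

lemma ev_prod_list: "ev e (prod_list (map f l)) = prod_list (map (\<lambda>i. ev e (f i)) l)"
  by (induction l) (simp_all add: ev_simps)

context hc_full
begin

text \<open>Modulo the relations f is an ordered expansion. If it evaluates to zero, then its top
  coefficients evaluate to zero by independence of the shift monomials, and such coefficients
  already lie in J; induction on the degree removes all terms.\<close>

lemma faithful:
  fixes J :: "hc_letter free set"
  assumes "hc_span (carrier (free_algebra (hc_letters n W))) J scal x\<^sub>g c\<^sub>g w\<^sub>g W W0 n N"
    and Jev: "\<And>f. f \<in> J \<Longrightarrow> ev (lv xO) f = 0"
    and f: "f \<in> carrier (free_algebra (hc_letters n W))" "ev (lv xO) f = 0"
  shows "f \<in> J"
proof -
  interpret hs: hc_span "carrier (free_algebra (hc_letters n W))" J scal x\<^sub>g c\<^sub>g w\<^sub>g W W0 n N by (rule assms(1))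
  let ?e = "ev (lv xO)"
  have e_cm: "?e (cm c\<^sub>g I) = cm cO I" and e_xm: "?e (xm x\<^sub>g A) = xm xO A" for I A
    by (simp_all add: cm_def xm_def ev_prod_list ev_fgen)
  have eqv: "?e h = ?e h'" if "hs.eqJ h h'" for h h' using Jev[of "h - h'"] that unfolding hs.eqJ_def by (simp add: ev_diff)
  have eqJ_0: "h \<in> J" if "hs.eqJ h h'" "h' \<in> J" for h h'
    using hs.J_add[OF _ that(2), of "h - h'"] that(1) unfolding hs.eqJ_def by simp
  have e_Sg: "?e u \<in> Sg" if "u \<in> hs.SS" for u
    using that
  proof induction
    case (alg_gen y) then show ?case by (auto simp: ev_fgen simp del: atLeastAtMost_iff intro: Sg_cO Sg_gO)
  qed (auto simp: ev_simps intro: alg_sca alg_add alg_mult)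
  \<comment> \<open>For coefficients the independence of the products c_I g_w forces all scalars of
    the normal form to vanish.\<close>
  have SSJ: "u \<in> J" if u: "u \<in> hs.SS" "?e u = 0" for u
  proof -
    obtain s where s: "hs.eqJ u (\<Sum>I\<in>Pow {1..n}. \<Sum>w\<in>W. scal (s I w) * (cm c\<^sub>g I * w\<^sub>g w))"
      using hs.SS_NF[OF u(1)] unfolding hs.NF_def by blast
    have "(\<Sum>I\<in>Pow {1..n}. \<Sum>w\<in>W. sc (s I w) * (cm cO I * gO w)) = 0"
      using eqv[OF s] u(2) by (simp add: ev_simps e_cm)
    then have "s I w = 0" if "I \<in> Pow {1..n}" "w \<in> W" for I w
      using cm_gO_independent[OF W_fin W_sp] that by blast
    then have "(\<Sum>I\<in>Pow {1..n}. \<Sum>w\<in>W. scal (s I w) * (cm c\<^sub>g I * w\<^sub>g w)) = 0"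
      by (intro sum.neutral ballI) simp
    then show ?thesis using eqJ_0[OF s] hs.J_0 by simp
  qed
  have J_sum: "sum G B \<in> J" if "\<And>b. b \<in> B \<Longrightarrow> G b \<in> J" for G :: "nat multiset \<Rightarrow> hc_letter free" and B
    using that by (induction B rule: infinite_finite_induct) (auto intro: hs.J_0 hs.J_add)
  have main: "(\<Sum>l\<le>m. \<Sum>A\<in>Fset n l. xm x\<^sub>g A * U A) \<in> J"
    if US: "\<forall>A. U A \<in> hs.SS" and e0: "?e (\<Sum>l\<le>m. \<Sum>A\<in>Fset n l. xm x\<^sub>g A * U A) = 0" for m U
    using e0
  proof (induction m)
    case (0)
    have eS: "?e (U A) \<in> Sg" for A using e_Sg US by blast
    have "(\<Sum>l\<le>0. \<Sum>A\<in>Fset n l. xm xO A * ?e (U A)) = 0" using 0 by (simp only: ev_simps e_xm)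
    then have s0: "(\<Sum>A\<in>Fset n 0. xm sO A * ?e (U A)) = 0"
      using dcomp_expansion[of "\<lambda>A. ?e (U A)" 0 0, OF eS] by simp
    have U0: "?e (U A) = 0" if A: "A \<in> Fset n 0" for A by (rule Sg_independent[of "\<lambda>A. ?e (U A)", OF eS s0 A])
    have "(\<Sum>A\<in>Fset n 0. xm x\<^sub>g A * U A) \<in> J"
      by (rule J_sum, rule hs.J_left[OF hs.xm_Cr SSJ]) (use US U0 in auto)
    then show ?case by simp
  next
    case (Suc m)
    have eS: "?e (U A) \<in> Sg" for A using e_Sg US by blast
    have "(\<Sum>l\<le>Suc m. \<Sum>A\<in>Fset n l. xm xO A * ?e (U A)) = 0" using Suc.prems by (simp only: ev_simps e_xm)
    then have s0: "(\<Sum>A\<in>Fset n (Suc m). xm sO A * ?e (U A)) = 0"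
      using dcomp_expansion[of "\<lambda>A. ?e (U A)" "Suc m" "int (Suc m)", OF eS] by (simp only: dcomp_simps order.refl if_True simp_thms)
    have U0: "?e (U A) = 0" if A: "A \<in> Fset n (Suc m)" for A by (rule Sg_independent[of "\<lambda>A. ?e (U A)", OF eS s0 A])
    have "(\<Sum>A\<in>Fset n (Suc m). xm x\<^sub>g A * U A) \<in> J"
      by (rule J_sum, rule hs.J_left[OF hs.xm_Cr SSJ]) (use US U0 in auto)
    moreover have "(\<Sum>A\<in>Fset n (Suc m). xm xO A * ?e (U A)) = 0" by (intro sum.neutral) (simp add: U0)
    then have "?e (\<Sum>l\<le>m. \<Sum>A\<in>Fset n l. xm x\<^sub>g A * U A) = 0"
      using Suc.prems by (simp add: ev_simps e_xm)
    ultimately show ?case using Suc.IH hs.J_add by simp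
  qed
  have "f \<in> hs.HH" using f(1) by (simp only: free_alg fgen_letters)
  then obtain m where "f \<in> hs.Sp m" using hs.HH_Sp by blast
  then obtain U where U: "\<forall>A. U A \<in> hs.SS" "hs.eqJ f (\<Sum>l\<le>m. \<Sum>A\<in>Fset n l. xm x\<^sub>g A * U A)"
    unfolding hs.Sp_def by blast
  show ?thesis by (rule eqJ_0[OF U(2) main[OF U(1)]]) (use eqv[OF U(2)] f(2) in simp)
qed

lemma pc_lv: "l \<in> hc_letters n W \<Longrightarrow> pc (lv xO l) = (if is_Lc l then - lv xO l else lv xO l)"
  by (auto simp: hc_letters_def pc_ops pc_xO)

text \<open>The only point is the normalisation: the squared length in D and the normalised
  c_\<alpha> combine to the length, which is the one contained in \<open>kp\<close>.\<close>

lemma ev_dirac: "ev (lv xO) ((\<Sum>i = 1..n. x\<^sub>g i * c\<^sub>g i) + scal (complex_of_real (sqrt 2 / 2)) *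
    (\<Sum>\<alpha>\<in>P. scal (k \<alpha> * complex_of_real (ip n \<alpha> \<alpha>)) * s_tilde n \<alpha>)) = DO"
proof -
  have "sc (complex_of_real (sqrt 2 / 2)) * (sc (k \<alpha> * complex_of_real (ip n \<alpha> \<alpha>)) * ev (lv xO) (s_tilde n \<alpha>)) = sc (kp \<alpha>) * rs n \<alpha>"
    if \<alpha>: "\<alpha> \<in> P" for \<alpha>
  proof -
    let ?q = "ip n \<alpha> \<alpha>"
    have q: "?q > 0" by (rule ip_root[OF \<alpha>])
    have "ev (lv xO) (c_root n \<alpha>) = lin n cO (\<lambda>i. (1 / sqrt ?q) * \<alpha> i)"
      by (simp add: c_root_def ev_simps lin_def)
    also have "\<dots> = sc (complex_of_real (1 / sqrt ?q)) * cv n \<alpha>" by (rule lin_cmult)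
    finally have c: "ev (lv xO) (s_tilde n \<alpha>) = sc (complex_of_real (1 / sqrt ?q)) * rs n \<alpha>"
      unfolding s_tilde_def rs_def by (simp only: ev_mult ev_fgen lv.simps sc_ops)
    have "?q * (1 / sqrt ?q) = sqrt ?q" using q real_div_sqrt[of ?q] by simp
    then have "complex_of_real ?q * complex_of_real (1 / sqrt ?q) = complex_of_real (sqrt ?q)" by (metis of_real_mult)
    then have "k \<alpha> * complex_of_real ?q * complex_of_real (1 / sqrt ?q) = k \<alpha> * complex_of_real (sqrt ?q)"
      by (simp only: mult.assoc)
    then have "complex_of_real (sqrt 2 / 2) * (k \<alpha> * complex_of_real ?q * complex_of_real (1 / sqrt ?q)) = kp \<alpha>"
      unfolding kp_def of_real_mult by (simp only: mult.left_commute)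
    then show ?thesis unfolding c by (simp only: sc_sc mult.assoc)
  qed
  then have K: "(\<Sum>\<alpha>\<in>P. sc (complex_of_real (sqrt 2 / 2)) * (sc (k \<alpha> * complex_of_real (ip n \<alpha> \<alpha>)) * ev (lv xO) (s_tilde n \<alpha>))) = KO"
    unfolding KO_def by (intro sum.cong refl)
  show ?thesis unfolding DO_def K[symmetric] by (simp only: ev_simps lv.simps sum_distrib_left)
qed

end

section \<open>The defining relations in the model\<close>

context hc_simple
begin

lemma rel_simple:
  assumes b: "b \<in> {1..<n}" and B: "std b - std (b + 1) \<in> B" and j: "j \<in> {1..n}"
  shows "gO (refl_in n (std b - std (b + 1))) * xO b - xO (b + 1) * gO (refl_in n (std b - std (b + 1)))
      - sc (k (std b - std (b + 1))) * (- 1 + cO b * cO (b + 1)) = 0"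
    and "j \<noteq> b \<Longrightarrow> j \<noteq> b + 1 \<Longrightarrow> gO (refl_in n (std b - std (b + 1))) * xO j = xO j * gO (refl_in n (std b - std (b + 1)))"
proof -
  let ?\<beta> = "std b - std (b + 1) :: vec"
  have b1: "b \<in> {1..n}" "b + 1 \<in> {1..n}" using b by auto
  have "ip n ?\<beta> ?\<beta> = 2" using b1 by (simp add: ip_diff_left ip_diff_right ip_std)
  then have kap: "kap ?\<beta> = k ?\<beta>" by (simp add: kap_def)
  have cb: "cv n ?\<beta> = cO b - cO (b + 1)" using b1 by (simp only: lin_diff lin_std)
  {
    have p: "pr ?\<beta> (std b) = std b" by (auto simp: pr_def std_def fun_eq_iff)
    have r: "refl_in n ?\<beta> (std b) = std (b + 1)" unfolding simple_refl_std[OF b] by simp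
    have "(cO b - cO (b + 1)) * cO b = - 1 + cO b * cO (b + 1)"
      using cO_anti[of "b + 1" b] by (simp add: left_diff_distrib cO_sq)
    then show "gO (refl_in n ?\<beta>) * xO b - xO (b + 1) * gO (refl_in n ?\<beta>) - sc (k ?\<beta>) * (- 1 + cO b * cO (b + 1)) = 0"
      using gO_xv_simple[OF B, of "std b"] by (simp add: kap cb p r lin_std[OF b1(1)] xO_def)
  next
    assume jb: "j \<noteq> b" "j \<noteq> b + 1"
    have p: "pr ?\<beta> (std j) = (\<lambda>i. 0 * std j i)" using jb by (auto simp: pr_def std_def fun_eq_iff)
    have r: "refl_in n ?\<beta> (std j) = std j" unfolding simple_refl_std[OF b] using jb by (simp add: Transposition.transpose_def)
    show "gO (refl_in n ?\<beta>) * xO j = xO j * gO (refl_in n ?\<beta>)"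
      using gO_xv_simple[OF B, of "std j"] unfolding p r lin_cmult by (simp add: xO_def)
  }
qed

lemma rel_short:
  assumes n: "n \<ge> 1" and B: "std n \<in> B" and j: "j \<in> {1..<n}"
  shows "gO (refl_in n (std n)) * xO j = xO j * gO (refl_in n (std n))"
    and "gO (refl_in n (std n)) * cO j = cO j * gO (refl_in n (std n))"
proof -
  have nn: "n \<in> {1..n}" using n by simp
  have p: "pr (std n) (std j) = (\<lambda>i. 0 * std j i)" using j by (auto simp: pr_def std_def fun_eq_iff)
  have r: "refl_in n (std n) (std j) = std j" unfolding refl_std[OF nn] using j by (auto simp: std_def fun_eq_iff)
  show "gO (refl_in n (std n)) * xO j = xO j * gO (refl_in n (std n))"
    using gO_xv_simple[OF B, of "std j"] unfolding p r lin_cmult by (simp add: xO_def)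
  show "gO (refl_in n (std n)) * cO j = cO j * gO (refl_in n (std n))"
    using gO_cO_std[OF W_sp[OF refl_W], of "std n" j 1 j] B B_P r by (auto simp: fun_eq_iff)
qed

text \<open>Here \<open>kap\<close> of the short root is \<surd>2 times k, and c_n^2 = -1 supplies
  the sign of the inhomogeneous term.\<close>

lemma rel_short_n:
  assumes n: "n \<ge> 1" and B: "std n \<in> B"
  shows "gO (refl_in n (std n)) * xO n + xO n * gO (refl_in n (std n)) + sc (complex_of_real (sqrt 2) * k (std n)) = 0"
    and "gO (refl_in n (std n)) * cO n = - (cO n * gO (refl_in n (std n)))"
proof -
  have nn: "n \<in> {1..n}" using n by simp
  have p: "pr (std n) (std n) = std n" by (auto simp: pr_def std_def fun_eq_iff)
  have r: "refl_in n (std n) (std n) = (\<lambda>l. - 1 * std n l)" unfolding refl_std[OF nn] by (auto simp: std_def fun_eq_iff)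
  have kap: "kap (std n) = complex_of_real (sqrt 2) * k (std n)" using nn by (simp add: kap_def ip_std)
  have "xv (\<lambda>l. - 1 * std n l) = - xO n" unfolding xv_scale xO_def by (simp add: sc_uminus)
  then show "gO (refl_in n (std n)) * xO n + xO n * gO (refl_in n (std n)) + sc (complex_of_real (sqrt 2) * k (std n)) = 0"
    using gO_xv_simple[OF B, of "std n"] unfolding p r kap lin_std[OF nn] cO_sq by (simp add: xO_def)
  show "gO (refl_in n (std n)) * cO n = - (cO n * gO (refl_in n (std n)))"
    using gO_cO_std[OF W_sp[OF refl_W], of "std n" n "- 1" n] B B_P r by (auto simp: sc_uminus)
qed

end

section \<open>Modules and Dirac cohomology\<close>

definition peval :: "hend \<Rightarrow> complex poly \<Rightarrow> hend" where
  "peval Y p = fold_coeffs (\<lambda>a T. sc a + Y * T) p 0"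

lemma peval_0 [simp]: "peval Y 0 = 0"
  by (simp add: peval_def)

lemma peval_pCons: "peval Y (pCons a p) = sc a + Y * peval Y p"
  by (cases "p = 0 \<and> a = 0") (auto simp: peval_def)

lemma peval_add: "peval Y (p + q) = peval Y p + peval Y q"
  by (induction p q rule: poly_induct2) (simp_all add: peval_pCons sc_add distrib_left add_ac)

lemma peval_smult: "peval Y (smult c p) = sc c * peval Y p"
  by (induction p) (simp_all add: peval_pCons sc_mult distrib_left sc_left[of Y])

lemma peval_monom: "peval Y (monom c i) = sc c * Y ^ i"
  by (induction i) (simp_all add: monom_0 monom_Suc peval_pCons sc_left[of Y])

lemma peval_sum: "peval Y (sum F A) = (\<Sum>a\<in>A. peval Y (F a))"
  by (induction A rule: infinite_finite_induct) (simp_all add: peval_add)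

lemma peval_diff: "peval Y (p - q) = peval Y p - peval Y q"
  using peval_add[of Y "p - q" q] by simp

lemma peval_linear_factor: "peval Y ([:- r, 1:] * q) = (Y - sc r) * peval Y q"
  by (simp add: peval_add peval_diff peval_smult peval_pCons sc_uminus left_diff_distrib)

text \<open>The powers of exponent at most the cardinality of T are one too many to be distinct and
  independent. A coincidence gives a difference of two monomials, a dependence gives its
  coefficients as a polynomial.\<close>

lemma annihilating_poly:
  assumes "finite T" and span: "\<And>i. \<exists>s. Y ^ i = (\<Sum>v\<in>T. sc (s v) * v)"
  shows "\<exists>p. p \<noteq> 0 \<and> peval Y p = 0"
proof -
  interpret vs: vector_space "\<lambda>s (v :: hend). sc s * v"
    by unfold_locales (simp_all add: distrib_left distrib_right sc_add sc_sc)
  have inspan: "Y ^ i \<in> vs.span T" for i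
  proof -
    obtain s where s: "Y ^ i = (\<Sum>v\<in>T. sc (s v) * v)" using span by blast
    show ?thesis unfolding s by (intro vs.span_sum vs.span_scale vs.span_base)
  qed
  show ?thesis
  proof (cases "inj_on (\<lambda>i. Y ^ i) {..card T}")
    case False
    then obtain i j where ij: "i \<noteq> j" "Y ^ i = Y ^ j" unfolding inj_on_def by blast
    have "coeff (monom 1 i + monom (- 1) j) i = (1 :: complex)" using ij(1) by simp
    then have "monom 1 i + monom (- 1) j \<noteq> (0 :: complex poly)" by (metis coeff_0 zero_neq_one)
    moreover have "peval Y (monom 1 i + monom (- 1) j) = 0"
      by (simp add: peval_add peval_monom ij(2) sc_uminus)
    ultimately show ?thesis by blast
  next
    case True
    let ?S = "(\<lambda>i. Y ^ i) ` {..card T}"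
    have "card ?S = Suc (card T)" using True by (simp add: card_image)
    then have "vs.dependent ?S"
      using vs.independent_span_bound[OF assms(1), of ?S] inspan by fastforce
    then obtain s where s: "(\<Sum>v\<in>?S. sc (s v) * v) = 0" "\<exists>v\<in>?S. s v \<noteq> 0"
      using vs.dependent_finite[of ?S] by auto
    obtain i where i: "i \<le> card T" "s (Y ^ i) \<noteq> 0" using s(2) by auto
    define p where "p = (\<Sum>i\<le>card T. monom (s (Y ^ i)) i)"
    have "coeff p i = s (Y ^ i)" using i(1) by (simp add: p_def coeff_sum if_distrib cong: if_cong)
    then have "p \<noteq> 0" using i(2) by auto
    moreover have "peval Y p = (\<Sum>v\<in>?S. sc (s v) * v)"
      unfolding sum.reindex[OF True] by (simp add: p_def peval_sum peval_monom)
    ultimately show ?thesis using s(1) by auto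
  qed
qed

section \<open>Modules, and kernels and images of central elements\<close>

lemma (in left_module) smult_zero_right: assumes "a \<in> carrier A" shows "a \<odot>\<^bsub>M\<^esub> \<zero>\<^bsub>M\<^esub> = \<zero>\<^bsub>M\<^esub>"
proof -
  have "a \<odot>\<^bsub>M\<^esub> \<zero>\<^bsub>M\<^esub> \<oplus>\<^bsub>M\<^esub> a \<odot>\<^bsub>M\<^esub> \<zero>\<^bsub>M\<^esub> = a \<odot>\<^bsub>M\<^esub> \<zero>\<^bsub>M\<^esub>"
    using smult_r_distr[OF assms M.zero_closed M.zero_closed] by simp
  then show ?thesis using M.add.l_cancel_one[of "a \<odot>\<^bsub>M\<^esub> \<zero>\<^bsub>M\<^esub>" "a \<odot>\<^bsub>M\<^esub> \<zero>\<^bsub>M\<^esub>"] smult_closed[OF assms M.zero_closed] by simp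
qed

lemma (in left_module) smult_minus_right:
  assumes "a \<in> carrier A" "x \<in> carrier M" shows "a \<odot>\<^bsub>M\<^esub> (\<ominus>\<^bsub>M\<^esub> x) = \<ominus>\<^bsub>M\<^esub> (a \<odot>\<^bsub>M\<^esub> x)"
proof -
  have "a \<odot>\<^bsub>M\<^esub> (\<ominus>\<^bsub>M\<^esub> x) \<oplus>\<^bsub>M\<^esub> a \<odot>\<^bsub>M\<^esub> x = \<zero>\<^bsub>M\<^esub>"
    using smult_r_distr[OF assms(1) M.a_inv_closed[OF assms(2)] assms(2)] assms by (simp add: M.l_neg smult_zero_right)
  then show ?thesis using assms by (intro M.minus_equality[symmetric]) (auto intro: smult_closed)
qed

lemma (in left_module) smult_diff_right:
  assumes "a \<in> carrier A" "x \<in> carrier M" "y \<in> carrier M"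
  shows "a \<odot>\<^bsub>M\<^esub> (x \<ominus>\<^bsub>M\<^esub> y) = a \<odot>\<^bsub>M\<^esub> x \<ominus>\<^bsub>M\<^esub> a \<odot>\<^bsub>M\<^esub> y"
  using assms by (simp add: M.minus_eq smult_r_distr smult_minus_right)

lemma (in left_module) smult_diff_left:
  assumes "a \<in> carrier A" "b \<in> carrier A" "x \<in> carrier M"
  shows "(a \<ominus>\<^bsub>A\<^esub> b) \<odot>\<^bsub>M\<^esub> x = a \<odot>\<^bsub>M\<^esub> x \<ominus>\<^bsub>M\<^esub> b \<odot>\<^bsub>M\<^esub> x"
proof -
  have "(a \<ominus>\<^bsub>A\<^esub> b) \<odot>\<^bsub>M\<^esub> x \<oplus>\<^bsub>M\<^esub> b \<odot>\<^bsub>M\<^esub> x = ((a \<ominus>\<^bsub>A\<^esub> b) \<oplus>\<^bsub>A\<^esub> b) \<odot>\<^bsub>M\<^esub> x"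
    using assms by (simp add: smult_l_distr)
  also have "(a \<ominus>\<^bsub>A\<^esub> b) \<oplus>\<^bsub>A\<^esub> b = a" using assms by (simp add: R.minus_eq R.a_assoc R.l_neg)
  finally have e: "a \<odot>\<^bsub>M\<^esub> x = (a \<ominus>\<^bsub>A\<^esub> b) \<odot>\<^bsub>M\<^esub> x \<oplus>\<^bsub>M\<^esub> b \<odot>\<^bsub>M\<^esub> x" by simp
  show ?thesis unfolding e
    using assms smult_closed[OF R.minus_closed[OF assms(1,2)] assms(3)] smult_closed[OF assms(2,3)]
    by (simp add: M.minus_eq M.a_assoc M.r_neg)
qed

lemma (in abelian_group) minus_eq_zero: "x \<in> carrier G \<Longrightarrow> y \<in> carrier G \<Longrightarrow> x \<ominus>\<^bsub>G\<^esub> y = \<zero>\<^bsub>G\<^esub> \<longleftrightarrow> x = y"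
  by (metis minus_eq a_inv_closed r_neg minus_equality minus_minus)

lemma (in left_module) kernel_submodule:
  assumes "t \<in> carrier A" "\<And>a. a \<in> carrier A \<Longrightarrow> t \<otimes>\<^bsub>A\<^esub> a = a \<otimes>\<^bsub>A\<^esub> t"
  shows "submodule {x \<in> carrier M. t \<odot>\<^bsub>M\<^esub> x = \<zero>\<^bsub>M\<^esub>} A M"
proof (intro submodule.intro submodule_axioms.intro)
  show "subgroup {x \<in> carrier M. t \<odot>\<^bsub>M\<^esub> x = \<zero>\<^bsub>M\<^esub>} (add_monoid M)"
    by (rule M.add.subgroupI)
      (use assms(1) smult_zero_right smult_minus_right smult_r_distr M.zero_closed in \<open>auto simp: a_inv_def[symmetric]\<close>)
  fix a x assume a: "a \<in> carrier A" and x: "x \<in> {x \<in> carrier M. t \<odot>\<^bsub>M\<^esub> x = \<zero>\<^bsub>M\<^esub>}"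
  then have "t \<odot>\<^bsub>M\<^esub> (a \<odot>\<^bsub>M\<^esub> x) = a \<odot>\<^bsub>M\<^esub> (t \<odot>\<^bsub>M\<^esub> x)"
    using smult_assoc[OF assms(1) a, of x] smult_assoc[OF a assms(1), of x] assms(2)[OF a] by simp
  then show "a \<odot>\<^bsub>M\<^esub> x \<in> {x \<in> carrier M. t \<odot>\<^bsub>M\<^esub> x = \<zero>\<^bsub>M\<^esub>}" using a x by (simp add: smult_zero_right smult_closed)
qed

lemma (in left_module) image_submodule:
  assumes "t \<in> carrier A" "\<And>a. a \<in> carrier A \<Longrightarrow> t \<otimes>\<^bsub>A\<^esub> a = a \<otimes>\<^bsub>A\<^esub> t"
  shows "submodule ((\<lambda>x. t \<odot>\<^bsub>M\<^esub> x) ` carrier M) A M"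
proof (intro submodule.intro submodule_axioms.intro)
  show "subgroup ((\<lambda>x. t \<odot>\<^bsub>M\<^esub> x) ` carrier M) (add_monoid M)"
  proof (rule M.add.subgroupI)
    show "(\<lambda>x. t \<odot>\<^bsub>M\<^esub> x) ` carrier M \<subseteq> carrier M" using assms(1) smult_closed by auto
    show "(\<lambda>x. t \<odot>\<^bsub>M\<^esub> x) ` carrier M \<noteq> {}" using M.zero_closed by blast
    fix x assume "x \<in> (\<lambda>x. t \<odot>\<^bsub>M\<^esub> x) ` carrier M"
    then obtain v where v: "v \<in> carrier M" "x = t \<odot>\<^bsub>M\<^esub> v" by blast
    have "\<ominus>\<^bsub>M\<^esub> x = t \<odot>\<^bsub>M\<^esub> (\<ominus>\<^bsub>M\<^esub> v)" using v assms(1) by (simp add: smult_minus_right)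
    then show "\<ominus>\<^bsub>M\<^esub> x \<in> (\<lambda>x. t \<odot>\<^bsub>M\<^esub> x) ` carrier M" using v(1) by blast
    fix y assume "y \<in> (\<lambda>x. t \<odot>\<^bsub>M\<^esub> x) ` carrier M"
    then obtain v' where v': "v' \<in> carrier M" "y = t \<odot>\<^bsub>M\<^esub> v'" by blast
    have "x \<oplus>\<^bsub>M\<^esub> y = t \<odot>\<^bsub>M\<^esub> (v \<oplus>\<^bsub>M\<^esub> v')" using v v' assms(1) by (simp add: smult_r_distr)
    then show "x \<oplus>\<^bsub>M\<^esub> y \<in> (\<lambda>x. t \<odot>\<^bsub>M\<^esub> x) ` carrier M" using v(1) v'(1) by simp
  qed
  fix a x assume a: "a \<in> carrier A" and "x \<in> (\<lambda>x. t \<odot>\<^bsub>M\<^esub> x) ` carrier M"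
  then obtain v where v: "v \<in> carrier M" "x = t \<odot>\<^bsub>M\<^esub> v" by blast
  then have "a \<odot>\<^bsub>M\<^esub> x = t \<odot>\<^bsub>M\<^esub> (a \<odot>\<^bsub>M\<^esub> v)"
    using smult_assoc[OF assms(1) a, of v] smult_assoc[OF a assms(1), of v] assms(2)[OF a] by simp
  then show "a \<odot>\<^bsub>M\<^esub> x \<in> (\<lambda>x. t \<odot>\<^bsub>M\<^esub> x) ` carrier M" using v a smult_closed by blast
qed

text \<open>All that the module argument needs to know about a type: \<open>psi\<close> identifies
  H, the subalgebra S and D with the operator algebras and \<open>DO\<close>, gradings and scalars
  included.\<close>

locale hc_transfer = hc_full n P k W a
  for n :: nat and P :: "vec set" and k :: "vec \<Rightarrow> complex" and W :: "(vec \<Rightarrow> vec) set" and a :: complex +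
  fixes H S :: "'a superalgebra" and D :: 'a and psi :: "'a \<Rightarrow> hend"
  assumes psi_inj: "inj_on psi (carrier H)"
    and psi_add: "x \<in> carrier H \<Longrightarrow> y \<in> carrier H \<Longrightarrow> psi (x \<oplus>\<^bsub>H\<^esub> y) = psi x + psi y"
    and psi_mult: "x \<in> carrier H \<Longrightarrow> y \<in> carrier H \<Longrightarrow> psi (x \<otimes>\<^bsub>H\<^esub> y) = psi x * psi y"
    and psi_one: "psi \<one>\<^bsub>H\<^esub> = 1"
    and psi_img: "psi ` carrier H = Hg"
    and S_eq: "S = H\<lparr>carrier := carrier S, homog := (\<lambda>p. homog H p \<inter> carrier S)\<rparr>"
    and S_H: "carrier S \<subseteq> carrier H" and psi_S: "psi ` carrier S = Sg"
    and homog_eq: "homog H p = {h \<in> carrier H. pc (psi h) = (if p then - psi h else psi h)}"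
    and scalar_H: "scalar H s \<in> carrier H" and psi_scalar: "psi (scalar H s) = sc s"
    and D_H: "D \<in> carrier H" and psi_D: "psi D = DO"
    and ring_H: "ring H"
begin

interpretation H: ring H by (rule ring_H)

lemma S_sel: "x \<oplus>\<^bsub>S\<^esub> y = x \<oplus>\<^bsub>H\<^esub> y" "x \<otimes>\<^bsub>S\<^esub> y = x \<otimes>\<^bsub>H\<^esub> y" "\<zero>\<^bsub>S\<^esub> = \<zero>\<^bsub>H\<^esub>" "\<one>\<^bsub>S\<^esub> = \<one>\<^bsub>H\<^esub>"
    "scalar S = scalar H" "homog S p = homog H p \<inter> carrier S"
  by (subst S_eq, simp)+

lemma psi_eqI: "x \<in> carrier H \<Longrightarrow> y \<in> carrier H \<Longrightarrow> psi x = psi y \<Longrightarrow> x = y"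
  using psi_inj by (auto dest: inj_onD)

lemma psi_zero: "psi \<zero>\<^bsub>H\<^esub> = 0"
  using psi_add[OF H.zero_closed H.zero_closed] by simp

lemma psi_minus: assumes "x \<in> carrier H" shows "psi (\<ominus>\<^bsub>H\<^esub> x) = - psi x"
proof -
  have "psi x + psi (\<ominus>\<^bsub>H\<^esub> x) = 0"
    using psi_add[OF assms H.a_inv_closed[OF assms]] by (simp only: H.r_neg[OF assms] psi_zero)
  then show ?thesis by (simp only: add_eq_0_iff)
qed

lemma psi_diff: "x \<in> carrier H \<Longrightarrow> y \<in> carrier H \<Longrightarrow> psi (x \<ominus>\<^bsub>H\<^esub> y) = psi x - psi y"
  by (simp add: H.minus_eq psi_add psi_minus)

lemma psi_S_ex: assumes "u \<in> Sg" obtains x where "x \<in> carrier S" "psi x = u"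
  using assms unfolding psi_S[symmetric] by blast

lemma psi_H_ex: assumes "u \<in> Hg" obtains x where "x \<in> carrier H" "psi x = u"
  using assms unfolding psi_img[symmetric] by blast

lemma S_mem: assumes "x \<in> carrier H" "psi x \<in> Sg" shows "x \<in> carrier S"
proof -
  obtain y where y: "y \<in> carrier S" "psi y = psi x" using psi_S_ex[OF assms(2)] .
  have "y \<in> carrier H" using y(1) S_H by blast
  then have "y = x" using assms(1) y(2) by (rule psi_eqI)
  then show ?thesis using y(1) by simp
qed

lemma psi_S_mem: "x \<in> carrier S \<Longrightarrow> psi x \<in> Sg" using psi_S by blast
lemma psi_H_mem: "x \<in> carrier H \<Longrightarrow> psi x \<in> Hg" using psi_img by blast
lemma S_in_H: "x \<in> carrier S \<Longrightarrow> x \<in> carrier H" using S_H by blast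

lemma S_closed:
  "x \<in> carrier S \<Longrightarrow> y \<in> carrier S \<Longrightarrow> x \<oplus>\<^bsub>H\<^esub> y \<in> carrier S"
  "x \<in> carrier S \<Longrightarrow> y \<in> carrier S \<Longrightarrow> x \<otimes>\<^bsub>H\<^esub> y \<in> carrier S"
  "\<zero>\<^bsub>H\<^esub> \<in> carrier S" "\<one>\<^bsub>H\<^esub> \<in> carrier S" "x \<in> carrier S \<Longrightarrow> \<ominus>\<^bsub>H\<^esub> x \<in> carrier S" "scalar H s \<in> carrier S"
  by (rule S_mem; simp add: S_in_H psi_add psi_mult psi_zero psi_one psi_minus psi_scalar scalar_H psi_S_mem
      alg_add alg_mult alg_0 alg_1 alg_uminus alg_sca)+

lemma ring_S: "ring S"
proof (rule ringI)
  show "abelian_group S"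
  proof (rule abelian_groupI)
    fix x assume x: "x \<in> carrier S"
    show "\<exists>y\<in>carrier S. y \<oplus>\<^bsub>S\<^esub> x = \<zero>\<^bsub>S\<^esub>"
      using x S_closed(5) H.l_neg[OF S_in_H[OF x]] by (auto simp: S_sel)
  qed (simp_all add: S_sel S_closed S_in_H H.a_ac)
  show "monoid S"
    by (rule monoidI) (simp_all add: S_sel S_closed S_in_H H.m_assoc)
qed (simp_all add: S_sel S_in_H H.l_distr H.r_distr)

lemma D_comm:
  assumes "x \<in> carrier S"
  obtains x' where "x' \<in> carrier S" "D \<otimes>\<^bsub>H\<^esub> x = x' \<otimes>\<^bsub>H\<^esub> D" "x \<otimes>\<^bsub>H\<^esub> D = D \<otimes>\<^bsub>H\<^esub> x'"
proof -
  obtain x' where x': "x' \<in> carrier S" "psi x' = pc (psi x)" using psi_S_ex[OF pc_Sg[OF psi_S_mem[OF assms]]] .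
  note m = S_in_H[OF assms] S_in_H[OF x'(1)] D_H
  have "D \<otimes>\<^bsub>H\<^esub> x = x' \<otimes>\<^bsub>H\<^esub> D"
    by (rule psi_eqI) (simp_all add: m psi_mult psi_D x'(2) DO_Sg[OF psi_S_mem[OF assms]])
  moreover have "x \<otimes>\<^bsub>H\<^esub> D = D \<otimes>\<^bsub>H\<^esub> x'"
    by (rule psi_eqI) (simp_all add: m psi_mult psi_D x'(2) DO_Sg[OF pc_Sg[OF psi_S_mem[OF assms]]] pc_pc)
  ultimately show ?thesis using that x'(1) by blast
qed

text \<open>This resolves the definite description of \<zeta>. Two candidates differ by an element
  of \<open>Sg\<close> that is a d-image, to which \<open>zeta_unique\<close> applies; its odd
  primitive is the difference of those of the candidates.\<close>

lemma zeta:
  assumes z: "z \<in> even_center H"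
  shows "dirac_zeta H S D z \<in> even_center S \<and>
    (\<exists>h\<in>carrier H. z \<ominus>\<^bsub>H\<^esub> dirac_zeta H S D z = D \<otimes>\<^bsub>H\<^esub> h \<oplus>\<^bsub>H\<^esub> h \<otimes>\<^bsub>H\<^esub> D)"
proof -
  have zH: "z \<in> carrier H" "pc (psi z) = psi z" "\<And>h. h \<in> carrier H \<Longrightarrow> z \<otimes>\<^bsub>H\<^esub> h = h \<otimes>\<^bsub>H\<^esub> z"
    using z by (auto simp: even_center_def homog_eq)
  have "psi z * h = h * psi z" if hg: "h \<in> Hg" for h
  proof -
    obtain h' where h': "h' \<in> carrier H" "psi h' = h" using psi_H_ex[OF hg] .
    show ?thesis using arg_cong[OF zH(3)[OF h'(1)], of psi] by (simp add: psi_mult zH(1) h')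
  qed
  from zeta_exists[OF psi_H_mem[OF zH(1)] zH(2) this] obtain Y h where
    Y: "Y \<in> Sg" "pc Y = Y" "\<forall>u\<in>Sg. Y * u = u * Y" and h: "h \<in> Hg" "pc h = - h" "psi z - Y = DO * h + h * DO" by blast
  obtain y where y: "y \<in> carrier S" "psi y = Y" using psi_S_ex[OF Y(1)] .
  obtain h' where h': "h' \<in> carrier H" "psi h' = h" using psi_H_ex[OF h(1)] .
  have yH: "y \<in> carrier H" by (rule S_in_H[OF y(1)])
  have yc: "y \<in> even_center S"
    unfolding even_center_def
  proof (intro CollectI conjI ballI)
    show "y \<in> homog S False" using y Y(2) yH by (simp add: S_sel homog_eq)
    fix u assume u: "u \<in> carrier S"
    show "y \<otimes>\<^bsub>S\<^esub> u = u \<otimes>\<^bsub>S\<^esub> y" unfolding S_sel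
      by (rule psi_eqI) (simp_all add: psi_mult yH S_in_H[OF u] y(2) Y(3)[rule_format, OF psi_S_mem[OF u]])
  qed
  have zy: "z \<ominus>\<^bsub>H\<^esub> y = D \<otimes>\<^bsub>H\<^esub> h' \<oplus>\<^bsub>H\<^esub> h' \<otimes>\<^bsub>H\<^esub> D"
    by (rule psi_eqI) (simp_all add: zH(1) yH h'(1) D_H psi_diff psi_add psi_mult psi_D h'(2) y(2) h(3))
  have hT: "h' \<in> homog H True" using h' h(2) by (simp add: homog_eq)
  have 0: "\<zero>\<^bsub>H\<^esub> \<in> homog H False" by (simp add: homog_eq psi_zero pc_0)
  have im: "z \<ominus>\<^bsub>H\<^esub> y \<in> dirac_d_image H D"
    unfolding dirac_d_image_def
  proof (intro CollectI exI conjI)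
    show "z \<ominus>\<^bsub>H\<^esub> y = (D \<otimes>\<^bsub>H\<^esub> \<zero>\<^bsub>H\<^esub> \<ominus>\<^bsub>H\<^esub> \<zero>\<^bsub>H\<^esub> \<otimes>\<^bsub>H\<^esub> D) \<oplus>\<^bsub>H\<^esub> (D \<otimes>\<^bsub>H\<^esub> h' \<oplus>\<^bsub>H\<^esub> h' \<otimes>\<^bsub>H\<^esub> D)"
      unfolding zy using D_H h'(1) by (simp add: H.minus_eq)
  qed (rule 0 hT)+
  have uniq: "y2 = y" if y2: "y2 \<in> even_center S \<and> z \<ominus>\<^bsub>H\<^esub> y2 \<in> dirac_d_image H D" for y2
  proof -
    have y2S: "y2 \<in> carrier S" "pc (psi y2) = psi y2" "\<And>u. u \<in> carrier S \<Longrightarrow> y2 \<otimes>\<^bsub>H\<^esub> u = u \<otimes>\<^bsub>H\<^esub> y2"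
      using y2 by (auto simp: even_center_def S_sel homog_eq)
    have y2H: "y2 \<in> carrier H" by (rule S_in_H[OF y2S(1)])
    obtain h0 h1 where hh: "h0 \<in> homog H False" "h1 \<in> homog H True"
      "z \<ominus>\<^bsub>H\<^esub> y2 = (D \<otimes>\<^bsub>H\<^esub> h0 \<ominus>\<^bsub>H\<^esub> h0 \<otimes>\<^bsub>H\<^esub> D) \<oplus>\<^bsub>H\<^esub> (D \<otimes>\<^bsub>H\<^esub> h1 \<oplus>\<^bsub>H\<^esub> h1 \<otimes>\<^bsub>H\<^esub> D)"
      using y2 unfolding dirac_d_image_def by blast
    have hH: "h0 \<in> carrier H" "h1 \<in> carrier H" "pc (psi h0) = psi h0" "pc (psi h1) = - psi h1"
      using hh by (auto simp: homog_eq)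
    have e2: "psi z - psi y2 = (DO * psi h0 - psi h0 * DO) + (DO * psi h1 + psi h1 * DO)"
      using arg_cong[OF hh(3), of psi] by (simp add: psi_diff psi_add psi_mult psi_D zH(1) y2H hH D_H)
    have "Y - psi y2 = 0"
    proof (rule zeta_unique[where ?h0.0 = "psi h0" and ?h1.0 = "psi h1 - h"])
      show "Y - psi y2 \<in> Sg" by (intro alg_diff Y(1) psi_S_mem y2S(1))
      show "pc (Y - psi y2) = Y - psi y2" by (simp add: pc_diff Y(2) y2S(2))
      show "(Y - psi y2) * u = u * (Y - psi y2)" if ug: "u \<in> Sg" for u
      proof -
        obtain u' where u': "u' \<in> carrier S" "psi u' = u" using psi_S_ex[OF ug] .
        have "psi y2 * u = u * psi y2"
          using arg_cong[OF y2S(3)[OF u'(1)], of psi] by (simp add: psi_mult y2H S_in_H[OF u'(1)] u'(2))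
        then show ?thesis using Y(3) ug by (simp add: left_diff_distrib right_diff_distrib)
      qed
      show "psi h0 \<in> Hg" "psi h1 - h \<in> Hg" by (intro psi_H_mem hH alg_diff h(1))+
      show "pc (psi h0) = psi h0" by (rule hH(3))
      show "pc (psi h1 - h) = - (psi h1 - h)" by (simp add: pc_diff hH(4) h(2))
      have "Y - psi y2 = (psi z - psi y2) - (psi z - Y)" by simp
      also have "\<dots> = (DO * psi h0 - psi h0 * DO) + (DO * (psi h1 - h) + (psi h1 - h) * DO)"
        unfolding e2 h(3) by (simp add: algebra_simps)
      finally show "Y - psi y2 = (DO * psi h0 - psi h0 * DO) + (DO * (psi h1 - h) + (psi h1 - h) * DO)" .
    qed
    then show ?thesis using psi_eqI[OF y2H yH] y(2) by simp
  qed
  have "dirac_zeta H S D z = y"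
    unfolding dirac_zeta_def by (rule the_equality) (use yc im uniq in blast)+
  then show ?thesis using yc zy h'(1) by auto
qed

text \<open>No finiteness of U is assumed. Seg(W) is finite-dimensional, so y satisfies a nonzero
  polynomial; one of its linear factors has a kernel on U, and that kernel is a submodule because y
  is central.\<close>

lemma eigenvalue:
  assumes U: "irreducible_module S U" and y: "y \<in> even_center S"
  shows "\<exists>s. \<forall>u\<in>carrier U. y \<odot>\<^bsub>U\<^esub> u = scalar H s \<odot>\<^bsub>U\<^esub> u"
proof -
  have lm: "left_module S U" and Unz: "carrier U \<noteq> {\<zero>\<^bsub>U\<^esub>}"
    and irr: "\<And>N. submodule N S U \<Longrightarrow> N = {\<zero>\<^bsub>U\<^esub>} \<or> N = carrier U"
    using U by (auto simp: irreducible_module_def)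
  interpret U: left_module S U by (rule lm)
  have yS: "y \<in> carrier S" and yc: "\<And>u. u \<in> carrier S \<Longrightarrow> y \<otimes>\<^bsub>S\<^esub> u = u \<otimes>\<^bsub>S\<^esub> y"
    using y by (auto simp: even_center_def S_sel homog_eq)
  define Y where "Y = psi y"
  have YS: "Y \<in> Sg" unfolding Y_def by (rule psi_S_mem[OF yS])
  \<comment> \<open>The action on U is transported along the inverse of \<open>psi\<close>, so that
    polynomials in the operator Y act on U.\<close>
  define act where "act T u = inv_into (carrier S) psi T \<odot>\<^bsub>U\<^esub> u" for T u
  have inv: "inv_into (carrier S) psi (psi x) = x" if "x \<in> carrier S" for x
    using inv_into_f_f[OF inj_on_subset[OF psi_inj S_H] that] .
  have act_psi: "act (psi x) u = x \<odot>\<^bsub>U\<^esub> u" if "x \<in> carrier S" for x u by (simp add: act_def inv[OF that])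
  have act_mult: "act (T * T') u = act T (act T' u)" if T: "T \<in> Sg" "T' \<in> Sg" and u: "u \<in> carrier U" for T T' u
  proof -
    obtain t where t: "t \<in> carrier S" "psi t = T" using psi_S_ex[OF T(1)] .
    obtain t' where t': "t' \<in> carrier S" "psi t' = T'" using psi_S_ex[OF T(2)] .
    have "T * T' = psi (t \<otimes>\<^bsub>H\<^esub> t')" using t t' by (simp add: psi_mult S_in_H)
    then have "act (T * T') u = (t \<otimes>\<^bsub>S\<^esub> t') \<odot>\<^bsub>U\<^esub> u" using t t' by (simp add: act_psi S_closed S_sel)
    also have "\<dots> = act T (act T' u)"
      unfolding t(2)[symmetric] t'(2)[symmetric] using U.smult_assoc[OF t(1) t'(1) u] t(1) t'(1) by (simp add: act_psi)
    finally show ?thesis .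
  qed
  have act_closed: "act T u \<in> carrier U" if T: "T \<in> Sg" and u: "u \<in> carrier U" for T u
  proof -
    obtain t where t: "t \<in> carrier S" "psi t = T" using psi_S_ex[OF T] .
    show ?thesis unfolding t(2)[symmetric] act_psi[OF t(1)] by (rule U.smult_closed[OF t(1) u])
  qed
  have act_zero: "act T \<zero>\<^bsub>U\<^esub> = \<zero>\<^bsub>U\<^esub>" if T: "T \<in> Sg" for T
  proof -
    obtain t where t: "t \<in> carrier S" "psi t = T" using psi_S_ex[OF T] .
    show ?thesis unfolding t(2)[symmetric] act_psi[OF t(1)] by (rule U.smult_zero_right[OF t(1)])
  qed
  have act_one: "act 1 u = u" if "u \<in> carrier U" for u
    using act_psi[OF S_closed(4), of u] U.smult_one[OF that] by (simp add: psi_one S_sel)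
  have act_0: "act 0 u = \<zero>\<^bsub>U\<^esub>" if u: "u \<in> carrier U" for u
  proof -
    have "(\<one>\<^bsub>S\<^esub> \<ominus>\<^bsub>S\<^esub> \<one>\<^bsub>S\<^esub>) \<odot>\<^bsub>U\<^esub> u = \<zero>\<^bsub>U\<^esub>"
      using U.smult_diff_left[OF U.R.one_closed U.R.one_closed u] u
      by (simp add: U.smult_one U.M.minus_eq_zero)
    moreover have "\<one>\<^bsub>S\<^esub> \<ominus>\<^bsub>S\<^esub> \<one>\<^bsub>S\<^esub> = \<zero>\<^bsub>S\<^esub>" by (simp add: U.R.minus_eq U.R.r_neg)
    ultimately show ?thesis using act_psi[OF S_closed(3), of u] by (simp add: psi_zero S_sel)
  qed
  obtain u1 where u1: "u1 \<in> carrier U" "u1 \<noteq> \<zero>\<^bsub>U\<^esub>" using Unz U.M.zero_closed by blast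
  have pS: "peval Y p \<in> Sg" for p
    by (induction p) (auto simp: peval_pCons intro!: alg_0 alg_add alg_sca alg_mult YS)
  have Ys: "Y - sc r \<in> Sg" for r by (intro alg_diff YS alg_sca)
  let ?T = "(\<lambda>(I, w). cm cO I * gO w) ` (Pow {1..n} \<times> W)"
  have powS: "Y ^ i \<in> Sg" for i by (induction i) (auto intro!: alg_1 alg_mult YS)
  have "\<exists>s. Y ^ i = (\<Sum>v\<in>?T. sc (s v) * v)" for i
  proof -
    interpret vs: vector_space "\<lambda>s (v :: hend). sc s * v"
      by unfold_locales (simp_all add: distrib_left distrib_right sc_add sc_sc)
    obtain s where s: "Y ^ i = (\<Sum>I\<in>Pow {1..n}. \<Sum>w\<in>W. sc (s I w) * (cm cO I * gO w))"
      using sp.SS_NF[OF powS[of i]] unfolding sp.NF_def sp.eqJ_def by auto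
    have "Y ^ i \<in> vs.span ?T" unfolding s
      by (intro vs.span_sum vs.span_scale vs.span_base) auto
    then show ?thesis using vs.span_finite[of ?T] W_fin by auto
  qed
  then obtain p where p: "p \<noteq> 0" "peval Y p = 0" using annihilating_poly[of ?T Y] W_fin by auto
  \<comment> \<open>Induction on the degree: either the linear factor at a root of p annihilates a
    nonzero vector, or it is injective and can be cancelled.\<close>
  have "\<exists>r. \<exists>u\<in>carrier U. u \<noteq> \<zero>\<^bsub>U\<^esub> \<and> act (Y - sc r) u = \<zero>\<^bsub>U\<^esub>"
    if "p \<noteq> 0" "\<forall>u\<in>carrier U. act (peval Y p) u = \<zero>\<^bsub>U\<^esub>" for p
    using that
  proof (induction "degree p" arbitrary: p)
    case 0
    then obtain c where c: "p = [:c:]" by (metis degree_eq_zeroE)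
    with 0(2) have c: "p = [:c:]" "c \<noteq> 0" by auto
    have "act (sc c) u1 = \<zero>\<^bsub>U\<^esub>" using 0(3) u1(1) by (simp add: c(1) peval_pCons)
    moreover have "act (sc (1 / c) * sc c) u1 = act (sc (1 / c)) (act (sc c) u1)"
      by (rule act_mult[OF alg_sca alg_sca u1(1)])
    ultimately have "u1 = \<zero>\<^bsub>U\<^esub>" using c(2) act_zero[OF alg_sca] act_one[OF u1(1)] by (simp add: sc_mult[symmetric])
    then show ?case using u1(2) by blast
  next
    case (Suc d)
    have "\<not> constant (poly p)" using Suc.hyps(2) by (simp add: constant_degree)
    then obtain r where "poly p r = 0" using fundamental_theorem_of_algebra by blast
    then obtain q where q: "p = [:- r, 1:] * q" using poly_eq_0_iff_dvd[of p r] by (auto elim: dvdE)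
    have q0: "q \<noteq> 0" using Suc.prems(1) q by auto
    have "Suc d = degree [:- r, 1:] + degree q" unfolding Suc.hyps(2) q by (rule degree_mult_eq) (use q0 in auto)
    then have dq: "d = degree q" by simp
    show ?case
    proof (cases "\<exists>u\<in>carrier U. u \<noteq> \<zero>\<^bsub>U\<^esub> \<and> act (Y - sc r) u = \<zero>\<^bsub>U\<^esub>")
      case True then show ?thesis by blast
    next
      case False
      have "\<forall>u\<in>carrier U. act (peval Y q) u = \<zero>\<^bsub>U\<^esub>"
      proof
        fix u assume u: "u \<in> carrier U"
        have "act ((Y - sc r) * peval Y q) u = \<zero>\<^bsub>U\<^esub>"
          using Suc.prems(2) u by (simp add: q peval_linear_factor del: mult_pCons_left)
        then have "act (Y - sc r) (act (peval Y q) u) = \<zero>\<^bsub>U\<^esub>" unfolding act_mult[OF Ys pS u] .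
        then show "act (peval Y q) u = \<zero>\<^bsub>U\<^esub>" using False act_closed[OF pS u] by blast
      qed
      then show ?thesis using Suc.hyps(1)[OF dq q0] by blast
    qed
  qed
  from this[OF p(1)] obtain r u where u: "u \<in> carrier U" "u \<noteq> \<zero>\<^bsub>U\<^esub>" "act (Y - sc r) u = \<zero>\<^bsub>U\<^esub>"
    using act_0 by (auto simp: p(2))
  have sS: "scalar H r \<in> carrier S" by (rule S_closed(6))
  let ?t = "y \<ominus>\<^bsub>S\<^esub> scalar H r"
  have tS: "?t \<in> carrier S" using yS sS by (rule U.R.minus_closed)
  have tH: "?t = y \<ominus>\<^bsub>H\<^esub> scalar H r"
  proof -
    have "\<ominus>\<^bsub>S\<^esub> scalar H r = \<ominus>\<^bsub>H\<^esub> scalar H r"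
      using U.R.minus_equality[of "\<ominus>\<^bsub>H\<^esub> scalar H r" "scalar H r"] S_closed(5)[OF sS] sS H.l_neg[OF S_in_H[OF sS]]
      by (simp add: S_sel)
    then show ?thesis by (simp add: U.R.minus_eq H.minus_eq S_sel)
  qed
  have pt: "psi ?t = Y - sc r" unfolding tH by (simp add: psi_diff S_in_H yS scalar_H psi_scalar Y_def)
  have tc: "?t \<otimes>\<^bsub>S\<^esub> x = x \<otimes>\<^bsub>S\<^esub> ?t" if x: "x \<in> carrier S" for x
  proof -
    have "Y * psi x = psi x * Y" unfolding Y_def
      using arg_cong[OF yc[OF x], of psi] by (simp add: S_sel psi_mult S_in_H yS x)
    then show ?thesis unfolding S_sel
      by (intro psi_eqI H.m_closed S_in_H tS x)
        (simp add: psi_mult S_in_H tS x pt left_diff_distrib right_diff_distrib sc_commute[of "psi x"])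
  qed
  have "{v \<in> carrier U. ?t \<odot>\<^bsub>U\<^esub> v = \<zero>\<^bsub>U\<^esub>} = carrier U"
    using irr[OF U.kernel_submodule[OF tS tc]] u act_psi[OF tS, of u] by (auto simp: pt)
  then have "?t \<odot>\<^bsub>U\<^esub> v = \<zero>\<^bsub>U\<^esub>" if "v \<in> carrier U" for v using that by blast
  then have "y \<odot>\<^bsub>U\<^esub> v = scalar H r \<odot>\<^bsub>U\<^esub> v" if v: "v \<in> carrier U" for v
    using U.smult_diff_left[OF yS sS v] v
      U.M.minus_eq_zero[OF U.smult_closed[OF yS v] U.smult_closed[OF sS v]] by simp
  then show ?thesis by blast
qed

text \<open>The difference of distinct scalars is invertible. This makes the description in
  \<open>central_character\<close> unambiguous.\<close>

lemma scalar_unique: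
  assumes lm: "left_module A V" and A: "A = H \<or> A = S" and nz: "carrier V \<noteq> {\<zero>\<^bsub>V\<^esub>}"
    and eq: "\<And>v. v \<in> carrier V \<Longrightarrow> scalar H s \<odot>\<^bsub>V\<^esub> v = scalar H t \<odot>\<^bsub>V\<^esub> v"
  shows "s = t"
proof (rule ccontr)
  assume ne: "s \<noteq> t"
  interpret V: left_module A V by (rule lm)
  obtain v where v: "v \<in> carrier V" "v \<noteq> \<zero>\<^bsub>V\<^esub>" using nz V.M.zero_closed by blast
  have sc_A: "scalar H r \<in> carrier A" for r using A scalar_H S_closed(6) by auto
  let ?d = "scalar H s \<ominus>\<^bsub>A\<^esub> scalar H t" and ?i = "scalar H (1 / (s - t))"
  have d0: "?d \<odot>\<^bsub>V\<^esub> v = \<zero>\<^bsub>V\<^esub>"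
    using V.smult_diff_left[OF sc_A sc_A v(1)] eq[OF v(1)] V.M.minus_eq_zero V.smult_closed[OF sc_A v(1)] by metis
  have dA: "?d \<in> carrier A" by (intro V.R.minus_closed sc_A)
  have AH: "x \<otimes>\<^bsub>A\<^esub> y = x \<otimes>\<^bsub>H\<^esub> y" "\<one>\<^bsub>A\<^esub> = \<one>\<^bsub>H\<^esub>" "x \<oplus>\<^bsub>A\<^esub> y = x \<oplus>\<^bsub>H\<^esub> y" for x y using A S_sel by auto
  have inH: "x \<in> carrier H" if "x \<in> carrier A" for x using that A S_in_H by auto
  have "?d \<oplus>\<^bsub>A\<^esub> scalar H t = scalar H s" using sc_A by (simp add: V.R.minus_eq V.R.a_assoc V.R.l_neg)
  then have "psi ?d + sc t = sc s"
    using psi_add[OF inH[OF dA] scalar_H[of t]] by (simp add: AH psi_scalar)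
  then have pd: "psi ?d = sc (s - t)" by (simp add: sc_diff algebra_simps)
  have "?i \<otimes>\<^bsub>A\<^esub> ?d = \<one>\<^bsub>A\<^esub>"
    unfolding AH
    by (rule psi_eqI) (use ne in \<open>simp_all add: inH[OF dA] scalar_H psi_mult psi_scalar psi_one pd sc_mult[symmetric]\<close>)
  then have "v = ?i \<odot>\<^bsub>V\<^esub> (?d \<odot>\<^bsub>V\<^esub> v)" using V.smult_assoc[OF sc_A[of "1 / (s - t)"] dA v(1)] V.smult_one[OF v(1)] by simp
  then show False using v(2) by (simp add: d0 V.smult_zero_right[OF sc_A])
qed

text \<open>Seg(W) acts on the cohomology because D passes each of its elements up to the parity
  automorphism. For the characters, z minus a scalar is even and central, so its kernel and image
  are graded submodules even though U carries no grading.\<close>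

lemma cohomology_theorem:
  fixes M :: "('a, 'x) module" and U :: "('a, 'u) module"
  assumes irrM: "irreducible_supermodule H M G"
  shows "(left_module S (dirac_cohomology M D) \<and>
          (\<forall>a \<in> carrier S. \<forall>x \<in> action_kernel M D.
             a \<odot>\<^bsub>M\<^esub> x \<in> action_kernel M D \<and>
             a \<odot>\<^bsub>dirac_cohomology M D\<^esub> (dirac_boundary M D +>\<^bsub>M\<^esub> x)
               = dirac_boundary M D +>\<^bsub>M\<^esub> (a \<odot>\<^bsub>M\<^esub> x)))
       \<and> (irreducible_module S U \<longrightarrow>
          (\<exists>f \<in> module_homs S U (dirac_cohomology M D).
             \<exists>u \<in> carrier U. f u \<noteq> \<zero>\<^bsub>dirac_cohomology M D\<^esub>) \<longrightarrow>
          (\<forall>z \<in> even_center H.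
             central_character H M z = central_character S U (dirac_zeta H S D z)))"
proof -
  have sm: "supermodule H M G" and Mnz: "carrier M \<noteq> {\<zero>\<^bsub>M\<^esub>}"
    and irr: "\<And>N. submodule N H M \<Longrightarrow> graded_subset M G N \<Longrightarrow> N = {\<zero>\<^bsub>M\<^esub>} \<or> N = carrier M"
    using irrM by (auto simp: irreducible_supermodule_def)
  interpret M: supermodule H M G by (rule sm)
  let ?K = "action_kernel M D" and ?B = "dirac_boundary M D" and ?C = "dirac_cohomology M D"
  let ?q = "\<lambda>x. ?B +>\<^bsub>M\<^esub> x"
  have KM: "x \<in> carrier M" "D \<odot>\<^bsub>M\<^esub> x = \<zero>\<^bsub>M\<^esub>" if "x \<in> ?K" for x using that by (auto simp: action_kernel_def)
  have KI: "x \<in> ?K" if "x \<in> carrier M" "D \<odot>\<^bsub>M\<^esub> x = \<zero>\<^bsub>M\<^esub>" for x using that by (auto simp: action_kernel_def)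
  have BK: "b \<in> ?K" if "b \<in> ?B" for b using that by (auto simp: dirac_boundary_def)
  have B_ex: "\<exists>v\<in>carrier M. b = D \<odot>\<^bsub>M\<^esub> v" if "b \<in> ?B" for b using that by (auto simp: dirac_boundary_def action_image_def)
  have BI: "D \<odot>\<^bsub>M\<^esub> v \<in> ?B" if "v \<in> carrier M" "D \<odot>\<^bsub>M\<^esub> v \<in> ?K" for v using that by (auto simp: dirac_boundary_def action_image_def)
  have aH: "a \<in> carrier H" if "a \<in> carrier S" for a using that by (rule S_in_H)
  have Kadd: "x \<oplus>\<^bsub>M\<^esub> y \<in> ?K" if "x \<in> ?K" "y \<in> ?K" for x y
    by (rule KI) (simp_all add: KM that M.smult_r_distr D_H)
  have Kinv: "\<ominus>\<^bsub>M\<^esub> x \<in> ?K" if "x \<in> ?K" for x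
    by (rule KI) (simp_all add: KM that M.smult_minus_right D_H)
  have K0: "\<zero>\<^bsub>M\<^esub> \<in> ?K" by (rule KI) (simp_all add: M.smult_zero_right D_H)
  have Ka: "a \<odot>\<^bsub>M\<^esub> x \<in> ?K" if a: "a \<in> carrier S" and x: "x \<in> ?K" for a x
  proof (rule KI)
    show "a \<odot>\<^bsub>M\<^esub> x \<in> carrier M" by (rule M.smult_closed[OF aH[OF a] KM(1)[OF x]])
    obtain a' where a': "a' \<in> carrier S" "D \<otimes>\<^bsub>H\<^esub> a = a' \<otimes>\<^bsub>H\<^esub> D" using D_comm[OF a] by blast
    have "D \<odot>\<^bsub>M\<^esub> (a \<odot>\<^bsub>M\<^esub> x) = a' \<odot>\<^bsub>M\<^esub> (D \<odot>\<^bsub>M\<^esub> x)"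
      using M.smult_assoc[OF D_H aH[OF a] KM(1)[OF x]] M.smult_assoc[OF aH[OF a'(1)] D_H KM(1)[OF x]] a'(2) by simp
    then show "D \<odot>\<^bsub>M\<^esub> (a \<odot>\<^bsub>M\<^esub> x) = \<zero>\<^bsub>M\<^esub>" by (simp add: KM(2)[OF x] M.smult_zero_right aH[OF a'(1)])
  qed
  have Ba: "a \<odot>\<^bsub>M\<^esub> b \<in> ?B" if a: "a \<in> carrier S" and b: "b \<in> ?B" for a b
  proof -
    obtain v where v: "v \<in> carrier M" "b = D \<odot>\<^bsub>M\<^esub> v" using B_ex[OF b] by blast
    obtain a' where a': "a' \<in> carrier S" "a \<otimes>\<^bsub>H\<^esub> D = D \<otimes>\<^bsub>H\<^esub> a'" using D_comm[OF a] by blast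
    have e: "a \<odot>\<^bsub>M\<^esub> b = D \<odot>\<^bsub>M\<^esub> (a' \<odot>\<^bsub>M\<^esub> v)"
      using M.smult_assoc[OF aH[OF a] D_H v(1)] M.smult_assoc[OF D_H aH[OF a'(1)] v(1)] a'(2) v(2) by simp
    show ?thesis unfolding e
      using Ka[OF a BK[OF b]] unfolding e by (intro BI M.smult_closed aH a'(1) v(1))
  qed
  have Bsub: "additive_subgroup ?B M"
  proof (rule additive_subgroup.intro, rule M.M.add.subgroupI)
    show "?B \<subseteq> carrier M" using BK KM(1) by blast
    have "D \<odot>\<^bsub>M\<^esub> \<zero>\<^bsub>M\<^esub> \<in> ?B" using K0 by (intro BI M.M.zero_closed) (simp add: M.smult_zero_right D_H)
    then show "?B \<noteq> {}" by blast
    fix b assume b: "b \<in> ?B"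
    then obtain v where v: "v \<in> carrier M" "b = D \<odot>\<^bsub>M\<^esub> v" using B_ex by blast
    have e: "\<ominus>\<^bsub>M\<^esub> b = D \<odot>\<^bsub>M\<^esub> (\<ominus>\<^bsub>M\<^esub> v)" using v by (simp add: M.smult_minus_right D_H)
    show "\<ominus>\<^bsub>M\<^esub> b \<in> ?B" using Kinv[OF BK[OF b]] v(1) unfolding e by (intro BI) auto
    fix c assume c: "c \<in> ?B"
    then obtain v' where v': "v' \<in> carrier M" "c = D \<odot>\<^bsub>M\<^esub> v'" using B_ex by blast
    have e: "b \<oplus>\<^bsub>M\<^esub> c = D \<odot>\<^bsub>M\<^esub> (v \<oplus>\<^bsub>M\<^esub> v')" using v v' by (simp add: M.smult_r_distr D_H)
    show "b \<oplus>\<^bsub>M\<^esub> c \<in> ?B" using Kadd[OF BK[OF b] BK[OF c]] v(1) v'(1) unfolding e by (intro BI) auto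
  qed
  interpret B: abelian_subgroup ?B M
    by (rule abelian_subgroupI3[OF Bsub M.M.abelian_group_axioms])
  have q_add: "?q x <+>\<^bsub>M\<^esub> ?q y = ?q (x \<oplus>\<^bsub>M\<^esub> y)" if "x \<in> carrier M" "y \<in> carrier M" for x y
    using B.a_rcos_sum that by blast
  have q_self: "x \<in> ?q x" if "x \<in> carrier M" for x using B.a_rcos_self[OF that] .
  have q_B: "?q b = ?B" if "b \<in> ?B" for b using B.a_rcos_const[OF that] .
  have B0: "\<zero>\<^bsub>M\<^esub> \<in> ?B" by (rule B.zero_closed)
  have q_mem: "\<exists>b\<in>?B. x' = b \<oplus>\<^bsub>M\<^esub> x" if "x' \<in> ?q x" for x' x
    using that by (auto simp: a_r_coset_def r_coset_def)
  have q_B_add: "?q (b \<oplus>\<^bsub>M\<^esub> x) = ?q x" if b: "b \<in> ?B" and x: "x \<in> carrier M" for b x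
  proof -
    have bM: "b \<in> carrier M" using BK[OF b] KM(1) by blast
    have "?q (b \<oplus>\<^bsub>M\<^esub> x) = ?q b <+>\<^bsub>M\<^esub> ?q x" by (rule q_add[OF bM x, symmetric])
    also have "?q b = ?q \<zero>\<^bsub>M\<^esub>" using q_B[OF b] q_B[OF B0] by simp
    also have "?q \<zero>\<^bsub>M\<^esub> <+>\<^bsub>M\<^esub> ?q x = ?q x" using x by (simp add: q_add)
    finally show ?thesis .
  qed
  have q_eq: "?q x = ?q y \<Longrightarrow> x \<ominus>\<^bsub>M\<^esub> y \<in> ?B" if x: "x \<in> carrier M" and y: "y \<in> carrier M" for x y
  proof -
    assume "?q x = ?q y"
    then obtain b where b: "b \<in> ?B" "x = b \<oplus>\<^bsub>M\<^esub> y" using q_mem[of x y] q_self[OF x] by auto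
    have "b \<in> carrier M" using BK[OF b(1)] KM(1) by blast
    then have "x \<ominus>\<^bsub>M\<^esub> y = b" using y by (simp add: b(2) M.M.minus_eq M.M.a_assoc M.M.r_neg)
    then show ?thesis using b(1) by simp
  qed
  have C: "carrier ?C = ?q ` ?K" "\<zero>\<^bsub>?C\<^esub> = ?B" "\<And>P Q. P \<oplus>\<^bsub>?C\<^esub> Q = P <+>\<^bsub>M\<^esub> Q"
    by (simp_all add: dirac_cohomology_def)
  have C_smult: "a \<odot>\<^bsub>?C\<^esub> ?q x = ?q (a \<odot>\<^bsub>M\<^esub> x)" if a: "a \<in> carrier S" and x: "x \<in> ?K" for a x
  proof -
    have "?q (a \<odot>\<^bsub>M\<^esub> x') = ?q (a \<odot>\<^bsub>M\<^esub> x)" if x': "x' \<in> ?q x" for x'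
    proof -
      obtain b where b: "b \<in> ?B" "x' = b \<oplus>\<^bsub>M\<^esub> x" using q_mem[OF x'] by blast
      have "a \<odot>\<^bsub>M\<^esub> x' = a \<odot>\<^bsub>M\<^esub> b \<oplus>\<^bsub>M\<^esub> a \<odot>\<^bsub>M\<^esub> x"
        unfolding b(2) by (rule M.smult_r_distr[OF aH[OF a] KM(1)[OF BK[OF b(1)]] KM(1)[OF x]])
      then show ?thesis using q_B_add[OF Ba[OF a b(1)] M.smult_closed[OF aH[OF a] KM(1)[OF x]]] by simp
    qed
    then have "(\<Union>x'\<in>?q x. ?q (a \<odot>\<^bsub>M\<^esub> x')) = ?q (a \<odot>\<^bsub>M\<^esub> x)" using q_self[OF KM(1)[OF x]] by blast
    then show ?thesis by (simp add: dirac_cohomology_def)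
  qed
  have q0: "?q \<zero>\<^bsub>M\<^esub> = ?B" by (rule q_B[OF B0])
  have agC: "abelian_group ?C"
  proof (rule abelian_groupI)
    show "\<zero>\<^bsub>?C\<^esub> \<in> carrier ?C" unfolding C using q0 K0 by blast
    fix P assume "P \<in> carrier ?C"
    then obtain x where x: "x \<in> ?K" "P = ?q x" unfolding C by blast
    have zC: "\<zero>\<^bsub>?C\<^esub> = ?q \<zero>\<^bsub>M\<^esub>" unfolding C(2) by (rule q0[symmetric])
    show "\<zero>\<^bsub>?C\<^esub> \<oplus>\<^bsub>?C\<^esub> P = P"
      unfolding C(3) x(2) zC using q_add[OF M.M.zero_closed KM(1)[OF x(1)]] KM(1)[OF x(1)] by simp
    have "?q (\<ominus>\<^bsub>M\<^esub> x) \<oplus>\<^bsub>?C\<^esub> P = \<zero>\<^bsub>?C\<^esub>"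
      unfolding C(3) x(2) zC using q_add[of "\<ominus>\<^bsub>M\<^esub> x" x] KM(1)[OF x(1)] by (simp add: M.M.l_neg)
    then show "\<exists>y\<in>carrier ?C. y \<oplus>\<^bsub>?C\<^esub> P = \<zero>\<^bsub>?C\<^esub>" unfolding C(1) using Kinv[OF x(1)] by blast
    fix Q assume "Q \<in> carrier ?C"
    then obtain y where y: "y \<in> ?K" "Q = ?q y" unfolding C by blast
    show "P \<oplus>\<^bsub>?C\<^esub> Q \<in> carrier ?C" unfolding C x(2) y(2) using Kadd[OF x(1) y(1)] q_add[OF KM(1)[OF x(1)] KM(1)[OF y(1)]] by simp
    show "P \<oplus>\<^bsub>?C\<^esub> Q = Q \<oplus>\<^bsub>?C\<^esub> P" unfolding C x(2) y(2) by (simp add: q_add KM x(1) y(1) M.M.a_comm)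
    fix R assume "R \<in> carrier ?C"
    then obtain w where w: "w \<in> ?K" "R = ?q w" unfolding C by blast
    show "P \<oplus>\<^bsub>?C\<^esub> Q \<oplus>\<^bsub>?C\<^esub> R = P \<oplus>\<^bsub>?C\<^esub> (Q \<oplus>\<^bsub>?C\<^esub> R)"
      unfolding C x(2) y(2) w(2) by (simp add: q_add KM x(1) y(1) w(1) M.M.a_assoc)
  qed
  have lmC: "left_module S ?C"
  proof (intro left_module.intro left_module_axioms.intro ring_S agC)
    show "\<one>\<^bsub>S\<^esub> \<odot>\<^bsub>?C\<^esub> P = P" if P: "P \<in> carrier ?C" for P
    proof -
      obtain x where x: "x \<in> ?K" "P = ?q x" using P unfolding C by blast
      show ?thesis
        unfolding x(2) S_sel C_smult[OF S_closed(4) x(1)] by (simp add: M.smult_one KM(1)[OF x(1)])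
    qed
    fix a b P assume a: "a \<in> carrier S" and "P \<in> carrier ?C"
    then obtain x where x: "x \<in> ?K" "P = ?q x" unfolding C by blast
    note xM = KM(1)[OF x(1)]
    show "a \<odot>\<^bsub>?C\<^esub> P \<in> carrier ?C" unfolding x(2) C_smult[OF a x(1)] C(1) using Ka[OF a x(1)] by blast
    {
      fix Q assume "Q \<in> carrier ?C"
      then obtain y where y: "y \<in> ?K" "Q = ?q y" unfolding C by blast
      note yM = KM(1)[OF y(1)]
      show "a \<odot>\<^bsub>?C\<^esub> (P \<oplus>\<^bsub>?C\<^esub> Q) = a \<odot>\<^bsub>?C\<^esub> P \<oplus>\<^bsub>?C\<^esub> a \<odot>\<^bsub>?C\<^esub> Q"
        unfolding C(3) x(2) y(2) q_add[OF xM yM] C_smult[OF a x(1)] C_smult[OF a y(1)] C_smult[OF a Kadd[OF x(1) y(1)]]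
        by (simp add: q_add M.smult_closed aH[OF a] xM yM M.smult_r_distr)
    }
    assume b: "b \<in> carrier S"
    show "(a \<oplus>\<^bsub>S\<^esub> b) \<odot>\<^bsub>?C\<^esub> P = a \<odot>\<^bsub>?C\<^esub> P \<oplus>\<^bsub>?C\<^esub> b \<odot>\<^bsub>?C\<^esub> P"
      unfolding C(3) x(2) S_sel C_smult[OF a x(1)] C_smult[OF b x(1)] C_smult[OF S_closed(1)[OF a b] x(1)]
      by (simp add: q_add M.smult_closed aH[OF a] aH[OF b] xM M.smult_l_distr)
    show "(a \<otimes>\<^bsub>S\<^esub> b) \<odot>\<^bsub>?C\<^esub> P = a \<odot>\<^bsub>?C\<^esub> (b \<odot>\<^bsub>?C\<^esub> P)"
      unfolding x(2) S_sel C_smult[OF b x(1)] C_smult[OF a Ka[OF b x(1)]] C_smult[OF S_closed(2)[OF a b] x(1)]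
      by (simp add: aH[OF a] aH[OF b] xM M.smult_assoc)
  qed
  have chars: "central_character H M z = central_character S U (dirac_zeta H S D z)"
    if irrU: "irreducible_module S U" and f: "f \<in> module_homs S U ?C" "u0 \<in> carrier U" "f u0 \<noteq> \<zero>\<^bsub>?C\<^esub>"
      and z: "z \<in> even_center H" for f u0 z
  proof -
    let ?y = "dirac_zeta H S D z"
    have zH: "z \<in> carrier H" "pc (psi z) = psi z" "\<And>h. h \<in> carrier H \<Longrightarrow> z \<otimes>\<^bsub>H\<^esub> h = h \<otimes>\<^bsub>H\<^esub> z"
      using z by (auto simp: even_center_def homog_eq)
    obtain h where yc: "?y \<in> even_center S" and h: "h \<in> carrier H" "z \<ominus>\<^bsub>H\<^esub> ?y = D \<otimes>\<^bsub>H\<^esub> h \<oplus>\<^bsub>H\<^esub> h \<otimes>\<^bsub>H\<^esub> D"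
      using zeta[OF z] by blast
    have yS: "?y \<in> carrier S" using yc by (simp add: even_center_def S_sel)
    obtain s where s: "\<And>u. u \<in> carrier U \<Longrightarrow> ?y \<odot>\<^bsub>U\<^esub> u = scalar H s \<odot>\<^bsub>U\<^esub> u" using eigenvalue[OF irrU yc] by blast
    have lmU: "left_module S U" and Unz: "carrier U \<noteq> {\<zero>\<^bsub>U\<^esub>}" using irrU by (auto simp: irreducible_module_def)
    have cU: "central_character S U ?y = s"
      unfolding central_character_def S_sel
    proof (rule the_equality)
      show "\<forall>x\<in>carrier U. ?y \<odot>\<^bsub>U\<^esub> x = scalar H s \<odot>\<^bsub>U\<^esub> x" using s by blast
      fix t assume "\<forall>x\<in>carrier U. ?y \<odot>\<^bsub>U\<^esub> x = scalar H t \<odot>\<^bsub>U\<^esub> x"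
      then have "scalar H t \<odot>\<^bsub>U\<^esub> x = scalar H s \<odot>\<^bsub>U\<^esub> x" if "x \<in> carrier U" for x using s[OF that] that by simp
      then show "t = s" using scalar_unique[OF lmU _ Unz] by blast
    qed
    let ?s = "scalar H s"
    let ?t = "z \<ominus>\<^bsub>H\<^esub> ?s"
    have tH: "?t \<in> carrier H" by (intro H.minus_closed zH(1) scalar_H)
    have pt: "psi ?t = psi z - sc s" by (simp add: psi_diff zH(1) scalar_H psi_scalar)
    have tc: "?t \<otimes>\<^bsub>H\<^esub> x = x \<otimes>\<^bsub>H\<^esub> ?t" if x: "x \<in> carrier H" for x
    proof (rule psi_eqI)
      have "psi z * psi x = psi x * psi z" using arg_cong[OF zH(3)[OF x], of psi] by (simp add: psi_mult zH(1) x)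
      then show "psi (?t \<otimes>\<^bsub>H\<^esub> x) = psi (x \<otimes>\<^bsub>H\<^esub> ?t)"
        by (simp add: psi_mult tH x pt left_diff_distrib right_diff_distrib sc_commute[of "psi x"])
    qed (simp_all add: tH x)
    have th: "?t \<in> homog H False" using tH by (simp add: homog_eq pt pc_diff pc_sc zH(2))
    have tG: "?t \<odot>\<^bsub>M\<^esub> x \<in> G p" if "x \<in> G p" for x p using M.smult_part[OF th that] by simp
    have GM: "x \<in> carrier M" if "x \<in> G p" for x p using subgroup.subset[OF M.part_subgroup[of p]] that by auto
    have Gadd: "x \<oplus>\<^bsub>M\<^esub> y \<in> G p" if "x \<in> G p" "y \<in> G p" for x y p
      using subgroup.m_closed[OF M.part_subgroup[of p] that] by simp
    have decomp: "\<exists>x0\<in>G False. \<exists>x1\<in>G True. x = x0 \<oplus>\<^bsub>M\<^esub> x1" if x: "x \<in> carrier M" for x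
    proof -
      have "x \<in> G False <+>\<^bsub>M\<^esub> G True" using x unfolding M.parts_sum[symmetric] .
      then show ?thesis unfolding set_add_def' by blast
    qed
    let ?I = "(\<lambda>x. ?t \<odot>\<^bsub>M\<^esub> x) ` carrier M" and ?L = "{x \<in> carrier M. ?t \<odot>\<^bsub>M\<^esub> x = \<zero>\<^bsub>M\<^esub>}"
    have smI: "submodule ?I H M" by (rule M.image_submodule[OF tH tc])
    have smL: "submodule ?L H M" by (rule M.kernel_submodule[OF tH tc])
    have graded: "graded_subset M G N"
      if "submodule N H M" and dec: "\<And>x. x \<in> N \<Longrightarrow> \<exists>x0\<in>N \<inter> G False. \<exists>x1\<in>N \<inter> G True. x = x0 \<oplus>\<^bsub>M\<^esub> x1" for N
    proof -
      have clos: "x \<oplus>\<^bsub>M\<^esub> y \<in> N" if "x \<in> N" "y \<in> N" for x y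
        using subgroup.m_closed[OF submodule.axioms(1)[OF \<open>submodule N H M\<close>] that] by simp
      show ?thesis
        unfolding graded_subset_def set_add_def'
      proof (intro equalityI subsetI)
        fix x assume "x \<in> N"
        from dec[OF this] show "x \<in> (\<Union>x0\<in>N \<inter> G False. \<Union>x1\<in>N \<inter> G True. {x0 \<oplus>\<^bsub>M\<^esub> x1})" by blast
      next
        fix x assume "x \<in> (\<Union>x0\<in>N \<inter> G False. \<Union>x1\<in>N \<inter> G True. {x0 \<oplus>\<^bsub>M\<^esub> x1})"
        then obtain x0 x1 where "x0 \<in> N" "x1 \<in> N" "x = x0 \<oplus>\<^bsub>M\<^esub> x1" by blast
        then show "x \<in> N" using clos by simp
      qed
    qed
    have gI: "graded_subset M G ?I"
    proof (rule graded[OF smI])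
      fix x assume "x \<in> ?I"
      then obtain v where v: "v \<in> carrier M" "x = ?t \<odot>\<^bsub>M\<^esub> v" by blast
      obtain v0 v1 where v01: "v0 \<in> G False" "v1 \<in> G True" "v = v0 \<oplus>\<^bsub>M\<^esub> v1" using decomp[OF v(1)] by blast
      have "x = ?t \<odot>\<^bsub>M\<^esub> v0 \<oplus>\<^bsub>M\<^esub> ?t \<odot>\<^bsub>M\<^esub> v1"
        unfolding v(2) v01(3) by (rule M.smult_r_distr[OF tH GM[OF v01(1)] GM[OF v01(2)]])
      then show "\<exists>x0\<in>?I \<inter> G False. \<exists>x1\<in>?I \<inter> G True. x = x0 \<oplus>\<^bsub>M\<^esub> x1"
        using tG v01 GM[OF v01(1)] GM[OF v01(2)] by (intro bexI[of _ "?t \<odot>\<^bsub>M\<^esub> v0"] bexI[of _ "?t \<odot>\<^bsub>M\<^esub> v1"]) auto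
    qed
    have gL: "graded_subset M G ?L"
    proof (rule graded[OF smL])
      fix x assume x: "x \<in> ?L"
      then have xM: "x \<in> carrier M" "?t \<odot>\<^bsub>M\<^esub> x = \<zero>\<^bsub>M\<^esub>" by auto
      obtain v0 v1 where v01: "v0 \<in> G False" "v1 \<in> G True" "x = v0 \<oplus>\<^bsub>M\<^esub> v1" using decomp[OF xM(1)] by blast
      let ?a = "?t \<odot>\<^bsub>M\<^esub> v0" and ?b = "?t \<odot>\<^bsub>M\<^esub> v1"
      have ab: "?a \<in> carrier M" "?b \<in> carrier M" using M.smult_closed[OF tH] GM v01 by auto
      have e: "?a \<oplus>\<^bsub>M\<^esub> ?b = \<zero>\<^bsub>M\<^esub>"
        using xM(2) unfolding v01(3) M.smult_r_distr[OF tH GM[OF v01(1)] GM[OF v01(2)]] .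
      \<comment> \<open>The images of the even and odd components are negatives of each other while
        lying in the even and odd part, so both vanish.\<close>
      have "?a = \<ominus>\<^bsub>M\<^esub> ?b" using M.M.minus_equality[OF e ab(2,1)] by simp
      moreover have "\<ominus>\<^bsub>M\<^esub> ?b \<in> G True"
        using subgroup.m_inv_closed[OF M.part_subgroup[of True] tG[OF v01(2)]] by (simp add: a_inv_def)
      ultimately have a0: "?a = \<zero>\<^bsub>M\<^esub>" using tG[OF v01(1)] M.parts_inter by auto
      then have b0: "?b = \<zero>\<^bsub>M\<^esub>" using e ab by simp
      show "\<exists>x0\<in>?L \<inter> G False. \<exists>x1\<in>?L \<inter> G True. x = x0 \<oplus>\<^bsub>M\<^esub> x1"
        using a0 b0 v01 GM[OF v01(1)] GM[OF v01(2)] by blast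
    qed
    have "?I = {\<zero>\<^bsub>M\<^esub>}"
    \<comment> \<open>By irreducibility a nonzero image is all of M and then the kernel is zero, so
      z - s would be bijective.\<close>
    proof (rule ccontr)
      assume "?I \<noteq> {\<zero>\<^bsub>M\<^esub>}"
      then have I: "?I = carrier M" using irr[OF smI gI] by blast
      have L: "?L = {\<zero>\<^bsub>M\<^esub>}"
      proof (rule ccontr)
        assume "?L \<noteq> {\<zero>\<^bsub>M\<^esub>}"
        then have "?L = carrier M" using irr[OF smL gL] by blast
        then have "?t \<odot>\<^bsub>M\<^esub> x = \<zero>\<^bsub>M\<^esub>" if "x \<in> carrier M" for x using that by blast
        then have "?I \<subseteq> {\<zero>\<^bsub>M\<^esub>}" by auto
        then show False using I Mnz M.M.zero_closed by auto
      qed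
      have fU: "f \<in> carrier U \<rightarrow> carrier ?C" "\<And>a x. a \<in> carrier S \<Longrightarrow> x \<in> carrier U \<Longrightarrow> f (a \<odot>\<^bsub>U\<^esub> x) = a \<odot>\<^bsub>?C\<^esub> f x"
        using f(1) by (auto simp: module_homs_def)
      obtain x0 where x0: "x0 \<in> ?K" "f u0 = ?q x0" using fU(1) f(2) unfolding C by blast
      note x0M = KM(1)[OF x0(1)]
      have sS: "?s \<in> carrier S" by (rule S_closed(6))
      note yx = M.smult_closed[OF aH[OF yS] x0M] and sx = M.smult_closed[OF scalar_H[of s] x0M] and zx = M.smult_closed[OF zH(1) x0M]
      have "?q (?y \<odot>\<^bsub>M\<^esub> x0) = ?q (?s \<odot>\<^bsub>M\<^esub> x0)"
        using fU(2)[OF yS f(2)] fU(2)[OF sS f(2)] s[OF f(2)] C_smult[OF yS x0(1)] C_smult[OF sS x0(1)] x0(2) by simp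
      then have "?y \<odot>\<^bsub>M\<^esub> x0 \<ominus>\<^bsub>M\<^esub> ?s \<odot>\<^bsub>M\<^esub> x0 \<in> ?B" by (rule q_eq[OF yx sx])
      then obtain v1 where v1: "v1 \<in> carrier M" "?y \<odot>\<^bsub>M\<^esub> x0 \<ominus>\<^bsub>M\<^esub> ?s \<odot>\<^bsub>M\<^esub> x0 = D \<odot>\<^bsub>M\<^esub> v1" using B_ex by blast
      have hx: "h \<odot>\<^bsub>M\<^esub> x0 \<in> carrier M" by (rule M.smult_closed[OF h(1) x0M])
      have "z \<odot>\<^bsub>M\<^esub> x0 \<ominus>\<^bsub>M\<^esub> ?y \<odot>\<^bsub>M\<^esub> x0 = (D \<otimes>\<^bsub>H\<^esub> h \<oplus>\<^bsub>H\<^esub> h \<otimes>\<^bsub>H\<^esub> D) \<odot>\<^bsub>M\<^esub> x0"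
        unfolding h(2)[symmetric] by (rule M.smult_diff_left[OF zH(1) aH[OF yS] x0M, symmetric])
      also have "\<dots> = D \<odot>\<^bsub>M\<^esub> (h \<odot>\<^bsub>M\<^esub> x0) \<oplus>\<^bsub>M\<^esub> h \<odot>\<^bsub>M\<^esub> (D \<odot>\<^bsub>M\<^esub> x0)"
        by (simp add: M.smult_l_distr D_H h(1) x0M M.smult_assoc)
      also have "\<dots> = D \<odot>\<^bsub>M\<^esub> (h \<odot>\<^bsub>M\<^esub> x0)"
        by (simp add: KM(2)[OF x0(1)] M.smult_zero_right h(1) M.smult_closed D_H hx)
      finally have zy: "z \<odot>\<^bsub>M\<^esub> x0 \<ominus>\<^bsub>M\<^esub> ?y \<odot>\<^bsub>M\<^esub> x0 = D \<odot>\<^bsub>M\<^esub> (h \<odot>\<^bsub>M\<^esub> x0)" .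
      \<comment> \<open>A preimage under D of (z - s) x0: the summand h x0 accounts for z - \<zeta>
        z, where the term h D dies on the kernel of D, and v1 accounts for \<zeta> z - s, which is a
        boundary on the class of x0.\<close>
      let ?v = "h \<odot>\<^bsub>M\<^esub> x0 \<oplus>\<^bsub>M\<^esub> v1"
      have vM: "?v \<in> carrier M" using hx v1(1) by simp
      have "?t \<odot>\<^bsub>M\<^esub> x0 = z \<odot>\<^bsub>M\<^esub> x0 \<ominus>\<^bsub>M\<^esub> ?s \<odot>\<^bsub>M\<^esub> x0" by (rule M.smult_diff_left[OF zH(1) scalar_H x0M])
      also have "\<dots> = (z \<odot>\<^bsub>M\<^esub> x0 \<ominus>\<^bsub>M\<^esub> ?y \<odot>\<^bsub>M\<^esub> x0) \<oplus>\<^bsub>M\<^esub> (?y \<odot>\<^bsub>M\<^esub> x0 \<ominus>\<^bsub>M\<^esub> ?s \<odot>\<^bsub>M\<^esub> x0)"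
        using yx sx zx by (simp add: M.M.minus_eq M.M.a_assoc M.M.r_neg2 M.M.r_neg1)
      also have "\<dots> = D \<odot>\<^bsub>M\<^esub> ?v" unfolding zy v1(2) by (rule M.smult_r_distr[OF D_H hx v1(1), symmetric])
      finally have tx: "?t \<odot>\<^bsub>M\<^esub> x0 = D \<odot>\<^bsub>M\<^esub> ?v" .
      \<comment> \<open>Surjectivity lets v be written as (z - s) v'. Since D commutes with z - s,
        injectivity cancels it and exhibits x0 = D v' as a boundary.\<close>
      obtain v' where v': "v' \<in> carrier M" "?v = ?t \<odot>\<^bsub>M\<^esub> v'" using vM I by blast
      have Dv': "D \<odot>\<^bsub>M\<^esub> v' \<in> carrier M" by (rule M.smult_closed[OF D_H v'(1)])
      have "D \<odot>\<^bsub>M\<^esub> ?v = ?t \<odot>\<^bsub>M\<^esub> (D \<odot>\<^bsub>M\<^esub> v')"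
        unfolding v'(2) using M.smult_assoc[OF D_H tH v'(1)] M.smult_assoc[OF tH D_H v'(1)] tc[OF D_H] by simp
      then have "?t \<odot>\<^bsub>M\<^esub> (x0 \<ominus>\<^bsub>M\<^esub> D \<odot>\<^bsub>M\<^esub> v') = \<zero>\<^bsub>M\<^esub>"
        using tx M.smult_closed[OF tH Dv'] by (simp add: M.smult_diff_right[OF tH x0M Dv'] M.M.minus_eq_zero)
      moreover have "x0 \<ominus>\<^bsub>M\<^esub> D \<odot>\<^bsub>M\<^esub> v' \<in> carrier M" using x0M Dv' by simp
      ultimately have "x0 \<ominus>\<^bsub>M\<^esub> D \<odot>\<^bsub>M\<^esub> v' = \<zero>\<^bsub>M\<^esub>" using L by blast
      then have "x0 = D \<odot>\<^bsub>M\<^esub> v'" using M.M.minus_eq_zero[OF x0M Dv'] by simp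
      then have "x0 \<in> ?B" using BI[OF v'(1)] x0(1) by simp
      then show False using f(3) q_B x0(2) unfolding C by simp
    qed
    then have t0: "?t \<odot>\<^bsub>M\<^esub> x = \<zero>\<^bsub>M\<^esub>" if "x \<in> carrier M" for x using that by blast
    have zs: "z \<odot>\<^bsub>M\<^esub> x = ?s \<odot>\<^bsub>M\<^esub> x" if x: "x \<in> carrier M" for x
      using t0[OF x] M.smult_diff_left[OF zH(1) scalar_H x, of s]
        M.M.minus_eq_zero[OF M.smult_closed[OF zH(1) x] M.smult_closed[OF scalar_H[of s] x]] by simp
    have "central_character H M z = s"
      unfolding central_character_def
    proof (rule the_equality)
      show "\<forall>x\<in>carrier M. z \<odot>\<^bsub>M\<^esub> x = ?s \<odot>\<^bsub>M\<^esub> x" using zs by blast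
      fix t assume "\<forall>x\<in>carrier M. z \<odot>\<^bsub>M\<^esub> x = scalar H t \<odot>\<^bsub>M\<^esub> x"
      then have "scalar H t \<odot>\<^bsub>M\<^esub> x = ?s \<odot>\<^bsub>M\<^esub> x" if "x \<in> carrier M" for x using zs[OF that] that by simp
      then show "t = s" using scalar_unique[OF M.left_module_axioms _ Mnz] by blast
    qed
    then show ?thesis using cU by simp
  qed
  show ?thesis
  proof (intro conjI ballI impI)
    show "left_module S ?C" by (rule lmC)
    show "a \<odot>\<^bsub>M\<^esub> x \<in> ?K" "a \<odot>\<^bsub>?C\<^esub> ?q x = ?q (a \<odot>\<^bsub>M\<^esub> x)" if "a \<in> carrier S" "x \<in> ?K" for a x
      by (rule Ka[OF that], rule C_smult[OF that])
    fix z assume U: "irreducible_module S U" and hom: "\<exists>f\<in>module_homs S U ?C. \<exists>u\<in>carrier U. f u \<noteq> \<zero>\<^bsub>?C\<^esub>"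
      and z: "z \<in> even_center H"
    obtain f u0 where "f \<in> module_homs S U ?C" "u0 \<in> carrier U" "f u0 \<noteq> \<zero>\<^bsub>?C\<^esub>" using hom by blast
    from chars[OF U this z] show "central_character H M z = central_character S U (dirac_zeta H S D z)" .
  qed
qed

end

section \<open>The three types\<close>

lemma weyl_roots: "weyl n (P \<union> uminus ` P) = weyl n P"
  using weyl_pos weyl_mono by blast

lemma weyl_roots_eq: "weyl n (rootsA n) = weyl n (pos_rootsA n)" "weyl n (rootsB n) = weyl n (pos_rootsB n)"
  "weyl n (rootsD n) = weyl n (pos_rootsD n)"
  unfolding rootsA_def rootsB_def rootsD_def by (rule weyl_roots)+

text \<open>The extended parameter is zero on short roots, so x_i and K are the same operators for
  types D and B. The commutators agree, and commutation of K^2 with W(B) restricts to W(D).\<close>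

lemma hc_full_D:
  assumes k: "weyl_invariant n (rootsD n) k" and kB: "weyl_invariant n (rootsB n) (extend_by_zero n k)" and n: "n \<ge> 1"
  shows "hc_full n (pos_rootsD n) k (weyl n (pos_rootsD n)) a"
    and "hc_model.xO n (pos_rootsD n) k a = hc_model.xO n (pos_rootsB n) (extend_by_zero n k) a"
proof -
  let ?k = "extend_by_zero n k"
  interpret B: hc_full n "pos_rootsB n" ?k "weyl n (pos_rootsB n)" a by (rule hc_full_B[OF kB n])
  interpret D: hc_model n "pos_rootsD n" k "weyl n (pos_rootsD n)" a
  proof (rule hc_model_weyl[OF D_B])
    show "u \<alpha> \<in> pos_rootsD n \<or> - u \<alpha> \<in> pos_rootsD n" if "u \<in> weyl n (pos_rootsD n)" "\<alpha> \<in> pos_rootsD n" for u \<alpha>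
      by (rule signed_perm_rootsD[OF weyl_signed_perm[OF that(1) D_B] that(2)])
    show "weyl_invariant n (pos_rootsD n \<union> uminus ` pos_rootsD n) k" using k by (simp only: rootsD_def)
  qed
  have k0: "?k \<alpha> = 0" if "\<alpha> \<in> pos_rootsB n - pos_rootsD n" for \<alpha>
  proof -
    have "\<alpha> \<notin> uminus ` pos_rootsD n"
    proof
      assume "\<alpha> \<in> uminus ` pos_rootsD n"
      then obtain \<delta> where "\<delta> \<in> pos_rootsD n" "\<alpha> = - \<delta>" by blast
      then have "- \<alpha> \<in> pos_rootsB n" using D_B by auto
      then show False using B.root_neg[of \<alpha>] that by blast
    qed
    then show ?thesis using that unfolding extend_by_zero_def rootsD_def by auto
  qed
  have k1: "?k \<alpha> = k \<alpha>" if "\<alpha> \<in> pos_rootsD n" for \<alpha>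
    using that unfolding extend_by_zero_def rootsD_def by auto
  have xv: "D.xv v = B.xv v" for v
  proof -
    have "(\<Sum>\<alpha>\<in>pos_rootsD n. sc (D.kap \<alpha>) * D.th \<alpha> v) = (\<Sum>\<alpha>\<in>pos_rootsB n. sc (B.kap \<alpha>) * B.th \<alpha> v)"
      by (rule sum.mono_neutral_cong_left[OF B.finP D_B]) (simp_all add: B.kap_def D.kap_def B.th_def D.th_def k0 k1)
    then show ?thesis unfolding D.xv_def B.xv_def by simp
  qed
  have xO: "D.xO i = B.xO i" for i unfolding D.xO_def B.xO_def by (rule xv)
  then show "hc_model.xO n (pos_rootsD n) k a = hc_model.xO n (pos_rootsB n) ?k a" by (intro ext)
  have KO: "D.KO = B.KO"
    unfolding D.KO_def B.KO_def
    by (rule sum.mono_neutral_cong_left[OF B.finP D_B]) (simp_all add: B.kp_def D.kp_def k0 k1)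
  show "hc_full n (pos_rootsD n) k (weyl n (pos_rootsD n)) a"
  proof (intro hc_full.intro hc_full_axioms.intro D.hc_model_axioms)
    show "D.xO i * D.xO j - D.xO j * D.xO i = sc (- 2 * a\<^sup>2) * (cO j * cO i)" if "i \<in> {1..n}" "j \<in> {1..n}" "i \<noteq> j" for i j
      unfolding xO by (rule B.xx[OF that])
    show "gO u * (D.KO * D.KO) = D.KO * D.KO * gO u" if "u \<in> weyl n (pos_rootsD n)" for u
      unfolding KO by (rule B.KK[OF weyl_mono[OF that D_B]])
  qed
qed

lemma (in hc_model) group_ev: "r \<in> group_rels W \<Longrightarrow> ev (lv X') r = 0"
  unfolding group_rels_def by (auto simp: ev_simps gO_id gO_mult[OF W_sp])

lemma (in hc_simple) common_ev:
  assumes W: "weyl n (rootsA n) \<subseteq> W" and B: "simpleA n \<subseteq> B" and r: "r \<in> common_rels n k"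
  shows "ev (lv xO) r = 0"
proof -
  have B': "std i - std (i + 1) \<in> B" if "i \<in> {1..<n}" for i using B that unfolding simpleA_def by blast
  have wc: "gO w * cO i = cO j * gO w" if "w \<in> weyl n (rootsA n)" "w (std i) = std j" for w i j
    using gO_cO_std[OF W_sp, of w i 1 j] W that by auto
  show ?thesis
    using r unfolding common_rels_def
  proof (elim UnE CollectE exE conjE)
    fix i assume r: "r = w\<^sub>g (refl_in n (std i - std (i + 1))) * x\<^sub>g i - x\<^sub>g (i + 1) * w\<^sub>g (refl_in n (std i - std (i + 1)))
        - scal (k (std i - std (i + 1))) * (- 1 + c\<^sub>g i * c\<^sub>g (i + 1))" and i: "i \<in> {1..<n}"
    show ?thesis unfolding r ev_simps lv.simps by (rule rel_simple(1)[OF i B'[OF i], of i]) (use i in auto)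
  next
    fix i j assume r: "r = w\<^sub>g (refl_in n (std i - std (i + 1))) * x\<^sub>g j - x\<^sub>g j * w\<^sub>g (refl_in n (std i - std (i + 1)))"
      and i: "i \<in> {1..<n}" and j: "j \<in> {1..n}" "j \<noteq> i" "j \<noteq> i + 1"
    show ?thesis unfolding r ev_simps lv.simps by (simp only: rel_simple(2)[OF i B'[OF i] j] diff_self)
  next
    fix w i j assume r: "r = w\<^sub>g w * c\<^sub>g i - c\<^sub>g j * w\<^sub>g w" and w: "w \<in> weyl n (rootsA n)" "w (std i) = std j"
    show ?thesis unfolding r ev_simps lv.simps by (simp only: wc[OF w] diff_self)
  next
    fix i j assume r: "r = c\<^sub>g i * c\<^sub>g j + c\<^sub>g j * c\<^sub>g i" and ij: "i \<noteq> j"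
    show ?thesis unfolding r ev_simps lv.simps by (simp only: cO_anti[OF ij] add.left_inverse)
  qed (simp_all add: ev_simps xO_cO cO_sq)
qed

lemma common_carrier:
  assumes W: "weyl n (rootsA n) \<subseteq> W"
  shows "common_rels n k \<subseteq> carrier (free_algebra (hc_letters n W))"
proof -
  have "refl_in n (std i - std (i + 1)) \<in> W" if "i \<in> {1..<n}" for i
    by (rule subsetD[OF W], rule refl_weyl, unfold rootsA_def, rule UnI1, rule rootA_mem) (use that in auto)
  then have s: "w\<^sub>g (refl_in n (std i - std (i + 1))) \<in> carrier (free_algebra (hc_letters n W))" if "i \<in> {1..<n}" for i
    using that by (intro free_fgen) (auto simp: hc_letters_def)
  have x: "x\<^sub>g i \<in> carrier (free_algebra (hc_letters n W))" "c\<^sub>g i \<in> carrier (free_algebra (hc_letters n W))" if "i \<in> {1..n}" for i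
    using that by (auto simp: hc_letters_def intro!: free_fgen)
  have w: "w\<^sub>g u \<in> carrier (free_algebra (hc_letters n W))" if "u \<in> weyl n (rootsA n)" for u
    using that W by (auto simp: hc_letters_def intro!: free_fgen)
  show ?thesis
  proof
    fix r assume "r \<in> common_rels n k"
    then show "r \<in> carrier (free_algebra (hc_letters n W))"
      unfolding common_rels_def
      by (elim UnE CollectE exE conjE; hypsubst)
        (intro free_add free_diff free_mult free_uminus free_scal free_1 s x w; (assumption | simp))+
  qed
qed

lemma group_carrier:
  assumes "id \<in> W" "\<And>u v. u \<in> W \<Longrightarrow> v \<in> W \<Longrightarrow> u \<circ> v \<in> W"
  shows "group_rels W \<subseteq> carrier (free_algebra (hc_letters n W))"
proof -
  have w: "w\<^sub>g u \<in> carrier (free_algebra (hc_letters n W))" if "u \<in> W" for u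
    using that by (auto simp: hc_letters_def intro!: free_fgen)
  show ?thesis unfolding group_rels_def using assms by (auto intro!: free_diff free_mult free_1 w)
qed

text \<open>With a = 0 the model has commuting x_i, and the commutation relation becomes the case N
  = 0 of the one used in the spanning argument.\<close>

lemma presentation_A:
  assumes k: "weyl_invariant n (rootsA n) k"
  shows "presentation (hc_letters n (weyl n (rootsA n))) is_Lc (hc_relsA n k) (lv (hc_model.xO n (pos_rootsA n) k 0))"
proof -
  interpret s: hc_simple n "pos_rootsA n" k "weyl n (pos_rootsA n)" 0 "simpleA n" by (rule hc_simple_A[OF k])
  interpret f: hc_full n "pos_rootsA n" k "weyl n (pos_rootsA n)" 0 by (rule hc_full_A[OF k])
  let ?W = "weyl n (rootsA n)"
  let ?F = "free_algebra (hc_letters n ?W)"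
  note We = weyl_roots_eq(1)
  have x: "x\<^sub>g i \<in> carrier ?F" if "i \<in> {1..n}" for i
    using that by (auto simp: hc_letters_def intro!: free_fgen)
  have "{x\<^sub>g i * x\<^sub>g j - x\<^sub>g j * x\<^sub>g i | i j. i \<in> {1..n} \<and> j \<in> {1..n}} \<subseteq> carrier ?F"
    by (auto simp del: atLeastAtMost_iff intro!: free_diff free_mult x)
  then have Rc: "hc_relsA n k \<subseteq> carrier ?F"
    unfolding hc_relsA_def using common_carrier[OF order.refl] group_carrier[of ?W n] s.W_id s.W_comp by (simp add: We)
  have Re: "ev (lv s.xO) r = 0" if r: "r \<in> hc_relsA n k" for r
    using r unfolding hc_relsA_def
  proof (elim UnE CollectE exE conjE)
    assume c: "r \<in> common_rels n k"
    show ?thesis by (rule s.common_ev[OF _ order.refl c]) (simp add: We)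
  next
    assume "r \<in> group_rels ?W" then show ?thesis unfolding We by (rule s.group_ev)
  next
    fix i j assume r: "r = x\<^sub>g i * x\<^sub>g j - x\<^sub>g j * x\<^sub>g i" and ij: "i \<in> {1..n}" "j \<in> {1..n}"
    show ?thesis using f.xx[OF ij] by (cases "i = j") (simp_all add: r ev_simps)
  qed
  have span: "hc_span (carrier ?F) (Idl\<^bsub>?F\<^esub> (hc_relsA n k)) scal x\<^sub>g c\<^sub>g w\<^sub>g ?W (refl_in n ` simpleA n) n 0"
  proof (rule hc_span_free[OF Rc, where k = k])
    show "finite ?W" "id \<in> ?W" unfolding We by (rule s.W_fin s.W_id)+
    show "u \<circ> v \<in> ?W" if "u \<in> ?W" "v \<in> ?W" for u v using s.W_comp that unfolding We by blast
    show "refl_in n ` simpleA n \<subseteq> ?W" unfolding We using s.refl_W s.B_P by blast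
    show "?W \<subseteq> wgen (refl_in n ` simpleA n)" unfolding We by (rule s.W_gen)
    show "group_rels ?W \<subseteq> hc_relsA n k" "common_rels n k \<subseteq> hc_relsA n k" unfolding hc_relsA_def by blast+
    show "x\<^sub>g i * x\<^sub>g j - x\<^sub>g j * x\<^sub>g i - scal 0 * (c\<^sub>g j * c\<^sub>g i) \<in> hc_relsA n k" if "i \<in> {1..n}" "j \<in> {1..n}" "i \<noteq> j" for i j
      using that unfolding hc_relsA_def by auto
  qed (auto simp: simpleA_def)
  show ?thesis
  proof
    show "f \<in> Idl\<^bsub>?F\<^esub> (hc_relsA n k)" if "f \<in> carrier ?F" "ev (lv s.xO) f = 0" for f
      by (rule f.faithful[OF span[unfolded We] genideal_ev[OF Rc[unfolded We] Re], folded We]) (use that in \<open>simp_all add: We\<close>)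
    show "pc (lv s.xO l) = (if is_Lc l then - lv s.xO l else lv s.xO l)" if "l \<in> hc_letters n ?W" for l
      by (rule f.pc_lv) (use that in \<open>simp add: We\<close>)
  qed (use Rc Re in auto)
qed

lemma presentation_B:
  assumes k: "weyl_invariant n (rootsB n) k" and n: "n \<ge> 1" and N: "N = - 2 * a\<^sup>2"
  shows "presentation (hc_letters n (weyl n (rootsB n))) is_Lc (hc_relsB n k N) (lv (hc_model.xO n (pos_rootsB n) k a))"
proof -
  interpret s: hc_simple n "pos_rootsB n" k "weyl n (pos_rootsB n)" a "simpleB n" by (rule hc_simple_B[OF k n])
  interpret f: hc_full n "pos_rootsB n" k "weyl n (pos_rootsB n)" a by (rule hc_full_B[OF k n])
  let ?W = "weyl n (rootsB n)" and ?s = "refl_in n (std n)"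
  let ?F = "free_algebra (hc_letters n ?W)"
  note We = weyl_roots_eq(2)
  have nn: "n \<in> {1..n}" using n by simp
  have sB: "std n \<in> simpleB n" "simpleA n \<subseteq> simpleB n" unfolding simpleB_def by blast+
  have AW: "weyl n (rootsA n) \<subseteq> ?W" unfolding weyl_roots_eq using weyl_mono[OF _ A_B] by blast
  have sW: "?s \<in> ?W" unfolding We using s.refl_W s.B_P sB by blast
  have x: "x\<^sub>g i \<in> carrier ?F" "c\<^sub>g i \<in> carrier ?F" if "i \<in> {1..n}" for i
    using that by (auto simp: hc_letters_def intro!: free_fgen)
  have sF: "w\<^sub>g ?s \<in> carrier ?F" using sW by (auto simp: hc_letters_def intro!: free_fgen)
  have lt: "i \<in> {1..n}" if "i \<in> {1..<n}" for i using that by auto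
  have gc: "group_rels ?W \<subseteq> carrier ?F" by (rule group_carrier) (auto simp: We intro: s.W_id s.W_comp)
  have Rc: "hc_relsB n k N \<subseteq> carrier ?F"
  proof
    fix r assume r: "r \<in> hc_relsB n k N"
    show "r \<in> carrier ?F"
      using r unfolding hc_relsB_def
    proof (elim UnE CollectE exE conjE)
      assume "r \<in> group_rels ?W" then show ?thesis using gc by blast
    next
      assume "r \<in> common_rels n k" then show ?thesis using common_carrier[OF AW] by blast
    next
      fix i j assume r: "r = x\<^sub>g i * x\<^sub>g j - x\<^sub>g j * x\<^sub>g i - scal N * (c\<^sub>g j * c\<^sub>g i)" and ij: "i \<in> {1..n}" "j \<in> {1..n}"
      show ?thesis unfolding r by (intro free_diff free_mult free_scal x ij)
    qed (simp only: singleton_iff, (intro free_add free_diff free_mult free_scal sF x nn; (rule lt)?; assumption)+)+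
  qed
  have Re: "ev (lv s.xO) r = 0" if r: "r \<in> hc_relsB n k N" for r
    using r unfolding hc_relsB_def
  proof (elim UnE CollectE exE conjE)
    assume c: "r \<in> common_rels n k"
    show ?thesis by (rule s.common_ev[OF _ sB(2) c]) (use AW in \<open>simp add: We\<close>)
  next
    assume "r \<in> group_rels ?W" then show ?thesis unfolding We by (rule s.group_ev)
  next
    fix i j assume r: "r = x\<^sub>g i * x\<^sub>g j - x\<^sub>g j * x\<^sub>g i - scal N * (c\<^sub>g j * c\<^sub>g i)" and ij: "i \<in> {1..n}" "j \<in> {1..n}" "i \<noteq> j"
    show ?thesis unfolding r ev_simps lv.simps f.xx[OF ij] N by simp
  next
    fix i assume r: "r = w\<^sub>g ?s * c\<^sub>g i - c\<^sub>g i * w\<^sub>g ?s" and i: "i \<in> {1..<n}"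
    show ?thesis unfolding r ev_simps lv.simps by (simp only: s.rel_short(2)[OF n sB(1) i] diff_self)
  next
    fix i assume r: "r = w\<^sub>g ?s * x\<^sub>g i - x\<^sub>g i * w\<^sub>g ?s" and i: "i \<in> {1..<n}"
    show ?thesis unfolding r ev_simps lv.simps by (simp only: s.rel_short(1)[OF n sB(1) i] diff_self)
  next
    assume "r \<in> {w\<^sub>g ?s * x\<^sub>g n + x\<^sub>g n * w\<^sub>g ?s + scal (complex_of_real (sqrt 2) * k (std n))}"
    then show ?thesis using s.rel_short_n(1)[OF n sB(1)] by (simp only: singleton_iff ev_simps lv.simps)
  next
    assume "r \<in> {w\<^sub>g ?s * c\<^sub>g n + c\<^sub>g n * w\<^sub>g ?s}"
    then show ?thesis by (simp only: singleton_iff ev_simps lv.simps s.rel_short_n(2)[OF n sB(1)] add.left_inverse)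
  qed
  have span: "hc_span (carrier ?F) (Idl\<^bsub>?F\<^esub> (hc_relsB n k N)) scal x\<^sub>g c\<^sub>g w\<^sub>g ?W (refl_in n ` simpleB n) n N"
  proof (rule hc_span_free[OF Rc, where k = k])
    show "finite ?W" "id \<in> ?W" unfolding We by (rule s.W_fin s.W_id)+
    show "u \<circ> v \<in> ?W" if "u \<in> ?W" "v \<in> ?W" for u v using s.W_comp that unfolding We by blast
    show "refl_in n ` simpleB n \<subseteq> ?W" unfolding We using s.refl_W s.B_P by blast
    show "?W \<subseteq> wgen (refl_in n ` simpleB n)" unfolding We by (rule s.W_gen)
    show "group_rels ?W \<subseteq> hc_relsB n k N" "common_rels n k \<subseteq> hc_relsB n k N" unfolding hc_relsB_def by blast+
    show "x\<^sub>g i * x\<^sub>g j - x\<^sub>g j * x\<^sub>g i - scal N * (c\<^sub>g j * c\<^sub>g i) \<in> hc_relsB n k N" if "i \<in> {1..n}" "j \<in> {1..n}" "i \<noteq> j" for i j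
      using that unfolding hc_relsB_def by blast
    fix u assume "u \<in> refl_in n ` simpleB n"
    then consider "u = ?s" | "\<exists>b\<in>{1..<n}. u = refl_in n (std b - std (b + 1))" unfolding simpleB_def simpleA_def by blast
    then show "(\<exists>b\<in>{1..<n}. u = refl_in n (std b - std (b + 1))) \<or>
      u = ?s \<and> n \<ge> 1 \<and> w\<^sub>g u * c\<^sub>g n + c\<^sub>g n * w\<^sub>g u \<in> hc_relsB n k N \<and>
        (\<forall>i\<in>{1..<n}. w\<^sub>g u * c\<^sub>g i - c\<^sub>g i * w\<^sub>g u \<in> hc_relsB n k N \<and> w\<^sub>g u * x\<^sub>g i - x\<^sub>g i * w\<^sub>g u \<in> hc_relsB n k N) \<and>
        (\<exists>s. w\<^sub>g u * x\<^sub>g n + x\<^sub>g n * w\<^sub>g u + scal s \<in> hc_relsB n k N)"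
    proof cases
      case 1
      then show ?thesis using n unfolding hc_relsB_def by blast
    qed blast
  qed
  show ?thesis
  proof
    show "f \<in> Idl\<^bsub>?F\<^esub> (hc_relsB n k N)" if "f \<in> carrier ?F" "ev (lv s.xO) f = 0" for f
      by (rule f.faithful[OF span[unfolded We] genideal_ev[OF Rc[unfolded We] Re], folded We]) (use that in \<open>simp_all add: We\<close>)
    show "pc (lv s.xO l) = (if is_Lc l then - lv s.xO l else lv s.xO l)" if "l \<in> hc_letters n ?W" for l
      by (rule f.pc_lv) (use that in \<open>simp add: We\<close>)
  qed (use Rc Re in auto)
qed

lemma dirac_carrier:
  assumes "\<And>\<alpha>. \<alpha> \<in> P \<Longrightarrow> refl_in n \<alpha> \<in> W"
  shows "(\<Sum>i = 1..n. x\<^sub>g i * c\<^sub>g i) + scal s * (\<Sum>\<alpha>\<in>P. scal (t \<alpha>) * s_tilde n \<alpha>) \<in> carrier (free_algebra (hc_letters n W))"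
proof -
  have x: "x\<^sub>g i \<in> carrier (free_algebra (hc_letters n W))" "c\<^sub>g i \<in> carrier (free_algebra (hc_letters n W))" if "i \<in> {1..n}" for i
    using that by (auto simp: hc_letters_def intro!: free_fgen)
  have w: "w\<^sub>g (refl_in n \<alpha>) \<in> carrier (free_algebra (hc_letters n W))" if "\<alpha> \<in> P" for \<alpha>
    using assms[OF that] by (auto simp: hc_letters_def intro!: free_fgen)
  show ?thesis unfolding s_tilde_def c_root_def by (intro free_add free_mult free_sum free_scal x w; assumption)
qed

lemma hc_transferI:
  assumes full: "hc_full n P k W a" and rep: "rep_alg H psi"
    and img: "psi ` carrier H = alg sc (hc_model.xO n P k a ` {1..n} \<union> cO ` {1..n} \<union> gO ` W)"
    and Y: "Y \<subseteq> carrier H" "psi ` Y = gO ` W \<union> cO ` {1..n}"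
    and D: "D \<in> carrier H" "psi D = hc_model.DO n P k a"
  shows "hc_transfer n P k W a H (gen_subalgebra H Y) D psi"
proof -
  interpret r: rep_alg H psi by (rule rep)
  show ?thesis
  proof (intro hc_transfer.intro full hc_transfer_axioms.intro)
    show "psi ` carrier (gen_subalgebra H Y) = alg sc (cO ` {1..n} \<union> gO ` W)"
      unfolding r.gen_subalgebra_img[OF Y(1)] Y(2) by (simp only: Un_commute)
    show "carrier (gen_subalgebra H Y) \<subseteq> carrier H" by (rule r.gen_subalgebra_subset[OF Y(1)])
  qed (rule r.inj r.add r.mult r.one img r.gen_subalgebra_sel r.homog_eq r.scalar_closed r.scalar D r.ring_A; assumption)+
qed

theorem theorem4p25:
  fixes T :: hc_type and n :: nat and k :: "vec \<Rightarrow> complex"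
    and M :: "(hc_elem, 'x) module" and G :: "bool \<Rightarrow> 'x set"
    and U :: "(hc_elem, 'u) module"
  defines "H \<equiv> hc_algebra T n k"
    and "S \<equiv> hc_Seg T n k"
    and "D \<equiv> hc_dirac T n k"
  assumes "n \<ge> 1"
    and "hc_parameter T n k"
    and "irreducible_supermodule H M G"
  shows "(left_module S (dirac_cohomology M D) \<and>
          (\<forall>a \<in> carrier S. \<forall>x \<in> action_kernel M D.
             a \<odot>\<^bsub>M\<^esub> x \<in> action_kernel M D \<and>
             a \<odot>\<^bsub>dirac_cohomology M D\<^esub> (dirac_boundary M D +>\<^bsub>M\<^esub> x)
               = dirac_boundary M D +>\<^bsub>M\<^esub> (a \<odot>\<^bsub>M\<^esub> x)))
       \<and> (irreducible_module S U \<longrightarrow>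
          (\<exists>f \<in> module_homs S U (dirac_cohomology M D).
             \<exists>u \<in> carrier U. f u \<noteq> \<zero>\<^bsub>dirac_cohomology M D\<^esub>) \<longrightarrow>
          (\<forall>z \<in> even_center H.
             central_character H M z = central_character S U (dirac_zeta H S D z)))"
proof -
  note n = \<open>n \<ge> 1\<close> and k = \<open>hc_parameter T n k\<close> and irr = \<open>irreducible_supermodule H M G\<close>
  \<comment> \<open>The ring axioms are part of the hypothesis on M. They are used in type D, where
    H is a generated subalgebra.\<close>
  have ringH: "ring H"
    using irr unfolding irreducible_supermodule_def
    by (blast dest: supermodule.axioms(1) left_module.axioms(1))
  have "\<exists>P W a psi. hc_transfer n P k W a H S D psi"
  proof (cases T)
    case TypeA
    have kA: "weyl_invariant n (rootsA n) k" using k TypeA by simp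
    interpret f: hc_full n "pos_rootsA n" k "weyl n (pos_rootsA n)" 0 by (rule hc_full_A[OF kA])
    interpret p: presentation "hc_letters n (weyl n (rootsA n))" is_Lc "hc_relsA n k" "lv f.xO" by (rule presentation_A[OF kA])
    note We = weyl_roots_eq(1)
    have H: "H = p.A" unfolding H_def TypeA by (simp add: hc_algebraA_def)
    let ?T = "Lw ` weyl n (rootsA n) \<union> Lc ` {1..n}"
    have T: "?T \<subseteq> hc_letters n (weyl n (rootsA n))" unfolding hc_letters_def by blast
    have S: "S = gen_subalgebra H ((\<lambda>l. p.cls (fgen l)) ` ?T)"
      unfolding S_def hc_Seg_def H_def TypeA by simp
    let ?d = "(\<Sum>i = 1..n. x\<^sub>g i * c\<^sub>g i) + scal (complex_of_real (sqrt 2 / 2)) *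
        (\<Sum>\<alpha>\<in>pos_rootsA n. scal (k \<alpha> * complex_of_real (ip n \<alpha> \<alpha>)) * s_tilde n \<alpha>)"
    have D: "D = p.cls ?d" unfolding D_def TypeA hc_dirac_def by simp
    have d: "?d \<in> carrier p.F" by (rule dirac_carrier) (simp add: We f.refl_W)
    have "hc_transfer n (pos_rootsA n) k (weyl n (pos_rootsA n)) 0 H S D (ev_class (lv f.xO))"
      unfolding S
    proof (rule hc_transferI[OF f.hc_full_axioms])
      show "rep_alg H (ev_class (lv f.xO))" unfolding H by (rule p.rep_alg)
      show "ev_class (lv f.xO) ` carrier H = alg sc (f.xO ` {1..n} \<union> cO ` {1..n} \<union> gO ` weyl n (pos_rootsA n))"
        unfolding lv_letters[symmetric] We[symmetric] H by (rule p.img_A)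
      show "(\<lambda>l. p.cls (fgen l)) ` ?T \<subseteq> carrier H" unfolding H by (rule p.class_gens(1)[OF T])
      show "ev_class (lv f.xO) ` ((\<lambda>l. p.cls (fgen l)) ` ?T) = gO ` weyl n (pos_rootsA n) \<union> cO ` {1..n}"
        unfolding p.class_gens(2)[OF T] by (simp add: image_Un image_image We)
      show "D \<in> carrier H" unfolding D H p.A_sel using d by (rule imageI)
      show "ev_class (lv f.xO) D = f.DO" unfolding D p.ev_cls[OF d] by (rule f.ev_dirac)
    qed
    then show ?thesis by blast
  next
    case (TypeB N)
    have kB: "weyl_invariant n (rootsB n) k" using k TypeB by simp
    \<comment> \<open>A square root chosen so that the commutator parameter -2 a^2 of the model
      equals N.\<close>
    define a where "a = csqrt (- N / 2)"
    have N: "N = - 2 * a\<^sup>2" by (simp add: a_def)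
    interpret f: hc_full n "pos_rootsB n" k "weyl n (pos_rootsB n)" a by (rule hc_full_B[OF kB n])
    interpret p: presentation "hc_letters n (weyl n (rootsB n))" is_Lc "hc_relsB n k N" "lv f.xO" by (rule presentation_B[OF kB n N])
    note We = weyl_roots_eq(2)
    have H: "H = p.A" unfolding H_def TypeB by (simp add: hc_algebraB_def)
    let ?T = "Lw ` weyl n (rootsB n) \<union> Lc ` {1..n}"
    have T: "?T \<subseteq> hc_letters n (weyl n (rootsB n))" unfolding hc_letters_def by blast
    have S: "S = gen_subalgebra H ((\<lambda>l. p.cls (fgen l)) ` ?T)"
      unfolding S_def hc_Seg_def H_def TypeB by simp
    let ?d = "(\<Sum>i = 1..n. x\<^sub>g i * c\<^sub>g i) + scal (complex_of_real (sqrt 2 / 2)) *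
        (\<Sum>\<alpha>\<in>pos_rootsB n. scal (k \<alpha> * complex_of_real (ip n \<alpha> \<alpha>)) * s_tilde n \<alpha>)"
    have D: "D = p.cls ?d" unfolding D_def TypeB hc_dirac_def by simp
    have d: "?d \<in> carrier p.F" by (rule dirac_carrier) (simp add: We f.refl_W)
    have "hc_transfer n (pos_rootsB n) k (weyl n (pos_rootsB n)) a H S D (ev_class (lv f.xO))"
      unfolding S
    proof (rule hc_transferI[OF f.hc_full_axioms])
      show "rep_alg H (ev_class (lv f.xO))" unfolding H by (rule p.rep_alg)
      show "ev_class (lv f.xO) ` carrier H = alg sc (f.xO ` {1..n} \<union> cO ` {1..n} \<union> gO ` weyl n (pos_rootsB n))"
        unfolding lv_letters[symmetric] We[symmetric] H by (rule p.img_A)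
      show "(\<lambda>l. p.cls (fgen l)) ` ?T \<subseteq> carrier H" unfolding H by (rule p.class_gens(1)[OF T])
      show "ev_class (lv f.xO) ` ((\<lambda>l. p.cls (fgen l)) ` ?T) = gO ` weyl n (pos_rootsB n) \<union> cO ` {1..n}"
        unfolding p.class_gens(2)[OF T] by (simp add: image_Un image_image We)
      show "D \<in> carrier H" unfolding D H p.A_sel using d by (rule imageI)
      show "ev_class (lv f.xO) D = f.DO" unfolding D p.ev_cls[OF d] by (rule f.ev_dirac)
    qed
    then show ?thesis by blast
  next
    case (TypeD N)
    have kD: "weyl_invariant n (rootsD n) k" and kB: "weyl_invariant n (rootsB n) (extend_by_zero n k)"
      using k TypeD by simp_all
    define a where "a = csqrt (- N / 2)"
    have N: "N = - 2 * a\<^sup>2" by (simp add: a_def)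
    interpret f: hc_full n "pos_rootsD n" k "weyl n (pos_rootsD n)" a by (rule hc_full_D(1)[OF kD kB n])
    interpret p: presentation "hc_letters n (weyl n (rootsB n))" is_Lc "hc_relsB n (extend_by_zero n k) N" "lv f.xO"
      using presentation_B[OF kB n N] unfolding hc_full_D(2)[OF kD kB n] .
    note We = weyl_roots_eq(3)
    have DB: "weyl n (rootsD n) \<subseteq> weyl n (rootsB n)" unfolding weyl_roots_eq using weyl_mono[OF _ D_B] by blast
    let ?Y = "(\<lambda>l. p.cls (fgen l)) ` hc_letters n (weyl n (rootsD n))"
    have H: "H = gen_subalgebra p.A ?Y" unfolding H_def TypeD by (simp add: hc_algebraB_def)
    have L: "hc_letters n (weyl n (rootsD n)) \<subseteq> hc_letters n (weyl n (rootsB n))" using DB unfolding hc_letters_def by blast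
    interpret rA: rep_alg p.A "ev_class (lv f.xO)" by (rule p.rep_alg)
    note Y = p.class_gens[OF L]
    have img: "ev_class (lv f.xO) ` carrier H = alg sc (f.xO ` {1..n} \<union> cO ` {1..n} \<union> gO ` weyl n (pos_rootsD n))"
      unfolding lv_letters[symmetric] We[symmetric] Y(2)[symmetric] H by (rule rA.gen_subalgebra_img[OF Y(1)])
    have HA: "carrier H \<subseteq> carrier p.A" unfolding H by (rule rA.gen_subalgebra_subset[OF Y(1)])
    let ?T = "Lw ` weyl n (rootsD n) \<union> Lc ` {1..n}"
    have T: "?T \<subseteq> hc_letters n (weyl n (rootsD n))" unfolding hc_letters_def by blast
    have S: "S = gen_subalgebra H ((\<lambda>l. p.cls (fgen l)) ` ?T)"
      unfolding S_def hc_Seg_def H_def TypeD by simp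
    let ?d = "(\<Sum>i = 1..n. x\<^sub>g i * c\<^sub>g i) + scal (complex_of_real (sqrt 2 / 2)) *
        (\<Sum>\<alpha>\<in>pos_rootsD n. scal (k \<alpha> * complex_of_real (ip n \<alpha> \<alpha>)) * s_tilde n \<alpha>)"
    have D: "D = p.cls ?d" unfolding D_def TypeD hc_dirac_def by simp
    have "?d \<in> carrier (free_algebra (hc_letters n (weyl n (rootsB n))))"
      by (rule dirac_carrier) (use DB f.refl_W in \<open>auto simp: We\<close>)
    then have d: "?d \<in> carrier p.F" .
    have pD: "ev_class (lv f.xO) D = f.DO" unfolding D p.ev_cls[OF d] by (rule f.ev_dirac)
    \<comment> \<open>In type D the class of the Dirac expression lives in the algebra of type B.
      Its operator lies in the image of the subalgebra H, and injectivity brings it back into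
      H.\<close>
    have DH: "D \<in> carrier H"
    proof -
      have "ev_class (lv f.xO) D \<in> ev_class (lv f.xO) ` carrier H" unfolding pD img by (rule f.Hg_DO)
      then obtain h where h: "h \<in> carrier H" "ev_class (lv f.xO) D = ev_class (lv f.xO) h" by blast
      have "D \<in> carrier p.A" unfolding D p.A_sel using d by (rule imageI)
      then have "D = h" using inj_onD[OF rA.inj h(2)] h(1) HA by blast
      then show ?thesis using h(1) by simp
    qed
    have "hc_transfer n (pos_rootsD n) k (weyl n (pos_rootsD n)) a H S D (ev_class (lv f.xO))"
      unfolding S
    proof (rule hc_transferI[OF f.hc_full_axioms _ img _ _ DH pD])
      show "rep_alg H (ev_class (lv f.xO))" unfolding H by (rule rA.gen_subalgebra_rep[OF Y(1) ringH[unfolded H]])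
      show "(\<lambda>l. p.cls (fgen l)) ` ?T \<subseteq> carrier H"
        unfolding H rA.gen_subalgebra_carrier using T by (blast intro: generate_ring.incl)
      show "ev_class (lv f.xO) ` ((\<lambda>l. p.cls (fgen l)) ` ?T) = gO ` weyl n (pos_rootsD n) \<union> cO ` {1..n}"
        unfolding p.class_gens(2)[OF order.trans[OF T L]] by (simp add: image_Un image_image We)
    qed
    then show ?thesis by blast
  qed
  then obtain P W a psi where "hc_transfer n P k W a H S D psi" by blast
  then show ?thesis using irr by (rule hc_transfer.cohomology_theorem)
qed

end
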